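(* Let $G$ be a connected Lie group with Lie algebra $\mathfrak g$, $G_1$ a closed connected subgroup of $G$, and $H:T^*G\to\mathbb R$ a smooth Hamiltonian invariant by the action $\widehat\Phi^R_1$ of $G_1$ on $T^*G$. Assume that there exists a finite-dimensional vector subspace $V$ of $C^\infty(G/G_1,\mathbb R)$ which is mapped onto itself by the linear representation of $G$ given by $f\mapsto f\circ L_{g^{-1}}$ ($g\in G$) and which separates points (i.e. for any pair of distinct points in $G/G_1$ there exists at least one function in $V$ taking different values at these points). Then there exists a Hamiltonian action of the semi-direct product $G\times V$ on $T^*G$ which extends the action $\widehat\Phi^L$ of $G$ on $T^*G$. The momentum map $(J^L,K)$ of that action, which takes its values in $\mathfrak g^*\times V^*$, has as first component the momentum map $J^L$ of the action $\widehat\Phi^L$. Its second component $K:T^*G\to V^*$ is given by $$\bigl\langle K(\zeta),f\bigr\rangle=f\bigl(\varpi\circ\pi_G(\zeta)\bigr),\quad\zeta\in T^*G,\ f\in V.$$ Moreover, $(J^L,K)$ is constant on each orbit of the action $\widehat\Phi^R_1$ and the Hamiltonian $H$ is constant on each level set of $(J^L,K)$. If a smooth function $h:\mathfrak g^*\times V^*\to\mathbb R$ is such that $H=h\circ(J^L,K)$, then $(J^L,K)$ maps each integral curve of the Hamiltonian vector field $\mathcal X_H$ on the symplectic manifold $(T^*G,\omega_{T^*G})$ onto an integral curve of the Hamiltonian vector field $\mathcal X_h$ on the Poisson manifold $\mathfrak g^*\times V^*$.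
   Context: $\mathfrak g$ is identified with $T_eG$ and $\mathfrak g^*$ with $T_e^*G$; $\pi_G:T^*G\to G$ and $\varpi:G\to G/G_1$, $\varpi(g)=gG_1$, are the canonical projections. $L_g(x)=gx$, $R_g(x)=xg$, with tangent maps $TL_g,TR_g$; the superscript $t$ denotes the transpose, so for $\zeta\in T^*_xG$, $(TL_{g^{-1}})^t(\zeta)\in T^*_{gx}G$ and $(TR_{g^{-1}})^t(\zeta)\in T^*_{xg}G$. The lifted actions are $\widehat\Phi^L(g,\zeta)=(TL_{g^{-1}})^t(\zeta)$ and $\widehat\Phi^R(\zeta,g)=(TR_{g^{-1}})^t(\zeta)$; $\widehat\Phi^R_1$ is the restriction of $\widehat\Phi^R$ to $G_1$. The momentum map of $\widehat\Phi^L$ is $J^L(\zeta)=(TR_{\pi_G(\zeta)})^t(\zeta)$. Functions on $G/G_1$ are identified with functions on $G$ constant on the cosets $gG_1$, so that the representation of $G$ is $(g\cdot f)(xG_1)=f(g^{-1}xG_1)$. The semi-direct product $G\times V$ is the group with law $(g_1,f_1)(g_2,f_2)=(g_1g_2,\,f_1+g_1\cdot f_2)$; $G$ is identified with the subgroup $G\times\{0\}$. $\omega_{T^*G}=\mathrm d\eta$, with $\eta$ the Liouville form $\langle\eta(\xi),w\rangle=\langle\xi,T\pi_G(w)\rangle$; the Hamiltonian vector field of $f$ is defined by $i(\mathcal X_f)\omega_{T^*G}=-\mathrm df$, and $\{f,g\}=i(\mathcal X_f)\mathrm dg$. A (left) action is Hamiltonian with momentum map $\mathcal J$ if, for each element $Y$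 of the Lie algebra, the fundamental vector field $\zeta\mapsto\frac{\mathrm d}{\mathrm dt}\exp(tY)\cdot\zeta\big|_{t=0}$ is the Hamiltonian vector field with Hamiltonian $\langle\mathcal J,Y\rangle$. The dual $\mathfrak g^*\times V^*$ of the Lie algebra $\mathfrak g\times V$ of $G\times V$ carries the Kirillov–Kostant–Souriau Poisson structure $\{F_1,F_2\}(\mu)=\langle\mu,[\mathrm dF_1(\mu),\mathrm dF_2(\mu)]\rangle$, the bracket on $\mathfrak g\times V$ being that of right-invariant vector fields on the group $G\times V$ (the opposite of the bracket of left-invariant vector fields); the Hamiltonian vector field of $h$ is given by $\mathcal X_h(F)=\{h,F\}$. *)

theory Defs
  imports
    "HOL-Analysis.Analysis"
    "HOL-Algebra.Group_Action"
    "HOL-Library.Function_Algebras"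
begin

section \<open>Real vector spaces of functions\<close>

text \<open>
  Linear forms, spaces of functions on a group, and tangent vectors are all represented by
  functions; they are added pointwise and scaled by the following operation.
\<close>

definition fscale :: "real \<Rightarrow> ('x \<Rightarrow> 'b::real_vector) \<Rightarrow> 'x \<Rightarrow> 'b"
  where "fscale a f = (\<lambda>x. a *\<^sub>R f x)"

global_interpretation fun_space: vector_space "fscale :: real \<Rightarrow> ('x \<Rightarrow> 'b::real_vector) \<Rightarrow> 'x \<Rightarrow> 'b"
  by unfold_locales (auto simp: fscale_def scaleR_add_right scaleR_add_left fun_eq_iff)

definition linear_on_subspace :: "('x \<Rightarrow> 'b::real_vector) set \<Rightarrow> (('x \<Rightarrow> 'b) \<Rightarrow> 'c::real_vector) \<Rightarrow> bool"
  where "linear_on_subspace W \<phi> \<longleftrightarrow>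
    (\<forall>f\<in>W. \<forall>g\<in>W. \<phi> (f + g) = \<phi> f + \<phi> g) \<and> (\<forall>f\<in>W. \<forall>a. \<phi> (fscale a f) = a *\<^sub>R \<phi> f)"

text \<open>Linear forms on W, extended by 0 outside W so that each of them is a single function.\<close>

definition dual_space :: "('x \<Rightarrow> 'b::real_vector) set \<Rightarrow> (('x \<Rightarrow> 'b) \<Rightarrow> real) set"
  where "dual_space W = {\<alpha>. linear_on_subspace W \<alpha> \<and> (\<forall>f. f \<notin> W \<longrightarrow> \<alpha> f = 0)}"


section \<open>Smooth manifolds\<close>

text \<open>
  Model spaces are finite-dimensional normed spaces rather than Euclidean spaces, because every
  type of class \<open>euclidean_space\<close> has dimension at least 1, while dimension 0 has to be allowed here.
\<close>

definition finite_dimensional :: "'m::real_vector itself \<Rightarrow> bool"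
  where "finite_dimensional TYPE('m) \<longleftrightarrow> (\<exists>B :: 'm set. finite B \<and> span B = UNIV)"

text \<open>
  For open S and a finite-dimensional domain: f is k times continuously differentiable on S.
\<close>

primrec Ck_on :: "nat \<Rightarrow> 'm::real_normed_vector set \<Rightarrow> ('m \<Rightarrow> 'n::real_normed_vector) \<Rightarrow> bool" where
  "Ck_on 0 = (\<lambda>S f. continuous_on S f)"
| "Ck_on (Suc k) = (\<lambda>S f. (\<forall>x\<in>S. f differentiable (at x)) \<and>
      (\<forall>v. Ck_on k S (\<lambda>x. frechet_derivative f (at x) v)))"

definition smooth_on :: "'m::real_normed_vector set \<Rightarrow> ('m \<Rightarrow> 'n::real_normed_vector) \<Rightarrow> bool"
  where "smooth_on S f \<longleftrightarrow> (\<forall>k. Ck_on k S f)"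

text \<open>
  A chart is a domain together with a map; the map is irrelevant outside the domain.
  The topology of the manifold is the one determined by an atlas.
\<close>

type_synonym ('a, 'm) chart = "'a set \<times> ('a \<Rightarrow> 'm)"
type_synonym ('a, 'm) atlas = "('a, 'm) chart set"

definition atlas_space :: "('a, 'm) atlas \<Rightarrow> 'a set"
  where "atlas_space A = (\<Union>(U, \<phi>)\<in>A. U)"

definition atlas_topology :: "('a, 'm::topological_space) atlas \<Rightarrow> 'a topology"
  where "atlas_topology A =
    topology_generated_by {{x \<in> U. \<phi> x \<in> Q} | U \<phi> Q. (U, \<phi>) \<in> A \<and> open Q}"

definition smooth_atlas :: "('a, 'm::real_normed_vector) atlas \<Rightarrow> bool"
  where "smooth_atlas A \<longleftrightarrow>
    (\<forall>(U, \<phi>)\<in>A. inj_on \<phi> U \<and> open (\<phi> ` U)) \<and>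
    (\<forall>(U, \<phi>)\<in>A. \<forall>(W, \<psi>)\<in>A.
        open (\<phi> ` (U \<inter> W)) \<and> smooth_on (\<phi> ` (U \<inter> W)) (\<psi> \<circ> inv_into U \<phi>))"

definition manifold :: "('a, 'm::real_normed_vector) atlas \<Rightarrow> bool"
  where "manifold A \<longleftrightarrow> finite_dimensional TYPE('m) \<and> smooth_atlas A \<and>
    Hausdorff_space (atlas_topology A) \<and> second_countable (atlas_topology A)"

definition smooth_map ::
    "('a, 'm::real_normed_vector) atlas \<Rightarrow> ('b, 'n::real_normed_vector) atlas \<Rightarrow> ('a \<Rightarrow> 'b) \<Rightarrow> bool"
  where "smooth_map A B F \<longleftrightarrow>
    continuous_map (atlas_topology A) (atlas_topology B) F \<and>
    (\<forall>(U, \<phi>)\<in>A. \<forall>(W, \<psi>)\<in>B. smooth_on (\<phi> ` {x \<in> U. F x \<in> W}) (\<psi> \<circ> F \<circ> inv_into U \<phi>))"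

definition real_atlas :: "(real, real) atlas"
  where "real_atlas = {(UNIV, \<lambda>t. t)}"

definition prod_atlas :: "('a, 'm) atlas \<Rightarrow> ('b, 'n) atlas \<Rightarrow> ('a \<times> 'b, 'm \<times> 'n) atlas"
  where "prod_atlas A B = {(U \<times> W, map_prod \<phi> \<psi>) | U \<phi> W \<psi>. (U, \<phi>) \<in> A \<and> (W, \<psi>) \<in> B}"

text \<open>
  The standard smooth structure of a finite-dimensional vector space W of functions: the charts
  are all linear isomorphisms onto the model space (which must have the dimension of W).
\<close>

definition vector_atlas :: "('x \<Rightarrow> 'b::real_vector) set \<Rightarrow> ('x \<Rightarrow> 'b, 'm::real_vector) atlas"
  where "vector_atlas W = {(W, \<phi>) | \<phi>. linear_on_subspace W \<phi> \<and> bij_betw \<phi> W UNIV}"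


section \<open>Tangent and cotangent vectors\<close>

text \<open>
  A tangent vector at p is the family of its components in all charts around p, related by the
  transformation law; the entries for all other pairs are 0. So tangent vectors at p form a
  vector space under the pointwise operations.
\<close>

type_synonym ('a, 'm) tangent = "('a, 'm) chart \<Rightarrow> 'm"

definition tangent_space :: "('a, 'm::real_normed_vector) atlas \<Rightarrow> 'a \<Rightarrow> ('a, 'm) tangent set"
  where "tangent_space A p = {v.
    (\<forall>(U, \<phi>)\<in>A. \<forall>(W, \<psi>)\<in>A. p \<in> U \<inter> W \<longrightarrow>
        v (W, \<psi>) = frechet_derivative (\<psi> \<circ> inv_into U \<phi>) (at (\<phi> p)) (v (U, \<phi>))) \<and>
    (\<forall>c. c \<notin> A \<or> p \<notin> fst c \<longrightarrow> v c = 0)}"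

definition chart_at :: "('a, 'm) atlas \<Rightarrow> 'a \<Rightarrow> ('a, 'm) chart"
  where "chart_at A p = (SOME c. c \<in> A \<and> p \<in> fst c)"

definition coord_vector ::
    "('a, 'm::real_normed_vector) atlas \<Rightarrow> ('a, 'm) chart \<Rightarrow> 'a \<Rightarrow> 'm \<Rightarrow> ('a, 'm) tangent"
  where "coord_vector A c p w = (\<lambda>(W, \<psi>). if (W, \<psi>) \<in> A \<and> p \<in> W
    then frechet_derivative (\<psi> \<circ> inv_into (fst c) (snd c)) (at (snd c p)) w else 0)"

definition tangent_map ::
    "('a, 'm::real_normed_vector) atlas \<Rightarrow> ('b, 'n::real_normed_vector) atlas \<Rightarrow> ('a \<Rightarrow> 'b) \<Rightarrow> 'a
      \<Rightarrow> ('a, 'm) tangent \<Rightarrow> ('b, 'n) tangent"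
  where "tangent_map A B F p v = (\<lambda>(W, \<psi>). if (W, \<psi>) \<in> B \<and> F p \<in> W
    then (let (U, \<phi>) = chart_at A p
          in frechet_derivative (\<psi> \<circ> F \<circ> inv_into U \<phi>) (at (\<phi> p)) (v (U, \<phi>)))
    else 0)"

definition differential ::
    "('a, 'm::real_normed_vector) atlas \<Rightarrow> ('a \<Rightarrow> real) \<Rightarrow> 'a \<Rightarrow> ('a, 'm) tangent \<Rightarrow> real"
  where "differential A f p v = tangent_map A real_atlas f p v (UNIV, \<lambda>t. t)"

definition velocity ::
    "('a, 'm::real_normed_vector) atlas \<Rightarrow> (real \<Rightarrow> 'a) \<Rightarrow> real \<Rightarrow> ('a, 'm) tangent"
  where "velocity A c t = (\<lambda>(W, \<psi>). if (W, \<psi>) \<in> A \<and> c t \<in> W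
    then vector_derivative (\<psi> \<circ> c) (at t) else 0)"

definition integral_curve ::
    "('a, 'm::real_normed_vector) atlas \<Rightarrow> ('a \<Rightarrow> ('a, 'm) tangent) \<Rightarrow> real set \<Rightarrow> (real \<Rightarrow> 'a) \<Rightarrow> bool"
  where "integral_curve A X I \<gamma> \<longleftrightarrow> is_interval I \<and>
    continuous_map (top_of_set I) (atlas_topology A) \<gamma> \<and>
    (\<forall>t\<in>I. \<forall>(U, \<phi>)\<in>A. \<gamma> t \<in> U \<longrightarrow>
        ((\<phi> \<circ> \<gamma>) has_vector_derivative X (\<gamma> t) (U, \<phi>)) (at t within I))"

definition vf_bracket ::
    "('a, 'm::real_normed_vector) atlas \<Rightarrow> ('a \<Rightarrow> ('a, 'm) tangent) \<Rightarrow> ('a \<Rightarrow> ('a, 'm) tangent)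
      \<Rightarrow> 'a \<Rightarrow> ('a, 'm) tangent"
  where "vf_bracket A X Y p = (\<lambda>(U, \<phi>). if (U, \<phi>) \<in> A \<and> p \<in> U
    then frechet_derivative (\<lambda>y. Y (inv_into U \<phi> y) (U, \<phi>)) (at (\<phi> p)) (X p (U, \<phi>)) -
         frechet_derivative (\<lambda>y. X (inv_into U \<phi> y) (U, \<phi>)) (at (\<phi> p)) (Y p (U, \<phi>))
    else 0)"

text \<open>
  Exterior derivative of a 1-form, in coordinates:
  \<open>d\<eta>(v, w) = \<partial>\<^sub>v (\<eta>(w)) - \<partial>\<^sub>w (\<eta>(v))\<close> for constant coordinate fields v and w.
\<close>

definition exterior_derivative ::
    "('a, 'm::real_normed_vector) atlas \<Rightarrow> ('a \<Rightarrow> ('a, 'm) tangent \<Rightarrow> real)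
      \<Rightarrow> 'a \<Rightarrow> ('a, 'm) tangent \<Rightarrow> ('a, 'm) tangent \<Rightarrow> real"
  where "exterior_derivative A \<eta> p v w =
    (let (U, \<phi>) = chart_at A p;
         \<eta>c = (\<lambda>u y. \<eta> (inv_into U \<phi> y) (coord_vector A (U, \<phi>) (inv_into U \<phi> y) u))
     in frechet_derivative (\<eta>c (w (U, \<phi>))) (at (\<phi> p)) (v (U, \<phi>)) -
        frechet_derivative (\<eta>c (v (U, \<phi>))) (at (\<phi> p)) (w (U, \<phi>)))"

definition hamiltonian_vf ::
    "('a, 'm::real_normed_vector) atlas \<Rightarrow> ('a \<Rightarrow> ('a, 'm) tangent \<Rightarrow> ('a, 'm) tangent \<Rightarrow> real)
      \<Rightarrow> ('a \<Rightarrow> real) \<Rightarrow> 'a \<Rightarrow> ('a, 'm) tangent"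
  where "hamiltonian_vf A \<omega> f p = (THE v. v \<in> tangent_space A p \<and>
    (\<forall>w\<in>tangent_space A p. \<omega> p v w = - differential A f p w))"


section \<open>The cotangent bundle\<close>

text \<open>A point of the cotangent bundle is a pair of a base point and a linear form.\<close>

type_synonym ('a, 'm) cotangent = "'a \<times> (('a, 'm) tangent \<Rightarrow> real)"

definition cotangent_space ::
    "('a, 'm::real_normed_vector) atlas \<Rightarrow> 'a \<Rightarrow> (('a, 'm) tangent \<Rightarrow> real) set"
  where "cotangent_space A p = dual_space (tangent_space A p)"

definition cotangent_atlas ::
    "('a, 'm::real_normed_vector) atlas \<Rightarrow> (('a, 'm) cotangent, 'm \<times> ('m \<Rightarrow>\<^sub>L real)) atlas"
  where "cotangent_atlas A =
    (\<lambda>(U, \<phi>). (Sigma U (cotangent_space A),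
       \<lambda>(p, \<zeta>). (\<phi> p, Blinfun (\<lambda>w. \<zeta> (coord_vector A (U, \<phi>) p w))))) ` A"

definition liouville_form ::
    "('a, 'm::real_normed_vector) atlas \<Rightarrow> ('a, 'm) cotangent
      \<Rightarrow> (('a, 'm) cotangent, 'm \<times> ('m \<Rightarrow>\<^sub>L real)) tangent \<Rightarrow> real"
  where "liouville_form A \<xi> w = snd \<xi> (tangent_map (cotangent_atlas A) A fst \<xi> w)"

definition cotangent_symplectic_form ::
    "('a, 'm::real_normed_vector) atlas \<Rightarrow> ('a, 'm) cotangent
      \<Rightarrow> (('a, 'm) cotangent, 'm \<times> ('m \<Rightarrow>\<^sub>L real)) tangent
      \<Rightarrow> (('a, 'm) cotangent, 'm \<times> ('m \<Rightarrow>\<^sub>L real)) tangent \<Rightarrow> real"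
  where "cotangent_symplectic_form A =
    exterior_derivative (cotangent_atlas A) (liouville_form A)"

text \<open>Transpose of the tangent map at y of a self-map F, as a map from covectors at F(y) to covectors at y.\<close>

definition transpose_tangent ::
    "('a, 'm::real_normed_vector) atlas \<Rightarrow> ('a \<Rightarrow> 'a) \<Rightarrow> 'a
      \<Rightarrow> (('a, 'm) tangent \<Rightarrow> real) \<Rightarrow> ('a, 'm) tangent \<Rightarrow> real"
  where "transpose_tangent A F y \<zeta> =
    (\<lambda>w. if w \<in> tangent_space A y then \<zeta> (tangent_map A A F y w) else 0)"


section \<open>Lie groups, their Lie algebras and actions\<close>

definition lie_group :: "'g monoid \<Rightarrow> ('g, 'm::real_normed_vector) atlas \<Rightarrow> bool"
  where "lie_group G A \<longleftrightarrow> group G \<and> manifold A \<and> atlas_space A = carrier G \<and>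
    smooth_map (prod_atlas A A) A (\<lambda>(x, y). x \<otimes>\<^bsub>G\<^esub> y) \<and> smooth_map A A (\<lambda>x. inv\<^bsub>G\<^esub> x)"

definition lie_algebra :: "'g monoid \<Rightarrow> ('g, 'm::real_normed_vector) atlas \<Rightarrow> ('g, 'm) tangent set"
  where "lie_algebra G A = tangent_space A \<one>\<^bsub>G\<^esub>"

definition lie_bracket :: "'g monoid \<Rightarrow> ('g, 'm::real_normed_vector) atlas
      \<Rightarrow> ('g, 'm) tangent \<Rightarrow> ('g, 'm) tangent \<Rightarrow> ('g, 'm) tangent"
  \<comment> \<open>bracket of right-invariant vector fields\<close>
  where "lie_bracket G A X Y =
    vf_bracket A (\<lambda>s. tangent_map A A (\<lambda>x. x \<otimes>\<^bsub>G\<^esub> s) \<one>\<^bsub>G\<^esub> X)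
                 (\<lambda>s. tangent_map A A (\<lambda>x. x \<otimes>\<^bsub>G\<^esub> s) \<one>\<^bsub>G\<^esub> Y) \<one>\<^bsub>G\<^esub>"

definition lie_exp :: "'g monoid \<Rightarrow> ('g, 'm::real_normed_vector) atlas \<Rightarrow> ('g, 'm) tangent \<Rightarrow> 'g"
  where "lie_exp G A Y = (THE c. smooth_map real_atlas A c \<and>
    (\<forall>s t. c (s + t) = c s \<otimes>\<^bsub>G\<^esub> c t) \<and> velocity A c 0 = Y) 1"

definition lie_dual ::
    "'g monoid \<Rightarrow> ('g, 'm::real_normed_vector) atlas \<Rightarrow> (('g, 'm) tangent \<Rightarrow> real) set"
  where "lie_dual G A = dual_space (lie_algebra G A)"

definition lie_dual_atlas :: "'g monoid \<Rightarrow> ('g, 'm::real_normed_vector) atlas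
      \<Rightarrow> (('g, 'm) tangent \<Rightarrow> real, 'm \<Rightarrow>\<^sub>L real) atlas"
  where "lie_dual_atlas G A = vector_atlas (lie_dual G A)"

text \<open>
  The differential at \<open>\<mu>\<close> of a function on the dual of the Lie algebra, as an element of the
  Lie algebra, by the canonical identification with the bidual.
\<close>

definition dual_differential :: "'g monoid \<Rightarrow> ('g, 'm::real_normed_vector) atlas
      \<Rightarrow> ((('g, 'm) tangent \<Rightarrow> real) \<Rightarrow> real) \<Rightarrow> (('g, 'm) tangent \<Rightarrow> real) \<Rightarrow> ('g, 'm) tangent"
  where "dual_differential G A F \<mu> = (THE Y. Y \<in> lie_algebra G A \<and>
    (\<forall>\<nu>\<in>lie_dual G A. ((\<lambda>t. F (\<mu> + fscale t \<nu>)) has_real_derivative \<nu> Y) (at 0)))"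

definition kks_bracket :: "'g monoid \<Rightarrow> ('g, 'm::real_normed_vector) atlas
      \<Rightarrow> ((('g, 'm) tangent \<Rightarrow> real) \<Rightarrow> real) \<Rightarrow> ((('g, 'm) tangent \<Rightarrow> real) \<Rightarrow> real)
      \<Rightarrow> (('g, 'm) tangent \<Rightarrow> real) \<Rightarrow> real"
  where "kks_bracket G A F1 F2 \<mu> =
    \<mu> (lie_bracket G A (dual_differential G A F1 \<mu>) (dual_differential G A F2 \<mu>))"

definition kks_hamiltonian_vf :: "'g monoid \<Rightarrow> ('g, 'm::real_normed_vector) atlas
      \<Rightarrow> ((('g, 'm) tangent \<Rightarrow> real) \<Rightarrow> real) \<Rightarrow> (('g, 'm) tangent \<Rightarrow> real)
      \<Rightarrow> (('g, 'm) tangent \<Rightarrow> real, 'm \<Rightarrow>\<^sub>L real) tangent"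
  where "kks_hamiltonian_vf G A h \<mu> = (THE v. v \<in> tangent_space (lie_dual_atlas G A) \<mu> \<and>
    (\<forall>F. smooth_map (lie_dual_atlas G A) real_atlas F \<longrightarrow>
        differential (lie_dual_atlas G A) F \<mu> v = kks_bracket G A h F \<mu>))"

definition hamiltonian_action :: "'g monoid \<Rightarrow> ('g, 'm::real_normed_vector) atlas
      \<Rightarrow> ('p, 'n::real_normed_vector) atlas \<Rightarrow> ('p \<Rightarrow> ('p, 'n) tangent \<Rightarrow> ('p, 'n) tangent \<Rightarrow> real)
      \<Rightarrow> ('g \<Rightarrow> 'p \<Rightarrow> 'p) \<Rightarrow> ('p \<Rightarrow> ('g, 'm) tangent \<Rightarrow> real) \<Rightarrow> bool"
  where "hamiltonian_action G A M \<omega> \<Phi> J \<longleftrightarrow>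
    group_action G (atlas_space M) \<Phi> \<and>
    smooth_map (prod_atlas A M) M (\<lambda>(g, \<xi>). \<Phi> g \<xi>) \<and>
    smooth_map M (lie_dual_atlas G A) J \<and>
    (\<forall>Y\<in>lie_algebra G A. \<forall>\<xi>\<in>atlas_space M.
        velocity M (\<lambda>t. \<Phi> (lie_exp G A (fscale t Y)) \<xi>) 0 =
        hamiltonian_vf M \<omega> (\<lambda>\<xi>'. J \<xi>' Y) \<xi>)"


section \<open>The lifted actions and the semi-direct product\<close>

definition lift_left :: "'g monoid \<Rightarrow> ('g, 'm::real_normed_vector) atlas
      \<Rightarrow> 'g \<Rightarrow> ('g, 'm) cotangent \<Rightarrow> ('g, 'm) cotangent"
  where "lift_left G A g = (\<lambda>(x, \<zeta>). (g \<otimes>\<^bsub>G\<^esub> x,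
    transpose_tangent A (\<lambda>y. inv\<^bsub>G\<^esub> g \<otimes>\<^bsub>G\<^esub> y) (g \<otimes>\<^bsub>G\<^esub> x) \<zeta>))"

definition lift_right :: "'g monoid \<Rightarrow> ('g, 'm::real_normed_vector) atlas
      \<Rightarrow> ('g, 'm) cotangent \<Rightarrow> 'g \<Rightarrow> ('g, 'm) cotangent"
  where "lift_right G A = (\<lambda>(x, \<zeta>) g. (x \<otimes>\<^bsub>G\<^esub> g,
    transpose_tangent A (\<lambda>y. y \<otimes>\<^bsub>G\<^esub> inv\<^bsub>G\<^esub> g) (x \<otimes>\<^bsub>G\<^esub> g) \<zeta>))"

definition momentum_left :: "'g monoid \<Rightarrow> ('g, 'm::real_normed_vector) atlas
      \<Rightarrow> ('g, 'm) cotangent \<Rightarrow> ('g, 'm) tangent \<Rightarrow> real"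
  where "momentum_left G A = (\<lambda>(x, \<zeta>). transpose_tangent A (\<lambda>y. y \<otimes>\<^bsub>G\<^esub> x) \<one>\<^bsub>G\<^esub> \<zeta>)"

text \<open>
  Smooth functions on \<open>G/G\<^sub>1\<close>, identified with functions on G that are constant on the cosets
  (and, as a normalisation, 0 outside the carrier).
\<close>

definition smooth_coset_functions ::
    "'g monoid \<Rightarrow> ('g, 'm::real_normed_vector) atlas \<Rightarrow> 'g set \<Rightarrow> ('g \<Rightarrow> real) set"
  where "smooth_coset_functions G A G1 = {f. smooth_map A real_atlas f \<and>
    (\<forall>x\<in>carrier G. \<forall>y\<in>x <#\<^bsub>G\<^esub> G1. f y = f x) \<and> (\<forall>x. x \<notin> carrier G \<longrightarrow> f x = 0)}"

definition translate :: "'g monoid \<Rightarrow> 'g \<Rightarrow> ('g \<Rightarrow> real) \<Rightarrow> 'g \<Rightarrow> real"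
  where "translate G g f = (\<lambda>x. if x \<in> carrier G then f (inv\<^bsub>G\<^esub> g \<otimes>\<^bsub>G\<^esub> x) else 0)"

definition semidirect :: "'g monoid \<Rightarrow> ('g \<Rightarrow> real) set \<Rightarrow> ('g \<times> ('g \<Rightarrow> real)) monoid"
  where "semidirect G V = \<lparr>carrier = carrier G \<times> V,
    monoid.mult = (\<lambda>(g1, f1) (g2, f2). (g1 \<otimes>\<^bsub>G\<^esub> g2, f1 + translate G g1 f2)),
    one = (\<one>\<^bsub>G\<^esub>, 0)\<rparr>"

definition semidirect_atlas :: "('g, 'm::real_normed_vector) atlas \<Rightarrow> ('g \<Rightarrow> real) set
      \<Rightarrow> ('g \<times> ('g \<Rightarrow> real), 'm \<times> 'v::real_normed_vector) atlas"
  where "semidirect_atlas A V = prod_atlas A (vector_atlas V)"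

text \<open>
  The Lie algebra of the semi-direct product is \<open>\<gg> \<times> V\<close>: the projections send a tangent vector Y
  at the identity to an element of \<open>\<gg>\<close> and to a tangent vector of V at 0, and the latter is the
  initial velocity of \<open>t \<mapsto> t f\<close> for exactly one f in V.
\<close>

definition semidirect_lie_fst :: "'g monoid \<Rightarrow> ('g, 'm::real_normed_vector) atlas \<Rightarrow> ('g \<Rightarrow> real) set
      \<Rightarrow> ('g \<times> ('g \<Rightarrow> real), 'm \<times> 'v::real_normed_vector) tangent \<Rightarrow> ('g, 'm) tangent"
  where "semidirect_lie_fst G A V Y = tangent_map (semidirect_atlas A V) A fst (\<one>\<^bsub>G\<^esub>, 0) Y"

definition semidirect_lie_snd :: "'g monoid \<Rightarrow> ('g, 'm::real_normed_vector) atlas \<Rightarrow> ('g \<Rightarrow> real) set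
      \<Rightarrow> ('g \<times> ('g \<Rightarrow> real), 'm \<times> 'v::real_normed_vector) tangent \<Rightarrow> 'g \<Rightarrow> real"
  where "semidirect_lie_snd G A V Y =
    inv_into V (\<lambda>f. velocity (vector_atlas V :: ('g \<Rightarrow> real, 'v) atlas) (\<lambda>t. fscale t f) 0)
      (tangent_map (semidirect_atlas A V) (vector_atlas V) snd (\<one>\<^bsub>G\<^esub>, 0) Y)"

text \<open>The element of the dual of the Lie algebra of the semi-direct product given by a pair in \<open>\<gg>\<^sup>* \<times> V\<^sup>*\<close>.\<close>

definition semidirect_dual :: "'g monoid \<Rightarrow> ('g, 'm::real_normed_vector) atlas \<Rightarrow> ('g \<Rightarrow> real) set
      \<Rightarrow> (('g, 'm) tangent \<Rightarrow> real) \<times> (('g \<Rightarrow> real) \<Rightarrow> real)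
      \<Rightarrow> ('g \<times> ('g \<Rightarrow> real), 'm \<times> 'v::real_normed_vector) tangent \<Rightarrow> real"
  where "semidirect_dual G A V = (\<lambda>(\<alpha>, \<beta>) Y.
    if Y \<in> lie_algebra (semidirect G V) (semidirect_atlas A V)
    then \<alpha> (semidirect_lie_fst G A V Y) + \<beta> (semidirect_lie_snd G A V Y) else 0)"

definition momentum_functions ::
    "('g \<Rightarrow> real) set \<Rightarrow> ('g, 'm::real_normed_vector) cotangent \<Rightarrow> ('g \<Rightarrow> real) \<Rightarrow> real"
  where "momentum_functions V \<xi> = (\<lambda>f. if f \<in> V then f (fst \<xi>) else 0)"

definition momentum_pair :: "'g monoid \<Rightarrow> ('g, 'm::real_normed_vector) atlas \<Rightarrow> ('g \<Rightarrow> real) set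
      \<Rightarrow> ('g, 'm) cotangent \<Rightarrow> (('g, 'm) tangent \<Rightarrow> real) \<times> (('g \<Rightarrow> real) \<Rightarrow> real)"
  where "momentum_pair G A V \<xi> = (momentum_left G A \<xi>, momentum_functions V \<xi>)"

end

theory Submission
  imports Defs
begin

text \<open>
  A pair (g, f) acts on a covector by the left translation by g followed by the subtraction of
  \<open>df\<close>. Every element of the Lie algebra has a momentum function of the form
  \<open>\<zeta> \<mapsto> \<langle>\<zeta>, X\<rangle> + f\<close> with X right-invariant and f in V, and the Hamiltonian vector field of such
  a function is determined by its projection X and by its effect on the functions \<open>\<zeta> \<mapsto> \<langle>\<zeta>, Z\<rangle>\<close>
  with Z left-invariant. Since X and Z commute, this effect is \<open>- Z f\<close>, exactly as for the
  infinitesimal action. Computing the bracket of right-invariant fields on the semi-direct product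
  shows that the momentum map is Poisson. If \<open>H = h \<circ> J\<close>, then at each point H and the momentum
  function of \<open>dh\<close> have the same differential, so J carries the Hamiltonian field of H to that of h.
  The level sets of J are orbits of \<open>G\<^sub>1\<close> because V separates the cosets and \<open>J\<^sup>L\<close> is injective on
  each cotangent space.
\<close>

section \<open>Finite-dimensional normed spaces and differentiable functions\<close>

text \<open>The minus sign in the action is forced by the convention i(X) omega = - df: the
  Hamiltonian field of a function lifted from G is vertical with fibre component - df. With the
  bracket of right-invariant fields, which generate left translations, the momentum map then
  preserves brackets without a further sign. The exponential, the Hamiltonian fields on both sides
  and differentials on the dual are definite descriptions, so existence and uniqueness have to be
  shown for each. The exponential requires global one-parameter subgroups, hence a local theory of
  differential equations; Hamiltonian vectors on the bundle require nondegeneracy, those on the dual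
  the separation of vectors by linear functions. Model spaces are arbitrary finite-dimensional
  normed spaces, possibly zero, so coordinates come from a chosen basis with bounded coordinate
  functionals. Elements of V and linear forms on a Lie algebra are functions, determined linearly by
  their values at finitely many points. Smoothness of maps into such spaces is therefore tested
  point by point, and expressions in which function and point both vary are split into finite sums
  of products.\<close>

lemma coefficient_sum_le_norm:
  fixes B :: "'m::real_normed_vector set"
  assumes "finite B" "independent B"
  shows "\<exists>C\<ge>0. \<forall>c. (\<Sum>b\<in>B. \<bar>c b\<bar>) \<le> C * norm (\<Sum>b\<in>B. c b *\<^sub>R b)"
  using assms
proof (induction B rule: finite_induct)
  case empty
  then show ?case by (intro exI[of _ 0]) auto
next
  case (insert b B)
  have indB: "independent B" and bB: "b \<notin> span B"
    using insert.prems insert.hyps by (auto simp: independent_insert)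
  obtain C where C0: "C \<ge> 0" and C: "\<And>c. (\<Sum>x\<in>B. \<bar>c x\<bar>) \<le> C * norm (\<Sum>x\<in>B. c x *\<^sub>R x)"
    using insert.IH[OF indB] by blast
  \<comment> \<open>The new basis vector has positive distance from the span of the old ones.
    Otherwise vectors \<open>s n\<close> of that span tend to \<open>- b\<close>; the induction
    hypothesis makes their coefficients Cauchy sequences, and the limits of the coefficients put
    \<open>- b\<close> into the span.\<close>
  have "\<exists>d>0. \<forall>c. d \<le> norm (b + (\<Sum>x\<in>B. c x *\<^sub>R x))"
  proof (rule ccontr)
    assume neg: "\<not> ?thesis"
    have "\<exists>c. norm (b + (\<Sum>x\<in>B. c x *\<^sub>R x)) < inverse (real (Suc n))" for n
    proof -
      have "(0::real) < inverse (real (Suc n))" by simp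
      then show ?thesis using neg by (meson not_le)
    qed
    then obtain c where c: "\<And>n. norm (b + (\<Sum>x\<in>B. c n x *\<^sub>R x)) < inverse (real (Suc n))"
      by metis
    define s where "s = (\<lambda>n. \<Sum>x\<in>B. c n x *\<^sub>R x)"
    have "(\<lambda>n. b + s n) \<longlonglongrightarrow> 0"
      by (rule Lim_null_comparison[OF _ LIMSEQ_inverse_real_of_nat])
        (use c in \<open>auto simp: s_def intro!: always_eventually less_imp_le\<close>)
    then have slim: "s \<longlonglongrightarrow> - b"
      using tendsto_diff[OF _ tendsto_const[of b], of "\<lambda>n. b + s n" 0] by simp
    then have cs: "Cauchy s" by (rule LIMSEQ_imp_Cauchy)
    have "convergent (\<lambda>n. c n x)" if "x \<in> B" for x
    proof -
      have le: "\<bar>c m x - c n x\<bar> \<le> C * norm (s m - s n)" for m n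
      proof -
        have "\<bar>c m x - c n x\<bar> \<le> (\<Sum>y\<in>B. \<bar>c m y - c n y\<bar>)"
          by (rule member_le_sum[where f="\<lambda>y. \<bar>c m y - c n y\<bar>"]) (use that insert.hyps in auto)
        also have "\<dots> \<le> C * norm (\<Sum>y\<in>B. (c m y - c n y) *\<^sub>R y)"
          by (rule C)
        finally show ?thesis by (simp add: s_def scaleR_left_diff_distrib sum_subtractf)
      qed
      have "Cauchy (\<lambda>n. c n x)"
      proof (rule CauchyI)
        fix e :: real assume "e > 0"
        then have "e / (C + 1) > 0" using C0 by simp
        then obtain M where M: "\<And>m n. m \<ge> M \<Longrightarrow> n \<ge> M \<Longrightarrow> norm (s m - s n) < e / (C + 1)"
          using CauchyD[OF cs] by blast
        show "\<exists>M. \<forall>m\<ge>M. \<forall>n\<ge>M. norm (c m x - c n x) < e"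
        proof (intro exI allI impI)
          fix m n assume "m \<ge> M" "n \<ge> M"
          have "C * norm (s m - s n) \<le> (C + 1) * norm (s m - s n)"
            by (simp add: mult_right_mono)
          also have "\<dots> < e" using M[OF \<open>m \<ge> M\<close> \<open>n \<ge> M\<close>] C0 by (simp add: field_simps)
          finally show "norm (c m x - c n x) < e" using le[of m n] by simp
        qed
      qed
      then show ?thesis by (simp add: Cauchy_convergent_iff)
    qed
    then obtain l where l: "\<And>x. x \<in> B \<Longrightarrow> (\<lambda>n. c n x) \<longlonglongrightarrow> l x"
      unfolding convergent_def by metis
    have "s \<longlonglongrightarrow> (\<Sum>x\<in>B. l x *\<^sub>R x)"
      unfolding s_def by (intro tendsto_intros l)
    then have "- b = (\<Sum>x\<in>B. l x *\<^sub>R x)" using slim LIMSEQ_unique by blast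
    then have "- b \<in> span B" by (simp add: span_base span_scale span_sum)
    then show False using bB span_neg by fastforce
  qed
  then obtain d where d0: "d > 0" and d: "\<And>c. d \<le> norm (b + (\<Sum>x\<in>B. c x *\<^sub>R x))"
    by blast
  show ?case
  proof (intro exI conjI allI)
    \<comment> \<open>With \<open>T\<close> the whole sum and \<open>S\<close> its part over
      \<open>B\<close>: \<open>\<bar>c b\<bar> \<le> norm T / d\<close>, hence
      \<open>norm S \<le> norm T + norm T / d * norm b\<close>, and \<open>C * norm S\<close> bounds
      the other coefficients. Adding the two estimates gives this constant.\<close>
    show "1 / d + C + C * norm b / d \<ge> 0" using d0 C0 by simp
    fix c :: "'m \<Rightarrow> real"
    define S where "S = (\<Sum>x\<in>B. c x *\<^sub>R x)"
    define T where "T = c b *\<^sub>R b + S"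
    have Tb: "\<bar>c b\<bar> \<le> norm T / d"
    proof (cases "c b = 0")
      case False
      have "T = c b *\<^sub>R (b + (\<Sum>x\<in>B. (c x / c b) *\<^sub>R x))"
        using False by (simp add: T_def S_def scaleR_add_right scaleR_sum_right)
      then have "norm T \<ge> \<bar>c b\<bar> * d" using d by (simp add: mult_left_mono)
      then show ?thesis using d0 by (simp add: field_simps)
    qed (use d0 in simp)
    have "norm S \<le> norm T + \<bar>c b\<bar> * norm b"
      using norm_triangle_ineq4[of T "c b *\<^sub>R b"] by (simp add: T_def)
    also have "\<dots> \<le> norm T + norm T / d * norm b"
      by (intro add_left_mono mult_right_mono Tb) simp
    finally have "C * norm S \<le> C * (norm T + norm T / d * norm b)"
      using C0 by (rule mult_left_mono)
    then have "(\<Sum>x\<in>B. \<bar>c x\<bar>) \<le> C * (norm T + norm T / d * norm b)"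
      using C[of c] by (simp add: S_def)
    then have "\<bar>c b\<bar> + (\<Sum>x\<in>B. \<bar>c x\<bar>) \<le> norm T / d + C * (norm T + norm T / d * norm b)"
      using Tb by linarith
    also have "\<dots> = (1 / d + C + C * norm b / d) * norm T"
      using d0 by (simp add: field_simps)
    finally show "(\<Sum>b\<in>insert b B. \<bar>c b\<bar>) \<le> (1 / d + C + C * norm b / d) * norm (\<Sum>b\<in>insert b B. c b *\<^sub>R b)"
      using insert.hyps by (simp add: T_def S_def)
  qed
qed

text \<open>The coordinate functionals of a basis are bounded by
  \<open>coefficient_sum_le_norm\<close>. Whenever a derivative is taken in a moving direction, or
  vectors of the model space have to be handled by coordinates, they are expanded in such a frame;
  the empty frame covers dimension 0.\<close>

lemma finite_dimensional_frame:
  assumes "finite_dimensional TYPE('m::real_normed_vector)"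
  obtains B :: "'m::real_normed_vector set" and co :: "'m::real_normed_vector \<Rightarrow> 'm \<Rightarrow> real"
  where "finite B" "independent B" "span B = UNIV" "\<And>b. bounded_linear (co b)"
    "\<And>x. (\<Sum>b\<in>B. co b x *\<^sub>R b) = x"
proof -
  obtain B0 :: "'m set" where B0: "finite B0" "span B0 = UNIV"
    using assms by (auto simp: finite_dimensional_def)
  obtain B where B: "B \<subseteq> B0" "independent B" "B0 \<subseteq> span B"
    using maximal_independent_subset[of B0] by blast
  have fB: "finite B" using B B0 finite_subset by blast
  have sB: "span B = UNIV" using B B0 by (metis span_mono span_span top.extremum_uniqueI)
  have sum: "(\<Sum>b\<in>B. representation B x b *\<^sub>R b) = x" for x
    using B(2) sB fB by (simp add: real_vector.sum_representation_eq)
  obtain C where C0: "C \<ge> 0" and C: "\<And>c. (\<Sum>x\<in>B. \<bar>c x\<bar>) \<le> C * norm (\<Sum>x\<in>B. c x *\<^sub>R x)"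
    using coefficient_sum_le_norm[OF fB B(2)] by blast
  have "bounded_linear (\<lambda>x. representation B x b)" for b
  proof (rule bounded_linear_intro)
    show "representation B (x + y) b = representation B x b + representation B y b" for x y
      using B(2) sB by (simp add: real_vector.representation_add)
    show "representation B (r *\<^sub>R x) b = r *\<^sub>R representation B x b" for r x
      using B(2) sB by (simp add: real_vector.representation_scale)
    show "norm (representation B x b) \<le> norm x * C" for x
    proof (cases "b \<in> B")
      case True
      have "\<bar>representation B x b\<bar> \<le> (\<Sum>y\<in>B. \<bar>representation B x y\<bar>)"
        by (rule member_le_sum[where f="\<lambda>y. \<bar>representation B x y\<bar>"]) (use True fB in auto)
      also have "\<dots> \<le> C * norm x" using C[of "representation B x"] by (simp add: sum)
      finally show ?thesis by (simp add: mult.commute)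
    next
      case False
      then have "representation B x b = 0"
        using real_vector.representation_ne_zero by blast
      then show ?thesis using C0 by simp
    qed
  qed
  then show thesis
    using that[of B "\<lambda>b x. representation B x b"] fB B(2) sB sum by simp
qed

lemma finite_dimensional_linear_bounded:
  fixes f :: "'m::real_normed_vector \<Rightarrow> 'n::real_normed_vector"
  assumes "finite_dimensional TYPE('m)" "linear f"
  shows "bounded_linear f"
proof -
  obtain B :: "'m set" and co where B: "finite B" "\<And>b. bounded_linear (co b)"
    "\<And>x. (\<Sum>b\<in>B. co b x *\<^sub>R b) = x"
    using finite_dimensional_frame[OF assms(1)] by metis
  have "f = (\<lambda>x. \<Sum>b\<in>B. co b x *\<^sub>R f b)"
  proof
    fix x show "f x = (\<Sum>b\<in>B. co b x *\<^sub>R f b)"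
      by (subst B(3)[of x, symmetric]) (simp add: linear_sum[OF assms(2)] linear_scale[OF assms(2)])
  qed
  moreover have "bounded_linear (\<lambda>x. \<Sum>b\<in>B. co b x *\<^sub>R f b)"
    by (intro bounded_linear_sum bounded_linear_compose[OF bounded_linear_scaleR_left] B(2))
  ultimately show ?thesis by simp
qed

lemma finite_dimensionalI:
  fixes f :: "'i \<Rightarrow> 'm::real_normed_vector"
  assumes "finite I" "\<And>x. \<exists>c. x = (\<Sum>i\<in>I. c i *\<^sub>R f i)"
  shows "finite_dimensional TYPE('m)"
  unfolding finite_dimensional_def
proof (intro exI conjI)
  show "finite (f ` I)" using assms by simp
  show "span (f ` I) = UNIV"
  proof safe
    fix x :: 'm
    obtain c where "x = (\<Sum>i\<in>I. c i *\<^sub>R f i)" using assms(2) by blast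
    then show "x \<in> span (f ` I)" by (simp add: span_sum span_scale span_base)
  qed simp
qed

lemma finite_dimensional_real [simp]: "finite_dimensional TYPE(real)"
proof (rule finite_dimensionalI[of "{()}" "\<lambda>_. 1"])
  show "\<exists>c. x = (\<Sum>i\<in>{()}. c i *\<^sub>R 1)" for x :: real
    by (rule exI[of _ "\<lambda>_. x"]) simp
qed simp

lemma finite_dimensional_prod:
  assumes "finite_dimensional TYPE('m::real_normed_vector)" "finite_dimensional TYPE('n::real_normed_vector)"
  shows "finite_dimensional TYPE('m::real_normed_vector \<times> 'n::real_normed_vector)"
proof -
  obtain B :: "'m set" and co where B: "finite B" "\<And>x. (\<Sum>b\<in>B. co b x *\<^sub>R b) = x"
    using finite_dimensional_frame[OF assms(1)] by metis
  obtain C :: "'n set" and do where C: "finite C" "\<And>x. (\<Sum>b\<in>C. do b x *\<^sub>R b) = x"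
    using finite_dimensional_frame[OF assms(2)] by metis
  show ?thesis
  proof (rule finite_dimensionalI)
    show "finite (B <+> C)" using B C by simp
    fix x :: "'m \<times> 'n"
    have "x = (\<Sum>i\<in>B <+> C. case_sum (\<lambda>b. co b (fst x)) (\<lambda>b. do b (snd x)) i *\<^sub>R case_sum (\<lambda>b. (b, 0)) (\<lambda>b. (0, b)) i)"
      using B C by (subst sum.Plus) (auto simp: prod_eq_iff fst_sum snd_sum)
    then show "\<exists>c. x = (\<Sum>i\<in>B <+> C. c i *\<^sub>R case_sum (\<lambda>b. (b, 0)) (\<lambda>b. (0, b)) i)" by blast
  qed
qed

text \<open>\<open>d\<close> is the dual basis. A linear form is thus a finite combination whose
  coefficients are its values at fixed vectors, which is how smoothness of a map into linear forms
  is tested.\<close>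

lemma blinfun_frame:
  assumes "finite_dimensional TYPE('m::real_normed_vector)"
  obtains B :: "'m::real_normed_vector set" and d :: "'m::real_normed_vector \<Rightarrow> 'm \<Rightarrow>\<^sub>L real"
  where "finite B" "\<And>\<alpha> :: 'm \<Rightarrow>\<^sub>L real. (\<Sum>b\<in>B. blinfun_apply \<alpha> b *\<^sub>R d b) = \<alpha>"
proof -
  obtain B :: "'m set" and co where B: "finite B" "\<And>b. bounded_linear (co b)"
    "\<And>x. (\<Sum>b\<in>B. co b x *\<^sub>R b) = x"
    using finite_dimensional_frame[OF assms(1)] by metis
  have "(\<Sum>b\<in>B. blinfun_apply \<alpha> b *\<^sub>R Blinfun (co b)) = \<alpha>" for \<alpha> :: "'m \<Rightarrow>\<^sub>L real"
  proof (rule blinfun_eqI)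
    fix x
    have "blinfun_apply \<alpha> x = blinfun_apply \<alpha> (\<Sum>b\<in>B. co b x *\<^sub>R b)" by (simp add: B)
    then show "blinfun_apply (\<Sum>b\<in>B. blinfun_apply \<alpha> b *\<^sub>R Blinfun (co b)) x = blinfun_apply \<alpha> x"
      by (simp add: blinfun.sum_left blinfun.scaleR_left bounded_linear_Blinfun_apply[OF B(2)]
          blinfun.sum_right blinfun.scaleR_right mult.commute)
  qed
  then show thesis using that[OF B(1), of "\<lambda>b. Blinfun (co b)"] by simp
qed

lemma finite_dimensional_blinfun:
  assumes "finite_dimensional TYPE('m::real_normed_vector)"
  shows "finite_dimensional TYPE('m::real_normed_vector \<Rightarrow>\<^sub>L real)"
proof -
  obtain B :: "'m set" and d where B: "finite B" "\<And>\<alpha> :: 'm \<Rightarrow>\<^sub>L real. (\<Sum>b\<in>B. blinfun_apply \<alpha> b *\<^sub>R d b) = \<alpha>"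
    using blinfun_frame[OF assms] by metis
  have "\<exists>c. \<alpha> = (\<Sum>b\<in>B. c b *\<^sub>R d b)" for \<alpha> :: "'m \<Rightarrow>\<^sub>L real"
    by (rule exI[of _ "blinfun_apply \<alpha>"]) (simp add: B)
  then show ?thesis by (rule finite_dimensionalI[OF B(1)])
qed


section \<open>Calculus of C^k and smooth maps on open sets\<close>

lemma frechet_derivative_cong_open:
  assumes "open S" "x \<in> S" "\<And>y. y \<in> S \<Longrightarrow> f y = g y"
  shows "frechet_derivative f (at x) = frechet_derivative g (at x)"
proof -
  have "(f has_derivative D) (at x) \<longleftrightarrow> (g has_derivative D) (at x)" for D
    using has_derivative_transform_within_open[OF _ assms(1,2), of f D _ g]
      has_derivative_transform_within_open[OF _ assms(1,2), of g D _ f] assms(3) by metis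
  then show ?thesis by (simp add: frechet_derivative_def)
qed

lemma differentiable_cong_open:
  assumes "open S" "x \<in> S" "\<And>y. y \<in> S \<Longrightarrow> f y = g y" "f differentiable (at x)"
  shows "g differentiable (at x)"
  using assms has_derivative_transform_within_open[OF _ assms(1,2), of f _ _ g]
  by (metis differentiable_def)

lemma frechet_derivative_eqI: "(f has_derivative D) (at x) \<Longrightarrow> frechet_derivative f (at x) = D"
  by (rule frechet_derivative_at[symmetric])

text \<open>Derivatives are taken in full neighbourhoods, so equality on \<open>S\<close> passes to
  them because \<open>S\<close> is open.\<close>

lemma Ck_on_cong:
  assumes "open S" "\<And>x. x \<in> S \<Longrightarrow> f x = g x" "Ck_on k S f"
  shows "Ck_on k S g"
  using assms(2,3)
proof (induction k arbitrary: f g)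
  case 0
  then show ?case using continuous_on_cong[of S S f g] by simp
next
  case (Suc k)
  have "Ck_on k S (\<lambda>x. frechet_derivative g (at x) v)" for v
    using Suc.prems Suc.IH[of "\<lambda>x. frechet_derivative f (at x) v" "\<lambda>x. frechet_derivative g (at x) v"]
      frechet_derivative_cong_open[OF assms(1), of _ f g]
    by simp
  then show ?case using Suc.prems differentiable_cong_open[OF assms(1), of _ f g] by auto
qed

lemma Ck_on_subset: "Ck_on k S f \<Longrightarrow> T \<subseteq> S \<Longrightarrow> Ck_on k T f"
  by (induction k arbitrary: f) (auto intro: continuous_on_subset)

lemma Ck_on_SucD: "Ck_on (Suc k) S f \<Longrightarrow> Ck_on k S f"
proof (induction k arbitrary: f)
  case 0
  then show ?case
    by (auto intro!: differentiable_imp_continuous_on simp: differentiable_on_def differentiable_at_withinI)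
qed auto

text \<open>\<open>Ck_on\<close> uses derivatives in full neighbourhoods, so it is a property of the
  individual points of \<open>S\<close>, whether or not \<open>S\<close> itself is open.\<close>

lemma Ck_on_local:
  assumes "\<And>x. x \<in> S \<Longrightarrow> \<exists>T. open T \<and> x \<in> T \<and> Ck_on k T f"
  shows "Ck_on k S f"
  using assms
proof (induction k arbitrary: f)
  case 0
  have "isCont f x" if x: "x \<in> S" for x
    using 0[OF x] continuous_on_eq_continuous_at by auto
  then show ?case by (simp add: continuous_at_imp_continuous_on)
next
  case (Suc k)
  have "f differentiable (at x)" if "x \<in> S" for x using Suc.prems[OF that] by auto
  moreover have "Ck_on k S (\<lambda>x. frechet_derivative f (at x) v)" for v
    by (rule Suc.IH) (use Suc.prems in fastforce)
  ultimately show ?case by simp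
qed

lemma Ck_on_const [simp]: "Ck_on k S (\<lambda>x. c)"
  by (induction k arbitrary: c) auto

lemma Ck_on_bounded_linear: 
  assumes "bounded_linear L" shows "Ck_on k S L"
proof (cases k)
  case 0
  then show ?thesis using assms by (simp add: linear_continuous_on)
next
  case (Suc j)
  have D: "(L has_derivative L) (at x)" for x by (rule bounded_linear_imp_has_derivative[OF assms])
  then show ?thesis using Suc by (auto simp: frechet_derivative_eqI[OF D] differentiable_def)
qed

lemma Ck_on_add:
  assumes "open S" "Ck_on k S f" "Ck_on k S g"
  shows "Ck_on k S (\<lambda>x. f x + g x)"
  using assms(2,3)
proof (induction k arbitrary: f g)
  case (Suc k)
  have D: "((\<lambda>x. f x + g x) has_derivative
      (\<lambda>v. frechet_derivative f (at x) v + frechet_derivative g (at x) v)) (at x)" if "x \<in> S" for x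
    using Suc.prems that by (intro has_derivative_add) (auto simp: frechet_derivative_works)
  have "Ck_on k S (\<lambda>x. frechet_derivative (\<lambda>x. f x + g x) (at x) v)" for v
  proof (rule Ck_on_cong[OF assms(1)])
    show "Ck_on k S (\<lambda>x. frechet_derivative f (at x) v + frechet_derivative g (at x) v)"
      using Suc by simp
  qed (simp add: frechet_derivative_eqI[OF D])
  then show ?case using D by (auto simp: differentiable_def)
qed (auto intro: continuous_intros)

lemma Ck_on_bilinear:
  assumes "bounded_bilinear pr" "open S" "Ck_on k S f" "Ck_on k S g"
  shows "Ck_on k S (\<lambda>x. pr (f x) (g x))"
  using assms(3,4)
proof (induction k arbitrary: f g)
  case 0
  then show ?case by (simp add: bounded_bilinear.continuous_on[OF assms(1)])
next
  case (Suc k)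
  have D: "((\<lambda>x. pr (f x) (g x)) has_derivative
      (\<lambda>v. pr (f x) (frechet_derivative g (at x) v) + pr (frechet_derivative f (at x) v) (g x))) (at x)"
    if "x \<in> S" for x
    using Suc.prems that
    by (intro bounded_bilinear.FDERIV[OF assms(1)]) (auto simp: frechet_derivative_works)
  have "Ck_on k S (\<lambda>x. frechet_derivative (\<lambda>x. pr (f x) (g x)) (at x) v)" for v
  proof (rule Ck_on_cong[OF assms(2)])
    show "Ck_on k S (\<lambda>x. pr (f x) (frechet_derivative g (at x) v) + pr (frechet_derivative f (at x) v) (g x))"
      using Suc.prems Ck_on_SucD[of k S f] Ck_on_SucD[of k S g] by (intro Ck_on_add assms(2) Suc.IH) auto
  qed (simp add: frechet_derivative_eqI[OF D])
  then show ?case using D by (auto simp: differentiable_def)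
qed

lemma Ck_on_bounded_linear_compose:
  assumes "bounded_linear L" "open S" "Ck_on k S f"
  shows "Ck_on k S (\<lambda>x. L (f x))"
  using assms(3)
proof (induction k arbitrary: f)
  case 0
  then show ?case by (simp add: bounded_linear.continuous_on[OF assms(1)])
next
  case (Suc k)
  have D: "((\<lambda>x. L (f x)) has_derivative (\<lambda>v. L (frechet_derivative f (at x) v))) (at x)"
    if "x \<in> S" for x
    using Suc.prems that
    by (intro bounded_linear.has_derivative[OF assms(1)]) (auto simp: frechet_derivative_works)
  have "Ck_on k S (\<lambda>x. frechet_derivative (\<lambda>x. L (f x)) (at x) v)" for v
    by (rule Ck_on_cong[OF assms(2) _ Suc.IH[of "\<lambda>x. frechet_derivative f (at x) v"]])
      (use Suc.prems in \<open>simp_all add: frechet_derivative_eqI[OF D]\<close>)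
  then show ?case using D by (auto simp: differentiable_def)
qed

lemma Ck_on_sum:
  assumes "open S" "\<And>i. i \<in> I \<Longrightarrow> Ck_on k S (f i)"
  shows "Ck_on k S (\<lambda>x. \<Sum>i\<in>I. f i x)"
  using assms(2) by (induction I rule: infinite_finite_induct) (auto intro!: Ck_on_add assms(1))

text \<open>\<open>Ck_on\<close> speaks of derivatives in fixed directions only, but the chain rule
  differentiates \<open>g\<close> in the direction \<open>frechet_derivative f (at x) v\<close>,
  which moves with \<open>x\<close>. Expanding that direction in a frame turns the derivative into a
  sum of products whose factors fall under the induction hypothesis or the assumption on
  \<open>f\<close>.\<close>

lemma Ck_on_compose:
  fixes f :: "'m::real_normed_vector \<Rightarrow> 'n::real_normed_vector" and g :: "'n \<Rightarrow> 'p::real_normed_vector"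
  assumes fd: "finite_dimensional TYPE('n)" and "open S" "open T" "Ck_on k S f" "Ck_on k T g" "f ` S \<subseteq> T"
  shows "Ck_on k S (\<lambda>x. g (f x))"
  using assms(4,5)
proof (induction k arbitrary: g)
  case 0
  then show ?case using assms(6) by (auto intro: continuous_on_compose2)
next
  case (Suc k)
  obtain B :: "'n set" and co where B: "finite B" "\<And>b. bounded_linear (co b)"
    "\<And>x. (\<Sum>b\<in>B. co b x *\<^sub>R b) = x"
    using finite_dimensional_frame[OF fd] by metis
  have fD: "(f has_derivative frechet_derivative f (at x)) (at x)" if "x \<in> S" for x
    using Suc.prems that by (auto simp: frechet_derivative_works)
  have gD: "(g has_derivative frechet_derivative g (at x)) (at x)" if "x \<in> T" for x
    using Suc.prems that by (auto simp: frechet_derivative_works)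
  have D: "((\<lambda>x. g (f x)) has_derivative (\<lambda>v. frechet_derivative g (at (f x)) (frechet_derivative f (at x) v))) (at x)"
    if "x \<in> S" for x
    using has_derivative_compose[OF fD[OF that] gD] that assms(6) by blast
  have "Ck_on k S (\<lambda>x. frechet_derivative (\<lambda>x. g (f x)) (at x) v)" for v
  proof (rule Ck_on_cong[OF assms(2)])
    show "Ck_on k S (\<lambda>x. \<Sum>b\<in>B. co b (frechet_derivative f (at x) v) *\<^sub>R frechet_derivative g (at (f x)) b)"
    proof (intro Ck_on_sum Ck_on_bilinear[OF bounded_bilinear_scaleR] assms(2)
        Ck_on_bounded_linear_compose[OF B(2)])
      fix b
      show "Ck_on k S (\<lambda>x. frechet_derivative f (at x) v)" using Suc.prems by simp
      show "Ck_on k S (\<lambda>x. frechet_derivative g (at (f x)) b)"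
        using Suc.prems Suc.IH[of "\<lambda>y. frechet_derivative g (at y) b"] Ck_on_SucD[of k S f] by simp
    qed
    fix x assume x: "x \<in> S"
    then have lin: "linear (frechet_derivative g (at (f x)))"
      using gD[of "f x"] assms(6) has_derivative_linear by blast
    show "(\<Sum>b\<in>B. co b (frechet_derivative f (at x) v) *\<^sub>R frechet_derivative g (at (f x)) b) =
        frechet_derivative (\<lambda>x. g (f x)) (at x) v"
      unfolding frechet_derivative_eqI[OF D[OF x]]
      by (subst (2) B(3)[of "frechet_derivative f (at x) v", symmetric])
        (simp add: linear_sum[OF lin] linear_scale[OF lin])
  qed
  then show ?case using D by (auto simp: differentiable_def)
qed

lemma smooth_on_cong: "open S \<Longrightarrow> smooth_on S f \<Longrightarrow> (\<And>x. x \<in> S \<Longrightarrow> f x = g x) \<Longrightarrow> smooth_on S g"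
  unfolding smooth_on_def using Ck_on_cong[of S f g] by blast

lemma smooth_on_subset: "smooth_on S f \<Longrightarrow> T \<subseteq> S \<Longrightarrow> smooth_on T f"
  unfolding smooth_on_def using Ck_on_subset by blast

lemma smooth_on_local: "(\<And>x. x \<in> S \<Longrightarrow> \<exists>T. open T \<and> x \<in> T \<and> smooth_on T f) \<Longrightarrow> smooth_on S f"
  unfolding smooth_on_def by (meson Ck_on_local)

lemma smooth_on_const [simp]: "smooth_on S (\<lambda>x. c)"
  by (simp add: smooth_on_def)

lemma smooth_on_bounded_linear: "bounded_linear L \<Longrightarrow> smooth_on S L"
  by (simp add: smooth_on_def Ck_on_bounded_linear)

lemma smooth_on_id [simp]: "smooth_on S (\<lambda>x. x)"
  by (simp add: smooth_on_bounded_linear bounded_linear_ident)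

lemma smooth_on_add: "open S \<Longrightarrow> smooth_on S f \<Longrightarrow> smooth_on S g \<Longrightarrow> smooth_on S (\<lambda>x. f x + g x)"
  by (simp add: smooth_on_def Ck_on_add)

lemma smooth_on_sum: "open S \<Longrightarrow> (\<And>i. i \<in> I \<Longrightarrow> smooth_on S (f i)) \<Longrightarrow> smooth_on S (\<lambda>x. \<Sum>i\<in>I. f i x)"
  by (simp add: smooth_on_def Ck_on_sum)

lemma smooth_on_bilinear:
  "bounded_bilinear pr \<Longrightarrow> open S \<Longrightarrow> smooth_on S f \<Longrightarrow> smooth_on S g \<Longrightarrow> smooth_on S (\<lambda>x. pr (f x) (g x))"
  by (simp add: smooth_on_def Ck_on_bilinear)

lemma smooth_on_bounded_linear_compose:
  "bounded_linear L \<Longrightarrow> open S \<Longrightarrow> smooth_on S f \<Longrightarrow> smooth_on S (\<lambda>x. L (f x))"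
  by (simp add: smooth_on_def Ck_on_bounded_linear_compose)

lemmas smooth_on_scaleR = smooth_on_bilinear[OF bounded_bilinear_scaleR]
lemmas smooth_on_mult = smooth_on_bilinear[OF bounded_bilinear_mult]
lemmas smooth_on_snd = smooth_on_bounded_linear_compose[OF bounded_linear_snd]

lemma smooth_on_diff: "open S \<Longrightarrow> smooth_on S f \<Longrightarrow> smooth_on S g \<Longrightarrow> smooth_on S (\<lambda>x. f x - g x)"
  using smooth_on_add[of S f "\<lambda>x. - g x"]
    smooth_on_bounded_linear_compose[OF bounded_linear_minus[OF bounded_linear_ident], of S g] by simp

lemma smooth_on_Pair:
  fixes f :: "'a::real_normed_vector \<Rightarrow> 'b::real_normed_vector"
    and g :: "'a \<Rightarrow> 'c::real_normed_vector"
  assumes "open S" "smooth_on S f" "smooth_on S g"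
  shows "smooth_on S (\<lambda>x. (f x, g x))"
proof -
  have "bounded_linear (\<lambda>x :: 'b. (x, 0 :: 'c))" "bounded_linear (\<lambda>x :: 'c. (0 :: 'b, x))"
    by (auto intro!: bounded_linear_Pair bounded_linear_ident bounded_linear_zero)
  then have "smooth_on S (\<lambda>x. (f x, 0 :: 'c) + (0 :: 'b, g x))"
    using smooth_on_bounded_linear_compose[OF _ assms(1,2)] smooth_on_bounded_linear_compose[OF _ assms(1,3)]
    by (intro smooth_on_add assms(1))
  then show ?thesis by simp
qed

lemma smooth_on_compose:
  fixes f :: "'m::real_normed_vector \<Rightarrow> 'n::real_normed_vector" and g :: "'n \<Rightarrow> 'p::real_normed_vector"
  assumes "finite_dimensional TYPE('n)" "open S" "open T" "smooth_on S f" "smooth_on T g"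
    "\<And>x. x \<in> S \<Longrightarrow> f x \<in> T"
  shows "smooth_on S (\<lambda>x. g (f x))"
  using assms unfolding smooth_on_def by (blast intro: Ck_on_compose)

lemma smooth_on_differentiable: "smooth_on S f \<Longrightarrow> x \<in> S \<Longrightarrow> f differentiable (at x)"
  unfolding smooth_on_def by (metis Ck_on.simps(2))

lemma smooth_on_has_derivative:
  "smooth_on S f \<Longrightarrow> x \<in> S \<Longrightarrow> (f has_derivative frechet_derivative f (at x)) (at x)"
  using smooth_on_differentiable frechet_derivative_works by blast

lemma smooth_on_continuous_on: "smooth_on S f \<Longrightarrow> continuous_on S f"
  unfolding smooth_on_def by (metis Ck_on.simps(1))

lemma smooth_on_derivative: "smooth_on S f \<Longrightarrow> smooth_on S (\<lambda>x. frechet_derivative f (at x) v)"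
  unfolding smooth_on_def by (metis Ck_on.simps(2))

text \<open>Base point and direction may move together; the direction is again expanded in a frame.
  This yields the smoothness of invariant fields and of the transition maps of the cotangent
  bundle.\<close>

lemma smooth_on_derivative_compose:
  fixes f :: "'m::real_normed_vector \<Rightarrow> 'n::real_normed_vector"
    and u :: "'p::real_normed_vector \<Rightarrow> 'm"
  assumes fd: "finite_dimensional TYPE('m)" and "open S" "open T" "smooth_on S u" "smooth_on S g"
    "smooth_on T f" "\<And>x. x \<in> S \<Longrightarrow> u x \<in> T"
  shows "smooth_on S (\<lambda>x. frechet_derivative f (at (u x)) (g x))"
proof -
  obtain B :: "'m set" and co where B: "finite B" "\<And>b. bounded_linear (co b)"
    "\<And>x. (\<Sum>b\<in>B. co b x *\<^sub>R b) = x"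
    using finite_dimensional_frame[OF fd] by metis
  show ?thesis
  proof (rule smooth_on_cong[OF assms(2)])
    show "smooth_on S (\<lambda>x. \<Sum>b\<in>B. co b (g x) *\<^sub>R frechet_derivative f (at (u x)) b)"
      by (intro smooth_on_sum smooth_on_scaleR assms(2) smooth_on_bounded_linear_compose[OF B(2)] assms(5)
        smooth_on_compose[OF fd assms(2,3,4) smooth_on_derivative[OF assms(6)]] assms(7))
    fix x assume "x \<in> S"
    then have lin: "linear (frechet_derivative f (at (u x)))"
      using smooth_on_has_derivative[OF assms(6) assms(7)] has_derivative_linear by blast
    show "(\<Sum>b\<in>B. co b (g x) *\<^sub>R frechet_derivative f (at (u x)) b) = frechet_derivative f (at (u x)) (g x)"
      by (subst (2) B(3)[of "g x", symmetric]) (simp add: linear_sum[OF lin] linear_scale[OF lin])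
  qed
qed

lemma smooth_on_blinfunI:
  fixes f :: "'a::real_normed_vector \<Rightarrow> ('m::real_normed_vector \<Rightarrow>\<^sub>L real)"
  assumes fd: "finite_dimensional TYPE('m)" and "open S" "\<And>w. smooth_on S (\<lambda>x. blinfun_apply (f x) w)"
  shows "smooth_on S f"
proof -
  obtain B :: "'m set" and d where B: "\<And>\<alpha> :: 'm \<Rightarrow>\<^sub>L real. (\<Sum>b\<in>B. blinfun_apply \<alpha> b *\<^sub>R d b) = \<alpha>"
    using blinfun_frame[OF fd] by metis
  have "smooth_on S (\<lambda>x. \<Sum>b\<in>B. blinfun_apply (f x) b *\<^sub>R d b)"
    by (intro smooth_on_sum smooth_on_scaleR assms smooth_on_const)
  then show ?thesis by (simp add: B)
qed

text \<open>One step of the bootstrap for solutions of differential equations: a curve gains one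
  order over its velocity.\<close>

lemma Ck_on_vector_derivative:
  fixes x :: "real \<Rightarrow> 'm::real_normed_vector"
  assumes "open S" "\<And>t. t \<in> S \<Longrightarrow> (x has_vector_derivative g t) (at t)" "Ck_on k S g"
  shows "Ck_on (Suc k) S x"
proof -
  have "frechet_derivative x (at t) v = v *\<^sub>R g t" if "t \<in> S" for t v
    using assms(2)[OF that] by (simp add: has_vector_derivative_def frechet_derivative_eqI)
  moreover have "Ck_on k S (\<lambda>t. v *\<^sub>R g t)" for v
    by (rule Ck_on_bounded_linear_compose[OF bounded_linear_scaleR_right assms(1,3)])
  ultimately have "Ck_on k S (\<lambda>t. frechet_derivative x (at t) v)" for v
    using Ck_on_cong[OF assms(1), of "\<lambda>t. v *\<^sub>R g t"] by simp
  then show ?thesis using assms(2) by (auto simp: differentiable_def has_vector_derivative_def)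
qed

section \<open>Derivatives along lines and the symmetry of second derivatives\<close>

lemma smooth_on_line_has_vector_derivative:
  assumes "smooth_on S f" "x + s *\<^sub>R u \<in> S"
  shows "((\<lambda>s. f (x + s *\<^sub>R u)) has_vector_derivative frechet_derivative f (at (x + s *\<^sub>R u)) u) (at s)"
proof -
  have "((\<lambda>s. x + s *\<^sub>R u) has_derivative (\<lambda>h. h *\<^sub>R u)) (at s)"
    by (auto intro!: derivative_eq_intros)
  from has_derivative_compose[OF this smooth_on_has_derivative[OF assms]]
  show ?thesis
    using linear_scale[OF has_derivative_linear[OF smooth_on_has_derivative[OF assms]]]
    by (simp add: has_vector_derivative_def)
qed

text \<open>The second difference is an increment of \<open>g\<close>, to which the mean value
  theorem applies in the direction \<open>u\<close> and then, for the resulting first derivative, in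
  the direction \<open>v\<close>. The second difference is symmetric in \<open>u\<close> and
  \<open>v\<close>, so two such representations can be compared.\<close>

lemma second_difference_mean_value:
  fixes f :: "'m::real_normed_vector \<Rightarrow> real"
  assumes "smooth_on S f" "h > 0"
    "\<And>a b. 0 \<le> a \<Longrightarrow> a \<le> h \<Longrightarrow> 0 \<le> b \<Longrightarrow> b \<le> h \<Longrightarrow> x + a *\<^sub>R u + b *\<^sub>R v \<in> S"
  shows "\<exists>a b. 0 \<le> a \<and> a \<le> h \<and> 0 \<le> b \<and> b \<le> h \<and>
    f (x + h *\<^sub>R u + h *\<^sub>R v) - f (x + h *\<^sub>R u) - f (x + h *\<^sub>R v) + f x =
    h^2 * frechet_derivative (\<lambda>z. frechet_derivative f (at z) u) (at (x + a *\<^sub>R u + b *\<^sub>R v)) v"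
proof -
  define g where "g s = f ((x + h *\<^sub>R v) + s *\<^sub>R u) - f (x + s *\<^sub>R u)" for s
  define Df where "Df y = frechet_derivative f (at y) u" for y
  have "DERIV g s :> Df ((x + h *\<^sub>R v) + s *\<^sub>R u) - Df (x + s *\<^sub>R u)" if "0 \<le> s" "s \<le> h" for s
  proof -
    have "(x + h *\<^sub>R v) + s *\<^sub>R u \<in> S" "x + s *\<^sub>R u \<in> S"
      using assms(3)[of s h] assms(3)[of s 0] that assms(2) by (auto simp: algebra_simps)
    from this[THEN smooth_on_line_has_vector_derivative[OF assms(1)]] show ?thesis
      unfolding g_def Df_def has_real_derivative_iff_has_vector_derivative
      by (intro has_vector_derivative_diff)
  qed
  then obtain a where a: "0 < a" "a < h"
    "g h - g 0 = (h - 0) * (Df ((x + h *\<^sub>R v) + a *\<^sub>R u) - Df (x + a *\<^sub>R u))"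
    using MVT2[of 0 h g "\<lambda>s. Df ((x + h *\<^sub>R v) + s *\<^sub>R u) - Df (x + s *\<^sub>R u)"] assms(2) by auto
  have "DERIV (\<lambda>t. Df ((x + a *\<^sub>R u) + t *\<^sub>R v)) t :> frechet_derivative Df (at ((x + a *\<^sub>R u) + t *\<^sub>R v)) v"
    if "0 \<le> t" "t \<le> h" for t
  proof -
    have "(x + a *\<^sub>R u) + t *\<^sub>R v \<in> S" using assms(3)[of a t] a that by auto
    then show ?thesis
      using smooth_on_line_has_vector_derivative[OF smooth_on_derivative[OF assms(1)], of "x + a *\<^sub>R u" t v u]
      unfolding Df_def has_real_derivative_iff_has_vector_derivative by blast
  qed
  then obtain b where b: "0 < b" "b < h"
    "Df ((x + a *\<^sub>R u) + h *\<^sub>R v) - Df ((x + a *\<^sub>R u) + 0 *\<^sub>R v) =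
      (h - 0) * frechet_derivative Df (at ((x + a *\<^sub>R u) + b *\<^sub>R v)) v"
    using MVT2[of 0 h "\<lambda>t. Df ((x + a *\<^sub>R u) + t *\<^sub>R v)"] assms(2) by meson
  have "f (x + h *\<^sub>R u + h *\<^sub>R v) - f (x + h *\<^sub>R u) - f (x + h *\<^sub>R v) + f x = g h - g 0"
    by (simp add: g_def algebra_simps)
  also have "\<dots> = h * (Df ((x + a *\<^sub>R u) + h *\<^sub>R v) - Df ((x + a *\<^sub>R u) + 0 *\<^sub>R v))"
    using a(3) by (simp add: algebra_simps)
  also have "\<dots> = h^2 * frechet_derivative Df (at (x + a *\<^sub>R u + b *\<^sub>R v)) v"
    unfolding b(3) by (simp add: power2_eq_square)
  finally have "f (x + h *\<^sub>R u + h *\<^sub>R v) - f (x + h *\<^sub>R u) - f (x + h *\<^sub>R v) + f x =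
    h^2 * frechet_derivative (\<lambda>z. frechet_derivative f (at z) u) (at (x + a *\<^sub>R u + b *\<^sub>R v)) v"
    by (simp add: Df_def[abs_def])
  moreover have "0 \<le> a" "a \<le> h" "0 \<le> b" "b \<le> h" using a b by auto
  ultimately show ?thesis by blast
qed

text \<open>Schwarz's theorem: the same second difference, divided by \<open>h^2\<close>, is a value
  of either mixed derivative at a point close to \<open>x\<close>, and both mixed derivatives are
  continuous at \<open>x\<close>.\<close>

lemma second_derivative_symmetric_real:
  fixes f :: "'m::real_normed_vector \<Rightarrow> real"
  assumes "smooth_on S f" "open S" "x \<in> S"
  shows "frechet_derivative (\<lambda>z. frechet_derivative f (at z) u) (at x) v =
    frechet_derivative (\<lambda>z. frechet_derivative f (at z) v) (at x) u"
proof -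
  define P where "P u v y = frechet_derivative (\<lambda>z. frechet_derivative f (at z) u) (at y) v" for u v y
  have cont: "isCont (P u v) x" for u v
    using smooth_on_continuous_on[OF smooth_on_derivative[OF smooth_on_derivative[OF assms(1)]]]
      assms(2,3) continuous_on_eq_continuous_at unfolding P_def by blast
  have "\<bar>P u v x - P v u x\<bar> < e" if e: "e > 0" for e
  proof -
    obtain d1 where d1: "d1 > 0" "ball x d1 \<subseteq> S" using assms(2,3) open_contains_ball by blast
    obtain d2 where d2: "d2 > 0" "\<And>y. dist y x < d2 \<Longrightarrow> dist (P u v y) (P u v x) < e / 2"
      using cont[of u v, unfolded continuous_at_eps_delta, rule_format, OF half_gt_zero[OF e]] by blast
    obtain d3 where d3: "d3 > 0" "\<And>y. dist y x < d3 \<Longrightarrow> dist (P v u y) (P v u x) < e / 2"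
      using cont[of v u, unfolded continuous_at_eps_delta, rule_format, OF half_gt_zero[OF e]] by blast
    define d where "d = min d1 (min d2 d3)"
    have d: "d > 0" using d1 d2 d3 by (simp add: d_def)
    \<comment> \<open>The whole parallelogram with sides \<open>h *\<^sub>R u\<close> and
      \<open>h *\<^sub>R v\<close> lies within distance less than \<open>d\<close> of
      \<open>x\<close>, where both mixed derivatives are within \<open>e / 2\<close> of their values
      at \<open>x\<close>. The summand 1 covers vanishing \<open>u\<close> and
      \<open>v\<close>.\<close>
    define h where "h = d / (norm u + norm v + 1)"
    have n: "norm u + norm v + 1 > 0" by (simp add: add_nonneg_pos)
    have h: "h > 0" using d n by (simp add: h_def)
    have near: "dist (x + a *\<^sub>R u + b *\<^sub>R v) x < d" if "0 \<le> a" "a \<le> h" "0 \<le> b" "b \<le> h" for a b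
    proof -
      have "norm (a *\<^sub>R u + b *\<^sub>R v) \<le> a * norm u + b * norm v"
        using that by (intro norm_triangle_le) simp
      also have "\<dots> \<le> h * norm u + h * norm v"
        using that by (intro add_mono mult_right_mono) auto
      also have "\<dots> < h * (norm u + norm v + 1)" using h by (simp add: algebra_simps)
      also have "\<dots> = d" using n by (simp add: h_def)
      finally show ?thesis by (simp add: dist_norm add.assoc)
    qed
    have inS: "x + a *\<^sub>R u + b *\<^sub>R v \<in> S"
      if "0 \<le> a" "a \<le> h" "0 \<le> b" "b \<le> h" for a b
      using near[OF that] d1(2) by (auto simp: d_def dist_commute subset_iff)
    have inS': "x + a *\<^sub>R v + b *\<^sub>R u \<in> S"
      if "0 \<le> a" "a \<le> h" "0 \<le> b" "b \<le> h" for a b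
      using inS[OF that(3,4,1,2)] by (simp add: add_ac)
    obtain a b where 1: "0 \<le> a" "a \<le> h" "0 \<le> b" "b \<le> h"
      "f (x + h *\<^sub>R u + h *\<^sub>R v) - f (x + h *\<^sub>R u) - f (x + h *\<^sub>R v) + f x = h^2 * P u v (x + a *\<^sub>R u + b *\<^sub>R v)"
      using second_difference_mean_value[OF assms(1) h inS] unfolding P_def by blast
    obtain a' b' where 2: "0 \<le> a'" "a' \<le> h" "0 \<le> b'" "b' \<le> h"
      "f (x + h *\<^sub>R v + h *\<^sub>R u) - f (x + h *\<^sub>R v) - f (x + h *\<^sub>R u) + f x = h^2 * P v u (x + a' *\<^sub>R v + b' *\<^sub>R u)"
      using second_difference_mean_value[OF assms(1) h inS'] unfolding P_def by blast
    have "h^2 * P u v (x + a *\<^sub>R u + b *\<^sub>R v) = h^2 * P v u (x + a' *\<^sub>R v + b' *\<^sub>R u)"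
      using 1(5) 2(5) by (simp add: algebra_simps)
    then have "P u v (x + a *\<^sub>R u + b *\<^sub>R v) = P v u (x + a' *\<^sub>R v + b' *\<^sub>R u)" using h by simp
    moreover have "dist (P u v (x + a *\<^sub>R u + b *\<^sub>R v)) (P u v x) < e / 2"
      using near[OF 1(1-4)] by (intro d2) (simp add: d_def)
    moreover have "dist (P v u (x + a' *\<^sub>R v + b' *\<^sub>R u)) (P v u x) < e / 2"
      using near[OF 2(3,4,1,2)] by (intro d3) (simp add: d_def add_ac)
    ultimately show ?thesis by (simp add: dist_real_def abs_if split: if_splits)
  qed
  then have "P u v x = P v u x" by (metis abs_0_eq abs_ge_zero eq_iff_diff_eq_0 less_irrefl order_le_less)
  then show ?thesis by (simp add: P_def)
qed

lemma second_derivative_symmetric: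
  fixes f :: "'m::real_normed_vector \<Rightarrow> 'n::real_normed_vector"
  assumes fd: "finite_dimensional TYPE('n)" and f: "smooth_on S f" and "open S" "x \<in> S"
  shows "frechet_derivative (\<lambda>z. frechet_derivative f (at z) u) (at x) v =
    frechet_derivative (\<lambda>z. frechet_derivative f (at z) v) (at x) u"
proof -
  obtain B :: "'n set" and co where B: "finite B" "\<And>b. bounded_linear (co b)"
    "\<And>x. (\<Sum>b\<in>B. co b x *\<^sub>R b) = x"
    using finite_dimensional_frame[OF fd] by metis
  have eq: "frechet_derivative (\<lambda>z. frechet_derivative (\<lambda>y. co b (f y)) (at z) u) (at x) v =
    co b (frechet_derivative (\<lambda>z. frechet_derivative f (at z) u) (at x) v)" for u v b
  proof -
    have "frechet_derivative (\<lambda>y. co b (f y)) (at z) u = co b (frechet_derivative f (at z) u)" if "z \<in> S" for z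
      using frechet_derivative_eqI[OF bounded_linear.has_derivative[OF B(2) smooth_on_has_derivative[OF f that]]] by simp
    then have "frechet_derivative (\<lambda>z. frechet_derivative (\<lambda>y. co b (f y)) (at z) u) (at x) =
        frechet_derivative (\<lambda>z. co b (frechet_derivative f (at z) u)) (at x)"
      by (rule frechet_derivative_cong_open[OF assms(3,4)])
    then show ?thesis
      using frechet_derivative_eqI[OF bounded_linear.has_derivative[OF B(2)
          smooth_on_has_derivative[OF smooth_on_derivative[OF f] assms(4)]]] by simp
  qed
  have "co b (frechet_derivative (\<lambda>z. frechet_derivative f (at z) u) (at x) v) =
    co b (frechet_derivative (\<lambda>z. frechet_derivative f (at z) v) (at x) u)" for b
    using second_derivative_symmetric_real[OF smooth_on_bounded_linear_compose[OF B(2) assms(3) f] assms(3,4), of b u v]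
    by (simp add: eq)
  then show ?thesis by (metis (no_types, lifting) B(3) sum.cong)
qed

section \<open>Ordinary differential equations: Lipschitz bounds, uniqueness, Picard iteration,
  regularity\<close>

lemma smooth_on_lipschitz_ball:
  fixes f :: "'m::real_normed_vector \<Rightarrow> 'n::real_normed_vector"
  assumes fd: "finite_dimensional TYPE('m)" and f: "smooth_on S f" and "open S" "x0 \<in> S"
  obtains r L where "r > 0" "L \<ge> 0" "cball x0 r \<subseteq> S"
    "\<And>y z. y \<in> cball x0 r \<Longrightarrow> z \<in> cball x0 r \<Longrightarrow> norm (f y - f z) \<le> L * norm (y - z)"
proof -
  obtain B :: "'m set" and co where B: "finite B" "\<And>b. bounded_linear (co b)"
    "\<And>x. (\<Sum>b\<in>B. co b x *\<^sub>R b) = x"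
    using finite_dimensional_frame[OF fd] by metis
  have "\<exists>K\<ge>0. \<forall>x. norm (co b x) \<le> norm x * K" for b
    using bounded_linear.nonneg_bounded[OF B(2)] by blast
  then obtain K where K: "\<And>b. K b \<ge> 0" "\<And>b x. norm (co b x) \<le> norm x * K b" by metis
  define D where "D = (\<lambda>b y. frechet_derivative f (at y) b)"
  \<comment> \<open>The derivative is bounded near \<open>x0\<close> through its continuity at
    \<open>x0\<close> in each frame direction separately.\<close>
  have "\<exists>d>0. \<forall>y. dist y x0 < d \<longrightarrow> norm (D b y) \<le> norm (D b x0) + 1" for b
  proof -
    have "isCont (D b) x0"
      using smooth_on_continuous_on[OF smooth_on_derivative[OF f]]
        assms(3,4) continuous_on_eq_continuous_at unfolding D_def by blast
    then obtain d where d: "d > 0" "\<And>y. dist y x0 < d \<Longrightarrow> dist (D b y) (D b x0) < 1"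
      unfolding continuous_at_eps_delta by (meson zero_less_one)
    have "norm (D b y) \<le> norm (D b x0) + 1" if "dist y x0 < d" for y
      using d(2)[OF that] norm_triangle_ineq2[of "D b y" "D b x0"] by (simp add: dist_norm)
    then show ?thesis using d(1) by blast
  qed
  then obtain d where d: "\<And>b. d b > 0" "\<And>b y. dist y x0 < d b \<Longrightarrow> norm (D b y) \<le> norm (D b x0) + 1"
    by metis
  obtain d0 where d0: "d0 > 0" "cball x0 d0 \<subseteq> S" using assms(3,4) open_contains_cball by blast
  \<comment> \<open>Halving \<open>d b\<close> gives the strict inequality \<open>r < d b\<close>
    needed on the closed ball; inserting \<open>d0\<close> keeps the set nonempty when the frame is
    empty.\<close>
  define r where "r = Min (insert d0 ((\<lambda>b. d b / 2) ` B))"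
  have r: "r > 0" "r \<le> d0" using B(1) d0 d by (auto simp: r_def)
  have r3: "r \<le> d b / 2" if "b \<in> B" for b
    unfolding r_def by (rule Min_le) (use B(1) that in auto)
  have rd: "r < d b" if "b \<in> B" for b
    using r3[OF that] d(1)[of b] by linarith
  define L where "L = (\<Sum>b\<in>B. K b * (norm (D b x0) + 1))"
  have L0: "L \<ge> 0" unfolding L_def by (intro sum_nonneg mult_nonneg_nonneg K) (simp add: add_nonneg_nonneg)
  have sub: "cball x0 r \<subseteq> S" using d0(2) r(2) by (meson dual_order.trans subset_cball)
  have bd: "norm (frechet_derivative f (at y) v) \<le> L * norm v" if y: "y \<in> cball x0 r" for y v
  proof -
    have lin: "linear (frechet_derivative f (at y))"
      using smooth_on_has_derivative[OF f] y sub has_derivative_linear by blast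
    have "norm (frechet_derivative f (at y) v) = norm (\<Sum>b\<in>B. co b v *\<^sub>R D b y)"
      by (subst B(3)[of v, symmetric]) (simp add: D_def linear_sum[OF lin] linear_scale[OF lin])
    also have "\<dots> \<le> (\<Sum>b\<in>B. norm v * K b * (norm (D b x0) + 1))"
    proof (rule order_trans[OF norm_sum sum_mono])
      fix b assume b: "b \<in> B"
      have "norm (D b y) \<le> norm (D b x0) + 1"
        by (rule d(2)) (use y rd[OF b] in \<open>simp add: dist_commute\<close>)
      moreover have "\<bar>co b v\<bar> \<le> norm v * K b" using K(2)[of b v] by simp
      ultimately show "norm (co b v *\<^sub>R D b y) \<le> norm v * K b * (norm (D b x0) + 1)"
        unfolding norm_scaleR using K(1)[of b] by (intro mult_mono) auto
    qed
    also have "\<dots> = L * norm v" unfolding L_def sum_distrib_right by (simp add: mult_ac)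
    finally show ?thesis .
  qed
  have "norm (f y - f z) \<le> L * norm (y - z)" if "y \<in> cball x0 r" "z \<in> cball x0 r" for y z
  proof (rule differentiable_bound[OF convex_cball _ _ that])
    fix w assume w: "w \<in> cball x0 r"
    show "(f has_derivative frechet_derivative f (at w)) (at w within cball x0 r)"
      using smooth_on_has_derivative[OF f] w sub has_derivative_at_withinI by blast
    show "onorm (frechet_derivative f (at w)) \<le> L"
      by (rule onorm_bound[OF L0 bd[OF w]])
  qed
  then show thesis using that r(1) L0 sub by blast
qed

text \<open>On so short an interval the largest value of the difference is at most half of itself:
  the mean value inequality bounds it by \<open>L * \<epsilon>\<close> times itself, and
  \<open>L * \<epsilon> \<le> 1 / 2\<close>.\<close>

lemma ode_unique:
  fixes x y :: "real \<Rightarrow> 'm::real_normed_vector"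
  assumes L: "L \<ge> 0" "L * \<epsilon> \<le> 1 / 2"
    and lip: "\<And>y z. y \<in> K \<Longrightarrow> z \<in> K \<Longrightarrow> norm (f y - f z) \<le> L * norm (y - z)"
    and x: "\<And>t. \<bar>t\<bar> < \<epsilon> \<Longrightarrow> x t \<in> K \<and> (x has_vector_derivative f (x t)) (at t)"
    and y: "\<And>t. \<bar>t\<bar> < \<epsilon> \<Longrightarrow> y t \<in> K \<and> (y has_vector_derivative f (y t)) (at t)"
    and xy: "x 0 = y 0" and t: "\<bar>t\<bar> < \<epsilon>"
  shows "x t = y t"
proof -
  define z where "z s = x s - y s" for s
  define T where "T = \<bar>t\<bar>"
  have zd: "(z has_vector_derivative (f (x s) - f (y s))) (at s)" if "s \<in> {-T..T}" for s
    unfolding z_def using x[of s] y[of s] that t by (intro has_vector_derivative_diff) (auto simp: T_def)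
  have cz: "continuous_on {-T..T} (\<lambda>s. norm (z s))"
    by (intro continuous_on_norm continuous_at_imp_continuous_on ballI has_vector_derivative_continuous[OF zd])
  have ne: "{-T..T} \<noteq> {}" by (simp add: T_def)
  obtain t0 where t0: "t0 \<in> {-T..T}" "\<And>s. s \<in> {-T..T} \<Longrightarrow> norm (z s) \<le> norm (z t0)"
    using continuous_attains_sup[OF compact_Icc ne cz] by blast
  have "norm (z t0 - z 0) \<le> (L * norm (z t0)) * norm (t0 - 0)"
  proof (rule differentiable_bound[of "{-T..T}"])
    fix s assume s: "s \<in> {-T..T}"
    show "(z has_derivative (\<lambda>h. h *\<^sub>R (f (x s) - f (y s)))) (at s within {-T..T})"
      using zd[OF s] by (simp add: has_vector_derivative_def has_derivative_at_withinI)
    have "norm (f (x s) - f (y s)) \<le> L * norm (z s)"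
      unfolding z_def using x[of s] y[of s] s t by (intro lip) (auto simp: T_def)
    also have "\<dots> \<le> L * norm (z t0)" using t0(2)[OF s] L(1) by (rule mult_left_mono)
    finally have le: "norm (f (x s) - f (y s)) \<le> L * norm (z t0)" .
    show "onorm (\<lambda>h. h *\<^sub>R (f (x s) - f (y s))) \<le> L * norm (z t0)"
    proof (rule onorm_bound)
      show "norm (h *\<^sub>R (f (x s) - f (y s))) \<le> L * norm (z t0) * norm h" for h :: real
        using mult_left_mono[OF le, of "\<bar>h\<bar>"] by (simp add: mult_ac)
    qed (use L(1) in simp)
  qed (use t0 in \<open>auto simp: T_def\<close>)
  then have "norm (z t0) \<le> (L * \<bar>t0\<bar>) * norm (z t0)" using xy by (simp add: z_def mult_ac)
  also have "\<dots> \<le> (1 / 2) * norm (z t0)"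
  proof (intro mult_right_mono)
    have "L * \<bar>t0\<bar> \<le> L * \<epsilon>" using t0(1) t L(1) by (intro mult_left_mono) (auto simp: T_def)
    then show "L * \<bar>t0\<bar> \<le> 1 / 2" using L(2) by linarith
  qed simp
  finally have "norm (z t0) = 0" by simp
  moreover have "t \<in> {-T..T}" by (auto simp: T_def abs_if)
  ultimately have "norm (z t) \<le> 0" using t0(2) by metis
  then show ?thesis by (simp add: z_def)
qed

text \<open>Picard iteration, set up as a contraction of the closed set \<open>X\<close> of bounded
  continuous functions on the whole real line with values in the ball.\<close>

lemma ode_exists:
  fixes f :: "'m::banach \<Rightarrow> 'm"
  assumes r: "r > 0" and L: "L \<ge> 0" "3 * L * \<epsilon> \<le> 1 / 2" and M: "3 * M * \<epsilon> \<le> r" and \<epsilon>: "\<epsilon> > 0"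
    and lip: "\<And>y z. y \<in> cball x0 r \<Longrightarrow> z \<in> cball x0 r \<Longrightarrow> norm (f y - f z) \<le> L * norm (y - z)"
    and bd: "\<And>y. y \<in> cball x0 r \<Longrightarrow> norm (f y) \<le> M"
  shows "\<exists>x. x 0 = x0 \<and> (\<forall>t. \<bar>t\<bar> < \<epsilon> \<longrightarrow> x t \<in> cball x0 r \<and> (x has_vector_derivative f (x t)) (at t))"
proof -
  define X :: "(real \<Rightarrow>\<^sub>C 'm) set" where "X = PiC UNIV (\<lambda>_. cball x0 r)"
  \<comment> \<open>Clamping the time to the interval makes the iterates bounded continuous
    functions on the whole real line, where the supremum metric is complete.\<close>
  define cl :: "real \<Rightarrow> real" where "cl t = max (-\<epsilon>) (min \<epsilon> t)" for t
  have cl: "cl t \<in> {-\<epsilon>..\<epsilon>}" for t using \<epsilon> by (auto simp: cl_def)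
  \<comment> \<open>Integrals start at the left end point, so that a difference of two values of
    \<open>I\<close> is the oriented integral from 0 for times of either sign.\<close>
  define I where "I g u = integral {-\<epsilon>..u} g" for g :: "real \<Rightarrow> 'm" and u
  define T where "T x t = x0 + (I (\<lambda>s. f (x s)) (cl t) - I (\<lambda>s. f (x s)) 0)" for x t
  have Xin: "apply_bcontfun x s \<in> cball x0 r" if "x \<in> X" for x s
    using that by (auto simp: X_def mem_PiC_iff)
  have cf: "continuous_on (cball x0 r) f"
  proof (rule lipschitz_on_continuous_on[of L])
    show "L-lipschitz_on (cball x0 r) f"
      using L(1) lip by (auto intro!: lipschitz_onI simp: dist_norm)
  qed
  have cfx: "continuous_on A (\<lambda>s. f (apply_bcontfun x s))" if "x \<in> X" for x A
    by (rule continuous_on_compose2[OF cf]) (use Xin[OF that] in \<open>auto intro!: continuous_intros\<close>)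
  \<comment> \<open>The factor 3 comes from estimating the two values of \<open>I\<close>
    separately, by \<open>2 * C * \<epsilon>\<close> at \<open>cl t\<close> and by
    \<open>C * \<epsilon>\<close> at 0. It is the 3 of the smallness assumptions.\<close>
  have Ibound: "norm (I g (cl t) - I g 0) \<le> 3 * C * \<epsilon>"
    if "continuous_on {-\<epsilon>..\<epsilon>} g" "\<And>s. norm (g s) \<le> C" for g C t
  proof -
    have C: "C \<ge> 0" using that(2)[of 0] norm_ge_zero order_trans by blast
    have "norm (I g u) \<le> C * (u + \<epsilon>)" if u: "u \<in> {-\<epsilon>..\<epsilon>}" for u
      using integral_bound[of "-\<epsilon>" u g C] that \<open>\<And>s. norm (g s) \<le> C\<close>
        continuous_on_subset[OF \<open>continuous_on {-\<epsilon>..\<epsilon>} g\<close>, of "{-\<epsilon>..u}"] by (auto simp: I_def)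
    from this[OF cl[of t]] this[of 0] have
      "norm (I g (cl t)) \<le> C * (cl t + \<epsilon>)" "norm (I g 0) \<le> C * (0 + \<epsilon>)" using \<epsilon> by auto
    moreover have "C * (cl t + \<epsilon>) \<le> C * (2 * \<epsilon>)" using cl[of t] C by (intro mult_left_mono) auto
    ultimately have "norm (I g (cl t)) + norm (I g 0) \<le> 3 * C * \<epsilon>" by (simp add: algebra_simps)
    then show ?thesis using norm_triangle_ineq4 order_trans by blast
  qed
  have TX: "T (apply_bcontfun x) t \<in> cball x0 r" if "x \<in> X" for x t
    using Ibound[OF cfx[OF that] bd[OF Xin[OF that]], of t] M unfolding T_def
    by (simp add: dist_norm norm_minus_commute)
  have Tc: "continuous_on UNIV (T (apply_bcontfun x))" if "x \<in> X" for x
  proof -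
    have "continuous_on {-\<epsilon>..\<epsilon>} (I (\<lambda>s. f (apply_bcontfun x s)))"
      unfolding I_def by (intro indefinite_integral_continuous_1 integrable_continuous_real cfx that)
    then have "continuous_on UNIV (\<lambda>t. I (\<lambda>s. f (apply_bcontfun x s)) (cl t))"
      by (rule continuous_on_compose2) (use cl in \<open>auto simp: cl_def intro!: continuous_intros\<close>)
    then show ?thesis unfolding T_def by (intro continuous_intros)
  qed
  have Tb: "apply_bcontfun (Bcontfun (T (apply_bcontfun x))) = T (apply_bcontfun x)" if "x \<in> X" for x
  proof (rule Bcontfun_inverse, rule bcontfun_normI[OF Tc[OF that]])
    show "norm (T (apply_bcontfun x) t) \<le> norm x0 + r" for t
      using TX[OF that, of t] norm_triangle_sub[of "T (apply_bcontfun x) t" x0]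
      by (simp add: dist_norm norm_minus_commute)
  qed
  define TT where "TT x = Bcontfun (T (apply_bcontfun x))" for x
  \<comment> \<open>The bound \<open>M\<close> keeps the iterates in the ball, and
    \<open>3 * L * \<epsilon> \<le> 1 / 2\<close> is the contraction constant.\<close>
  have "\<exists>!x\<in>X. TT x = x"
  proof (rule Banach_fix[where c="1/2"])
    show "complete X" unfolding complete_eq_closed X_def by (intro closed_PiC) simp
    have "const_bcontfun x0 \<in> X" using r by (simp add: X_def mem_PiC_iff const_bcontfun.rep_eq)
    then show "X \<noteq> {}" by blast
    show "TT ` X \<subseteq> X" using TX Tb by (auto simp: X_def mem_PiC_iff TT_def)
    fix x y assume xy: "x \<in> X" "y \<in> X"
    show "dist (TT x) (TT y) \<le> 1 / 2 * dist x y"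
    proof (rule dist_bound)
      fix t
      define g where "g s = f (apply_bcontfun x s) - f (apply_bcontfun y s)" for s
      have "norm (g s) \<le> L * dist x y" for s
      proof -
        have "norm (g s) \<le> L * dist (apply_bcontfun x s) (apply_bcontfun y s)"
          unfolding g_def dist_norm by (intro lip Xin xy)
        also have "\<dots> \<le> L * dist x y" using L(1) dist_bounded by (intro mult_left_mono)
        finally show ?thesis .
      qed
      then have "norm (I g (cl t) - I g 0) \<le> 3 * (L * dist x y) * \<epsilon>"
        by (intro Ibound) (auto simp: g_def intro!: continuous_intros cfx xy)
      also have "\<dots> \<le> 1 / 2 * dist x y"
        using mult_right_mono[OF L(2), of "dist x y"] by (simp add: mult_ac)
      finally have "norm (I g (cl t) - I g 0) \<le> 1 / 2 * dist x y" .
      moreover have "I g u = I (\<lambda>s. f (apply_bcontfun x s)) u - I (\<lambda>s. f (apply_bcontfun y s)) u" for u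
        unfolding I_def g_def by (intro integral_diff integrable_continuous_real cfx xy)
      ultimately show "dist (apply_bcontfun (TT x) t) (apply_bcontfun (TT y) t) \<le> 1 / 2 * dist x y"
        unfolding TT_def Tb[OF xy(1)] Tb[OF xy(2)] T_def dist_norm by (simp add: algebra_simps)
    qed
  qed auto
  then obtain x where x: "x \<in> X" "TT x = x" by blast
  have fix_eq: "apply_bcontfun x t = T (apply_bcontfun x) t" for t
    using Tb[OF x(1)] x(2) by (simp add: TT_def)
  have "apply_bcontfun x 0 = x0" using fix_eq[of 0] \<epsilon> by (simp add: T_def cl_def)
  moreover have "(apply_bcontfun x has_vector_derivative f (apply_bcontfun x t)) (at t)" if t: "\<bar>t\<bar> < \<epsilon>" for t
  proof -
    have "(I (\<lambda>s. f (apply_bcontfun x s)) has_vector_derivative f (apply_bcontfun x t)) (at t within {-\<epsilon>..\<epsilon>})"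
      unfolding I_def by (rule integral_has_vector_derivative[OF cfx[OF x(1)]]) (use t in auto)
    then have "(I (\<lambda>s. f (apply_bcontfun x s)) has_vector_derivative f (apply_bcontfun x t)) (at t)"
      using t by (subst (asm) at_within_interior) auto
    then have "((\<lambda>t. x0 + (I (\<lambda>s. f (apply_bcontfun x s)) t - I (\<lambda>s. f (apply_bcontfun x s)) 0))
        has_vector_derivative f (apply_bcontfun x t)) (at t)"
      by (auto intro!: derivative_eq_intros)
    then show ?thesis
    proof (rule has_vector_derivative_transform_within_open[where S="{-\<epsilon><..<\<epsilon>}"])
      fix s assume "s \<in> {-\<epsilon><..<\<epsilon>}"
      then have "cl s = s" by (auto simp: cl_def)
      then show "x0 + (I (\<lambda>s. f (apply_bcontfun x s)) s - I (\<lambda>s. f (apply_bcontfun x s)) 0) = apply_bcontfun x s"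
        using fix_eq[of s] by (simp add: T_def)
    qed (use t in auto)
  qed
  ultimately show ?thesis using Xin[OF x(1)] by blast
qed

text \<open>The neighbourhood \<open>K\<close> and the time \<open>\<epsilon>\<close> serve
  existence and uniqueness at once. Uniqueness is offered for every
  \<open>\<delta> \<le> \<epsilon>\<close>, because curves to be compared later may stay in
  \<open>K\<close> only for shorter times.\<close>

lemma smooth_on_local_flow:
  fixes f :: "'m::banach \<Rightarrow> 'm"
  assumes fd: "finite_dimensional TYPE('m)" and f: "smooth_on S f" and S: "open S" "x0 \<in> S"
  obtains \<epsilon> K x where "\<epsilon> > 0" "open K" "x0 \<in> K" "K \<subseteq> S" "x 0 = x0"
    "\<And>t. \<bar>t\<bar> < \<epsilon> \<Longrightarrow> x t \<in> K \<and> (x has_vector_derivative f (x t)) (at t)"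
    "\<And>y z \<delta> t. \<lbrakk>\<delta> \<le> \<epsilon>; y 0 = z 0; \<bar>t\<bar> < \<delta>; \<And>s. \<bar>s\<bar> < \<delta> \<Longrightarrow> y s \<in> K \<and> (y has_vector_derivative f (y s)) (at s);
      \<And>s. \<bar>s\<bar> < \<delta> \<Longrightarrow> z s \<in> K \<and> (z has_vector_derivative f (z s)) (at s)\<rbrakk> \<Longrightarrow> y t = z t"
proof -
  obtain r L where rL: "r > 0" "L \<ge> 0" "cball x0 r \<subseteq> S"
    and lip: "\<And>y z. y \<in> cball x0 r \<Longrightarrow> z \<in> cball x0 r \<Longrightarrow> norm (f y - f z) \<le> L * norm (y - z)"
    using smooth_on_lipschitz_ball[OF fd f S] by metis
  define M where "M = norm (f x0) + L * r"
  have bd: "norm (f y) \<le> M" if "y \<in> cball x0 (r/2)" for y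
  proof -
    have y: "y \<in> cball x0 r" using that rL(1) by auto
    have "norm (f y - f x0) \<le> L * norm (y - x0)" using y rL(1) by (intro lip) auto
    also have "\<dots> \<le> L * r" using y rL(2) by (intro mult_left_mono) (auto simp: dist_norm norm_minus_commute)
    finally show ?thesis using norm_triangle_sub[of "f y" "f x0"] by (simp add: M_def)
  qed
  have M0: "M \<ge> 0" using rL by (simp add: M_def)
  \<comment> \<open>The two bounds give \<open>3 * L * \<epsilon> \<le> 1 / 2\<close> and
    \<open>3 * M * \<epsilon> \<le> r / 2\<close>. The iteration runs in the closed ball of radius
    \<open>r / 2\<close>, so the solution stays in the open ball of radius \<open>r\<close>. Adding
    1 avoids division by zero.\<close>
  define \<epsilon> where "\<epsilon> = min (1 / (6 * (L + 1))) (r / (6 * (M + 1)))"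
  have \<epsilon>: "\<epsilon> > 0" using rL M0 by (simp add: \<epsilon>_def)
  have "L * \<epsilon> \<le> (L + 1) * (1 / (6 * (L + 1)))"
    using rL(2) \<epsilon> by (intro mult_mono) (auto simp: \<epsilon>_def)
  also have "\<dots> = 1 / 6" using rL(2) by (simp add: field_simps)
  finally have L1: "3 * L * \<epsilon> \<le> 1 / 2" by simp
  have "M * \<epsilon> \<le> (M + 1) * (r / (6 * (M + 1)))"
    using M0 \<epsilon> by (intro mult_mono) (auto simp: \<epsilon>_def)
  also have "\<dots> = r / 6" using M0 by (simp add: field_simps)
  finally have M1: "3 * M * \<epsilon> \<le> r / 2" by simp
  have r2: "r / 2 > 0" using rL by simp
  have "\<exists>x. x 0 = x0 \<and> (\<forall>t. \<bar>t\<bar> < \<epsilon> \<longrightarrow> x t \<in> cball x0 (r/2) \<and> (x has_vector_derivative f (x t)) (at t))"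
    by (rule ode_exists[OF r2 rL(2) L1 M1 \<epsilon> _ bd]) (use rL(1) in \<open>auto intro!: lip\<close>)
  then obtain x where x: "x 0 = x0"
    "\<And>t. \<bar>t\<bar> < \<epsilon> \<Longrightarrow> x t \<in> cball x0 (r/2) \<and> (x has_vector_derivative f (x t)) (at t)" by blast
  show thesis
  proof (rule that[of \<epsilon> "ball x0 r" x])
    show "x t \<in> ball x0 r \<and> (x has_vector_derivative f (x t)) (at t)" if "\<bar>t\<bar> < \<epsilon>" for t
      using x(2)[OF that] rL(1) by auto
    fix y z \<delta> t
    assume *: "\<delta> \<le> \<epsilon>" "y 0 = z 0" "\<bar>t\<bar> < \<delta>"
      "\<And>s. \<bar>s\<bar> < \<delta> \<Longrightarrow> y s \<in> ball x0 r \<and> (y has_vector_derivative f (y s)) (at s)"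
      "\<And>s. \<bar>s\<bar> < \<delta> \<Longrightarrow> z s \<in> ball x0 r \<and> (z has_vector_derivative f (z s)) (at s)"
    have "L * \<delta> \<le> L * \<epsilon>" using *(1) rL(2) by (rule mult_left_mono)
    moreover have "L * \<epsilon> \<ge> 0" using rL \<epsilon> by simp
    ultimately have "L * \<delta> \<le> 1 / 2" using L1 by linarith
    then show "y t = z t"
      by (rule ode_unique[where K="ball x0 r" and f=f and L=L, OF rL(2)]) (use * lip in auto)
  qed (use \<epsilon> rL x(1) in auto)
qed

text \<open>Bootstrap: the velocity is \<open>f\<close> composed with \<open>x\<close>, so it has as
  many continuous derivatives as \<open>x\<close>, and \<open>x\<close> then has one more.\<close>

lemma smooth_on_ode_solution:
  fixes f :: "'m::real_normed_vector \<Rightarrow> 'm"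
  assumes fd: "finite_dimensional TYPE('m)" and f: "smooth_on S f" and S: "open S" and J: "open J"
    and x: "\<And>t. t \<in> J \<Longrightarrow> x t \<in> S \<and> (x has_vector_derivative f (x t)) (at t)"
  shows "smooth_on J x"
proof -
  have "Ck_on k J x" for k
  proof (induction k)
    case 0
    have "isCont x t" if "t \<in> J" for t using x[OF that] has_vector_derivative_continuous by blast
    then show ?case by (simp add: continuous_at_imp_continuous_on)
  next
    case (Suc k)
    have "Ck_on k J (\<lambda>t. f (x t))"
      by (rule Ck_on_compose[OF fd J S Suc]) (use x f in \<open>auto simp: smooth_on_def\<close>)
    then show ?case using Ck_on_vector_derivative[OF J, of x "\<lambda>t. f (x t)" k] x by simp
  qed
  then show ?thesis by (simp add: smooth_on_def)
qed

section \<open>Smooth maps between manifolds\<close>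

abbreviation cinv :: "('a, 'm) chart \<Rightarrow> 'm \<Rightarrow> 'a"
  where "cinv c \<equiv> inv_into (fst c) (snd c)"

definition fd_atlas :: "('a, 'm::real_normed_vector) atlas \<Rightarrow> bool"
  where "fd_atlas A \<longleftrightarrow> smooth_atlas A \<and> finite_dimensional TYPE('m)"

lemma smooth_atlas_iff: "smooth_atlas A \<longleftrightarrow>
    (\<forall>c\<in>A. inj_on (snd c) (fst c) \<and> open (snd c ` fst c)) \<and>
    (\<forall>c\<in>A. \<forall>d\<in>A. open (snd c ` (fst c \<inter> fst d)) \<and>
       smooth_on (snd c ` (fst c \<inter> fst d)) (\<lambda>y. snd d (cinv c y)))"
  by (simp add: smooth_atlas_def split_beta comp_def)

lemma fd_atlas_dim: 
  fixes A :: "('a, 'm::real_normed_vector) atlas"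
  shows "fd_atlas A \<Longrightarrow> finite_dimensional TYPE('m)"
  by (simp add: fd_atlas_def)

lemma chart_inj: "fd_atlas A \<Longrightarrow> c \<in> A \<Longrightarrow> inj_on (snd c) (fst c)"
  by (simp add: fd_atlas_def smooth_atlas_iff)

lemma chart_open: "fd_atlas A \<Longrightarrow> c \<in> A \<Longrightarrow> open (snd c ` fst c)"
  by (simp add: fd_atlas_def smooth_atlas_iff)

lemma cinv_chart [simp]: "fd_atlas A \<Longrightarrow> c \<in> A \<Longrightarrow> x \<in> fst c \<Longrightarrow> cinv c (snd c x) = x"
  by (simp add: chart_inj)

lemma chart_transition:
  assumes "fd_atlas A" "c \<in> A" "d \<in> A"
  shows "open (snd c ` (fst c \<inter> fst d))" "smooth_on (snd c ` (fst c \<inter> fst d)) (\<lambda>y. snd d (cinv c y))"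
  using assms by (auto simp: fd_atlas_def smooth_atlas_iff)

lemma atlas_space_iff: "x \<in> atlas_space A \<longleftrightarrow> (\<exists>c\<in>A. x \<in> fst c)"
  by (simp add: atlas_space_def split_beta)

lemma atlas_spaceE:
  assumes "x \<in> atlas_space A" obtains c where "c \<in> A" "x \<in> fst c"
  using assms by (auto simp: atlas_space_iff)

lemma atlas_spaceI: "c \<in> A \<Longrightarrow> x \<in> fst c \<Longrightarrow> x \<in> atlas_space A"
  by (auto simp: atlas_space_iff)

lemma atlas_topology_alt:
  "atlas_topology A = topology_generated_by {{x \<in> fst c. snd c x \<in> Q} | c Q. c \<in> A \<and> open Q}"
  unfolding atlas_topology_def by (rule arg_cong[of _ _ topology_generated_by]) auto

lemma openin_chart_vimage: "c \<in> A \<Longrightarrow> open Q \<Longrightarrow> openin (atlas_topology A) {x \<in> fst c. snd c x \<in> Q}"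
  unfolding atlas_topology_alt by (rule topology_generated_by_Basis) blast

lemma openin_chart_domain: "c \<in> A \<Longrightarrow> openin (atlas_topology A) (fst c)"
  using openin_chart_vimage[of c A UNIV] by simp

lemma topspace_atlas_topology [simp]: "topspace (atlas_topology A) = atlas_space A"
  unfolding atlas_topology_alt topology_generated_by_topspace
proof safe
  fix x assume "x \<in> atlas_space A"
  then obtain c where "c \<in> A" "x \<in> fst c" by (rule atlas_spaceE)
  then show "x \<in> \<Union> {{x \<in> fst c. snd c x \<in> Q} |c Q. c \<in> A \<and> open Q}"
    by (intro UnionI[of "{x \<in> fst c. snd c x \<in> UNIV}"]) (blast, simp)
qed (force simp: atlas_space_iff)

text \<open>Charts are open maps for the generated topology. Injectivity of the chart handles
  intersections; for a basic set of another chart the image is a preimage under the continuous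
  transition map.\<close>

lemma open_chart_image:
  assumes A: "fd_atlas A" "c \<in> A" and O: "openin (atlas_topology A) O'"
  shows "open (snd c ` (O' \<inter> fst c))"
proof -
  have "generate_topology_on {{x \<in> fst c. snd c x \<in> Q} | c Q. c \<in> A \<and> open Q} O'"
    using O by (simp add: atlas_topology_alt openin_topology_generated_by_iff)
  then show ?thesis
  proof induction
    case (Int a b)
    have "snd c ` (a \<inter> b \<inter> fst c) = snd c ` (a \<inter> fst c) \<inter> snd c ` (b \<inter> fst c)"
      using chart_inj[OF A] by (auto simp: inj_on_def)
    then show ?case using Int.IH by auto
  next
    case (UN K)
    have "snd c ` (\<Union>K \<inter> fst c) = (\<Union>k\<in>K. snd c ` (k \<inter> fst c))" by auto
    then show ?case using UN.IH by auto
  next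
    case (Basis s)
    then obtain d Q where d: "d \<in> A" "open Q" "s = {x \<in> fst d. snd d x \<in> Q}" by auto
    have "snd c ` (s \<inter> fst c) = snd c ` (fst c \<inter> fst d) \<inter> (\<lambda>y. snd d (cinv c y)) -` Q"
      using A d by (auto simp: image_iff intro!: bexI)
    moreover have "open (snd c ` (fst c \<inter> fst d) \<inter> (\<lambda>y. snd d (cinv c y)) -` Q)"
      by (rule continuous_open_preimage[OF smooth_on_continuous_on[OF chart_transition(2)[OF A d(1)]]
            chart_transition(1)[OF A d(1)] d(2)])
    ultimately show ?case by simp
  qed simp
qed

lemma cinv_in: "fd_atlas A \<Longrightarrow> c \<in> A \<Longrightarrow> y \<in> snd c ` fst c \<Longrightarrow> cinv c y \<in> fst c"
  by (simp add: inv_into_into)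

lemma chart_cinv: "y \<in> snd c ` fst c \<Longrightarrow> snd c (cinv c y) = y"
  by (simp add: f_inv_into_f)

lemma chart_image_mem:
  "fd_atlas A \<Longrightarrow> c \<in> A \<Longrightarrow> y \<in> snd c ` {x \<in> fst c. P x} \<Longrightarrow> cinv c y \<in> fst c \<and> P (cinv c y)"
  by auto

lemma smooth_map_iff: "smooth_map A B F \<longleftrightarrow>
    continuous_map (atlas_topology A) (atlas_topology B) F \<and>
    (\<forall>c\<in>A. \<forall>d\<in>B. smooth_on (snd c ` {x \<in> fst c. F x \<in> fst d}) (\<lambda>y. snd d (F (cinv c y))))"
  by (simp add: smooth_map_def split_beta comp_def)

lemma smooth_map_lrep:
  assumes "fd_atlas A" "smooth_map A B F" "c \<in> A" "d \<in> B"
  shows "open (snd c ` {x \<in> fst c. F x \<in> fst d})"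
    and "smooth_on (snd c ` {x \<in> fst c. F x \<in> fst d}) (\<lambda>y. snd d (F (cinv c y)))"
proof -
  have "openin (atlas_topology A) {x \<in> topspace (atlas_topology A). F x \<in> fst d}"
    using assms openin_chart_domain[OF assms(4)] by (auto simp: smooth_map_iff continuous_map_def)
  from open_chart_image[OF assms(1,3) this]
  have "open (snd c ` ({x \<in> atlas_space A. F x \<in> fst d} \<inter> fst c))" by simp
  moreover have "{x \<in> atlas_space A. F x \<in> fst d} \<inter> fst c = {x \<in> fst c. F x \<in> fst d}"
    using assms(3) by (auto simp: atlas_space_iff)
  ultimately show "open (snd c ` {x \<in> fst c. F x \<in> fst d})" by simp
qed (use assms in \<open>simp add: smooth_map_iff\<close>)

lemma smooth_map_space: "smooth_map A B F \<Longrightarrow> p \<in> atlas_space A \<Longrightarrow> F p \<in> atlas_space B"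
  by (auto simp: smooth_map_iff continuous_map_def Pi_iff)

text \<open>\<open>smooth_map\<close> asks for continuity and for smoothness in all pairs of charts.
  One good pair around each point suffices, since every other local representation arises by
  composition with transition maps; continuity follows from the same representations.\<close>

lemma smooth_mapI:
  fixes A :: "('a, 'm::real_normed_vector) atlas" and B :: "('b, 'n::real_normed_vector) atlas"
  assumes A: "fd_atlas A" and B: "fd_atlas B"
    and loc: "\<And>p. p \<in> atlas_space A \<Longrightarrow> \<exists>c\<in>A. \<exists>d\<in>B. \<exists>Q. p \<in> fst c \<and> open Q \<and> snd c p \<in> Q \<and> Q \<subseteq> snd c ` fst c
      \<and> (\<forall>y\<in>Q. F (cinv c y) \<in> fst d) \<and> smooth_on Q (\<lambda>y. snd d (F (cinv c y)))"
  shows "smooth_map A B F"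
  unfolding smooth_map_iff
proof
  note fdA = fd_atlas_dim[OF A] and fdB = fd_atlas_dim[OF B]
  \<comment> \<open>Exchange of the target chart: \<open>Q\<close> shrinks to the part whose image
    lies in both target charts, and the representation is composed with the transition from
    \<open>d\<close> to \<open>d'\<close>.\<close>
  have key: "\<exists>c\<in>A. \<exists>d\<in>B. \<exists>Q. p \<in> fst c \<and> open Q \<and> snd c p \<in> Q \<and> Q \<subseteq> snd c ` fst c \<and> F p \<in> fst d
      \<and> (\<forall>y\<in>Q. F (cinv c y) \<in> fst d \<and> F (cinv c y) \<in> fst d') \<and> smooth_on Q (\<lambda>y. snd d' (F (cinv c y)))"
    if p: "p \<in> atlas_space A" "F p \<in> fst d'" "d' \<in> B" for p d'
  proof -
    obtain c d Q where c: "c \<in> A" "d \<in> B" "p \<in> fst c" "open Q" "snd c p \<in> Q" "Q \<subseteq> snd c ` fst c"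
      "\<And>y. y \<in> Q \<Longrightarrow> F (cinv c y) \<in> fst d" "smooth_on Q (\<lambda>y. snd d (F (cinv c y)))"
      using loc[OF p(1)] by blast
    define Q' where "Q' = Q \<inter> (\<lambda>y. snd d (F (cinv c y))) -` (snd d ` (fst d \<inter> fst d'))"
    have "open Q'" unfolding Q'_def
      by (rule continuous_open_preimage[OF smooth_on_continuous_on[OF c(8)] c(4) chart_transition(1)[OF B c(2) p(3)]])
    moreover have in': "F (cinv c y) \<in> fst d'" if "y \<in> Q'" for y
      using that inj_onD[OF chart_inj[OF B c(2)]] c(7)[of y] unfolding Q'_def by blast
    moreover have "smooth_on Q' (\<lambda>y. snd d' (cinv d (snd d (F (cinv c y)))))"
      by (rule smooth_on_compose[OF fdB \<open>open Q'\<close> chart_transition(1)[OF B c(2) p(3)]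
            smooth_on_subset[OF c(8)] chart_transition(2)[OF B c(2) p(3)]])
        (auto simp: Q'_def)
    then have "smooth_on Q' (\<lambda>y. snd d' (F (cinv c y)))"
      by (rule smooth_on_cong[OF \<open>open Q'\<close>]) (use B c in \<open>auto simp: Q'_def\<close>)
    moreover have Fp: "F p \<in> fst d" using c(7)[OF c(5)] c(1,3) A by simp
    then have "snd c p \<in> Q'" using c(1,3,5) p A by (auto simp: Q'_def)
    ultimately show ?thesis using c(1-3,6,7) in' A c p Fp unfolding Q'_def
      by (intro bexI[of _ c] bexI[of _ d] exI[of _ Q']) (auto simp: Q'_def)
  qed
  show "continuous_map (atlas_topology A) (atlas_topology B) F"
    unfolding atlas_topology_alt[of B]
  proof (subst continuous_on_generated_topo_iff, intro conjI allI impI)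
    show "F ` topspace (atlas_topology A) \<subseteq> \<Union> {{x \<in> fst c. snd c x \<in> Q} |c Q. c \<in> B \<and> open Q}"
    proof clarify
      fix p assume "p \<in> topspace (atlas_topology A)"
      then obtain c d Q where "c \<in> A" "d \<in> B" "p \<in> fst c" "snd c p \<in> Q"  "\<forall>y\<in>Q. F (cinv c y) \<in> fst d"
        using loc[of p] by auto
      then have "d \<in> B" "F p \<in> fst d" using A by auto
      then show "F p \<in> \<Union> {{x \<in> fst c. snd c x \<in> Q} |c Q. c \<in> B \<and> open Q}"
        by (intro UnionI[of "{x \<in> fst d. snd d x \<in> UNIV}"]) (blast, simp)
    qed
    fix U assume "U \<in> {{x \<in> fst c. snd c x \<in> Q} |c Q. c \<in> B \<and> open Q}"
    then obtain d' R where d': "d' \<in> B" "open R" "U = {x \<in> fst d'. snd d' x \<in> R}" by auto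
    show "openin (atlas_topology A) (F -` U \<inter> topspace (atlas_topology A))"
    proof (subst openin_subopen, intro ballI)
      fix p assume p: "p \<in> F -` U \<inter> topspace (atlas_topology A)"
      then obtain c d Q where c: "c \<in> A" "p \<in> fst c" "open Q" "snd c p \<in> Q" "Q \<subseteq> snd c ` fst c"
        "\<forall>y\<in>Q. F (cinv c y) \<in> fst d'" "smooth_on Q (\<lambda>y. snd d' (F (cinv c y)))"
        using key[of p d'] d' by auto
      define Q' where "Q' = Q \<inter> (\<lambda>y. snd d' (F (cinv c y))) -` R"
      have "open Q'" unfolding Q'_def
        by (rule continuous_open_preimage[OF smooth_on_continuous_on[OF c(7)] c(3) d'(2)])
      then have "openin (atlas_topology A) {x \<in> fst c. snd c x \<in> Q'}"
        by (rule openin_chart_vimage[OF c(1)])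
      moreover have "p \<in> {x \<in> fst c. snd c x \<in> Q'}" using p c d' A by (auto simp: Q'_def)
      moreover have "{x \<in> fst c. snd c x \<in> Q'} \<subseteq> F -` U \<inter> topspace (atlas_topology A)"
      proof clarify
        fix x assume x: "x \<in> fst c" "snd c x \<in> Q'"
        then have "F x \<in> fst d'" "snd d' (F x) \<in> R"
          using bspec[OF c(6), of "snd c x"] A c(1) by (auto simp: Q'_def)
        then show "x \<in> F -` U \<inter> topspace (atlas_topology A)"
          using atlas_spaceI[OF c(1) x(1)] by (simp add: d'(3))
      qed
      ultimately show "\<exists>T. openin (atlas_topology A) T \<and> p \<in> T \<and> T \<subseteq> F -` U \<inter> topspace (atlas_topology A)"
        by blast
    qed
  qed
  show "\<forall>c\<in>A. \<forall>d\<in>B. smooth_on (snd c ` {x \<in> fst c. F x \<in> fst d}) (\<lambda>y. snd d (F (cinv c y)))"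
  proof (intro ballI smooth_on_local)
    fix c' d' y assume c': "c' \<in> A" "d' \<in> B" and y: "y \<in> snd c' ` {x \<in> fst c'. F x \<in> fst d'}"
    then obtain p where p: "p \<in> fst c'" "F p \<in> fst d'" "y = snd c' p" by auto
    have "p \<in> atlas_space A" using p c' by (auto simp: atlas_space_iff)
    from key[OF this p(2) c'(2)] obtain c Q where c: "c \<in> A" "p \<in> fst c" "open Q" "snd c p \<in> Q" "Q \<subseteq> snd c ` fst c"
      "smooth_on Q (\<lambda>y. snd d' (F (cinv c y)))"
      by auto
    \<comment> \<open>Exchange of the source chart: \<open>T\<close> is the part of the overlap,
      seen in the chart \<open>c'\<close>, that the transition sends into \<open>Q\<close>.\<close>
    define T where "T = snd c' ` (fst c' \<inter> fst c) \<inter> (\<lambda>y. snd c (cinv c' y)) -` Q"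
    have oT: "open T" unfolding T_def
      by (rule continuous_open_preimage[OF smooth_on_continuous_on[OF chart_transition(2)[OF A c'(1) c(1)]]
            chart_transition(1)[OF A c'(1) c(1)] c(3)])
    have "smooth_on T (\<lambda>y. snd d' (F (cinv c (snd c (cinv c' y)))))"
      by (rule smooth_on_compose[OF fdA oT c(3) smooth_on_subset[OF chart_transition(2)[OF A c'(1) c(1)]] c(6)])
        (auto simp: T_def)
    then have "smooth_on T (\<lambda>y. snd d' (F (cinv c' y)))"
      by (rule smooth_on_cong[OF oT]) (use A c c' in \<open>auto simp: T_def\<close>)
    moreover have "y \<in> T" using p c A c' by (auto simp: T_def)
    ultimately show "\<exists>T. open T \<and> y \<in> T \<and> smooth_on T (\<lambda>y. snd d' (F (cinv c' y)))"
      using oT by blast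
  qed
qed

lemma smooth_map_compose:
  fixes A :: "('a, 'm::real_normed_vector) atlas" and B :: "('b, 'n::real_normed_vector) atlas"
    and C :: "('c, 'k::real_normed_vector) atlas"
  assumes A: "fd_atlas A" and B: "fd_atlas B" and C: "fd_atlas C"
    and F: "smooth_map A B F" and G: "smooth_map B C G"
  shows "smooth_map A C (\<lambda>x. G (F x))"
proof (rule smooth_mapI[OF A C])
  fix p assume p: "p \<in> atlas_space A"
  obtain c where c: "c \<in> A" "p \<in> fst c" using p by (rule atlas_spaceE)
  obtain d where d: "d \<in> B" "F p \<in> fst d" using smooth_map_space[OF F p] by (rule atlas_spaceE)
  obtain e where e: "e \<in> C" "G (F p) \<in> fst e" using smooth_map_space[OF G smooth_map_space[OF F p]] by (rule atlas_spaceE)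
  note lF = smooth_map_lrep[OF A F c(1) d(1)] and lG = smooth_map_lrep[OF B G d(1) e(1)]
  define Q where "Q = snd c ` {x \<in> fst c. F x \<in> fst d} \<inter> (\<lambda>y. snd d (F (cinv c y))) -` (snd d ` {x \<in> fst d. G x \<in> fst e})"
  have oQ: "open Q" unfolding Q_def
    by (rule continuous_open_preimage[OF smooth_on_continuous_on[OF lF(2)] lF(1) lG(1)])
  have Qin: "F (cinv c y) \<in> fst d" "G (F (cinv c y)) \<in> fst e" if y: "y \<in> Q" for y
  proof -
    show 1: "F (cinv c y) \<in> fst d" using y A c by (auto simp: Q_def)
    obtain z where "z \<in> fst d" "G z \<in> fst e" "snd d (F (cinv c y)) = snd d z"
      using y unfolding Q_def by blast
    then show "G (F (cinv c y)) \<in> fst e" using inj_onD[OF chart_inj[OF B d(1)]] 1 by metis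
  qed
  have "smooth_on Q (\<lambda>y. snd e (G (cinv d (snd d (F (cinv c y))))))"
    by (rule smooth_on_compose[OF fd_atlas_dim[OF B] oQ lG(1) smooth_on_subset[OF lF(2)] lG(2)]) (auto simp: Q_def)
  then have "smooth_on Q (\<lambda>y. snd e (G (F (cinv c y))))"
    by (rule smooth_on_cong[OF oQ]) (use B d Qin in auto)
  moreover have "snd c p \<in> Q" using A c d e by (auto simp: Q_def)
  moreover have "Q \<subseteq> snd c ` fst c" by (auto simp: Q_def)
  ultimately show "\<exists>c\<in>A. \<exists>d\<in>C. \<exists>Q. p \<in> fst c \<and> open Q \<and> snd c p \<in> Q \<and> Q \<subseteq> snd c ` fst c
      \<and> (\<forall>y\<in>Q. G (F (cinv c y)) \<in> fst d) \<and> smooth_on Q (\<lambda>y. snd d (G (F (cinv c y))))"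
    using c e oQ Qin by blast
qed

text \<open>Maps are total functions, while group identities hold on the carrier only; this allows
  one expression to be replaced by another that agrees with it on the manifold.\<close>

lemma smooth_map_cong:
  assumes "fd_atlas A" "fd_atlas B" "smooth_map A B F" "\<And>x. x \<in> atlas_space A \<Longrightarrow> F x = G x"
  shows "smooth_map A B G"
proof -
  have FG: "F x = G x" if "c \<in> A" "x \<in> fst c" for c x
    using assms(4) atlas_spaceI[OF that] by blast
  have dom: "{x \<in> fst c. F x \<in> fst d} = {x \<in> fst c. G x \<in> fst d}" if "c \<in> A" for c d
    using FG[OF that] by auto
  have eqc: "F (cinv c y) = G (cinv c y)" if "c \<in> A" "y \<in> snd c ` {x \<in> fst c. F x \<in> fst d}" for c d y
    using FG[OF that(1)] that assms(1) by auto
  have cont: "continuous_map (atlas_topology A) (atlas_topology B) G"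
    by (rule continuous_map_eq[of _ _ F]) (use assms in \<open>simp_all add: smooth_map_iff\<close>)
  have sm: "smooth_on (snd c ` {x \<in> fst c. F x \<in> fst d}) (\<lambda>y. snd d (G (cinv c y)))"
    if "c \<in> A" "d \<in> B" for c d
    by (rule smooth_on_cong[OF smooth_map_lrep[OF assms(1,3) that]]) (rule arg_cong[of _ _ "snd d"], erule eqc[OF that(1)])
  show ?thesis unfolding smooth_map_iff using sm cont by (auto simp: dom)
qed

lemma smooth_map_id: "fd_atlas A \<Longrightarrow> smooth_map A A (\<lambda>x. x)"
proof (rule smooth_mapI)
  fix p assume A: "fd_atlas A" and "p \<in> atlas_space A"
  then obtain c where c: "c \<in> A" "p \<in> fst c" by (auto elim: atlas_spaceE)
  have "smooth_on (snd c ` fst c) (\<lambda>y. snd c (cinv c y))"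
    by (rule smooth_on_cong[OF chart_open[OF A c(1)] smooth_on_id]) (simp add: chart_cinv)
  then show "\<exists>c\<in>A. \<exists>d\<in>A. \<exists>Q. p \<in> fst c \<and> open Q \<and> snd c p \<in> Q \<and> Q \<subseteq> snd c ` fst c
      \<and> (\<forall>y\<in>Q. cinv c y \<in> fst d) \<and> smooth_on Q (\<lambda>y. snd d (cinv c y))"
    using c chart_open[OF A c(1)] A by (intro bexI[of _ c] exI[of _ "snd c ` fst c"]) (auto simp: cinv_in)
qed

lemma real_atlas_simps [simp]: "atlas_space real_atlas = UNIV" "c \<in> real_atlas \<longleftrightarrow> c = (UNIV, \<lambda>t. t)"
  by (auto simp: real_atlas_def atlas_space_def)

lemma inv_into_ident [simp]: "inv_into UNIV (\<lambda>t. t) = (\<lambda>t. t)"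
  by (rule inv_unique_comp) auto

lemma fd_atlas_real [simp]: "fd_atlas real_atlas"
  by (simp add: fd_atlas_def smooth_atlas_iff)

lemma smooth_map_realD:
  assumes "fd_atlas A" "smooth_map A real_atlas f" "c \<in> A"
  shows "smooth_on (snd c ` fst c) (\<lambda>y. f (cinv c y))"
  using smooth_map_lrep(2)[OF assms, of "(UNIV, \<lambda>t. t)"] by simp

lemma smooth_map_realI:
  assumes A: "fd_atlas A" and f: "\<And>c. c \<in> A \<Longrightarrow> smooth_on (snd c ` fst c) (\<lambda>y. f (cinv c y))"
  shows "smooth_map A real_atlas f"
proof (rule smooth_mapI[OF A fd_atlas_real])
  fix p assume "p \<in> atlas_space A"
  then obtain c where c: "c \<in> A" "p \<in> fst c" by (auto elim: atlas_spaceE)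
  then show "\<exists>c\<in>A. \<exists>d\<in>real_atlas. \<exists>Q. p \<in> fst c \<and> open Q \<and> snd c p \<in> Q \<and> Q \<subseteq> snd c ` fst c
      \<and> (\<forall>y\<in>Q. f (cinv c y) \<in> fst d) \<and> smooth_on Q (\<lambda>y. snd d (f (cinv c y)))"
    using f[OF c(1)] chart_open[OF A c(1)] by (intro bexI[of _ c] exI[of _ "snd c ` fst c"]) auto
qed

lemma smooth_map_real_iff:
  "fd_atlas A \<Longrightarrow> smooth_map A real_atlas f \<longleftrightarrow> (\<forall>c\<in>A. smooth_on (snd c ` fst c) (\<lambda>y. f (cinv c y)))"
  using smooth_map_realI smooth_map_realD by blast

lemma smooth_map_real_const: "fd_atlas A \<Longrightarrow> smooth_map A real_atlas (\<lambda>x. a)"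
  by (simp add: smooth_map_real_iff)

lemma smooth_map_real_add:
  "fd_atlas A \<Longrightarrow> smooth_map A real_atlas f \<Longrightarrow> smooth_map A real_atlas g \<Longrightarrow> smooth_map A real_atlas (\<lambda>x. f x + g x)"
  by (simp add: smooth_map_real_iff smooth_on_add chart_open)

lemma smooth_map_real_diff:
  "fd_atlas A \<Longrightarrow> smooth_map A real_atlas f \<Longrightarrow> smooth_map A real_atlas g \<Longrightarrow> smooth_map A real_atlas (\<lambda>x. f x - g x)"
  by (simp add: smooth_map_real_iff smooth_on_diff chart_open)

lemma smooth_map_real_mult:
  "fd_atlas A \<Longrightarrow> smooth_map A real_atlas f \<Longrightarrow> smooth_map A real_atlas g \<Longrightarrow> smooth_map A real_atlas (\<lambda>x. f x * g x)"
  by (simp add: smooth_map_real_iff smooth_on_mult chart_open)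

lemma smooth_map_real_sum:
  "fd_atlas A \<Longrightarrow> (\<And>i. i \<in> I \<Longrightarrow> smooth_map A real_atlas (f i)) \<Longrightarrow> smooth_map A real_atlas (\<lambda>x. \<Sum>i\<in>I. f i x)"
  by (simp add: smooth_map_real_iff smooth_on_sum chart_open)

section \<open>Products of manifolds\<close>

lemma prod_atlas_iff:
  "e \<in> prod_atlas A B \<longleftrightarrow> (\<exists>c\<in>A. \<exists>d\<in>B. e = (fst c \<times> fst d, map_prod (snd c) (snd d)))"
  by (simp add: prod_atlas_def Bex_def split_paired_Ex) blast

lemma prod_atlasE:
  assumes "e \<in> prod_atlas A B"
  obtains c d where "c \<in> A" "d \<in> B" "e = (fst c \<times> fst d, map_prod (snd c) (snd d))"
  using assms by (auto simp: prod_atlas_iff)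

lemma prod_atlasI: "c \<in> A \<Longrightarrow> d \<in> B \<Longrightarrow> (fst c \<times> fst d, map_prod (snd c) (snd d)) \<in> prod_atlas A B"
  by (auto simp: prod_atlas_iff)

lemma cinv_prod:
  assumes "fd_atlas A" "fd_atlas B" "c \<in> A" "d \<in> B" "y \<in> snd c ` fst c" "z \<in> snd d ` fst d"
  shows "inv_into (fst c \<times> fst d) (map_prod (snd c) (snd d)) (y, z) = (cinv c y, cinv d z)"
proof (rule inv_into_f_eq)
  show "inj_on (map_prod (snd c) (snd d)) (fst c \<times> fst d)"
    using assms by (intro map_prod_inj_on chart_inj)
qed (use assms in \<open>auto simp: chart_cinv cinv_in\<close>)

lemma atlas_space_prod [simp]: "atlas_space (prod_atlas A B) = atlas_space A \<times> atlas_space B"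
proof safe
  fix x y
  show "x \<in> atlas_space A" "y \<in> atlas_space B" if "(x, y) \<in> atlas_space (prod_atlas A B)"
    using that by (auto elim!: atlas_spaceE prod_atlasE intro: atlas_spaceI)
  assume "x \<in> atlas_space A" "y \<in> atlas_space B"
  then obtain c d where "c \<in> A" "d \<in> B" "x \<in> fst c" "y \<in> fst d" by (auto elim!: atlas_spaceE)
  then show "(x, y) \<in> atlas_space (prod_atlas A B)"
    by (intro atlas_spaceI[OF prod_atlasI[of c A d B]]) auto
qed

lemma fd_atlas_prod:
  assumes A: "fd_atlas A" and B: "fd_atlas B"
  shows "fd_atlas (prod_atlas A B)"
  unfolding fd_atlas_def smooth_atlas_iff
proof (intro conjI ballI)
  show "finite_dimensional TYPE('b \<times> 'd)" by (intro finite_dimensional_prod fd_atlas_dim[OF A] fd_atlas_dim[OF B])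
  fix e assume e: "e \<in> prod_atlas A B"
  then obtain c d where cd: "c \<in> A" "d \<in> B" "e = (fst c \<times> fst d, map_prod (snd c) (snd d))"
    by (rule prod_atlasE)
  show "inj_on (snd e) (fst e)" unfolding cd(3)
    by (simp add: map_prod_inj_on chart_inj[OF A cd(1)] chart_inj[OF B cd(2)])
  show "open (snd e ` fst e)" unfolding cd(3)
    by (simp add: map_prod_surj_on open_Times chart_open[OF A cd(1)] chart_open[OF B cd(2)] map_prod_image)
  fix e' assume e': "e' \<in> prod_atlas A B"
  then obtain c' d' where cd': "c' \<in> A" "d' \<in> B" "e' = (fst c' \<times> fst d', map_prod (snd c') (snd d'))"
    by (rule prod_atlasE)
  have eq: "snd e ` (fst e \<inter> fst e') = (snd c ` (fst c \<inter> fst c')) \<times> (snd d ` (fst d \<inter> fst d'))"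
    unfolding cd(3) cd'(3) by (auto simp: Times_Int_Times map_prod_image)
  show op: "open (snd e ` (fst e \<inter> fst e'))" unfolding eq
    by (rule open_Times[OF chart_transition(1)[OF A cd(1) cd'(1)] chart_transition(1)[OF B cd(2) cd'(2)]])
  have "smooth_on (snd e ` (fst e \<inter> fst e')) (\<lambda>y. (snd c' (cinv c (fst y)), snd d' (cinv d (snd y))))"
  proof (intro smooth_on_Pair op)
    show "smooth_on (snd e ` (fst e \<inter> fst e')) (\<lambda>y. snd c' (cinv c (fst y)))"
      by (rule smooth_on_compose[OF fd_atlas_dim[OF A] op chart_transition(1)[OF A cd(1) cd'(1)] _ chart_transition(2)[OF A cd(1) cd'(1)]])
        (auto simp: eq smooth_on_bounded_linear bounded_linear_fst)
    show "smooth_on (snd e ` (fst e \<inter> fst e')) (\<lambda>y. snd d' (cinv d (snd y)))"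
      by (rule smooth_on_compose[OF fd_atlas_dim[OF B] op chart_transition(1)[OF B cd(2) cd'(2)] _ chart_transition(2)[OF B cd(2) cd'(2)]])
        (auto simp: eq smooth_on_bounded_linear bounded_linear_snd)
  qed
  then show "smooth_on (snd e ` (fst e \<inter> fst e')) (\<lambda>y. snd e' (cinv e y))"
  proof (rule smooth_on_cong[OF op])
    fix y assume "y \<in> snd e ` (fst e \<inter> fst e')"
    then have "fst y \<in> snd c ` fst c" "snd y \<in> snd d ` fst d" by (auto simp: eq)
    from cinv_prod[OF A B cd(1,2) this]
    show "(snd c' (cinv c (fst y)), snd d' (cinv d (snd y))) = snd e' (cinv e y)"
      by (simp add: cd(3) cd'(3))
  qed
qed

lemma smooth_map_fst: 
  assumes A: "fd_atlas A" and B: "fd_atlas B"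
  shows "smooth_map (prod_atlas A B) A fst"
proof (rule smooth_mapI[OF fd_atlas_prod[OF A B] A])
  fix p assume "p \<in> atlas_space (prod_atlas A B)"
  then obtain c d where c: "c \<in> A" "d \<in> B" "fst p \<in> fst c" "snd p \<in> fst d"
    by (auto elim!: atlas_spaceE)
  define e where "e = (fst c \<times> fst d, map_prod (snd c) (snd d))"
  have e: "e \<in> prod_atlas A B" unfolding e_def by (rule prod_atlasI[OF c(1,2)])
  have op: "open (snd e ` fst e)" by (rule chart_open[OF fd_atlas_prod[OF A B] e])
  have eq: "cinv e y = (cinv c (fst y), cinv d (snd y))" "fst y \<in> snd c ` fst c" if "y \<in> snd e ` fst e" for y
    using cinv_prod[OF A B c(1,2), of "fst y" "snd y"] that by (auto simp: e_def)
  have "smooth_on (snd e ` fst e) (\<lambda>y. snd c (fst (cinv e y)))"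
    by (rule smooth_on_cong[OF op smooth_on_bounded_linear[OF bounded_linear_fst]]) (simp add: eq chart_cinv)
  then show "\<exists>c\<in>prod_atlas A B. \<exists>d\<in>A. \<exists>Q. p \<in> fst c \<and> open Q \<and> snd c p \<in> Q \<and> Q \<subseteq> snd c ` fst c
      \<and> (\<forall>y\<in>Q. fst (cinv c y) \<in> fst d) \<and> smooth_on Q (\<lambda>y. snd d (fst (cinv c y)))"
    using op c eq cinv_in[OF A c(1)]
    by (intro bexI[OF _ e] bexI[OF _ c(1)] exI[of _ "snd e ` fst e"]) (auto simp: e_def mem_Times_iff)
qed

lemma smooth_map_snd: 
  assumes A: "fd_atlas A" and B: "fd_atlas B"
  shows "smooth_map (prod_atlas A B) B snd"
proof (rule smooth_mapI[OF fd_atlas_prod[OF A B] B])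
  fix p assume "p \<in> atlas_space (prod_atlas A B)"
  then obtain c d where c: "c \<in> A" "d \<in> B" "fst p \<in> fst c" "snd p \<in> fst d"
    by (auto elim!: atlas_spaceE)
  define e where "e = (fst c \<times> fst d, map_prod (snd c) (snd d))"
  have e: "e \<in> prod_atlas A B" unfolding e_def by (rule prod_atlasI[OF c(1,2)])
  have op: "open (snd e ` fst e)" by (rule chart_open[OF fd_atlas_prod[OF A B] e])
  have eq: "cinv e y = (cinv c (fst y), cinv d (snd y))" "snd y \<in> snd d ` fst d" if "y \<in> snd e ` fst e" for y
    using cinv_prod[OF A B c(1,2), of "fst y" "snd y"] that by (auto simp: e_def)
  have "smooth_on (snd e ` fst e) (\<lambda>y. snd d (snd (cinv e y)))"
    by (rule smooth_on_cong[OF op smooth_on_bounded_linear[OF bounded_linear_snd]]) (simp add: eq chart_cinv)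
  then show "\<exists>c\<in>prod_atlas A B. \<exists>d\<in>B. \<exists>Q. p \<in> fst c \<and> open Q \<and> snd c p \<in> Q \<and> Q \<subseteq> snd c ` fst c
      \<and> (\<forall>y\<in>Q. snd (cinv c y) \<in> fst d) \<and> smooth_on Q (\<lambda>y. snd d (snd (cinv c y)))"
    using op c eq cinv_in[OF B c(2)]
    by (intro bexI[OF _ e] bexI[OF _ c(2)] exI[of _ "snd e ` fst e"]) (auto simp: e_def mem_Times_iff)
qed

lemma smooth_map_Pair:
  assumes P: "fd_atlas P" and A: "fd_atlas A" and B: "fd_atlas B"
    and F: "smooth_map P A F" and G: "smooth_map P B G"
  shows "smooth_map P (prod_atlas A B) (\<lambda>x. (F x, G x))"
proof (rule smooth_mapI[OF P fd_atlas_prod[OF A B]])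
  fix p assume p: "p \<in> atlas_space P"
  obtain c where c: "c \<in> P" "p \<in> fst c" using p by (rule atlas_spaceE)
  obtain a where a: "a \<in> A" "F p \<in> fst a" using smooth_map_space[OF F p] by (rule atlas_spaceE)
  obtain b where b: "b \<in> B" "G p \<in> fst b" using smooth_map_space[OF G p] by (rule atlas_spaceE)
  note lF = smooth_map_lrep[OF P F c(1) a(1)] and lG = smooth_map_lrep[OF P G c(1) b(1)]
  define Q where "Q = snd c ` {x \<in> fst c. F x \<in> fst a} \<inter> snd c ` {x \<in> fst c. G x \<in> fst b}"
  have oQ: "open Q" unfolding Q_def using lF(1) lG(1) by (rule open_Int)
  have "smooth_on Q (\<lambda>y. (snd a (F (cinv c y)), snd b (G (cinv c y))))"
    by (intro smooth_on_Pair oQ smooth_on_subset[OF lF(2)] smooth_on_subset[OF lG(2)]) (auto simp: Q_def)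
  moreover have "F (cinv c y) \<in> fst a" "G (cinv c y) \<in> fst b" if "y \<in> Q" for y
    using that chart_image_mem[OF P c(1), of y "\<lambda>x. F x \<in> fst a"]
      chart_image_mem[OF P c(1), of y "\<lambda>x. G x \<in> fst b"] by (simp_all add: Q_def)
  moreover have "snd c p \<in> Q" using c a b by (auto simp: Q_def)
  moreover have "Q \<subseteq> snd c ` fst c" by (auto simp: Q_def)
  ultimately show "\<exists>c\<in>P. \<exists>d\<in>prod_atlas A B. \<exists>Q. p \<in> fst c \<and> open Q \<and> snd c p \<in> Q \<and> Q \<subseteq> snd c ` fst c
      \<and> (\<forall>y\<in>Q. (F (cinv c y), G (cinv c y)) \<in> fst d) \<and> smooth_on Q (\<lambda>y. snd d (F (cinv c y), G (cinv c y)))"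
    using c oQ by (intro bexI[OF _ c(1)] bexI[OF _ prod_atlasI[OF a(1) b(1)]] exI[of _ Q]) auto
qed

section \<open>Tangent vectors and brackets\<close>

lemma lrep_has_derivative:
  assumes "fd_atlas A" "smooth_map A B F" "c \<in> A" "d \<in> B" "p \<in> fst c" "F p \<in> fst d"
  shows "((\<lambda>y. snd d (F (cinv c y))) has_derivative
    frechet_derivative (\<lambda>y. snd d (F (cinv c y))) (at (snd c p))) (at (snd c p))"
  by (rule smooth_on_has_derivative[OF smooth_map_lrep(2)[OF assms(1-4)]]) (use assms in auto)

lemma lrep_derivative_linear:
  assumes "fd_atlas A" "smooth_map A B F" "c \<in> A" "d \<in> B" "p \<in> fst c" "F p \<in> fst d"
  shows "linear (frechet_derivative (\<lambda>y. snd d (F (cinv c y))) (at (snd c p)))"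
  using has_derivative_linear[OF lrep_has_derivative[OF assms]] .

lemma lrep_derivative_compose:
  assumes A: "fd_atlas A" and B: "fd_atlas B" and F: "smooth_map A B F" and G: "smooth_map B C G"
    and c: "c \<in> A" "p \<in> fst c" and d: "d \<in> B" "F p \<in> fst d" and e: "e \<in> C" "G (F p) \<in> fst e"
  shows "frechet_derivative (\<lambda>y. snd e (G (F (cinv c y)))) (at (snd c p)) v =
    frechet_derivative (\<lambda>y. snd e (G (cinv d y))) (at (snd d (F p)))
      (frechet_derivative (\<lambda>y. snd d (F (cinv c y))) (at (snd c p)) v)"
proof -
  let ?f = "\<lambda>y. snd d (F (cinv c y))" and ?g = "\<lambda>y. snd e (G (cinv d y))"
  have "(?g has_derivative frechet_derivative ?g (at (snd d (F p)))) (at (?f (snd c p)))"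
    using lrep_has_derivative[OF B G d(1) e(1) d(2) e(2)] A c by simp
  from has_derivative_compose[OF lrep_has_derivative[OF A F c(1) d(1) c(2) d(2)] this]
  have "((\<lambda>y. ?g (?f y)) has_derivative (\<lambda>v. frechet_derivative ?g (at (snd d (F p)))
      (frechet_derivative ?f (at (snd c p)) v))) (at (snd c p))" .
  then have "((\<lambda>y. snd e (G (F (cinv c y)))) has_derivative (\<lambda>v. frechet_derivative ?g (at (snd d (F p)))
      (frechet_derivative ?f (at (snd c p)) v))) (at (snd c p))"
  proof (rule has_derivative_transform_within_open[OF _ smooth_map_lrep(1)[OF A F c(1) d(1)]])
    fix y assume "y \<in> snd c ` {x \<in> fst c. F x \<in> fst d}"
    then have "F (cinv c y) \<in> fst d" using chart_image_mem[OF A c(1), of y "\<lambda>x. F x \<in> fst d"] by simp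
    then show "?g (?f y) = snd e (G (F (cinv c y)))" using B d by simp
  qed (use c d in auto)
  then show ?thesis by (simp add: frechet_derivative_eqI)
qed

lemma tangent_space_iff: "v \<in> tangent_space A p \<longleftrightarrow>
   (\<forall>c\<in>A. \<forall>d\<in>A. p \<in> fst c \<longrightarrow> p \<in> fst d \<longrightarrow>
      v d = frechet_derivative (\<lambda>y. snd d (cinv c y)) (at (snd c p)) (v c)) \<and>
   (\<forall>c. c \<notin> A \<or> p \<notin> fst c \<longrightarrow> v c = 0)"
  by (simp add: tangent_space_def split_beta comp_def imp_conjL)

lemma tangent_space_transition:
  "v \<in> tangent_space A p \<Longrightarrow> c \<in> A \<Longrightarrow> d \<in> A \<Longrightarrow> p \<in> fst c \<Longrightarrow> p \<in> fst d \<Longrightarrow>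
    v d = frechet_derivative (\<lambda>y. snd d (cinv c y)) (at (snd c p)) (v c)"
  unfolding tangent_space_iff by blast

lemma tangent_space_outside: "v \<in> tangent_space A p \<Longrightarrow> c \<notin> A \<or> p \<notin> fst c \<Longrightarrow> v c = 0"
  unfolding tangent_space_iff by blast

lemma tangent_space_eqI:
  assumes "v \<in> tangent_space A p" "w \<in> tangent_space A p" "c \<in> A" "p \<in> fst c" "v c = w c"
  shows "v = w"
proof
  fix d show "v d = w d"
    using tangent_space_transition[OF assms(1) assms(3) _ assms(4), of d]
      tangent_space_transition[OF assms(2) assms(3) _ assms(4), of d] assms(5)
      tangent_space_outside[OF assms(1), of d] tangent_space_outside[OF assms(2), of d]
    by (cases "d \<in> A \<and> p \<in> fst d") auto
qed

lemma transition_linear: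
  assumes "fd_atlas A" "c \<in> A" "d \<in> A" "p \<in> fst c" "p \<in> fst d"
  shows "linear (frechet_derivative (\<lambda>y. snd d (cinv c y)) (at (snd c p)))"
  using lrep_derivative_linear[OF assms(1) smooth_map_id[OF assms(1)] assms(2-5)] .

lemma transition_self:
  assumes "fd_atlas A" "c \<in> A" "p \<in> fst c"
  shows "frechet_derivative (\<lambda>y. snd c (cinv c y)) (at (snd c p)) v = v"
proof -
  have "frechet_derivative (\<lambda>y. snd c (cinv c y)) (at (snd c p)) = frechet_derivative (\<lambda>y. y) (at (snd c p))"
    by (rule frechet_derivative_cong_open[OF chart_open[OF assms(1,2)]]) (use assms in \<open>auto simp: chart_cinv\<close>)
  then show ?thesis by (simp add: frechet_derivative_eqI[OF has_derivative_ident])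
qed

lemma transition_compose:
  assumes "fd_atlas A" "c \<in> A" "p \<in> fst c" "d \<in> A" "p \<in> fst d" "e \<in> A" "p \<in> fst e"
  shows "frechet_derivative (\<lambda>y. snd e (cinv d y)) (at (snd d p))
      (frechet_derivative (\<lambda>y. snd d (cinv c y)) (at (snd c p)) v) =
    frechet_derivative (\<lambda>y. snd e (cinv c y)) (at (snd c p)) v"
  using lrep_derivative_compose[OF assms(1,1) smooth_map_id[OF assms(1)] smooth_map_id[OF assms(1)] assms(2-)]
  by simp

lemma coord_vector_apply:
  "coord_vector A c p w d = (if d \<in> A \<and> p \<in> fst d
    then frechet_derivative (\<lambda>y. snd d (cinv c y)) (at (snd c p)) w else 0)"
  by (cases d) (simp add: coord_vector_def comp_def)

lemma coord_vector_in:
  assumes "fd_atlas A" "c \<in> A" "p \<in> fst c"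
  shows "coord_vector A c p w \<in> tangent_space A p"
  unfolding tangent_space_iff by (simp add: coord_vector_apply transition_compose[OF assms])

lemma coord_vector_self [simp]:
  assumes "fd_atlas A" "c \<in> A" "p \<in> fst c"
  shows "coord_vector A c p w c = w"
  using assms by (simp add: coord_vector_apply transition_self)

lemma coord_vector_component [simp]:
  assumes "fd_atlas A" "c \<in> A" "p \<in> fst c" "v \<in> tangent_space A p"
  shows "coord_vector A c p (v c) = v"
  by (rule tangent_space_eqI[OF coord_vector_in assms(4)]) (use assms in auto)

lemma tangent_space_zero: "fd_atlas A \<Longrightarrow> 0 \<in> tangent_space A p"
  by (simp add: tangent_space_iff linear_0[OF transition_linear])

lemma tangent_space_add:
  assumes A: "fd_atlas A" and v: "v \<in> tangent_space A p" and w: "w \<in> tangent_space A p"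
  shows "v + w \<in> tangent_space A p"
  unfolding tangent_space_iff
proof (intro conjI ballI impI allI)
  fix c d assume c: "c \<in> A" "d \<in> A" "p \<in> fst c" "p \<in> fst d"
  show "(v + w) d = frechet_derivative (\<lambda>y. snd d (cinv c y)) (at (snd c p)) ((v + w) c)"
    using tangent_space_transition[OF v c] tangent_space_transition[OF w c]
    by (simp only: plus_fun_apply linear_add[OF transition_linear[OF A c]])
qed (use tangent_space_outside[OF v] tangent_space_outside[OF w] in auto)

lemma tangent_space_fscale:
  assumes A: "fd_atlas A" and v: "v \<in> tangent_space A p"
  shows "fscale a v \<in> tangent_space A p"
  unfolding tangent_space_iff fscale_def
proof (intro conjI ballI impI allI)
  fix c d assume c: "c \<in> A" "d \<in> A" "p \<in> fst c" "p \<in> fst d"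
  show "a *\<^sub>R v d = frechet_derivative (\<lambda>y. snd d (cinv c y)) (at (snd c p)) (a *\<^sub>R v c)"
    using tangent_space_transition[OF v c] by (simp only: linear_scale[OF transition_linear[OF A c]])
qed (use tangent_space_outside[OF v] in auto)

lemma coord_vector_add:
  assumes "fd_atlas A" "c \<in> A" "p \<in> fst c"
  shows "coord_vector A c p (v + w) = coord_vector A c p v + coord_vector A c p w"
  by (rule tangent_space_eqI[OF coord_vector_in tangent_space_add]) (use assms in \<open>auto intro: coord_vector_in\<close>)

lemma coord_vector_fscale:
  assumes "fd_atlas A" "c \<in> A" "p \<in> fst c"
  shows "coord_vector A c p (a *\<^sub>R v) = fscale a (coord_vector A c p v)"
  by (rule tangent_space_eqI[OF coord_vector_in tangent_space_fscale])
    (use assms in \<open>auto intro: coord_vector_in simp: fscale_def\<close>)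

lemma chart_at:
  assumes "p \<in> atlas_space A"
  shows "chart_at A p \<in> A" "p \<in> fst (chart_at A p)"
proof -
  obtain c where "c \<in> A" "p \<in> fst c" using assms by (rule atlas_spaceE)
  then have "\<exists>c. c \<in> A \<and> p \<in> fst c" by blast
  from someI_ex[OF this] show "chart_at A p \<in> A" "p \<in> fst (chart_at A p)"
    unfolding chart_at_def by (rule conjunct1, rule conjunct2)
qed

text \<open>\<open>tangent_map\<close> is defined with the chart selected by
  \<open>chart_at\<close>; the chain rule and the transformation law of tangent vectors give the
  same result in every chart around \<open>p\<close>.\<close>

lemma tangent_map_apply:
  assumes A: "fd_atlas A" and F: "smooth_map A B F"
    and c: "c \<in> A" "p \<in> fst c" and d: "d \<in> B" "F p \<in> fst d" and v: "v \<in> tangent_space A p"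
  shows "tangent_map A B F p v d = frechet_derivative (\<lambda>y. snd d (F (cinv c y))) (at (snd c p)) (v c)"
proof -
  define e where "e = chart_at A p"
  have e: "e \<in> A" "p \<in> fst e" unfolding e_def by (rule chart_at[OF atlas_spaceI[OF c]])+
  have "tangent_map A B F p v d = frechet_derivative (\<lambda>y. snd d (F (cinv e y))) (at (snd e p)) (v e)"
    using d by (cases d) (simp add: tangent_map_def e_def[symmetric] split_beta Let_def comp_def)
  also have "v e = frechet_derivative (\<lambda>y. snd e (cinv c y)) (at (snd c p)) (v c)"
    by (rule tangent_space_transition[OF v c(1) e(1) c(2) e(2)])
  also have "frechet_derivative (\<lambda>y. snd d (F (cinv e y))) (at (snd e p)) \<dots> =
      frechet_derivative (\<lambda>y. snd d (F (cinv c y))) (at (snd c p)) (v c)"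
    using lrep_derivative_compose[OF A A smooth_map_id[OF A] F c e d] by simp
  finally show ?thesis .
qed

lemma tangent_map_outside: "d \<notin> B \<or> F p \<notin> fst d \<Longrightarrow> tangent_map A B F p v d = 0"
  by (cases d) (auto simp: tangent_map_def)

lemma tangent_map_in:
  assumes A: "fd_atlas A" and B: "fd_atlas B" and F: "smooth_map A B F"
    and p: "p \<in> atlas_space A" and v: "v \<in> tangent_space A p"
  shows "tangent_map A B F p v \<in> tangent_space B (F p)"
  unfolding tangent_space_iff
proof (intro conjI ballI allI impI)
  obtain c where c: "c \<in> A" "p \<in> fst c" using p by (rule atlas_spaceE)
  fix d e assume d: "d \<in> B" "F p \<in> fst d" and e: "e \<in> B" "F p \<in> fst e"
  show "tangent_map A B F p v e =
    frechet_derivative (\<lambda>y. snd e (cinv d y)) (at (snd d (F p))) (tangent_map A B F p v d)"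
    unfolding tangent_map_apply[OF A F c d v] tangent_map_apply[OF A F c e v]
    using lrep_derivative_compose[OF A B F smooth_map_id[OF B] c d e] by simp
qed (auto simp: tangent_map_outside)

lemma tangent_map_compose:
  assumes A: "fd_atlas A" and B: "fd_atlas B" and C: "fd_atlas C"
    and F: "smooth_map A B F" and G: "smooth_map B C G"
    and p: "p \<in> atlas_space A" and v: "v \<in> tangent_space A p"
  shows "tangent_map A C (\<lambda>x. G (F x)) p v = tangent_map B C G (F p) (tangent_map A B F p v)"
proof
  obtain c where c: "c \<in> A" "p \<in> fst c" using p by (rule atlas_spaceE)
  obtain d where d: "d \<in> B" "F p \<in> fst d" using smooth_map_space[OF F p] by (rule atlas_spaceE)
  fix e
  show "tangent_map A C (\<lambda>x. G (F x)) p v e = tangent_map B C G (F p) (tangent_map A B F p v) e"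
  proof (cases "e \<in> C \<and> G (F p) \<in> fst e")
    case True
    then have e: "e \<in> C" "G (F p) \<in> fst e" by auto
    show ?thesis
      unfolding tangent_map_apply[OF A smooth_map_compose[OF A B C F G] c e v]
        tangent_map_apply[OF B G d e tangent_map_in[OF A B F p v]] tangent_map_apply[OF A F c d v]
      by (rule lrep_derivative_compose[OF A B F G c d e])
  next
    case False
    then show ?thesis using tangent_map_outside[of e C "\<lambda>x. G (F x)" p A v] tangent_map_outside[of e C G "F p"] by auto
  qed
qed

lemma tangent_map_add:
  assumes A: "fd_atlas A" and F: "smooth_map A B F"
    and p: "p \<in> atlas_space A" and v: "v \<in> tangent_space A p" and w: "w \<in> tangent_space A p"
  shows "tangent_map A B F p (v + w) = tangent_map A B F p v + tangent_map A B F p w"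
proof
  obtain c where c: "c \<in> A" "p \<in> fst c" using p by (rule atlas_spaceE)
  fix d show "tangent_map A B F p (v + w) d = (tangent_map A B F p v + tangent_map A B F p w) d"
    using tangent_map_apply[OF A F c _ _ v, of d] tangent_map_apply[OF A F c _ _ w, of d]
      tangent_map_apply[OF A F c _ _ tangent_space_add[OF A v w], of d]
      lrep_derivative_linear[OF A F c(1) _ c(2), of d]
    by (cases "d \<in> B \<and> F p \<in> fst d") (auto simp: linear_add tangent_map_outside)
qed

lemma tangent_map_fscale:
  assumes A: "fd_atlas A" and F: "smooth_map A B F"
    and p: "p \<in> atlas_space A" and v: "v \<in> tangent_space A p"
  shows "tangent_map A B F p (fscale a v) = fscale a (tangent_map A B F p v)"
proof
  obtain c where c: "c \<in> A" "p \<in> fst c" using p by (rule atlas_spaceE)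
  fix d show "tangent_map A B F p (fscale a v) d = fscale a (tangent_map A B F p v) d"
    using tangent_map_apply[OF A F c _ _ v, of d]
      tangent_map_apply[OF A F c _ _ tangent_space_fscale[OF A v], of d a]
      lrep_derivative_linear[OF A F c(1) _ c(2), of d]
    by (cases "d \<in> B \<and> F p \<in> fst d") (auto simp: linear_scale tangent_map_outside fscale_def)
qed

lemma tangent_map_cong:
  fixes A :: "('a, 'm::real_normed_vector) atlas" and B :: "('b, 'n::real_normed_vector) atlas"
  assumes A: "fd_atlas A" and B: "fd_atlas B" and F: "smooth_map A B F" and p: "p \<in> atlas_space A"
    and v: "v \<in> tangent_space A p" and eq: "\<And>x. x \<in> atlas_space A \<Longrightarrow> F x = G x"
  shows "tangent_map A B F p v = tangent_map A B G p v"
proof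
  obtain c where c: "c \<in> A" "p \<in> fst c" using p by (rule atlas_spaceE)
  have G: "smooth_map A B G" by (rule smooth_map_cong[OF A B F eq])
  fix d :: "('b, 'n) chart"
  have "frechet_derivative (\<lambda>y. snd d (F (cinv c y))) (at (snd c p)) =
    frechet_derivative (\<lambda>y. snd d (G (cinv c y))) (at (snd c p))"
  proof (rule frechet_derivative_cong_open[OF chart_open[OF A c(1)]])
    show "snd d (F (cinv c y)) = snd d (G (cinv c y))" if "y \<in> snd c ` fst c" for y
      using eq[OF atlas_spaceI[OF c(1) cinv_in[OF A c(1) that]]] by simp
  qed (use c in simp)
  then show "tangent_map A B F p v d = tangent_map A B G p v d"
    using tangent_map_apply[OF A F c _ _ v, of d] tangent_map_apply[OF A G c _ _ v, of d] eq[OF p]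
    by (cases "d \<in> B \<and> F p \<in> fst d") (auto simp: tangent_map_outside)
qed

lemma tangent_map_id:
  assumes A: "fd_atlas A" and p: "p \<in> atlas_space A" and v: "v \<in> tangent_space A p"
  shows "tangent_map A A (\<lambda>x. x) p v = v"
proof -
  obtain c where c: "c \<in> A" "p \<in> fst c" using p by (rule atlas_spaceE)
  show ?thesis
    by (rule tangent_space_eqI[OF tangent_map_in[OF A A smooth_map_id[OF A] p v] v c])
      (simp add: tangent_map_apply[OF A smooth_map_id[OF A] c c v] transition_self[OF A c])
qed

lemma differential_eq:
  assumes A: "fd_atlas A" and f: "smooth_map A real_atlas f"
    and c: "c \<in> A" "p \<in> fst c" and v: "v \<in> tangent_space A p"
  shows "differential A f p v = frechet_derivative (\<lambda>y. f (cinv c y)) (at (snd c p)) (v c)"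
  unfolding differential_def using tangent_map_apply[OF A f c _ _ v, of "(UNIV, \<lambda>t. t)"] by simp

lemma differential_compose:
  assumes A: "fd_atlas A" and B: "fd_atlas B"
    and F: "smooth_map A B F" and f: "smooth_map B real_atlas f"
    and p: "p \<in> atlas_space A" and v: "v \<in> tangent_space A p"
  shows "differential A (\<lambda>x. f (F x)) p v = differential B f (F p) (tangent_map A B F p v)"
  unfolding differential_def tangent_map_compose[OF A B fd_atlas_real F f p v] ..

lemma real_has_derivative:
  assumes "fd_atlas A" "smooth_map A real_atlas f" "c \<in> A" "p \<in> fst c"
  shows "((\<lambda>y. f (cinv c y)) has_derivative frechet_derivative (\<lambda>y. f (cinv c y)) (at (snd c p))) (at (snd c p))"
  using lrep_has_derivative[OF assms(1-3), of "(UNIV, \<lambda>t. t)"] assms by simp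

lemma differential_add_vector:
  assumes "fd_atlas A" "smooth_map A real_atlas f" "p \<in> atlas_space A"
    "v \<in> tangent_space A p" "w \<in> tangent_space A p"
  shows "differential A f p (v + w) = differential A f p v + differential A f p w"
  unfolding differential_def by (simp add: tangent_map_add[OF assms])

lemma differential_fscale_vector:
  assumes "fd_atlas A" "smooth_map A real_atlas f" "p \<in> atlas_space A" "v \<in> tangent_space A p"
  shows "differential A f p (fscale a v) = a * differential A f p v"
  unfolding differential_def tangent_map_fscale[OF assms] by (simp add: fscale_def)

lemma differential_add:
  assumes A: "fd_atlas A" and f: "smooth_map A real_atlas f" and g: "smooth_map A real_atlas g"
    and p: "p \<in> atlas_space A" and v: "v \<in> tangent_space A p"
  shows "differential A (\<lambda>x. f x + g x) p v = differential A f p v + differential A g p v"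
proof -
  obtain c where c: "c \<in> A" "p \<in> fst c" using p by (rule atlas_spaceE)
  show ?thesis
    unfolding differential_eq[OF A f c v] differential_eq[OF A g c v]
      differential_eq[OF A smooth_map_real_add[OF A f g] c v]
    by (simp add: frechet_derivative_eqI[OF has_derivative_add[OF real_has_derivative[OF A f c] real_has_derivative[OF A g c]]])
qed

lemma differential_const_mult:
  assumes A: "fd_atlas A" and f: "smooth_map A real_atlas f"
    and p: "p \<in> atlas_space A" and v: "v \<in> tangent_space A p"
  shows "differential A (\<lambda>x. a * f x) p v = a * differential A f p v"
proof -
  obtain c where c: "c \<in> A" "p \<in> fst c" using p by (rule atlas_spaceE)
  show ?thesis
    unfolding differential_eq[OF A f c v]
      differential_eq[OF A smooth_map_real_mult[OF A smooth_map_real_const[OF A] f] c v]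
    by (simp add: frechet_derivative_eqI[OF has_derivative_mult_right[OF real_has_derivative[OF A f c]]])
qed

text \<open>The chain rule for curves, with derivatives within \<open>I\<close>, so that it serves
  velocities as well as integral curves on intervals with end points. \<open>near\<close> allows the
  curve to be rewritten through the chart \<open>c\<close>.\<close>

lemma chart_has_vector_derivative_transfer:
  assumes A: "fd_atlas A" and B: "fd_atlas B" and F: "smooth_map A B F"
    and c: "c \<in> A" "\<gamma> t \<in> fst c" and d: "d \<in> B" "F (\<gamma> t) \<in> fst d"
    and v: "v \<in> tangent_space A (\<gamma> t)"
    and near: "eventually (\<lambda>s. \<gamma> s \<in> fst c) (at t within I)" "t \<in> I"
    and deriv: "((\<lambda>s. snd c (\<gamma> s)) has_vector_derivative v c) (at t within I)"
  shows "((\<lambda>s. snd d (F (\<gamma> s))) has_vector_derivative tangent_map A B F (\<gamma> t) v d) (at t within I)"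
proof -
  have "((\<lambda>s. snd d (F (cinv c (snd c (\<gamma> s))))) has_derivative
      (\<lambda>h. frechet_derivative (\<lambda>y. snd d (F (cinv c y))) (at (snd c (\<gamma> t))) (h *\<^sub>R v c))) (at t within I)"
    using has_derivative_compose[OF deriv[unfolded has_vector_derivative_def] lrep_has_derivative[OF A F c(1) d(1) c(2) d(2)]] .
  then have "((\<lambda>s. snd d (F (cinv c (snd c (\<gamma> s))))) has_vector_derivative tangent_map A B F (\<gamma> t) v d) (at t within I)"
    by (simp add: has_vector_derivative_def tangent_map_apply[OF A F c d v]
        linear_scale[OF lrep_derivative_linear[OF A F c(1) d(1) c(2) d(2)]])
  moreover have "eventually (\<lambda>s. snd d (F (cinv c (snd c (\<gamma> s)))) = snd d (F (\<gamma> s))) (at t within I)"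
    using near(1) by eventually_elim (use A c in simp)
  ultimately show ?thesis
    unfolding has_vector_derivative_def
    using has_derivative_transform_eventually[of _ _ t I] near(2) A c by fastforce
qed

lemma velocity_apply: "velocity A \<gamma> t d = (if d \<in> A \<and> \<gamma> t \<in> fst d then vector_derivative (\<lambda>s. snd d (\<gamma> s)) (at t) else 0)"
  by (cases d) (simp add: velocity_def comp_def)

lemma velocity_eqI:
  assumes A: "fd_atlas A" and c: "c \<in> A" "\<gamma> t \<in> fst c" and v: "v \<in> tangent_space A (\<gamma> t)"
    and near: "eventually (\<lambda>s. \<gamma> s \<in> fst c) (at t)"
    and deriv: "((\<lambda>s. snd c (\<gamma> s)) has_vector_derivative v c) (at t)"
  shows "velocity A \<gamma> t = v"
proof
  fix d
  have "((\<lambda>s. snd d (\<gamma> s)) has_vector_derivative v d) (at t)" if "d \<in> A" "\<gamma> t \<in> fst d"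
    using chart_has_vector_derivative_transfer[OF A A smooth_map_id[OF A] c that v near UNIV_I deriv]
      tangent_map_id[OF A atlas_spaceI[OF c] v] by simp
  then show "velocity A \<gamma> t d = v d"
    using tangent_space_outside[OF v, of d] vector_derivative_at by (auto simp: velocity_apply)
qed

lemma smooth_curve_near:
  assumes A: "fd_atlas A" and \<gamma>: "smooth_map real_atlas A \<gamma>" and c: "c \<in> A" "\<gamma> t \<in> fst c"
  shows "eventually (\<lambda>s. \<gamma> s \<in> fst c) (at t)"
    and "((\<lambda>s. snd c (\<gamma> s)) has_vector_derivative velocity A \<gamma> t c) (at t)"
proof -
  have op: "open {s. \<gamma> s \<in> fst c}" and sm: "smooth_on {s. \<gamma> s \<in> fst c} (\<lambda>s. snd c (\<gamma> s))"
    using smooth_map_lrep[OF fd_atlas_real \<gamma>, of "(UNIV, \<lambda>t. t)" c] c(1) by auto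
  show "eventually (\<lambda>s. \<gamma> s \<in> fst c) (at t)"
    using eventually_at_in_open'[OF op, of t] c(2) by simp
  have "(\<lambda>s. snd c (\<gamma> s)) differentiable (at t)" using smooth_on_differentiable[OF sm] c(2) by simp
  then show "((\<lambda>s. snd c (\<gamma> s)) has_vector_derivative velocity A \<gamma> t c) (at t)"
    using c by (simp add: velocity_apply vector_derivative_works)
qed

text \<open>The chartwise derivatives obey the transformation law by the chain rule: they coincide
  with the coordinate vector built from the component in a single chart.\<close>

lemma velocity_in_tangent_space:
  assumes A: "fd_atlas A" and \<gamma>: "smooth_map real_atlas A \<gamma>"
  shows "velocity A \<gamma> t \<in> tangent_space A (\<gamma> t)"
proof -
  obtain c where c: "c \<in> A" "\<gamma> t \<in> fst c" using smooth_map_space[OF \<gamma>, of t] by (auto elim: atlas_spaceE)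
  have "velocity A \<gamma> t = coord_vector A c (\<gamma> t) (velocity A \<gamma> t c)"
    by (rule velocity_eqI[where \<gamma>=\<gamma> and t=t, OF A c coord_vector_in[OF A c]])
      (use smooth_curve_near[OF A \<gamma> c] A c in auto)
  then show ?thesis using coord_vector_in[OF A c] by metis
qed

lemma velocity_compose:
  assumes A: "fd_atlas A" and B: "fd_atlas B" and F: "smooth_map A B F" and \<gamma>: "smooth_map real_atlas A \<gamma>"
  shows "velocity B (\<lambda>s. F (\<gamma> s)) t = tangent_map A B F (\<gamma> t) (velocity A \<gamma> t)"
proof -
  obtain c where c: "c \<in> A" "\<gamma> t \<in> fst c" using smooth_map_space[OF \<gamma>, of t] by (auto elim: atlas_spaceE)
  obtain d where d: "d \<in> B" "F (\<gamma> t) \<in> fst d"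
    using smooth_map_space[OF F smooth_map_space[OF \<gamma>, of t]] by (auto elim: atlas_spaceE)
  note v = velocity_in_tangent_space[OF A \<gamma>, of t]
  show ?thesis
  proof (rule velocity_eqI[where \<gamma>="\<lambda>s. F (\<gamma> s)" and t=t, OF B d])
    show "tangent_map A B F (\<gamma> t) (velocity A \<gamma> t) \<in> tangent_space B (F (\<gamma> t))"
      by (rule tangent_map_in[OF A B F atlas_spaceI[OF c] v])
    show "eventually (\<lambda>s. F (\<gamma> s) \<in> fst d) (at t)"
      by (rule smooth_curve_near(1)[OF B smooth_map_compose[OF fd_atlas_real A B \<gamma> F] d])
    show "((\<lambda>s. snd d (F (\<gamma> s))) has_vector_derivative tangent_map A B F (\<gamma> t) (velocity A \<gamma> t) d) (at t)"
      by (rule chart_has_vector_derivative_transfer[where \<gamma>=\<gamma> and t=t, OF A B F c d v smooth_curve_near(1)[OF A \<gamma> c] UNIV_I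
            smooth_curve_near(2)[OF A \<gamma> c]])
  qed
qed


section \<open>Lie brackets of vector fields and related fields\<close>

lemma derivative_of_derivative_along_field:
  fixes f :: "'m::real_normed_vector \<Rightarrow> 'n::real_normed_vector"
  assumes fd: "finite_dimensional TYPE('m)" and S: "open S" "q \<in> S"
    and f: "smooth_on S f" and y: "smooth_on S y"
  shows "frechet_derivative (\<lambda>q. frechet_derivative f (at q) (y q)) (at q) v =
    frechet_derivative (\<lambda>q'. frechet_derivative f (at q') (y q)) (at q) v +
    frechet_derivative f (at q) (frechet_derivative y (at q) v)"
proof -
  obtain B :: "'m set" and co where B: "finite B" "\<And>b. bounded_linear (co b)"
    "\<And>x. (\<Sum>b\<in>B. co b x *\<^sub>R b) = x"
    using finite_dimensional_frame[OF fd] by metis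
  have lin: "linear (frechet_derivative f (at q))" if "q \<in> S" for q
    using has_derivative_linear[OF smooth_on_has_derivative[OF f that]] .
  have expand: "frechet_derivative f (at q) w = (\<Sum>b\<in>B. co b w *\<^sub>R frechet_derivative f (at q) b)"
    if "q \<in> S" for q w
    by (subst B(3)[of w, symmetric]) (simp add: linear_sum[OF lin[OF that]] linear_scale[OF lin[OF that]])
  define D2 where "D2 b = frechet_derivative (\<lambda>q. frechet_derivative f (at q) b) (at q)" for b
  have dD: "((\<lambda>q. frechet_derivative f (at q) b) has_derivative D2 b) (at q)" for b
    unfolding D2_def by (rule smooth_on_has_derivative[OF smooth_on_derivative[OF f] S(2)])
  have dy: "(y has_derivative frechet_derivative y (at q)) (at q)" by (rule smooth_on_has_derivative[OF y S(2)])
  have "((\<lambda>q. \<Sum>b\<in>B. co b (y q) *\<^sub>R frechet_derivative f (at q) b) has_derivative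
     (\<lambda>v. \<Sum>b\<in>B. co b (y q) *\<^sub>R D2 b v + co b (frechet_derivative y (at q) v) *\<^sub>R frechet_derivative f (at q) b)) (at q)"
    by (intro has_derivative_sum has_derivative_scaleR bounded_linear.has_derivative[OF B(2) dy] dD)
  then have "frechet_derivative (\<lambda>q. \<Sum>b\<in>B. co b (y q) *\<^sub>R frechet_derivative f (at q) b) (at q) v =
     (\<Sum>b\<in>B. co b (y q) *\<^sub>R D2 b v) + frechet_derivative f (at q) (frechet_derivative y (at q) v)"
    unfolding expand[OF S(2), of "frechet_derivative y (at q) v"]
    by (simp add: frechet_derivative_eqI sum.distrib)
  moreover have "frechet_derivative (\<lambda>q. frechet_derivative f (at q) (y q)) (at q) =
      frechet_derivative (\<lambda>q. \<Sum>b\<in>B. co b (y q) *\<^sub>R frechet_derivative f (at q) b) (at q)"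
    by (rule frechet_derivative_cong_open[OF S]) (rule expand)
  moreover have "((\<lambda>q'. \<Sum>b\<in>B. co b (y q) *\<^sub>R frechet_derivative f (at q') b) has_derivative
     (\<lambda>v. \<Sum>b\<in>B. co b (y q) *\<^sub>R D2 b v)) (at q)"
    by (intro has_derivative_sum has_derivative_scaleR_right dD)
  then have "frechet_derivative (\<lambda>q'. \<Sum>b\<in>B. co b (y q) *\<^sub>R frechet_derivative f (at q') b) (at q) v =
     (\<Sum>b\<in>B. co b (y q) *\<^sub>R D2 b v)" by (simp add: frechet_derivative_eqI)
  moreover have "frechet_derivative (\<lambda>q'. frechet_derivative f (at q') (y q)) (at q) =
      frechet_derivative (\<lambda>q'. \<Sum>b\<in>B. co b (y q) *\<^sub>R frechet_derivative f (at q') b) (at q)"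
    by (rule frechet_derivative_cong_open[OF S]) (rule expand)
  ultimately show ?thesis by simp
qed

text \<open>By the product rule each term on the right is a second derivative of \<open>f\<close>
  plus the first derivative of \<open>f\<close> applied to the derivative of a field, and the second
  derivatives cancel by symmetry. The identity yields both the naturality of the bracket under maps
  and its action on functions as a commutator.\<close>

lemma bracket_commutator:
  fixes f :: "'m::real_normed_vector \<Rightarrow> 'n::real_normed_vector"
  assumes fd: "finite_dimensional TYPE('m)" "finite_dimensional TYPE('n)" and S: "open S" "q \<in> S"
    and f: "smooth_on S f" and x: "smooth_on S x" and y: "smooth_on S y"
  shows "frechet_derivative f (at q) (frechet_derivative y (at q) (x q) - frechet_derivative x (at q) (y q)) =
    frechet_derivative (\<lambda>q. frechet_derivative f (at q) (y q)) (at q) (x q) -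
    frechet_derivative (\<lambda>q. frechet_derivative f (at q) (x q)) (at q) (y q)"
  unfolding derivative_of_derivative_along_field[OF fd(1) S f y] derivative_of_derivative_along_field[OF fd(1) S f x]
    second_derivative_symmetric[OF fd(2) f S, of "y q" "x q"]
    linear_diff[OF has_derivative_linear[OF smooth_on_has_derivative[OF f S(2)]]]
  by simp

definition smooth_vf :: "('a, 'm::real_normed_vector) atlas \<Rightarrow> ('a \<Rightarrow> ('a, 'm) tangent) \<Rightarrow> bool"
  where "smooth_vf A X \<longleftrightarrow> (\<forall>p\<in>atlas_space A. X p \<in> tangent_space A p) \<and>
    (\<forall>c\<in>A. smooth_on (snd c ` fst c) (\<lambda>y. X (cinv c y) c))"

lemma vf_bracket_apply:
  "vf_bracket A X Y p c = (if c \<in> A \<and> p \<in> fst c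
    then frechet_derivative (\<lambda>y. Y (cinv c y) c) (at (snd c p)) (X p c) -
         frechet_derivative (\<lambda>y. X (cinv c y) c) (at (snd c p)) (Y p c)
    else 0)"
  by (cases c) (simp add: vf_bracket_def)

text \<open>Relatedness says that \<open>X'\<close> along \<open>F\<close> is the derivative of
  \<open>F\<close> applied to \<open>X\<close>. Differentiating this in charts turns the bracket on
  the target into the commutator of \<open>bracket_commutator\<close>. \<open>F\<close> is any
  smooth map, so projections and the group multiplication are covered.\<close>

lemma vf_bracket_related_chart:
  fixes A :: "('a, 'm::real_normed_vector) atlas" and B :: "('b, 'n::real_normed_vector) atlas"
  assumes A: "fd_atlas A" and B: "fd_atlas B" and F: "smooth_map A B F"
    and X: "smooth_vf A X" and Y: "smooth_vf A Y" and X': "smooth_vf B X'" and Y': "smooth_vf B Y'"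
    and XX: "\<And>p. p \<in> atlas_space A \<Longrightarrow> X' (F p) = tangent_map A B F p (X p)"
    and YY: "\<And>p. p \<in> atlas_space A \<Longrightarrow> Y' (F p) = tangent_map A B F p (Y p)"
    and c: "c \<in> A" "p \<in> fst c" and d: "d \<in> B" "F p \<in> fst d"
  shows "vf_bracket B X' Y' (F p) d =
    frechet_derivative (\<lambda>y. snd d (F (cinv c y))) (at (snd c p)) (vf_bracket A X Y p c)"
proof -
  define S where "S = snd c ` {x \<in> fst c. F x \<in> fst d}"
  define f where "f = (\<lambda>y. snd d (F (cinv c y)))"
  have S: "open S" and f: "smooth_on S f"
    unfolding S_def f_def using smooth_map_lrep[OF A F c(1) d(1)] by auto
  have Sc: "S \<subseteq> snd c ` fst c" by (auto simp: S_def)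
  have q: "snd c p \<in> S" using c d by (auto simp: S_def)
  \<comment> \<open>The derivative of the target field in a direction coming from the source is, by
    the chain rule, that of the field along \<open>f\<close>; by relatedness the latter is
    \<open>frechet_derivative f\<close> applied to the source field.\<close>
  have dloc: "frechet_derivative (\<lambda>y. Z' (cinv d y) d) (at (snd d (F p))) (frechet_derivative f (at (snd c p)) v) =
      frechet_derivative (\<lambda>q. frechet_derivative f (at q) (Z (cinv c q) c)) (at (snd c p)) v"
    if Z: "smooth_vf A Z" and Z': "smooth_vf B Z'"
      and ZZ: "\<And>p. p \<in> atlas_space A \<Longrightarrow> Z' (F p) = tangent_map A B F p (Z p)" for Z Z' v
  proof -
    have "smooth_on (snd d ` fst d) (\<lambda>y. Z' (cinv d y) d)" using Z' d by (simp add: smooth_vf_def)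
    from smooth_on_has_derivative[OF this, of "snd d (F p)"] d
    have "((\<lambda>y. Z' (cinv d y) d) has_derivative frechet_derivative (\<lambda>y. Z' (cinv d y) d) (at (snd d (F p)))) (at (f (snd c p)))"
      using A c by (simp add: f_def)
    from frechet_derivative_eqI[OF has_derivative_compose[OF smooth_on_has_derivative[OF f q] this]]
    have "frechet_derivative (\<lambda>y. Z' (cinv d y) d) (at (snd d (F p))) (frechet_derivative f (at (snd c p)) v) =
      frechet_derivative (\<lambda>x. Z' (cinv d (f x)) d) (at (snd c p)) v" by simp
    moreover have "frechet_derivative (\<lambda>x. Z' (cinv d (f x)) d) (at (snd c p)) =
       frechet_derivative (\<lambda>q. frechet_derivative f (at q) (Z (cinv c q) c)) (at (snd c p))"
    proof (rule frechet_derivative_cong_open[OF S q])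
      fix y assume y: "y \<in> S"
      then have *: "cinv c y \<in> fst c" "F (cinv c y) \<in> fst d"
        using chart_image_mem[OF A c(1), of y "\<lambda>x. F x \<in> fst d"] unfolding S_def by simp_all
      have sp: "cinv c y \<in> atlas_space A" by (rule atlas_spaceI[OF c(1) *(1)])
      have "Z' (cinv d (f y)) d = tangent_map A B F (cinv c y) (Z (cinv c y)) d"
        using * B d ZZ[OF sp] by (simp add: f_def)
      also have "\<dots> = frechet_derivative f (at (snd c (cinv c y))) (Z (cinv c y) c)"
        unfolding f_def using Z sp by (intro tangent_map_apply[OF A F c(1) *(1) d(1) *(2)]) (simp add: smooth_vf_def)
      also have "snd c (cinv c y) = y" using y Sc by (auto simp: chart_cinv)
      finally show "Z' (cinv d (f y)) d = frechet_derivative f (at y) (Z (cinv c y) c)" .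
    qed
    ultimately show ?thesis by simp
  qed
  have p: "p \<in> atlas_space A" by (rule atlas_spaceI[OF c])
  have Xp: "X' (F p) d = frechet_derivative f (at (snd c p)) (X p c)"
    unfolding XX[OF p] f_def using X p by (intro tangent_map_apply[OF A F c d]) (simp add: smooth_vf_def)
  have Yp: "Y' (F p) d = frechet_derivative f (at (snd c p)) (Y p c)"
    unfolding YY[OF p] f_def using Y p by (intro tangent_map_apply[OF A F c d]) (simp add: smooth_vf_def)
  have x: "smooth_on S (\<lambda>q. X (cinv c q) c)" "smooth_on S (\<lambda>q. Y (cinv c q) c)"
    using X Y c(1) by (auto simp: smooth_vf_def intro: smooth_on_subset[OF _ Sc])
  have "vf_bracket B X' Y' (F p) d =
    frechet_derivative (\<lambda>q. frechet_derivative f (at q) (Y (cinv c q) c)) (at (snd c p)) (X p c) -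
    frechet_derivative (\<lambda>q. frechet_derivative f (at q) (X (cinv c q) c)) (at (snd c p)) (Y p c)"
    using d by (simp add: vf_bracket_apply Xp Yp dloc[OF X X' XX] dloc[OF Y Y' YY])
  also have "\<dots> = frechet_derivative f (at (snd c p)) (vf_bracket A X Y p c)"
    using bracket_commutator[OF fd_atlas_dim[OF A] fd_atlas_dim[OF B] S q f x] c A
    by (simp add: vf_bracket_apply)
  finally show ?thesis by (simp add: f_def)
qed

text \<open>The transformation law under a change of charts is naturality for the identity map,
  which relates each field to itself.\<close>

lemma vf_bracket_in:
  assumes A: "fd_atlas A" and X: "smooth_vf A X" and Y: "smooth_vf A Y"
  shows "vf_bracket A X Y p \<in> tangent_space A p"
  unfolding tangent_space_iff
proof (intro conjI ballI allI impI)
  fix c d assume c: "c \<in> A" "p \<in> fst c" and d: "d \<in> A" "p \<in> fst d"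
  have idZ: "Z p = tangent_map A A (\<lambda>x. x) p (Z p)" if "smooth_vf A Z" "p \<in> atlas_space A" for Z p
    using tangent_map_id[OF A that(2)] that by (simp add: smooth_vf_def)
  show "vf_bracket A X Y p d =
    frechet_derivative (\<lambda>y. snd d (cinv c y)) (at (snd c p)) (vf_bracket A X Y p c)"
    by (rule vf_bracket_related_chart[OF A A smooth_map_id[OF A] X Y X Y idZ[OF X] idZ[OF Y] c d])
qed (auto simp: vf_bracket_apply)

lemma vf_bracket_related:
  assumes A: "fd_atlas A" and B: "fd_atlas B" and F: "smooth_map A B F"
    and X: "smooth_vf A X" and Y: "smooth_vf A Y" and X': "smooth_vf B X'" and Y': "smooth_vf B Y'"
    and XX: "\<And>p. p \<in> atlas_space A \<Longrightarrow> X' (F p) = tangent_map A B F p (X p)"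
    and YY: "\<And>p. p \<in> atlas_space A \<Longrightarrow> Y' (F p) = tangent_map A B F p (Y p)"
    and p: "p \<in> atlas_space A"
  shows "vf_bracket B X' Y' (F p) = tangent_map A B F p (vf_bracket A X Y p)"
proof
  obtain c where c: "c \<in> A" "p \<in> fst c" using p by (rule atlas_spaceE)
  fix d
  show "vf_bracket B X' Y' (F p) d = tangent_map A B F p (vf_bracket A X Y p) d"
  proof (cases "d \<in> B \<and> F p \<in> fst d")
    case True
    then show ?thesis
      using vf_bracket_related_chart[OF A B F X Y X' Y' XX YY c] tangent_map_apply[OF A F c _ _ vf_bracket_in[OF A X Y]]
      by simp
  qed (auto simp: vf_bracket_apply tangent_map_outside)
qed

section \<open>Spaces of functions as manifolds\<close>

lemma sum_function_apply: "(\<Sum>i\<in>I. f i) x = (\<Sum>i\<in>I. f i x)"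
  by (induction I rule: infinite_finite_induct) auto

lemma linear_on_subspace_add: "linear_on_subspace W \<phi> \<Longrightarrow> f \<in> W \<Longrightarrow> g \<in> W \<Longrightarrow> \<phi> (f + g) = \<phi> f + \<phi> g"
  by (simp add: linear_on_subspace_def)

lemma linear_on_subspace_scale: "linear_on_subspace W \<phi> \<Longrightarrow> f \<in> W \<Longrightarrow> \<phi> (fscale a f) = a *\<^sub>R \<phi> f"
  by (simp add: linear_on_subspace_def)

lemma linear_on_subspace_zero:
  assumes "linear_on_subspace W \<phi>" "0 \<in> W" shows "\<phi> 0 = 0"
proof -
  have "fscale 0 (0 :: 'a \<Rightarrow> 'b) = 0" by (simp add: fscale_def fun_eq_iff)
  then show ?thesis using linear_on_subspace_scale[OF assms, of 0] by simp
qed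

lemma linear_on_subspace_sum:
  assumes "fun_space.subspace W" "linear_on_subspace W \<phi>" "\<And>i. i \<in> I \<Longrightarrow> e i \<in> W"
  shows "\<phi> (\<Sum>i\<in>I. fscale (a i) (e i)) = (\<Sum>i\<in>I. a i *\<^sub>R \<phi> (e i))"
  using assms(3)
proof (induction I rule: infinite_finite_induct)
  case (insert i I)
  have "(\<Sum>i\<in>I. fscale (a i) (e i)) \<in> W"
    using insert.prems by (intro fun_space.subspace_sum[OF assms(1)] fun_space.subspace_scale[OF assms(1)]) auto
  moreover have "fscale (a i) (e i) \<in> W" using insert.prems fun_space.subspace_scale[OF assms(1)] by auto
  ultimately show ?case
    using insert.IH insert.prems
    by (simp only: sum.insert[OF insert.hyps] linear_on_subspace_add[OF assms(2)]
        linear_on_subspace_scale[OF assms(2)] insertI1 insertI2)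
qed (use linear_on_subspace_zero[OF assms(2)] fun_space.subspace_0[OF assms(1)] in auto)

definition fd_subspace :: "('x \<Rightarrow> real) set \<Rightarrow> bool"
  where "fd_subspace W \<longleftrightarrow> fun_space.subspace W \<and> (\<exists>B. finite B \<and> fun_space.span B = W)"

lemma fd_subspace_add: "fd_subspace W \<Longrightarrow> f \<in> W \<Longrightarrow> g \<in> W \<Longrightarrow> f + g \<in> W"
  by (simp add: fd_subspace_def fun_space.subspace_add)

lemma fd_subspace_scale: "fd_subspace W \<Longrightarrow> f \<in> W \<Longrightarrow> fscale a f \<in> W"
  by (simp add: fd_subspace_def fun_space.subspace_scale)

lemma fd_subspace_zero: "fd_subspace W \<Longrightarrow> 0 \<in> W"
  by (simp add: fd_subspace_def fun_space.subspace_0)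

lemma fd_subspace_sum: "fd_subspace W \<Longrightarrow> (\<And>i. i \<in> I \<Longrightarrow> f i \<in> W) \<Longrightarrow> (\<Sum>i\<in>I. f i) \<in> W"
  by (simp add: fd_subspace_def fun_space.subspace_sum)

text \<open>
  Point evaluations span the dual of a finite-dimensional space of functions: a maximal finite
  set of points admitting a dual family in the space already determines every function.
\<close>

lemma fd_subspace_point_frame:
  assumes W: "fd_subspace W"
  obtains X e where "finite X" "\<And>x. x \<in> X \<Longrightarrow> e x \<in> W" "\<And>f. f \<in> W \<Longrightarrow> f = (\<Sum>x\<in>X. fscale (f x) (e x))"
proof -
  define D where "D X e \<longleftrightarrow> finite X \<and> (\<forall>x\<in>X. e x \<in> W) \<and>
     (\<forall>x\<in>X. \<forall>y\<in>X. e x y = (if x = y then 1 else 0))" for X and e :: "'a \<Rightarrow> 'a \<Rightarrow> real"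
  obtain B where B: "finite B" "fun_space.span B = W" using W by (auto simp: fd_subspace_def)
  \<comment> \<open>A dual family is linearly independent, because evaluating a vanishing
    combination at a point of \<open>X\<close> isolates one coefficient. So \<open>X\<close> has at
    most as many points as the spanning set has elements.\<close>
  have bound: "card X \<le> card B" if D: "D X e" for X e
  proof -
    have inj: "inj_on e X"
    proof (rule inj_onI)
      fix x y assume xy: "x \<in> X" "y \<in> X" "e x = e y"
      have "e x x = 1" using D xy(1) unfolding D_def by simp
      moreover have "e y x = (if y = x then 1 else 0)" using D xy(1,2) unfolding D_def by blast
      ultimately show "x = y" unfolding xy(3) by (cases "y = x") auto
    qed
    have "fun_space.independent (e ` X)"
    proof (rule fun_space.independent_if_scalars_zero)
      show "finite (e ` X)" using D by (simp add: D_def)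
      fix u and g assume sum: "(\<Sum>g\<in>e ` X. fscale (u g) g) = 0" and "g \<in> e ` X"
      then obtain x where x: "x \<in> X" "g = e x" by auto
      have "0 = (\<Sum>g\<in>e ` X. fscale (u g) g) x" by (simp add: sum)
      also have "\<dots> = (\<Sum>y\<in>X. u (e y) * e y x)"
        by (simp add: sum.reindex[OF inj] sum_function_apply fscale_def)
      also have "\<dots> = (\<Sum>y\<in>X. if y = x then u (e y) else 0)"
        using D x(1) by (intro sum.cong) (auto simp: D_def)
      also have "\<dots> = u (e x)" using D x(1) by (simp add: D_def)
      finally show "u g = 0" by (simp add: x(2))
    qed
    moreover have "e ` X \<subseteq> fun_space.span B" using D B by (auto simp: D_def)
    ultimately have "card (e ` X) \<le> card B" using fun_space.independent_span_bound[OF B(1)] by blast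
    then show ?thesis by (simp add: card_image[OF inj])
  qed
  have "\<exists>X e. D X e \<and> (\<forall>f\<in>W. f = (\<Sum>x\<in>X. fscale (f x) (e x)))"
  proof (rule ccontr)
    assume neg: "\<not> ?thesis"
    have "\<exists>X e. D X e \<and> card X = n" for n
    proof (induction n)
      case 0
      show ?case by (rule exI[of _ "{}"]) (simp add: D_def)
    next
      case (Suc n)
      then obtain X e where D: "D X e" "card X = n" by blast
      then obtain f where f: "f \<in> W" "f \<noteq> (\<Sum>x\<in>X. fscale (f x) (e x))" using neg by blast
      \<comment> \<open>The residual of a function that is not reproduced vanishes on
        \<open>X\<close> but not at some \<open>y\<close>. Normalised at \<open>y\<close> it joins
        the family, and the old members are corrected by multiples of it so as to vanish at
        \<open>y\<close>. This could be repeated without end, against the bound on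
        \<open>card X\<close>.\<close>
      define r where "r = f + fscale (- 1) (\<Sum>x\<in>X. fscale (f x) (e x))"
      have rW: "r \<in> W" unfolding r_def using D f(1)
        by (intro fd_subspace_add[OF W] fd_subspace_scale[OF W] fd_subspace_sum[OF W]) (auto simp: D_def)
      have r: "r z = f z - (\<Sum>x\<in>X. f x * e x z)" for z
        by (simp add: r_def fscale_def sum_function_apply)
      have rX: "r z = 0" if "z \<in> X" for z
      proof -
        have "(\<Sum>x\<in>X. f x * e x z) = (\<Sum>x\<in>X. if x = z then f x else 0)"
          using D that by (intro sum.cong) (auto simp: D_def)
        also have "\<dots> = f z" using D that by (simp add: D_def)
        finally show ?thesis by (simp add: r)
      qed
      obtain y where "f y \<noteq> (\<Sum>x\<in>X. fscale (f x) (e x)) y" using f(2) by (auto simp: fun_eq_iff)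
      then have y: "r y \<noteq> 0" by (simp add: r fscale_def sum_function_apply)
      then have yX: "y \<notin> X" using rX by blast
      define ey where "ey = fscale (1 / r y) r"
      have eyW: "ey \<in> W" unfolding ey_def by (rule fd_subspace_scale[OF W rW])
      have ey: "ey y = 1" "\<And>z. z \<in> X \<Longrightarrow> ey z = 0" using y rX by (auto simp: ey_def fscale_def)
      define e' where "e' x = (if x = y then ey else e x + fscale (- e x y) ey)" for x
      have "D (insert y X) e'"
        unfolding D_def
      proof (intro conjI ballI)
        show "finite (insert y X)" using D by (simp add: D_def)
        show "e' x \<in> W" if "x \<in> insert y X" for x
        proof (cases "x = y")
          case False
          then have "e x \<in> W" using that D unfolding D_def by blast
          from fd_subspace_add[OF W this fd_subspace_scale[OF W eyW]] show ?thesis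
            using False by (simp only: e'_def if_False)
        qed (simp add: e'_def eyW)
        show "e' x z = (if x = z then 1 else 0)" if "x \<in> insert y X" "z \<in> insert y X" for x z
          using that ey yX D by (auto simp: e'_def D_def fscale_def)
      qed
      moreover have "card (insert y X) = Suc n" using D yX by (simp add: D_def)
      ultimately show ?case by blast
    qed
    then obtain X e where "D X e" "card X = Suc (card B)" by blast
    then show False using bound[of X e] by simp
  qed
  then show thesis using that unfolding D_def by blast
qed

lemma vector_atlas_iff:
  "c \<in> vector_atlas W \<longleftrightarrow> fst c = W \<and> linear_on_subspace W (snd c) \<and> bij_betw (snd c) W UNIV"
  by (cases c) (auto simp: vector_atlas_def)

lemma vector_chart_inverse_linear:
  assumes W: "fd_subspace W" and c: "c \<in> vector_atlas W"
  shows "cinv c (x + y) = cinv c x + cinv c y" "cinv c (a *\<^sub>R x) = fscale a (cinv c x)"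
    "cinv c x \<in> W" "snd c (cinv c x) = x"
proof -
  have c': "fst c = W" "linear_on_subspace W (snd c)" "bij_betw (snd c) W UNIV"
    using c by (auto simp: vector_atlas_iff)
  have in': "cinv c x \<in> W" for x using c' by (metis bij_betw_imp_surj_on inv_into_into UNIV_I)
  have eq: "snd c (cinv c x) = x" for x using c' by (metis bij_betw_inv_into_right UNIV_I)
  have inv: "cinv c x = f" if "f \<in> W" "snd c f = x" for x f
    using c' that by (metis bij_betw_inv_into_left)
  show "cinv c (x + y) = cinv c x + cinv c y"
    by (rule inv) (auto simp: fd_subspace_add[OF W] in' eq linear_on_subspace_add[OF c'(2)])
  show "cinv c (a *\<^sub>R x) = fscale a (cinv c x)"
    by (rule inv) (auto simp: fd_subspace_scale[OF W] in' eq linear_on_subspace_scale[OF c'(2)])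
  show "cinv c x \<in> W" "snd c (cinv c x) = x" by (rule in', rule eq)
qed

lemma linear_on_subspace_chart_inverse:
  fixes L :: "('x \<Rightarrow> real) \<Rightarrow> 'n::real_normed_vector" and c :: "('x \<Rightarrow> real, 'm::real_normed_vector) chart"
  assumes W: "fd_subspace W" and c: "c \<in> vector_atlas W" and fd: "finite_dimensional TYPE('m)"
    and L: "linear_on_subspace W L"
  shows "bounded_linear (\<lambda>y. L (cinv c y))"
  by (rule finite_dimensional_linear_bounded[OF fd])
    (auto intro!: linearI simp: vector_chart_inverse_linear[OF W c] linear_on_subspace_add[OF L] linear_on_subspace_scale[OF L])

lemma vector_chart_image: "c \<in> vector_atlas W \<Longrightarrow> snd c ` fst c = UNIV"
  by (auto simp: vector_atlas_iff bij_betw_def)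

lemma fd_atlas_vector:
  assumes W: "fd_subspace W" and fd: "finite_dimensional TYPE('m::real_normed_vector)"
  shows "fd_atlas (vector_atlas W :: ('x \<Rightarrow> real, 'm) atlas)"
  unfolding fd_atlas_def smooth_atlas_iff
proof (intro conjI ballI fd)
  fix c d :: "('x \<Rightarrow> real, 'm) chart" assume c: "c \<in> vector_atlas W" and d: "d \<in> vector_atlas W"
  show "inj_on (snd c) (fst c)" "open (snd c ` fst c)"
    using c vector_chart_image[OF c] by (auto simp: vector_atlas_iff bij_betw_def)
  have "fst c \<inter> fst d = fst c" using c d by (auto simp: vector_atlas_iff)
  then show "open (snd c ` (fst c \<inter> fst d))" "smooth_on (snd c ` (fst c \<inter> fst d)) (\<lambda>y. snd d (cinv c y))"
    using vector_chart_image[OF c] linear_on_subspace_chart_inverse[OF W c fd, of "snd d"] d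
    by (auto simp: vector_atlas_iff smooth_on_bounded_linear)
qed

lemma atlas_space_vector:
  fixes c :: "('x \<Rightarrow> real, 'm::real_normed_vector) chart"
  assumes "c \<in> vector_atlas W"
  shows "atlas_space (vector_atlas W :: ('x \<Rightarrow> real, 'm) atlas) = W"
proof safe
  fix x assume "x \<in> atlas_space (vector_atlas W :: ('x \<Rightarrow> real, 'm) atlas)"
  then show "x \<in> W" by (rule atlas_spaceE) (simp add: vector_atlas_iff)
next
  fix x assume "x \<in> W"
  then show "x \<in> atlas_space (vector_atlas W :: ('x \<Rightarrow> real, 'm) atlas)"
    using assms by (intro atlas_spaceI[OF assms]) (simp add: vector_atlas_iff)
qed

lemma smooth_map_linear:
  assumes W: "fd_subspace W" and fd: "finite_dimensional TYPE('m::real_normed_vector)" and L: "linear_on_subspace W L"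
  shows "smooth_map (vector_atlas W :: ('x \<Rightarrow> real, 'm) atlas) real_atlas L"
  by (rule smooth_map_realI[OF fd_atlas_vector[OF W fd]])
    (auto intro!: smooth_on_bounded_linear linear_on_subspace_chart_inverse[OF W _ fd L])

lemma linear_on_subspace_eval: "linear_on_subspace W (\<lambda>f. f x :: real)"
  by (simp add: linear_on_subspace_def fscale_def)

lemma vector_chart_point_frame:
  assumes W: "fd_subspace W"
  obtains X e where "finite X" "\<And>x. x \<in> X \<Longrightarrow> e x \<in> W"
    "\<And>\<phi> f. linear_on_subspace W \<phi> \<Longrightarrow> f \<in> W \<Longrightarrow> \<phi> f = (\<Sum>x\<in>X. f x *\<^sub>R \<phi> (e x))"
proof -
  obtain X e where X: "finite X" "\<And>x. x \<in> X \<Longrightarrow> e x \<in> W" "\<And>f. f \<in> W \<Longrightarrow> f = (\<Sum>x\<in>X. fscale (f x) (e x))"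
    using fd_subspace_point_frame[OF W] by metis
  have "\<phi> f = (\<Sum>x\<in>X. f x *\<^sub>R \<phi> (e x))" if "linear_on_subspace W \<phi>" "f \<in> W" for \<phi> f
    by (subst X(3)[OF that(2)], rule linear_on_subspace_sum[OF _ that(1) X(2)]) (use W in \<open>auto simp: fd_subspace_def\<close>)
  then show thesis using that X(1,2) by blast
qed

text \<open>A chart of \<open>W\<close> is a finite combination of point evaluations, so smoothness
  of each \<open>p \<mapsto> F p x\<close> is enough. This is applied to \<open>V\<close> and, with
  vectors of the Lie algebra as points, to the dual of a Lie algebra.\<close>

lemma smooth_map_vectorI:
  fixes c :: "('x \<Rightarrow> real, 'm::real_normed_vector) chart" and F :: "'a \<Rightarrow> 'x \<Rightarrow> real"
  assumes W: "fd_subspace W" and fd: "finite_dimensional TYPE('m)" and c: "c \<in> vector_atlas W"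
    and A: "fd_atlas A" and F: "\<And>p. p \<in> atlas_space A \<Longrightarrow> F p \<in> W"
    and sm: "\<And>x. smooth_map A real_atlas (\<lambda>p. F p x)"
  shows "smooth_map A (vector_atlas W :: ('x \<Rightarrow> real, 'm) atlas) F"
proof (rule smooth_mapI[OF A fd_atlas_vector[OF W fd]])
  obtain X e where X: "finite X" "\<And>x. x \<in> X \<Longrightarrow> e x \<in> W"
    "\<And>\<phi> f. linear_on_subspace W (\<phi> :: _ \<Rightarrow> 'm) \<Longrightarrow> f \<in> W \<Longrightarrow> \<phi> f = (\<Sum>x\<in>X. f x *\<^sub>R \<phi> (e x))"
    using vector_chart_point_frame[OF W] by metis
  fix p assume "p \<in> atlas_space A"
  then obtain a where a: "a \<in> A" "p \<in> fst a" by (rule atlas_spaceE)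
  have op: "open (snd a ` fst a)" by (rule chart_open[OF A a(1)])
  have FW: "F (cinv a y) \<in> W" if "y \<in> snd a ` fst a" for y
    by (rule F[OF atlas_spaceI[OF a(1) cinv_in[OF A a(1) that]]])
  have "smooth_on (snd a ` fst a) (\<lambda>y. \<Sum>x\<in>X. F (cinv a y) x *\<^sub>R snd c (e x))"
    by (intro smooth_on_sum smooth_on_scaleR op smooth_map_realD[OF A sm a(1)] smooth_on_const)
  then have "smooth_on (snd a ` fst a) (\<lambda>y. snd c (F (cinv a y)))"
  proof (rule smooth_on_cong[OF op])
    fix y assume "y \<in> snd a ` fst a"
    then show "(\<Sum>x\<in>X. F (cinv a y) x *\<^sub>R snd c (e x)) = snd c (F (cinv a y))"
      using X(3)[OF _ FW, of "snd c"] c by (simp add: vector_atlas_iff)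
  qed
  moreover have "\<forall>y\<in>snd a ` fst a. F (cinv a y) \<in> fst c" using FW c by (simp add: vector_atlas_iff)
  ultimately show "\<exists>a\<in>A. \<exists>d\<in>vector_atlas W :: ('x \<Rightarrow> real, 'm) atlas. \<exists>Q. p \<in> fst a \<and> open Q \<and> snd a p \<in> Q \<and> Q \<subseteq> snd a ` fst a
      \<and> (\<forall>y\<in>Q. F (cinv a y) \<in> fst d) \<and> smooth_on Q (\<lambda>y. snd d (F (cinv a y)))"
    using op a by (intro bexI[OF _ a(1)] bexI[OF _ c] exI[of _ "snd a ` fst a"]) auto
qed

text \<open>The canonical identification of \<open>W\<close> with its tangent space at any point:
  transitions between linear charts are linear, so the components do not depend on the base
  point.\<close>

definition vector_tangent :: "('x \<Rightarrow> real) set \<Rightarrow> ('x \<Rightarrow> real) \<Rightarrow> ('x \<Rightarrow> real, 'm::real_normed_vector) tangent"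
  where "vector_tangent W f = (\<lambda>c. if c \<in> vector_atlas W then snd c f else 0)"

lemma linear_chart_derivative:
  fixes L :: "('x \<Rightarrow> real) \<Rightarrow> 'n::real_normed_vector" and c :: "('x \<Rightarrow> real, 'm::real_normed_vector) chart"
  assumes W: "fd_subspace W" and c: "c \<in> vector_atlas W" and fd: "finite_dimensional TYPE('m)"
    and L: "linear_on_subspace W L" and f: "f \<in> W"
  shows "frechet_derivative (\<lambda>y. L (cinv c y)) (at q) (snd c f) = L f"
proof -
  have "cinv c (snd c f) = f" using c f fd_atlas_vector[OF W fd] by (simp add: vector_atlas_iff bij_betw_def)
  then show ?thesis
    by (simp add: frechet_derivative_eqI[OF bounded_linear_imp_has_derivative[OF linear_on_subspace_chart_inverse[OF W c fd L]]])
qed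

lemma vector_tangent_in:
  assumes W: "fd_subspace W" and fd: "finite_dimensional TYPE('m::real_normed_vector)" and f: "f \<in> W" and p: "p \<in> W"
  shows "(vector_tangent W f :: ('x \<Rightarrow> real, 'm) tangent) \<in> tangent_space (vector_atlas W) p"
  unfolding tangent_space_iff
proof (intro conjI ballI impI allI)
  fix c d :: "('x \<Rightarrow> real, 'm) chart" assume c: "c \<in> vector_atlas W" and d: "d \<in> vector_atlas W"
  show "vector_tangent W f d = frechet_derivative (\<lambda>y. snd d (cinv c y)) (at (snd c p)) (vector_tangent W f c)"
    using linear_chart_derivative[OF W c fd _ f, of "snd d"] c d by (simp add: vector_tangent_def vector_atlas_iff)
qed (use p in \<open>auto simp: vector_tangent_def vector_atlas_iff\<close>)

text \<open>The charts of \<open>W\<close> are onto the model space, so every component is the value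
  of the chart at some vector of \<open>W\<close>.\<close>

lemma vector_tangent_cases:
  fixes c :: "('x \<Rightarrow> real, 'm::real_normed_vector) chart"
  assumes W: "fd_subspace W" and fd: "finite_dimensional TYPE('m)" and c: "c \<in> vector_atlas W" and p: "p \<in> W"
    and v: "(v :: ('x \<Rightarrow> real, 'm) tangent) \<in> tangent_space (vector_atlas W) p"
  shows "v = vector_tangent W (cinv c (v c))"
  by (rule tangent_space_eqI[OF v vector_tangent_in[OF W fd _ p] c])
    (use c p in \<open>auto simp: vector_tangent_def vector_chart_inverse_linear[OF W c] vector_atlas_iff\<close>)

lemma differential_linear:
  fixes c :: "('x \<Rightarrow> real, 'm::real_normed_vector) chart"
  assumes W: "fd_subspace W" and fd: "finite_dimensional TYPE('m)" and c: "c \<in> vector_atlas W"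
    and p: "p \<in> W" and f: "f \<in> W" and L: "linear_on_subspace W L"
  shows "differential (vector_atlas W :: ('x \<Rightarrow> real, 'm) atlas) L p (vector_tangent W f) = L f"
proof -
  have "p \<in> fst c" using c p by (simp add: vector_atlas_iff)
  from differential_eq[OF fd_atlas_vector[OF W fd] smooth_map_linear[OF W fd L] c this vector_tangent_in[OF W fd f p]]
  show ?thesis using linear_chart_derivative[OF W c fd L f] c by (simp add: vector_tangent_def)
qed

text \<open>A linear map on \<open>W\<close> is a combination of finitely many point values, so
  differentiability at each point suffices.\<close>

lemma vector_chart_curve_derivative:
  fixes \<gamma> :: "real \<Rightarrow> 'x \<Rightarrow> real" and L :: "('x \<Rightarrow> real) \<Rightarrow> 'n::real_normed_vector"
  assumes W: "fd_subspace W" and \<gamma>: "\<And>s. s \<in> I \<Longrightarrow> \<gamma> s \<in> W" and t: "t \<in> I" and f: "f \<in> W"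
    and L: "linear_on_subspace W L"
    and deriv: "\<And>x. ((\<lambda>s. \<gamma> s x) has_real_derivative f x) (at t within I)"
  shows "((\<lambda>s. L (\<gamma> s)) has_vector_derivative L f) (at t within I)"
proof -
  obtain X e where X: "finite X" "\<And>x. x \<in> X \<Longrightarrow> e x \<in> W"
    "\<And>\<phi> f. linear_on_subspace W (\<phi> :: _ \<Rightarrow> 'n) \<Longrightarrow> f \<in> W \<Longrightarrow> \<phi> f = (\<Sum>x\<in>X. f x *\<^sub>R \<phi> (e x))"
    using vector_chart_point_frame[OF W] by metis
  have "((\<lambda>s. \<Sum>x\<in>X. \<gamma> s x *\<^sub>R L (e x)) has_vector_derivative (\<Sum>x\<in>X. f x *\<^sub>R L (e x))) (at t within I)"
  proof (rule has_vector_derivative_sum)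
    fix x
    show "((\<lambda>s. \<gamma> s x *\<^sub>R L (e x)) has_vector_derivative f x *\<^sub>R L (e x)) (at t within I)"
      using has_vector_derivative_scaleR[OF deriv[of x] has_vector_derivative_const[of "L (e x)"]] by simp
  qed
  then have "((\<lambda>s. \<Sum>x\<in>X. \<gamma> s x *\<^sub>R L (e x)) has_vector_derivative L f) (at t within I)"
    by (simp add: X(3)[OF L f])
  then show ?thesis
    by (rule has_vector_derivative_transform[OF t, rotated]) (simp add: X(3)[OF L \<gamma>])
qed

text \<open>This links the derivatives along lines that define \<open>dual_differential\<close> with
  the chartwise \<open>differential\<close>.\<close>

lemma smooth_function_line_derivative:
  fixes c :: "('x \<Rightarrow> real, 'm::real_normed_vector) chart"
  assumes W: "fd_subspace W" and fd: "finite_dimensional TYPE('m)" and c: "c \<in> vector_atlas W"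
    and p: "p \<in> W" and f: "f \<in> W" and F: "smooth_map (vector_atlas W :: ('x \<Rightarrow> real, 'm) atlas) real_atlas F"
  shows "((\<lambda>t. F (p + fscale t f)) has_real_derivative
    differential (vector_atlas W :: ('x \<Rightarrow> real, 'm) atlas) F p (vector_tangent W f)) (at 0)"
proof -
  let ?A = "vector_atlas W :: ('x \<Rightarrow> real, 'm) atlas"
  note A = fd_atlas_vector[OF W fd]
  have pc: "p \<in> fst c" and L: "linear_on_subspace W (snd c)" using c p by (auto simp: vector_atlas_iff)
  have in': "p + fscale t f \<in> W" for t by (intro fd_subspace_add[OF W] fd_subspace_scale[OF W] p f)
  have "smooth_on UNIV (\<lambda>y. F (cinv c y))"
    using smooth_map_realD[OF A F c] vector_chart_image[OF c] by simp
  from smooth_on_line_has_vector_derivative[OF this, of "snd c p" 0 "snd c f"]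
  have "((\<lambda>t. F (cinv c (snd c p + t *\<^sub>R snd c f))) has_real_derivative
      frechet_derivative (\<lambda>y. F (cinv c y)) (at (snd c p)) (snd c f)) (at 0)"
    by (simp add: has_real_derivative_iff_has_vector_derivative)
  moreover have "cinv c (snd c p + t *\<^sub>R snd c f) = p + fscale t f" for t
  proof -
    have "snd c p + t *\<^sub>R snd c f = snd c (p + fscale t f)"
      by (simp add: linear_on_subspace_add[OF L p] linear_on_subspace_scale[OF L f] fd_subspace_scale[OF W f])
    then show ?thesis using cinv_chart[OF A c] in'[of t] c by (simp add: vector_atlas_iff)
  qed
  moreover have "differential ?A F p (vector_tangent W f) =
      frechet_derivative (\<lambda>y. F (cinv c y)) (at (snd c p)) (snd c f)"
    using differential_eq[OF A F c pc vector_tangent_in[OF W fd f p]] c by (simp add: vector_tangent_def)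
  ultimately show ?thesis by simp
qed

lemma velocity_line:
  assumes W: "fd_subspace W" and f: "f \<in> W"
  shows "velocity (vector_atlas W :: ('x \<Rightarrow> real, 'm::real_normed_vector) atlas) (\<lambda>t. fscale t f) 0 = vector_tangent W f"
proof
  fix d :: "('x \<Rightarrow> real, 'm) chart"
  have "((\<lambda>s. snd d (fscale s f)) has_vector_derivative snd d f) (at 0)" if "d \<in> vector_atlas W"
  proof (rule vector_chart_curve_derivative[OF W _ UNIV_I f])
    show "((\<lambda>s. fscale s f x) has_real_derivative f x) (at 0)" for x
      unfolding fscale_def by (auto intro!: derivative_eq_intros)
  qed (use that fd_subspace_scale[OF W f] in \<open>auto simp: vector_atlas_iff\<close>)
  then show "velocity (vector_atlas W) (\<lambda>t. fscale t f) 0 d = vector_tangent W f d"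
    using vector_derivative_at fd_subspace_scale[OF W f, of 0]
    by (auto simp: velocity_apply vector_tangent_def vector_atlas_iff)
qed

section \<open>The cotangent bundle\<close>

lemma fscale_apply: "fscale a f x = a *\<^sub>R f x"
  by (simp add: fscale_def)

lemma Sigma_iff_fst_snd: "\<xi> \<in> Sigma U C \<longleftrightarrow> fst \<xi> \<in> U \<and> snd \<xi> \<in> C (fst \<xi>)"
  by (cases \<xi>) simp

lemma fd_subspace_of_chart:
  fixes \<phi> :: "('x \<Rightarrow> real) \<Rightarrow> 'm::real_normed_vector"
  assumes W: "fun_space.subspace W" and fd: "finite_dimensional TYPE('m)"
    and lin: "linear_on_subspace W \<phi>" and bij: "bij_betw \<phi> W UNIV"
  shows "fd_subspace W"
  unfolding fd_subspace_def
proof (intro conjI W)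
  obtain B :: "'m set" and co where B: "finite B" "\<And>x. (\<Sum>b\<in>B. co b x *\<^sub>R b) = x"
    using finite_dimensional_frame[OF fd] by metis
  let ?i = "inv_into W \<phi>"
  have i: "?i b \<in> W" "\<phi> (?i b) = b" for b
    using bij by (metis bij_betw_imp_surj_on inv_into_into UNIV_I, metis bij_betw_inv_into_right UNIV_I)
  have "f \<in> fun_space.span (?i ` B)" if f: "f \<in> W" for f
  proof -
    have "f = (\<Sum>b\<in>B. fscale (co b (\<phi> f)) (?i b))"
    proof (rule inj_onD[OF bij_betw_imp_inj_on[OF bij] _ f])
      show "\<phi> f = \<phi> (\<Sum>b\<in>B. fscale (co b (\<phi> f)) (?i b))"
        by (simp only: linear_on_subspace_sum[OF W lin i(1)] i(2) B(2))
      show "(\<Sum>b\<in>B. fscale (co b (\<phi> f)) (?i b)) \<in> W"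
        by (intro fun_space.subspace_sum[OF W] fun_space.subspace_scale[OF W] i)
    qed
    moreover have "(\<Sum>b\<in>B. fscale (co b (\<phi> f)) (?i b)) \<in> fun_space.span (?i ` B)"
      by (intro fun_space.span_sum fun_space.span_scale fun_space.span_base imageI)
    ultimately show ?thesis by simp
  qed
  moreover have "fun_space.span (?i ` B) \<subseteq> W"
    by (rule fun_space.span_minimal[OF _ W]) (use i in auto)
  ultimately show "\<exists>B. finite B \<and> fun_space.span B = W"
    using B(1) by (intro exI[of _ "?i ` B"]) auto
qed

definition cochart :: "('a, 'm::real_normed_vector) atlas \<Rightarrow> ('a, 'm) chart \<Rightarrow> (('a, 'm) cotangent, 'm \<times> ('m \<Rightarrow>\<^sub>L real)) chart"
  where "cochart A c = (Sigma (fst c) (cotangent_space A),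
     \<lambda>\<xi>. (snd c (fst \<xi>), Blinfun (\<lambda>w. snd \<xi> (coord_vector A c (fst \<xi>) w))))"

text \<open>The inverse of the fibre coordinate induced by the chart \<open>c\<close>, extended by 0
  in the way that elements of \<open>cotangent_space\<close> are.\<close>

definition covector :: "('a, 'm::real_normed_vector) atlas \<Rightarrow> ('a, 'm) chart \<Rightarrow> 'a \<Rightarrow> ('m \<Rightarrow>\<^sub>L real) \<Rightarrow> ('a, 'm) tangent \<Rightarrow> real"
  where "covector A c p \<alpha> = (\<lambda>v. if v \<in> tangent_space A p then blinfun_apply \<alpha> (v c) else 0)"

lemma cotangent_atlas_alt: "cotangent_atlas A = cochart A ` A"
  by (simp add: cotangent_atlas_def cochart_def case_prod_beta')

lemma cotangent_space_iff: "\<zeta> \<in> cotangent_space A p \<longleftrightarrow>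
    linear_on_subspace (tangent_space A p) \<zeta> \<and> (\<forall>v. v \<notin> tangent_space A p \<longrightarrow> \<zeta> v = 0)"
  by (simp add: cotangent_space_def dual_space_def)

lemma cotangent_add: "\<zeta> \<in> cotangent_space A p \<Longrightarrow> v \<in> tangent_space A p \<Longrightarrow> w \<in> tangent_space A p \<Longrightarrow> \<zeta> (v + w) = \<zeta> v + \<zeta> w"
  using linear_on_subspace_add[of "tangent_space A p" \<zeta> v w] by (simp add: cotangent_space_iff)

lemma cotangent_fscale: "\<zeta> \<in> cotangent_space A p \<Longrightarrow> v \<in> tangent_space A p \<Longrightarrow> \<zeta> (fscale a v) = a * \<zeta> v"
  using linear_on_subspace_scale[of "tangent_space A p" \<zeta> v a] by (simp add: cotangent_space_iff)

lemma cotangentI: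
  assumes "\<And>v w. v \<in> tangent_space A p \<Longrightarrow> w \<in> tangent_space A p \<Longrightarrow> \<zeta> (v + w) = \<zeta> v + \<zeta> w"
    "\<And>v a. v \<in> tangent_space A p \<Longrightarrow> \<zeta> (fscale a v) = a * \<zeta> v" "\<And>v. v \<notin> tangent_space A p \<Longrightarrow> \<zeta> v = 0"
  shows "\<zeta> \<in> cotangent_space A p"
  using assms by (simp add: cotangent_space_iff linear_on_subspace_def)

lemma cotangent_eqI:
  assumes "\<zeta> \<in> cotangent_space A p" "\<zeta>' \<in> cotangent_space A p" "\<And>v. v \<in> tangent_space A p \<Longrightarrow> \<zeta> v = \<zeta>' v"
  shows "\<zeta> = \<zeta>'"
proof
  fix v show "\<zeta> v = \<zeta>' v"
    using assms by (cases "v \<in> tangent_space A p") (auto simp: cotangent_space_iff)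
qed

lemma covector_in:
  assumes A: "fd_atlas A" shows "covector A c p \<alpha> \<in> cotangent_space A p"
  by (rule cotangentI)
    (simp_all add: covector_def tangent_space_add[OF A] tangent_space_fscale[OF A] blinfun.add_right fscale_apply
      blinfun.scaleR_right)

lemma covector_coords_apply:
  fixes A :: "('a, 'm::real_normed_vector) atlas"
  assumes A: "fd_atlas A" and c: "c \<in> A" "p \<in> fst c" and \<zeta>: "\<zeta> \<in> cotangent_space A p"
  shows "blinfun_apply (Blinfun (\<lambda>w. \<zeta> (coord_vector A c p w))) w = \<zeta> (coord_vector A c p w)"
proof (rule bounded_linear_Blinfun_apply[THEN fun_cong], rule finite_dimensional_linear_bounded[OF fd_atlas_dim[OF A]])
  show "linear (\<lambda>w. \<zeta> (coord_vector A c p w))"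
    by (rule linearI) (simp_all add: coord_vector_add[OF A c] coord_vector_fscale[OF A c]
        cotangent_add[OF \<zeta>] cotangent_fscale[OF \<zeta>] coord_vector_in[OF A c])
qed

lemma covector_coords_covector:
  assumes A: "fd_atlas A" and c: "c \<in> A" "p \<in> fst c"
  shows "Blinfun (\<lambda>w. covector A c p \<alpha> (coord_vector A c p w)) = \<alpha>"
  by (rule blinfun_eqI, unfold covector_coords_apply[OF A c covector_in[OF A]])
    (simp add: covector_def coord_vector_in[OF A c] A c)

lemma covector_covector_coords:
  assumes A: "fd_atlas A" and c: "c \<in> A" "p \<in> fst c" and \<zeta>: "\<zeta> \<in> cotangent_space A p"
  shows "covector A c p (Blinfun (\<lambda>w. \<zeta> (coord_vector A c p w))) = \<zeta>"
  by (rule cotangent_eqI[OF covector_in[OF A] \<zeta>])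
    (simp add: covector_def covector_coords_apply[OF A c \<zeta>] A c)

text \<open>At the unit of a Lie group the fibre is the dual of the Lie algebra; this provides the
  linear charts of that dual and its finite dimension.\<close>

lemma cotangent_space_chart:
  assumes A: "fd_atlas A" and c: "c \<in> A" "p \<in> fst c"
  shows "(cotangent_space A p, \<lambda>\<zeta>. Blinfun (\<lambda>w. \<zeta> (coord_vector A c p w))) \<in> vector_atlas (cotangent_space A p)"
    and "fd_subspace (cotangent_space A p)"
proof -
  let ?\<phi> = "\<lambda>\<zeta>. Blinfun (\<lambda>w. \<zeta> (coord_vector A c p w))"
  have sub: "fun_space.subspace (cotangent_space A p)"
    unfolding fun_space.subspace_def
    by (intro conjI allI impI ballI cotangentI)
      (simp_all add: fscale_apply cotangent_add cotangent_fscale cotangent_space_iff algebra_simps)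
  have lin: "linear_on_subspace (cotangent_space A p) ?\<phi>"
    unfolding linear_on_subspace_def
  proof (intro conjI ballI allI; rule blinfun_eqI)
    fix \<zeta> \<zeta>' w assume \<zeta>: "\<zeta> \<in> cotangent_space A p" and \<zeta>': "\<zeta>' \<in> cotangent_space A p"
    show "blinfun_apply (?\<phi> (\<zeta> + \<zeta>')) w = blinfun_apply (?\<phi> \<zeta> + ?\<phi> \<zeta>') w"
      unfolding covector_coords_apply[OF A c fun_space.subspace_add[OF sub \<zeta> \<zeta>']] blinfun.add_left
        covector_coords_apply[OF A c \<zeta>] covector_coords_apply[OF A c \<zeta>'] by simp
  next
    fix \<zeta> a w assume \<zeta>: "\<zeta> \<in> cotangent_space A p"
    show "blinfun_apply (?\<phi> (fscale a \<zeta>)) w = blinfun_apply (a *\<^sub>R ?\<phi> \<zeta>) w"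
      unfolding covector_coords_apply[OF A c fun_space.subspace_scale[OF sub \<zeta>]] blinfun.scaleR_left
        covector_coords_apply[OF A c \<zeta>] by (simp add: fscale_apply)
  qed
  have bij: "bij_betw ?\<phi> (cotangent_space A p) UNIV"
    by (rule bij_betw_byWitness[where f'="covector A c p"])
      (auto simp: covector_coords_covector[OF A c] covector_covector_coords[OF A c] covector_in[OF A])
  show "(cotangent_space A p, ?\<phi>) \<in> vector_atlas (cotangent_space A p)"
    using lin bij by (simp add: vector_atlas_iff)
  show "fd_subspace (cotangent_space A p)"
    by (rule fd_subspace_of_chart[OF sub finite_dimensional_blinfun[OF fd_atlas_dim[OF A]] lin bij])
qed

lemma cochart_image:
  assumes A: "fd_atlas A" and c: "c \<in> A" and that: "U \<subseteq> fst c"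
  shows "snd (cochart A c) ` (Sigma U (cotangent_space A)) = (snd c ` U) \<times> UNIV"
proof safe
  fix p \<alpha> assume p: "p \<in> U"
  have "(snd c p, \<alpha>) = snd (cochart A c) (p, covector A c p \<alpha>)"
    using p that by (simp add: cochart_def covector_coords_covector[OF A c] subsetD)
  then show "(snd c p, \<alpha>) \<in> snd (cochart A c) ` (Sigma U (cotangent_space A))"
    using p covector_in[OF A] by blast
qed (auto simp: cochart_def)

lemma fst_cochart: "fst (cochart A c) = Sigma (fst c) (cotangent_space A)"
  by (simp add: cochart_def)

lemma fst_snd_cochart [simp]: "fst (snd (cochart A c) \<xi>) = snd c (fst \<xi>)"
  by (simp add: cochart_def)

lemma cochart_inj:
  assumes A: "fd_atlas A" and c: "c \<in> A"
  shows "inj_on (snd (cochart A c)) (fst (cochart A c))"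
proof (rule inj_onI)
  fix \<xi> \<xi>' assume \<xi>: "\<xi> \<in> fst (cochart A c)" and \<xi>': "\<xi>' \<in> fst (cochart A c)"
    and eq: "snd (cochart A c) \<xi> = snd (cochart A c) \<xi>'"
  have 1: "fst \<xi> = fst \<xi>'"
    using \<xi> \<xi>' eq by (intro inj_onD[OF chart_inj[OF A c]]) (auto simp: cochart_def)
  have "snd \<xi> = covector A c (fst \<xi>) (snd (snd (cochart A c) \<xi>))"
    using \<xi> by (auto simp: cochart_def covector_covector_coords[OF A c])
  also have "\<dots> = snd \<xi>'"
    unfolding eq 1 using \<xi>' by (auto simp: cochart_def covector_covector_coords[OF A c])
  finally show "\<xi> = \<xi>'" using 1 by (simp add: prod_eq_iff)
qed

lemma cinv_cochart:
  assumes A: "fd_atlas A" and c: "c \<in> A" and q: "q \<in> snd c ` fst c"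
  shows "cinv (cochart A c) (q, \<alpha>) = (cinv c q, covector A c (cinv c q) \<alpha>)"
proof (rule inv_into_f_eq[OF cochart_inj[OF A c]])
  show "(cinv c q, covector A c (cinv c q) \<alpha>) \<in> fst (cochart A c)"
    by (simp add: cochart_def cinv_in[OF A c q] covector_in[OF A])
  show "snd (cochart A c) (cinv c q, covector A c (cinv c q) \<alpha>) = (q, \<alpha>)"
    by (simp add: cochart_def covector_coords_covector[OF A c cinv_in[OF A c q]] chart_cinv[OF q])
qed

lemma cotangent_atlas_space: "atlas_space (cotangent_atlas A) = Sigma (atlas_space A) (cotangent_space A)"
  unfolding cotangent_atlas_alt by (auto simp: atlas_space_def cochart_def split_beta) 

lemma cotangent_chart_overlap:
  assumes A: "fd_atlas A" and c: "c \<in> A" and d: "d \<in> A"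
  shows "snd (cochart A c) ` (fst (cochart A c) \<inter> fst (cochart A d)) = (snd c ` (fst c \<inter> fst d)) \<times> UNIV"
proof -
  have "fst (cochart A c) \<inter> fst (cochart A d) = Sigma (fst c \<inter> fst d) (cotangent_space A)"
    by (auto simp: cochart_def)
  then show ?thesis using cochart_image[OF A c, of "fst c \<inter> fst d"] by simp
qed

text \<open>Fibre coordinates change by the transpose of the derivative of the inverse transition
  \<open>\<sigma>\<close>, taken at the image point \<open>\<tau> (fst y)\<close>. Smoothness of
  this operator-valued part is tested on fixed vectors.\<close>

lemma fd_atlas_cotangent:
  fixes A :: "('a, 'm::real_normed_vector) atlas"
  assumes A: "fd_atlas A"
  shows "fd_atlas (cotangent_atlas A)"
  unfolding fd_atlas_def smooth_atlas_iff cotangent_atlas_alt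
proof (intro conjI ballI; (elim imageE; hypsubst)?)
  note fd = fd_atlas_dim[OF A]
  show "finite_dimensional TYPE('m \<times> ('m \<Rightarrow>\<^sub>L real))"
    by (intro finite_dimensional_prod finite_dimensional_blinfun fd)
  fix c assume c: "c \<in> A"
  show "inj_on (snd (cochart A c)) (fst (cochart A c))" by (rule cochart_inj[OF A c])
  show "open (snd (cochart A c) ` fst (cochart A c))"
    unfolding fst_cochart cochart_image[OF A c subset_refl] by (intro open_Times chart_open[OF A c] open_UNIV)
  fix d assume d: "d \<in> A"
  let ?S = "(snd c ` (fst c \<inter> fst d)) \<times> (UNIV :: ('m \<Rightarrow>\<^sub>L real) set)"
  have eq: "snd (cochart A c) ` (fst (cochart A c) \<inter> fst (cochart A d)) = ?S"
    by (rule cotangent_chart_overlap[OF A c d])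
  have op: "open ?S" by (intro open_Times chart_transition(1)[OF A c d] open_UNIV)
  then show "open (snd (cochart A c) ` (fst (cochart A c) \<inter> fst (cochart A d)))" by (simp add: eq)
  define \<tau> where "\<tau> = (\<lambda>y. snd d (cinv c y))"
  define \<sigma> where "\<sigma> = (\<lambda>y. snd c (cinv d y))"
  have \<tau>: "smooth_on ?S (\<lambda>y. \<tau> (fst y))"
    by (rule smooth_on_compose[OF fd op chart_transition(1)[OF A c d] _ chart_transition(2)[OF A c d, folded \<tau>_def]])
      (auto simp: smooth_on_bounded_linear bounded_linear_fst)
  have \<tau>in: "\<tau> (fst y) \<in> snd d ` (fst d \<inter> fst c)" if "y \<in> ?S" for y
    using that A c d by (auto simp: \<tau>_def)
  define \<beta> where "\<beta> = (\<lambda>y. snd (snd (cochart A d) (cinv (cochart A c) y)))"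
  have \<beta>: "blinfun_apply (\<beta> y) w = blinfun_apply (snd y) (frechet_derivative \<sigma> (at (\<tau> (fst y))) w)"
    if "y \<in> ?S" for y w
  proof -
    have q: "fst y \<in> snd c ` fst c" using that by auto
    have pc: "cinv c (fst y) \<in> fst c" and pd: "cinv c (fst y) \<in> fst d" using that A c by auto
    have "cinv (cochart A c) y = (cinv c (fst y), covector A c (cinv c (fst y)) (snd y))"
      using cinv_cochart[OF A c q, of "snd y"] by simp
    then have "blinfun_apply (\<beta> y) w = covector A c (cinv c (fst y)) (snd y) (coord_vector A d (cinv c (fst y)) w)"
      by (simp add: \<beta>_def cochart_def covector_coords_apply[OF A d pd covector_in[OF A]])
    also have "\<dots> = blinfun_apply (snd y) (coord_vector A d (cinv c (fst y)) w c)"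
      by (simp add: covector_def coord_vector_in[OF A d pd])
    also have "coord_vector A d (cinv c (fst y)) w c = frechet_derivative \<sigma> (at (\<tau> (fst y))) w"
      using c pc by (simp add: coord_vector_apply \<sigma>_def \<tau>_def)
    finally show ?thesis .
  qed
  have "smooth_on ?S \<beta>"
  proof (rule smooth_on_blinfunI[OF fd op])
    fix w
    have "smooth_on ?S (\<lambda>y. blinfun_apply (snd y) (frechet_derivative \<sigma> (at (\<tau> (fst y))) w))"
      by (intro smooth_on_bilinear[OF bounded_bilinear_blinfun_apply] op smooth_on_snd smooth_on_id
          smooth_on_derivative_compose[OF fd op chart_transition(1)[OF A d c] \<tau> smooth_on_const
            chart_transition(2)[OF A d c, folded \<sigma>_def] \<tau>in])
    then show "smooth_on ?S (\<lambda>y. blinfun_apply (\<beta> y) w)"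
      by (rule smooth_on_cong[OF op]) (simp add: \<beta>)
  qed
  from smooth_on_Pair[OF op \<tau> this]
  have "smooth_on ?S (\<lambda>y. snd (cochart A d) (cinv (cochart A c) y))"
  proof (rule smooth_on_cong[OF op])
    fix y assume "y \<in> ?S"
    then have q: "fst y \<in> snd c ` fst c" by auto
    show "(\<tau> (fst y), \<beta> y) = snd (cochart A d) (cinv (cochart A c) y)"
      using cinv_cochart[OF A c q, of "snd y"] by (simp add: prod_eq_iff \<tau>_def \<beta>_def)
  qed
  then show "smooth_on (snd (cochart A c) ` (fst (cochart A c) \<inter> fst (cochart A d)))
      (\<lambda>y. snd (cochart A d) (cinv (cochart A c) y))" by (simp add: eq)
qed

lemma cochart_in: "c \<in> A \<Longrightarrow> cochart A c \<in> cotangent_atlas A"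
  by (simp add: cotangent_atlas_alt)

lemma cochart_full_image:
  "fd_atlas A \<Longrightarrow> c \<in> A \<Longrightarrow> snd (cochart A c) ` fst (cochart A c) = (snd c ` fst c) \<times> UNIV"
  by (simp add: fst_cochart cochart_image)

lemma smooth_map_cotangentI:
  fixes A :: "('a, 'm::real_normed_vector) atlas" and P :: "('p, 'n::real_normed_vector) atlas"
  assumes A: "fd_atlas A" and P: "fd_atlas P"
    and loc: "\<And>p. p \<in> atlas_space P \<Longrightarrow> \<exists>e\<in>P. \<exists>c\<in>A. \<exists>Q. p \<in> fst e \<and> open Q \<and> snd e p \<in> Q \<and> Q \<subseteq> snd e ` fst e
      \<and> (\<forall>y\<in>Q. fst (F (cinv e y)) \<in> fst c \<and> snd (F (cinv e y)) \<in> cotangent_space A (fst (F (cinv e y))))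
      \<and> smooth_on Q (\<lambda>y. snd c (fst (F (cinv e y))))
      \<and> (\<forall>w. smooth_on Q (\<lambda>y. snd (F (cinv e y)) (coord_vector A c (fst (F (cinv e y))) w)))"
  shows "smooth_map P (cotangent_atlas A) F"
proof (rule smooth_mapI[OF P fd_atlas_cotangent[OF A]])
  fix p assume "p \<in> atlas_space P"
  from loc[OF this] obtain e c Q where e: "e \<in> P" "c \<in> A" "p \<in> fst e" "open Q" "snd e p \<in> Q" "Q \<subseteq> snd e ` fst e"
    and in': "\<And>y. y \<in> Q \<Longrightarrow> fst (F (cinv e y)) \<in> fst c"
      "\<And>y. y \<in> Q \<Longrightarrow> snd (F (cinv e y)) \<in> cotangent_space A (fst (F (cinv e y)))"
    and sm: "smooth_on Q (\<lambda>y. snd c (fst (F (cinv e y))))"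
      "\<And>w. smooth_on Q (\<lambda>y. snd (F (cinv e y)) (coord_vector A c (fst (F (cinv e y))) w))"
    by blast
  have "smooth_on Q (\<lambda>y. Blinfun (\<lambda>w. snd (F (cinv e y)) (coord_vector A c (fst (F (cinv e y))) w)))"
  proof (rule smooth_on_blinfunI[OF fd_atlas_dim[OF A] e(4)])
    fix w
    show "smooth_on Q (\<lambda>y. blinfun_apply (Blinfun (\<lambda>w. snd (F (cinv e y)) (coord_vector A c (fst (F (cinv e y))) w))) w)"
      by (rule smooth_on_cong[OF e(4) sm(2)[of w]]) (simp add: covector_coords_apply[OF A e(2) in'])
  qed
  from smooth_on_Pair[OF e(4) sm(1) this]
  have "smooth_on Q (\<lambda>y. snd (cochart A c) (F (cinv e y)))" by (simp add: cochart_def)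
  moreover have "\<forall>y\<in>Q. F (cinv e y) \<in> fst (cochart A c)"
    using in' by (simp add: fst_cochart Sigma_iff_fst_snd)
  ultimately show "\<exists>e\<in>P. \<exists>d\<in>cotangent_atlas A. \<exists>Q. p \<in> fst e \<and> open Q \<and> snd e p \<in> Q \<and> Q \<subseteq> snd e ` fst e
      \<and> (\<forall>y\<in>Q. F (cinv e y) \<in> fst d) \<and> smooth_on Q (\<lambda>y. snd d (F (cinv e y)))"
    using e by (intro bexI[OF _ e(1)] bexI[OF _ cochart_in[OF e(2)]] exI[of _ Q]) auto
qed

lemma smooth_map_cotangent_fst:
  assumes A: "fd_atlas A" shows "smooth_map (cotangent_atlas A) A fst"
proof (rule smooth_mapI[OF fd_atlas_cotangent[OF A] A])
  fix p assume "p \<in> atlas_space (cotangent_atlas A)"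
  then obtain e where "e \<in> cotangent_atlas A" "p \<in> fst e" by (rule atlas_spaceE)
  then obtain c where c: "c \<in> A" "p \<in> fst (cochart A c)" by (auto simp: cotangent_atlas_alt)
  have op: "open (snd (cochart A c) ` fst (cochart A c))"
    by (rule chart_open[OF fd_atlas_cotangent[OF A] cochart_in[OF c(1)]])
  have eq: "cinv (cochart A c) y = (cinv c (fst y), covector A c (cinv c (fst y)) (snd y))" "fst y \<in> snd c ` fst c"
    if "y \<in> snd (cochart A c) ` fst (cochart A c)" for y
    using that cinv_cochart[OF A c(1), of "fst y" "snd y"] by (auto simp: cochart_full_image[OF A c(1)])
  have "smooth_on (snd (cochart A c) ` fst (cochart A c)) (\<lambda>y. snd c (fst (cinv (cochart A c) y)))"
    by (rule smooth_on_cong[OF op smooth_on_bounded_linear[OF bounded_linear_fst]]) (simp add: eq chart_cinv)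
  then show "\<exists>c\<in>cotangent_atlas A. \<exists>d\<in>A. \<exists>Q. p \<in> fst c \<and> open Q \<and> snd c p \<in> Q \<and> Q \<subseteq> snd c ` fst c
      \<and> (\<forall>y\<in>Q. fst (cinv c y) \<in> fst d) \<and> smooth_on Q (\<lambda>y. snd d (fst (cinv c y)))"
    using op c eq cinv_in[OF A c(1)]
    by (intro bexI[OF _ cochart_in[OF c(1)]] bexI[OF _ c(1)] exI[of _ "snd (cochart A c) ` fst (cochart A c)"]) auto
qed

lemma pairing_in_cochart:
  assumes A: "fd_atlas A" and c: "c \<in> A" and X: "smooth_vf A X" and y: "fst y \<in> snd c ` fst c"
  shows "snd (cinv (cochart A c) y) (X (fst (cinv (cochart A c) y))) = blinfun_apply (snd y) (X (cinv c (fst y)) c)"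
proof -
  have "X (cinv c (fst y)) \<in> tangent_space A (cinv c (fst y))"
    using X atlas_spaceI[OF c cinv_in[OF A c y]] by (simp add: smooth_vf_def)
  then show ?thesis using cinv_cochart[OF A c y, of "snd y"] by (simp add: covector_def)
qed

lemma smooth_map_pairing:
  assumes A: "fd_atlas A" and X: "smooth_vf A X"
  shows "smooth_map (cotangent_atlas A) real_atlas (\<lambda>\<xi>. snd \<xi> (X (fst \<xi>)))"
proof (rule smooth_map_realI[OF fd_atlas_cotangent[OF A]])
  fix e assume "e \<in> cotangent_atlas A"
  then obtain c where c: "c \<in> A" "e = cochart A c" by (auto simp: cotangent_atlas_alt)
  have op: "open ((snd c ` fst c) \<times> UNIV)" by (intro open_Times chart_open[OF A c(1)] open_UNIV)
  have sX: "smooth_on (snd c ` fst c) (\<lambda>y. X (cinv c y) c)" using X c by (simp add: smooth_vf_def)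
  have "smooth_on ((snd c ` fst c) \<times> UNIV) (\<lambda>y. X (cinv c (fst y)) c)"
    by (rule smooth_on_compose[OF fd_atlas_dim[OF A] op chart_open[OF A c(1)] smooth_on_bounded_linear[OF bounded_linear_fst] sX]) auto
  then have "smooth_on ((snd c ` fst c) \<times> UNIV) (\<lambda>y. blinfun_apply (snd y) (X (cinv c (fst y)) c))"
    by (intro smooth_on_bilinear[OF bounded_bilinear_blinfun_apply] op smooth_on_snd smooth_on_id)
  then show "smooth_on (snd e ` fst e) (\<lambda>y. snd (cinv e y) (X (fst (cinv e y))))"
    unfolding c(2) cochart_full_image[OF A c(1)]
    by (rule smooth_on_cong[OF op]) (auto simp: pairing_in_cochart[OF A c(1) X])
qed

section \<open>The canonical symplectic form in bundle coordinates\<close>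

lemma tangent_fst_cochart:
  assumes A: "fd_atlas A" and c: "c \<in> A" and \<xi>: "\<xi> \<in> fst (cochart A c)"
    and v: "v \<in> tangent_space (cotangent_atlas A) \<xi>"
  shows "tangent_map (cotangent_atlas A) A fst \<xi> v c = fst (v (cochart A c))"
proof -
  let ?e = "cochart A c"
  have pc: "fst \<xi> \<in> fst c" using \<xi> by (auto simp: fst_cochart)
  have "frechet_derivative (\<lambda>y. snd c (fst (cinv ?e y))) (at (snd ?e \<xi>)) = frechet_derivative fst (at (snd ?e \<xi>))"
  proof (rule frechet_derivative_cong_open[OF chart_open[OF fd_atlas_cotangent[OF A] cochart_in[OF c]]])
    fix y assume "y \<in> snd ?e ` fst ?e"
    then have "fst y \<in> snd c ` fst c" by (auto simp: cochart_full_image[OF A c])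
    from cinv_cochart[OF A c this, of "snd y"] this show "snd c (fst (cinv ?e y)) = fst y"
      by (simp add: chart_cinv)
  qed (use \<xi> in simp)
  also have "\<dots> = fst" by (rule frechet_derivative_eqI[OF bounded_linear_imp_has_derivative[OF bounded_linear_fst]])
  finally show ?thesis
    using tangent_map_apply[OF fd_atlas_cotangent[OF A] smooth_map_cotangent_fst[OF A] cochart_in[OF c] \<xi> c pc v]
    by simp
qed

text \<open>In bundle coordinates (q, p) the Liouville form on a constant field \<open>u\<close> is
  \<open>p\<close> applied to the base part of \<open>u\<close>. This is a bounded linear function
  of the coordinates, so the exterior derivative is read off. The chart is the one selected by
  \<open>chart_at\<close>; a tangent vector is determined by its component in that one.\<close>

lemma symplectic_form_coords:
  assumes A: "fd_atlas A" and \<xi>: "\<xi> \<in> atlas_space (cotangent_atlas A)"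
  obtains c where "c \<in> A" "\<xi> \<in> fst (cochart A c)"
    "\<And>v w. v \<in> tangent_space (cotangent_atlas A) \<xi> \<Longrightarrow> w \<in> tangent_space (cotangent_atlas A) \<xi> \<Longrightarrow>
      cotangent_symplectic_form A \<xi> v w =
      blinfun_apply (snd (v (cochart A c))) (fst (w (cochart A c))) -
      blinfun_apply (snd (w (cochart A c))) (fst (v (cochart A c)))"
proof -
  let ?T = "cotangent_atlas A"
  note T = fd_atlas_cotangent[OF A]
  obtain c where c: "c \<in> A" "chart_at ?T \<xi> = cochart A c"
    using chart_at(1)[OF \<xi>] by (auto simp: cotangent_atlas_alt)
  let ?e = "cochart A c"
  have e: "?e \<in> ?T" by (rule cochart_in[OF c(1)])
  have \<xi>e: "\<xi> \<in> fst ?e" using chart_at(2)[OF \<xi>] c(2) by simp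
  have D: "frechet_derivative (\<lambda>y. liouville_form A (cinv ?e y) (coord_vector ?T ?e (cinv ?e y) u)) (at (snd ?e \<xi>)) v
      = blinfun_apply (snd v) (fst u)" for u v
  proof -
    have "frechet_derivative (\<lambda>y. liouville_form A (cinv ?e y) (coord_vector ?T ?e (cinv ?e y) u)) (at (snd ?e \<xi>)) =
      frechet_derivative (\<lambda>y. blinfun_apply (snd y) (fst u)) (at (snd ?e \<xi>))"
    proof (rule frechet_derivative_cong_open[OF chart_open[OF T e]])
      fix y assume y: "y \<in> snd ?e ` fst ?e"
      then have q: "fst y \<in> snd c ` fst c" by (auto simp: cochart_full_image[OF A c(1)])
      have in': "cinv ?e y \<in> fst ?e" by (rule cinv_in[OF T e y])
      note cv = coord_vector_in[OF T e in', of u]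
      have "tangent_map ?T A fst (cinv ?e y) (coord_vector ?T ?e (cinv ?e y) u) \<in> tangent_space A (fst (cinv ?e y))"
        by (rule tangent_map_in[OF T A smooth_map_cotangent_fst[OF A] atlas_spaceI[OF e in'] cv])
      then show "liouville_form A (cinv ?e y) (coord_vector ?T ?e (cinv ?e y) u) = blinfun_apply (snd y) (fst u)"
        unfolding liouville_form_def
        using cinv_cochart[OF A c(1) q, of "snd y"] tangent_fst_cochart[OF A c(1) in' cv]
          coord_vector_self[OF T e in', of u]
        by (simp add: covector_def)
    qed (use \<xi>e in simp)
    moreover have "((\<lambda>y. blinfun_apply (snd y) (fst u)) has_derivative (\<lambda>v. blinfun_apply (snd v) (fst u))) (at (snd ?e \<xi>))"
      by (intro bounded_linear_imp_has_derivative bounded_linear_compose[OF blinfun.bounded_linear_left bounded_linear_snd])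
    ultimately show ?thesis by (simp add: frechet_derivative_eqI)
  qed
  have "cotangent_symplectic_form A \<xi> v w = blinfun_apply (snd (v ?e)) (fst (w ?e)) - blinfun_apply (snd (w ?e)) (fst (v ?e))" for v w
    unfolding cotangent_symplectic_form_def exterior_derivative_def c(2) Let_def split_beta prod.collapse
    by (simp add: D)
  then show thesis using that c(1) \<xi>e by blast
qed

lemma blinfun_separates:
  fixes a b :: "'m::real_normed_vector"
  assumes fd: "finite_dimensional TYPE('m)" and eq: "\<And>\<beta> :: 'm \<Rightarrow>\<^sub>L real. blinfun_apply \<beta> a = blinfun_apply \<beta> b"
  shows "a = b"
proof -
  obtain B :: "'m set" and co where B: "\<And>b. bounded_linear (co b)" "\<And>x. (\<Sum>b\<in>B. co b x *\<^sub>R b) = x"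
    using finite_dimensional_frame[OF fd] by metis
  have "co x a = co x b" for x
    using eq[of "Blinfun (co x)"] by (simp add: bounded_linear_Blinfun_apply[OF B(1)])
  then show ?thesis by (metis (no_types, lifting) B(2) sum.cong)
qed

text \<open>Nondegeneracy: coordinate vectors of the form (w, 0) recover the fibre component of a
  vector from the symplectic form, and those of the form (0, w) recover its base component. So the
  description in \<open>hamiltonian_vf\<close> has at most one solution.\<close>

lemma hamiltonian_vf_eqI:
  assumes A: "fd_atlas A" and \<xi>: "\<xi> \<in> atlas_space (cotangent_atlas A)"
    and v: "v \<in> tangent_space (cotangent_atlas A) \<xi>"
    and eq: "\<And>w. w \<in> tangent_space (cotangent_atlas A) \<xi> \<Longrightarrow>
      cotangent_symplectic_form A \<xi> v w = - differential (cotangent_atlas A) f \<xi> w"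
  shows "hamiltonian_vf (cotangent_atlas A) (cotangent_symplectic_form A) f \<xi> = v"
  unfolding hamiltonian_vf_def
proof (rule the_equality)
  let ?T = "cotangent_atlas A"
  note T = fd_atlas_cotangent[OF A]
  obtain c where c: "c \<in> A" "\<xi> \<in> fst (cochart A c)"
    and \<omega>: "\<And>v w. v \<in> tangent_space ?T \<xi> \<Longrightarrow> w \<in> tangent_space ?T \<xi> \<Longrightarrow>
      cotangent_symplectic_form A \<xi> v w =
      blinfun_apply (snd (v (cochart A c))) (fst (w (cochart A c))) -
      blinfun_apply (snd (w (cochart A c))) (fst (v (cochart A c)))"
    using symplectic_form_coords[OF A \<xi>] by metis
  let ?e = "cochart A c"
  have e: "?e \<in> ?T" by (rule cochart_in[OF c(1)])
  show "v \<in> tangent_space ?T \<xi> \<and> (\<forall>w\<in>tangent_space ?T \<xi>. cotangent_symplectic_form A \<xi> v w = - differential ?T f \<xi> w)"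
    using v eq by blast
  fix v' assume v': "v' \<in> tangent_space ?T \<xi> \<and> (\<forall>w\<in>tangent_space ?T \<xi>. cotangent_symplectic_form A \<xi> v' w = - differential ?T f \<xi> w)"
  have eq': "blinfun_apply (snd (v' ?e)) (fst u) - blinfun_apply (snd u) (fst (v' ?e)) =
      blinfun_apply (snd (v ?e)) (fst u) - blinfun_apply (snd u) (fst (v ?e))" for u
    using \<omega>[OF v, of "coord_vector ?T ?e \<xi> u"] \<omega>[of v' "coord_vector ?T ?e \<xi> u"] v' eq[of "coord_vector ?T ?e \<xi> u"]
      coord_vector_in[OF T e c(2), of u] T e c(2) by simp
  have "snd (v' ?e) = snd (v ?e)"
    by (rule blinfun_eqI) (use eq'[of "(_, 0)"] in simp)
  moreover have "fst (v' ?e) = fst (v ?e)"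
    by (rule blinfun_separates[OF fd_atlas_dim[OF A]]) (use eq'[of "(0, _)"] in simp)
  ultimately show "v' = v"
    using tangent_space_eqI[OF _ v e c(2), of v'] v' by (simp add: prod_eq_iff)
qed

section \<open>Lie groups\<close>

lemma smooth_map_const:
  assumes A: "fd_atlas A" and B: "fd_atlas B" and b: "b \<in> atlas_space B"
  shows "smooth_map A B (\<lambda>_. b)"
proof (rule smooth_mapI[OF A B])
  fix p assume "p \<in> atlas_space A"
  then obtain c where c: "c \<in> A" "p \<in> fst c" by (rule atlas_spaceE)
  obtain d where d: "d \<in> B" "b \<in> fst d" using b by (rule atlas_spaceE)
  show "\<exists>c\<in>A. \<exists>d\<in>B. \<exists>Q. p \<in> fst c \<and> open Q \<and> snd c p \<in> Q \<and> Q \<subseteq> snd c ` fst c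
      \<and> (\<forall>y\<in>Q. b \<in> fst d) \<and> smooth_on Q (\<lambda>y. snd d b)"
    using c d chart_open[OF A c(1)]
    by (intro bexI[OF _ c(1)] bexI[OF _ d(1)] exI[of _ "snd c ` fst c"]) auto
qed

lemma smooth_map_partial_left:
  assumes A: "fd_atlas A" and B: "fd_atlas B" and C: "fd_atlas C" and F: "smooth_map (prod_atlas A B) C F" and b: "b \<in> atlas_space B"
  shows "smooth_map A C (\<lambda>x. F (x, b))"
  by (rule smooth_map_compose[OF A fd_atlas_prod[OF A B] C smooth_map_Pair[OF A A B smooth_map_id[OF A] smooth_map_const[OF A B b]] F])

lemma smooth_map_partial_right:
  assumes A: "fd_atlas A" and B: "fd_atlas B" and C: "fd_atlas C" and F: "smooth_map (prod_atlas A B) C F" and a: "a \<in> atlas_space A"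
  shows "smooth_map B C (\<lambda>y. F (a, y))"
  by (rule smooth_map_compose[OF B fd_atlas_prod[OF A B] C smooth_map_Pair[OF B A B smooth_map_const[OF B A a] smooth_map_id[OF B]] F])

definition prod_chart :: "('a, 'm) chart \<Rightarrow> ('b, 'n) chart \<Rightarrow> ('a \<times> 'b, 'm \<times> 'n) chart"
  where "prod_chart c d = (fst c \<times> fst d, map_prod (snd c) (snd d))"

lemma prod_chart_simps [simp]: "fst (prod_chart c d) = fst c \<times> fst d" "snd (prod_chart c d) (x, y) = (snd c x, snd d y)"
  by (simp_all add: prod_chart_def)

lemma prod_chart_in: "c \<in> A \<Longrightarrow> d \<in> B \<Longrightarrow> prod_chart c d \<in> prod_atlas A B"
  by (simp add: prod_chart_def prod_atlasI)

lemma cinv_prod_chart: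
  "fd_atlas A \<Longrightarrow> fd_atlas B \<Longrightarrow> c \<in> A \<Longrightarrow> d \<in> B \<Longrightarrow> y \<in> snd c ` fst c \<Longrightarrow> z \<in> snd d ` fst d \<Longrightarrow>
    inv_into (fst c \<times> fst d) (snd (prod_chart c d)) (y, z) = (cinv c y, cinv d z)"
  using cinv_prod[of A B c d y z] by (simp add: prod_chart_def)

text \<open>Written as a full derivative of the local representation in the direction
  \<open>(v c, 0)\<close>, the partial tangent map depends smoothly on \<open>b\<close> by
  \<open>smooth_on_derivative_compose\<close>.\<close>

lemma partial_tangent_left:
  assumes A: "fd_atlas A" and B: "fd_atlas B" and C: "fd_atlas C" and F: "smooth_map (prod_atlas A B) C F"
    and c: "c \<in> A" "a \<in> fst c" and d: "d \<in> B" "b \<in> fst d" and e: "e \<in> C" "F (a, b) \<in> fst e"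
    and v: "v \<in> tangent_space A a"
  shows "tangent_map A C (\<lambda>x. F (x, b)) a v e =
    frechet_derivative (\<lambda>z. snd e (F (cinv (prod_chart c d) z))) (at (snd c a, snd d b)) (v c, 0)"
proof -
  let ?M = "\<lambda>z. snd e (F (cinv (prod_chart c d) z))"
  have "(?M has_derivative frechet_derivative ?M (at (snd c a, snd d b))) (at (snd c a, snd d b))"
    using lrep_has_derivative[OF fd_atlas_prod[OF A B] F prod_chart_in[OF c(1) d(1)] e(1), of "(a, b)"] c d e by simp
  moreover have "((\<lambda>y. (y, snd d b)) has_derivative (\<lambda>h. (h, 0))) (at (snd c a))"
    by (auto intro!: derivative_eq_intros)
  ultimately have h1: "((\<lambda>y. ?M (y, snd d b)) has_derivative (\<lambda>h. frechet_derivative ?M (at (snd c a, snd d b)) (h, 0))) (at (snd c a))"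
    by (rule has_derivative_compose[rotated])
  have h2: "frechet_derivative (\<lambda>y. ?M (y, snd d b)) (at (snd c a)) =
      frechet_derivative (\<lambda>y. snd e (F (cinv c y, b))) (at (snd c a))"
    by (rule frechet_derivative_cong_open[OF chart_open[OF A c(1)]])
      (use c d A B in \<open>auto simp: cinv_prod_chart\<close>)
  show ?thesis
    using tangent_map_apply[OF A smooth_map_partial_left[OF A B C F atlas_spaceI[OF d]] c e v]
      fun_cong[OF trans[OF sym[OF h2] frechet_derivative_eqI[OF h1]], of "v c"] by simp
qed

lemma partial_tangent_right:
  assumes A: "fd_atlas A" and B: "fd_atlas B" and C: "fd_atlas C" and F: "smooth_map (prod_atlas A B) C F"
    and c: "c \<in> A" "a \<in> fst c" and d: "d \<in> B" "b \<in> fst d" and e: "e \<in> C" "F (a, b) \<in> fst e"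
    and v: "v \<in> tangent_space B b"
  shows "tangent_map B C (\<lambda>y. F (a, y)) b v e =
    frechet_derivative (\<lambda>z. snd e (F (cinv (prod_chart c d) z))) (at (snd c a, snd d b)) (0, v d)"
proof -
  let ?M = "\<lambda>z. snd e (F (cinv (prod_chart c d) z))"
  have "(?M has_derivative frechet_derivative ?M (at (snd c a, snd d b))) (at (snd c a, snd d b))"
    using lrep_has_derivative[OF fd_atlas_prod[OF A B] F prod_chart_in[OF c(1) d(1)] e(1), of "(a, b)"] c d e by simp
  moreover have "((\<lambda>y. (snd c a, y)) has_derivative (\<lambda>h. (0, h))) (at (snd d b))"
    by (auto intro!: derivative_eq_intros)
  ultimately have h1: "((\<lambda>y. ?M (snd c a, y)) has_derivative (\<lambda>h. frechet_derivative ?M (at (snd c a, snd d b)) (0, h))) (at (snd d b))"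
    by (rule has_derivative_compose[rotated])
  have h2: "frechet_derivative (\<lambda>y. ?M (snd c a, y)) (at (snd d b)) =
      frechet_derivative (\<lambda>y. snd e (F (a, cinv d y))) (at (snd d b))"
    by (rule frechet_derivative_cong_open[OF chart_open[OF B d(1)]])
      (use c d A B in \<open>auto simp: cinv_prod_chart\<close>)
  show ?thesis
    using tangent_map_apply[OF B smooth_map_partial_right[OF A B C F atlas_spaceI[OF c]] d e v]
      fun_cong[OF trans[OF sym[OF h2] frechet_derivative_eqI[OF h1]], of "v d"] by simp
qed

text \<open>Interpreted both for \<open>G\<close> and for the semi-direct product. The class
  \<open>banach\<close> supplies the completeness used in the Picard iteration.\<close>

locale lie_grp = group G for G :: "'g monoid" (structure) +
  fixes A :: "('g, 'm::banach) atlas"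
  assumes atl: "fd_atlas A" and space: "atlas_space A = carrier G"
    and mult_smooth: "smooth_map (prod_atlas A A) A (\<lambda>(x, y). x \<otimes> y)"
begin

lemma right_smooth: "s \<in> carrier G \<Longrightarrow> smooth_map A A (\<lambda>x. x \<otimes> s)"
  using smooth_map_partial_left[OF atl atl atl mult_smooth] by (simp add: space)

lemma left_smooth: "s \<in> carrier G \<Longrightarrow> smooth_map A A (\<lambda>x. s \<otimes> x)"
  using smooth_map_partial_right[OF atl atl atl mult_smooth] by (simp add: space)

text \<open>The right-invariant vector field with value \<open>Y\<close> at the unit, an
  infinitesimal left translation.\<close>

definition rinv :: "('g, 'm) tangent \<Rightarrow> 'g \<Rightarrow> ('g, 'm) tangent"
  where "rinv Y s = tangent_map A A (\<lambda>x. x \<otimes> s) \<one> Y"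

lemma lie_algebra_eq: "lie_algebra G A = tangent_space A \<one>"
  by (simp add: lie_algebra_def)

lemma rinv_in: "Y \<in> lie_algebra G A \<Longrightarrow> s \<in> carrier G \<Longrightarrow> rinv Y s \<in> tangent_space A s"
  using tangent_map_in[OF atl atl right_smooth, of s \<one> Y] by (simp add: rinv_def space lie_algebra_eq)

lemma rinv_one: 
  assumes "Y \<in> lie_algebra G A" shows "rinv Y \<one> = Y"
proof -
  have "rinv Y \<one> = tangent_map A A (\<lambda>x. x) \<one> Y" unfolding rinv_def
    by (rule tangent_map_cong[OF atl atl right_smooth]) (use assms in \<open>auto simp: space lie_algebra_eq\<close>)
  then show ?thesis using tangent_map_id[OF atl, of \<one> Y] assms by (simp add: space lie_algebra_eq)
qed

lemma rinv_translate:
  assumes Y: "Y \<in> lie_algebra G A" and x: "x \<in> carrier G" and s: "s \<in> carrier G"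
  shows "rinv Y (x \<otimes> s) = tangent_map A A (\<lambda>z. z \<otimes> s) x (rinv Y x)"
proof -
  have Y': "Y \<in> tangent_space A \<one>" using Y by (simp add: lie_algebra_eq)
  have one: "\<one> \<in> atlas_space A" by (simp add: space)
  have "rinv Y (x \<otimes> s) = tangent_map A A (\<lambda>z. (z \<otimes> x) \<otimes> s) \<one> Y" unfolding rinv_def
    by (rule tangent_map_cong[OF atl atl right_smooth one Y']) (use x s in \<open>auto simp: space m_assoc\<close>)
  also have "\<dots> = tangent_map A A (\<lambda>z. z \<otimes> s) (\<one> \<otimes> x) (rinv Y x)" unfolding rinv_def
    by (rule tangent_map_compose[OF atl atl atl right_smooth[OF x] right_smooth[OF s] one Y'])
  finally show ?thesis using x by simp
qed

lemma rinv_add: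
  "Y \<in> lie_algebra G A \<Longrightarrow> Z \<in> lie_algebra G A \<Longrightarrow> s \<in> carrier G \<Longrightarrow> rinv (Y + Z) s = rinv Y s + rinv Z s"
  unfolding rinv_def lie_algebra_eq by (rule tangent_map_add[OF atl right_smooth]) (auto simp: space)

lemma rinv_fscale:
  "Y \<in> lie_algebra G A \<Longrightarrow> s \<in> carrier G \<Longrightarrow> rinv (fscale a Y) s = fscale a (rinv Y s)"
  unfolding rinv_def lie_algebra_eq by (rule tangent_map_fscale[OF atl right_smooth]) (auto simp: space)

text \<open>The value at \<open>s\<close> is the partial derivative of the multiplication at the
  pair of the unit and \<open>s\<close>, in a fixed direction of the first factor.\<close>

lemma rinv_smooth:
  assumes Y: "Y \<in> lie_algebra G A"
  shows "smooth_vf A (rinv Y)"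
  unfolding smooth_vf_def
proof (intro conjI ballI)
  show "rinv Y p \<in> tangent_space A p" if "p \<in> atlas_space A" for p
    using rinv_in[OF Y] that by (simp add: space)
  fix c assume c: "c \<in> A"
  obtain c1 where c1: "c1 \<in> A" "\<one> \<in> fst c1" using atlas_spaceE[of \<one> A] by (auto simp: space)
  let ?F = "\<lambda>(x, y). x \<otimes> y"
  let ?M = "\<lambda>z. snd c (?F (cinv (prod_chart c1 c) z))"
  let ?R = "snd (prod_chart c1 c) ` {p \<in> fst (prod_chart c1 c). ?F p \<in> fst c}"
  note M = smooth_map_lrep[OF fd_atlas_prod[OF atl atl] mult_smooth prod_chart_in[OF c1(1) c] c]
  have carr: "x \<in> carrier G" if "x \<in> fst c" for x using atlas_spaceI[OF c that] by (simp add: space)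
  have inR: "(snd c1 \<one>, y) \<in> ?R" if "y \<in> snd c ` fst c" for y
    using that c1(2) carr by (auto intro!: image_eqI[of _ _ "(\<one>, _)"])
  have "smooth_on (snd c ` fst c) (\<lambda>y. frechet_derivative ?M (at (snd c1 \<one>, y)) (Y c1, 0))"
    by (rule smooth_on_derivative_compose[OF finite_dimensional_prod[OF fd_atlas_dim[OF atl] fd_atlas_dim[OF atl]]
        chart_open[OF atl c] M(1) smooth_on_Pair[OF chart_open[OF atl c] smooth_on_const smooth_on_id] smooth_on_const M(2) inR])
  then show "smooth_on (snd c ` fst c) (\<lambda>y. rinv Y (cinv c y) c)"
  proof (rule smooth_on_cong[OF chart_open[OF atl c]])
    fix y assume y: "y \<in> snd c ` fst c"
    have p: "cinv c y \<in> fst c" by (rule cinv_in[OF atl c y])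
    have "\<one> \<otimes> cinv c y \<in> fst c" using p carr by simp
    with partial_tangent_left[OF atl atl atl mult_smooth c1 c p c, of Y] Y
    show "frechet_derivative ?M (at (snd c1 \<one>, y)) (Y c1, 0) = rinv Y (cinv c y) c"
      by (simp add: rinv_def lie_algebra_eq chart_cinv[OF y])
  qed
qed

text \<open>
  Picard iteration in a chart around the unit gives an integral curve of the right-invariant
  field; uniqueness makes it a local homomorphism, which extends to \<open>\<real>\<close> by taking powers.
\<close>

lemma local_flow_at_one:
  assumes Y: "Y \<in> lie_algebra G A" and c1: "c1 \<in> A" "\<one> \<in> fst c1"
  obtains \<epsilon> K x where "\<epsilon> > 0" "open K" "snd c1 \<one> \<in> K" "K \<subseteq> snd c1 ` fst c1" "x 0 = snd c1 \<one>"
    "\<And>t. \<bar>t\<bar> < \<epsilon> \<Longrightarrow> x t \<in> K \<and> (x has_vector_derivative rinv Y (cinv c1 (x t)) c1) (at t)"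
    "\<And>y z \<delta> t. \<lbrakk>\<delta> \<le> \<epsilon>; y 0 = z 0; \<bar>t\<bar> < \<delta>;
      \<And>s. \<bar>s\<bar> < \<delta> \<Longrightarrow> y s \<in> K \<and> (y has_vector_derivative rinv Y (cinv c1 (y s)) c1) (at s);
      \<And>s. \<bar>s\<bar> < \<delta> \<Longrightarrow> z s \<in> K \<and> (z has_vector_derivative rinv Y (cinv c1 (z s)) c1) (at s)\<rbrakk> \<Longrightarrow> y t = z t"
proof -
  have "smooth_on (snd c1 ` fst c1) (\<lambda>y. rinv Y (cinv c1 y) c1)"
    using rinv_smooth[OF Y] c1 by (simp add: smooth_vf_def)
  from smooth_on_local_flow[OF fd_atlas_dim[OF atl] this chart_open[OF atl c1(1)] imageI[OF c1(2)]]
  show thesis using that by blast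
qed

lemma right_translate_curve_derivative:
  assumes Y: "Y \<in> lie_algebra G A" and c: "c \<in> A" "\<gamma> s \<in> fst c" and g: "g \<in> carrier G"
    and d: "d \<in> A" "\<gamma> s \<otimes> g \<in> fst d"
    and near: "eventually (\<lambda>s. \<gamma> s \<in> fst c) (at s)"
    and deriv: "((\<lambda>s. snd c (\<gamma> s)) has_vector_derivative rinv Y (\<gamma> s) c) (at s)"
  shows "((\<lambda>s. snd d (\<gamma> s \<otimes> g)) has_vector_derivative rinv Y (\<gamma> s \<otimes> g) d) (at s)"
proof -
  have \<gamma>: "\<gamma> s \<in> carrier G" using atlas_spaceI[OF c] by (simp add: space)
  show ?thesis
    using chart_has_vector_derivative_transfer[where \<gamma>=\<gamma> and t=s, OF atl atl right_smooth[OF g] c d rinv_in[OF Y \<gamma>] near UNIV_I deriv]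
    by (simp add: rinv_translate[OF Y \<gamma> g])
qed

text \<open>For fixed \<open>t\<close> the curves \<open>\<gamma> (s + t)\<close> and
  \<open>\<gamma> s \<otimes> \<gamma> t\<close> in the variable \<open>s\<close> start at the same
  point and solve the same equation, because right translation preserves the right-invariant
  field.\<close>

lemma local_one_parameter_subgroup:
  assumes Y: "Y \<in> lie_algebra G A" and c1: "c1 \<in> A" "\<one> \<in> fst c1"
  obtains \<delta> \<gamma> where "\<delta> > 0" "\<gamma> 0 = \<one>" "\<And>t. \<bar>t\<bar> < \<delta> \<Longrightarrow> \<gamma> t \<in> fst c1"
    "\<And>s t. \<bar>s\<bar> < \<delta> \<Longrightarrow> \<bar>t\<bar> < \<delta> \<Longrightarrow> \<gamma> (s + t) = \<gamma> s \<otimes> \<gamma> t"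
    "smooth_on {-\<delta><..<\<delta>} (\<lambda>t. snd c1 (\<gamma> t))" "((\<lambda>t. snd c1 (\<gamma> t)) has_vector_derivative Y c1) (at 0)"
proof -
  obtain \<epsilon> K x where \<epsilon>: "\<epsilon> > 0" and K: "open K" "snd c1 \<one> \<in> K" "K \<subseteq> snd c1 ` fst c1" and x0: "x 0 = snd c1 \<one>"
    and x: "\<And>t. \<bar>t\<bar> < \<epsilon> \<Longrightarrow> x t \<in> K \<and> (x has_vector_derivative rinv Y (cinv c1 (x t)) c1) (at t)"
    and uniq: "\<And>y z \<delta> t. \<lbrakk>\<delta> \<le> \<epsilon>; y 0 = z 0; \<bar>t\<bar> < \<delta>;
      \<And>s. \<bar>s\<bar> < \<delta> \<Longrightarrow> y s \<in> K \<and> (y has_vector_derivative rinv Y (cinv c1 (y s)) c1) (at s);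
      \<And>s. \<bar>s\<bar> < \<delta> \<Longrightarrow> z s \<in> K \<and> (z has_vector_derivative rinv Y (cinv c1 (z s)) c1) (at s)\<rbrakk> \<Longrightarrow> y t = z t"
    using local_flow_at_one[OF Y c1] by metis
  define \<gamma> where "\<gamma> t = cinv c1 (x t)" for t
  have \<gamma>U: "\<gamma> t \<in> fst c1" and x\<gamma>: "snd c1 (\<gamma> t) = x t" if "\<bar>t\<bar> < \<epsilon>" for t
    using x[OF that] K(3) cinv_in[OF atl c1(1)] chart_cinv[of "x t" c1] by (auto simp: \<gamma>_def)
  have \<gamma>G: "\<gamma> t \<in> carrier G" if "\<bar>t\<bar> < \<epsilon>" for t
    using atlas_spaceI[OF c1(1) \<gamma>U[OF that]] by (simp add: space)
  have near: "eventually (\<lambda>s. \<gamma> s \<in> fst c1) (at t)" "eventually (\<lambda>s. snd c1 (\<gamma> s) = x s) (at t)" if "\<bar>t\<bar> < \<epsilon>" for t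
    using that by (auto intro!: eventually_at_in_open'[of "{-\<epsilon><..<\<epsilon>}" t, THEN eventually_mono] \<gamma>U x\<gamma>)
  have \<gamma>d: "((\<lambda>s. snd c1 (\<gamma> s)) has_vector_derivative rinv Y (\<gamma> t) c1) (at t)" if "\<bar>t\<bar> < \<epsilon>" for t
  proof (rule has_vector_derivative_transform_within_open[where S="{-\<epsilon><..<\<epsilon>}" and f=x])
    show "(x has_vector_derivative rinv Y (\<gamma> t) c1) (at t)" using x[OF that] by (simp add: \<gamma>_def)
  qed (use that x\<gamma> in auto)
  let ?F = "\<lambda>(x, y). x \<otimes> y"
  let ?N = "\<lambda>z. snd c1 (?F (cinv (prod_chart c1 c1) z))"
  let ?R = "snd (prod_chart c1 c1) ` {p \<in> fst (prod_chart c1 c1). ?F p \<in> fst c1}"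
  note N = smooth_map_lrep[OF fd_atlas_prod[OF atl atl] mult_smooth prod_chart_in[OF c1(1) c1(1)] c1(1)]
  \<comment> \<open>Coordinate pairs whose product lies in the chart with coordinate in
    \<open>K\<close>, where uniqueness is available. \<open>R\<close> is an open neighbourhood of
    the pair of units, and this yields the bound on the times.\<close>
  define R where "R = ?R \<inter> ?N -` K"
  have oR: "open R" unfolding R_def
    by (rule continuous_open_preimage[OF smooth_on_continuous_on[OF N(2)] N(1) K(1)])
  have R: "a \<otimes> b \<in> fst c1 \<and> snd c1 (a \<otimes> b) \<in> K" if ab: "a \<in> fst c1" "b \<in> fst c1" "(snd c1 a, snd c1 b) \<in> R" for a b
  proof -
    have cab: "cinv (prod_chart c1 c1) (snd c1 a, snd c1 b) = (a, b)"
      using ab atl c1 by (simp add: cinv_prod_chart)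
    have "(snd c1 a, snd c1 b) \<in> ?R" "?N (snd c1 a, snd c1 b) \<in> K" using ab(3) by (auto simp: R_def)
    from chart_image_mem[OF fd_atlas_prod[OF atl atl] prod_chart_in[OF c1(1) c1(1)] this(1)] this(2)
    show ?thesis unfolding cab by simp
  qed
  have "(snd c1 \<one>, snd c1 \<one>) \<in> R" unfolding R_def
    using K(2) c1 atl by (auto simp: cinv_prod_chart intro!: image_eqI[of _ _ "(\<one>, \<one>)"])
  then obtain U1 U2 where U: "open U1" "open U2" "snd c1 \<one> \<in> U1" "snd c1 \<one> \<in> U2" "U1 \<times> U2 \<subseteq> R"
    using open_prod_elim[OF oR] by (metis mem_Sigma_iff)
  have cx: "continuous_on {-\<epsilon><..<\<epsilon>} x"
    by (intro continuous_at_imp_continuous_on ballI has_vector_derivative_continuous[OF conjunct2[OF x]]) auto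
  have "open ({-\<epsilon><..<\<epsilon>} \<inter> x -` (U1 \<inter> U2))"
    by (rule continuous_open_preimage[OF cx]) (use U in auto)
  moreover have "0 \<in> {-\<epsilon><..<\<epsilon>} \<inter> x -` (U1 \<inter> U2)" using \<epsilon> x0 U by auto
  ultimately obtain \<delta>' where \<delta>': "\<delta>' > 0" "ball 0 \<delta>' \<subseteq> {-\<epsilon><..<\<epsilon>} \<inter> x -` (U1 \<inter> U2)"
    using open_contains_ball by blast
  \<comment> \<open>Half of \<open>\<epsilon>\<close> keeps \<open>s + t\<close> in the domain of
    the solution, and \<open>\<delta>'\<close> keeps the pairs \<open>(x s, x t)\<close> in
    \<open>R\<close>.\<close>
  define \<delta> where "\<delta> = min \<delta>' (\<epsilon> / 2)"
  have \<delta>: "\<delta> > 0" "\<delta> \<le> \<epsilon>" using \<delta>' \<epsilon> by (auto simp: \<delta>_def)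
  have \<delta>sum: "\<bar>s + t\<bar> < \<epsilon>" if "\<bar>s\<bar> < \<delta>" "\<bar>t\<bar> < \<delta>" for s t using that by (auto simp: \<delta>_def)
  have small: "(x s, x t) \<in> R" if "\<bar>s\<bar> < \<delta>" "\<bar>t\<bar> < \<delta>" for s t
  proof -
    have "s \<in> ball 0 \<delta>'" "t \<in> ball 0 \<delta>'" using that by (auto simp: \<delta>_def)
    then have "x s \<in> U1" "x t \<in> U2" using \<delta>'(2) by auto
    then show ?thesis using U(5) by auto
  qed
  have lt\<epsilon>: "\<bar>t\<bar> < \<epsilon>" if "\<bar>t\<bar> < \<delta>" for t using that \<delta>(2) by linarith
  have hom: "\<gamma> (s + t) = \<gamma> s \<otimes> \<gamma> t" if s: "\<bar>s\<bar> < \<delta>" and t: "\<bar>t\<bar> < \<delta>" for s t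
  proof -
    have prod: "\<gamma> s \<otimes> \<gamma> t \<in> fst c1 \<and> snd c1 (\<gamma> s \<otimes> \<gamma> t) \<in> K" if s: "\<bar>s\<bar> < \<delta>" for s
      by (rule R[OF \<gamma>U[OF lt\<epsilon>[OF s]] \<gamma>U[OF lt\<epsilon>[OF t]]])
        (use small[OF s t] x\<gamma>[OF lt\<epsilon>[OF s]] x\<gamma>[OF lt\<epsilon>[OF t]] in simp)
    have \<gamma>0: "\<gamma> 0 = \<one>" using x0 c1 atl by (simp add: \<gamma>_def)
    have "(\<lambda>s. x (s + t)) s = (\<lambda>s. snd c1 (\<gamma> s \<otimes> \<gamma> t)) s"
    proof (rule uniq[OF \<delta>(2) _ s])
      show "x (0 + t) = snd c1 (\<gamma> 0 \<otimes> \<gamma> t)" using \<gamma>G[OF lt\<epsilon>[OF t]] x\<gamma>[OF lt\<epsilon>[OF t]] by (simp add: \<gamma>0)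
      fix s assume s: "\<bar>s\<bar> < \<delta>"
      have "((\<lambda>s. x (s + t)) has_vector_derivative rinv Y (cinv c1 (x (s + t))) c1) (at s)"
      proof -
        have "((\<lambda>s. s + t) has_vector_derivative 1) (at s)" by (auto intro!: derivative_eq_intros)
        from vector_diff_chain_at[OF this conjunct2[OF x[OF \<delta>sum[OF s t]]]] show ?thesis by (simp add: comp_def)
      qed
      then show "x (s + t) \<in> K \<and> ((\<lambda>s. x (s + t)) has_vector_derivative rinv Y (cinv c1 (x (s + t))) c1) (at s)"
        using x[OF \<delta>sum[OF s t]] by simp
      have p: "\<gamma> s \<otimes> \<gamma> t \<in> fst c1" using prod[OF s] by simp
      have "((\<lambda>s. snd c1 (\<gamma> s \<otimes> \<gamma> t)) has_vector_derivative rinv Y (\<gamma> s \<otimes> \<gamma> t) c1) (at s)"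
        by (rule right_translate_curve_derivative[where \<gamma>=\<gamma> and s=s, OF Y c1(1) \<gamma>U[OF lt\<epsilon>[OF s]] \<gamma>G[OF lt\<epsilon>[OF t]] c1(1) p
            near(1)[OF lt\<epsilon>[OF s]] \<gamma>d[OF lt\<epsilon>[OF s]]])
      then show "snd c1 (\<gamma> s \<otimes> \<gamma> t) \<in> K \<and>
          ((\<lambda>s. snd c1 (\<gamma> s \<otimes> \<gamma> t)) has_vector_derivative rinv Y (cinv c1 (snd c1 (\<gamma> s \<otimes> \<gamma> t))) c1) (at s)"
        using prod[OF s] atl c1 by simp
    qed
    then have "\<gamma> (s + t) = cinv c1 (snd c1 (\<gamma> s \<otimes> \<gamma> t))" by (simp add: \<gamma>_def)
    then show ?thesis using prod[OF s] atl c1 by simp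
  qed
  have "smooth_on {-\<epsilon><..<\<epsilon>} x"
    by (rule smooth_on_ode_solution[OF fd_atlas_dim[OF atl] _ chart_open[OF atl c1(1)], where f="\<lambda>y. rinv Y (cinv c1 y) c1"])
      (use rinv_smooth[OF Y] c1 x K(3) in \<open>auto simp: smooth_vf_def\<close>)
  then have "smooth_on {-\<delta><..<\<delta>} x" by (rule smooth_on_subset) (use \<delta> in auto)
  then have sm: "smooth_on {-\<delta><..<\<delta>} (\<lambda>t. snd c1 (\<gamma> t))"
    by (rule smooth_on_cong[OF open_greaterThanLessThan]) (use x\<gamma> lt\<epsilon> in auto)
  have \<gamma>0: "\<gamma> 0 = \<one>" using x0 c1 atl by (simp add: \<gamma>_def)
  show thesis
    by (rule that[of \<delta> \<gamma>]) (use \<delta>(1) \<gamma>0 \<gamma>U[OF lt\<epsilon>] hom sm \<gamma>d[of 0] \<epsilon> rinv_one[OF Y] in auto)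
qed

text \<open>The value at \<open>t\<close> is the \<open>n\<close>-th power of
  \<open>\<gamma> (t / n)\<close> for large \<open>n\<close>. Two admissible exponents
  \<open>n\<close> and \<open>m\<close> are compared through \<open>n * m\<close>. Additivity holds
  because \<open>\<gamma> (s / n)\<close> and \<open>\<gamma> (t / n)\<close> commute, both products
  being \<open>\<gamma> ((s + t) / n)\<close>.\<close>

lemma one_parameter_subgroup_exists:
  assumes Y: "Y \<in> lie_algebra G A"
  shows "\<exists>c. smooth_map real_atlas A c \<and> (\<forall>s t. c (s + t) = c s \<otimes> c t) \<and> velocity A c 0 = Y"
proof -
  obtain c1 where c1: "c1 \<in> A" "\<one> \<in> fst c1" using atlas_spaceE[of \<one> A] by (auto simp: space)
  obtain \<delta> \<gamma> where \<delta>: "\<delta> > 0" and \<gamma>0: "\<gamma> 0 = \<one>" and \<gamma>U: "\<And>t. \<bar>t\<bar> < \<delta> \<Longrightarrow> \<gamma> t \<in> fst c1"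
    and hom: "\<And>s t. \<bar>s\<bar> < \<delta> \<Longrightarrow> \<bar>t\<bar> < \<delta> \<Longrightarrow> \<gamma> (s + t) = \<gamma> s \<otimes> \<gamma> t"
    and sm: "smooth_on {-\<delta><..<\<delta>} (\<lambda>t. snd c1 (\<gamma> t))" and d0: "((\<lambda>t. snd c1 (\<gamma> t)) has_vector_derivative Y c1) (at 0)"
    using local_one_parameter_subgroup[OF Y c1] by metis
  have \<gamma>G: "\<gamma> t \<in> carrier G" if "\<bar>t\<bar> < \<delta>" for t
    using atlas_spaceI[OF c1(1) \<gamma>U[OF that]] by (simp add: space)
  have pow: "\<gamma> (real j * s) = \<gamma> s [^] j" if "\<bar>real j * s\<bar> < \<delta>" "\<bar>s\<bar> < \<delta>" for s j
    using that(1)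
  proof (induction j)
    case (Suc j)
    have "\<bar>real j * s\<bar> \<le> \<bar>real (Suc j) * s\<bar>" unfolding abs_mult by (intro mult_right_mono) auto
    then have j: "\<bar>real j * s\<bar> < \<delta>" using Suc.prems by linarith
    have "\<gamma> (real (Suc j) * s) = \<gamma> (real j * s + s)" by (simp add: algebra_simps)
    also have "\<dots> = \<gamma> s [^] j \<otimes> \<gamma> s" by (simp only: hom[OF j that(2)] Suc.IH[OF j])
    finally show ?case by simp
  qed (simp add: \<gamma>0)
  define good where "good n t \<longleftrightarrow> n > 0 \<and> \<bar>t / real n\<bar> < \<delta>" for n t
  define C where "C t = (let n = (SOME n. good n t) in \<gamma> (t / real n) [^] n)" for t
  have ex: "\<exists>n. good n s \<and> good n t \<and> good n (s + t)" for s t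
  proof -
    obtain n where n: "(\<bar>s\<bar> + \<bar>t\<bar>) / \<delta> < real n" using reals_Archimedean2 by blast
    have n0: "n > 0" using n \<delta> by (metis abs_ge_zero add_nonneg_nonneg divide_nonneg_pos gr0I not_less of_nat_0)
    have "\<bar>s\<bar> + \<bar>t\<bar> < real n * \<delta>" using n \<delta> by (simp add: field_simps)
    then have "\<bar>s\<bar> < real n * \<delta>" "\<bar>t\<bar> < real n * \<delta>" "\<bar>s + t\<bar> < real n * \<delta>" by linarith+
    then have "good n s" "good n t" "good n (s + t)" using n0 by (auto simp: good_def abs_divide field_simps)
    then show ?thesis by blast
  qed
  have same: "\<gamma> (t / real n) [^] n = \<gamma> (t / real m) [^] m" if n: "good n t" and m: "good m t" for n m t
  proof -
    have *: "\<gamma> (t / real n) [^] n = \<gamma> (t / real (n * m)) [^] (n * m)" if n: "good n t" and m: "m > 0" for n m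
    proof -
      have eq: "real m * (t / real (n * m)) = t / real n" using n m by (simp add: good_def)
      have sm: "\<bar>t / real (n * m)\<bar> < \<delta>"
      proof -
        have "\<bar>t / real (n * m)\<bar> = \<bar>t / real n\<bar> / real m" by (simp add: abs_divide)
        also have "\<dots> \<le> \<bar>t / real n\<bar> / 1" using m by (intro divide_left_mono) auto
        finally show ?thesis using n by (simp add: good_def)
      qed
      have "\<gamma> (t / real n) = \<gamma> (t / real (n * m)) [^] m"
        using pow[of m "t / real (n * m)", OF _ sm] n unfolding eq by (simp add: good_def)
      then show ?thesis using \<gamma>G[OF sm] by (simp add: nat_pow_pow mult.commute)
    qed
    show ?thesis using *[OF n, of m] *[OF m, of n] n m by (simp add: good_def mult.commute)
  qed
  have C: "C t = \<gamma> (t / real n) [^] n" if "good n t" for n t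
    using same[OF someI[of "\<lambda>n. good n t", OF that] that] by (simp add: C_def Let_def)
  have CG: "C t \<in> carrier G" for t
    using ex[of t t] C \<gamma>G by (metis good_def nat_pow_closed)
  have Chom: "C (s + t) = C s \<otimes> C t" for s t
  proof -
    obtain n where n: "good n s" "good n t" "good n (s + t)" using ex by blast
    then have sn: "\<bar>s / real n\<bar> < \<delta>" and tn: "\<bar>t / real n\<bar> < \<delta>" by (auto simp: good_def)
    have "\<gamma> (s / real n) \<otimes> \<gamma> (t / real n) = \<gamma> (t / real n) \<otimes> \<gamma> (s / real n)"
      using hom[OF sn tn] hom[OF tn sn] by (simp add: add.commute)
    then have "(\<gamma> (s / real n) \<otimes> \<gamma> (t / real n)) [^] n = C s \<otimes> C t"
      unfolding C[OF n(1)] C[OF n(2)] by (rule pow_mult_distrib[OF _ \<gamma>G[OF sn] \<gamma>G[OF tn]])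
    moreover have "C (s + t) = (\<gamma> (s / real n) \<otimes> \<gamma> (t / real n)) [^] n"
      unfolding C[OF n(3)] by (simp add: hom[OF sn tn, symmetric] add_divide_distrib)
    ultimately show ?thesis by simp
  qed
  have Clocal: "C t = \<gamma> t" if "\<bar>t\<bar> < \<delta>" for t
    using C[of 1 t] that \<gamma>G[OF that] by (simp add: good_def)
  \<comment> \<open>Near \<open>t0\<close> the curve is
    \<open>C t0 \<otimes> \<gamma> (t - t0)\<close>, a left translate of the smooth local
    piece.\<close>
  have Csmooth: "smooth_map real_atlas A C"
  proof (rule smooth_mapI[OF fd_atlas_real atl])
    fix t0 :: real
    obtain d where d: "d \<in> A" "C t0 \<in> fst d" using atlas_spaceE[of "C t0" A] CG by (auto simp: space)
    note L = smooth_map_lrep[OF atl left_smooth[OF CG[of t0]] c1(1) d(1)]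
    let ?S = "snd c1 ` {x \<in> fst c1. C t0 \<otimes> x \<in> fst d}"
    let ?x = "\<lambda>t. snd c1 (\<gamma> (t - t0))"
    define J where "J = {t0 - \<delta><..<t0 + \<delta>}"
    have smx: "smooth_on J ?x"
      by (rule smooth_on_compose[OF finite_dimensional_real _ open_greaterThanLessThan _ sm])
        (auto simp: J_def intro!: smooth_on_diff)
    define Q where "Q = J \<inter> ?x -` ?S"
    have oJ: "open J" by (simp add: J_def)
    have oQ: "open Q" unfolding Q_def
      by (rule continuous_open_preimage[OF smooth_on_continuous_on[OF smx] oJ L(1)])
    have CQ: "C t = C t0 \<otimes> \<gamma> (t - t0)" and Q\<gamma>: "\<gamma> (t - t0) \<in> fst c1" if "t \<in> J" for t
    proof -
      have *: "\<bar>t - t0\<bar> < \<delta>" using that by (auto simp: J_def)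
      show "C t = C t0 \<otimes> \<gamma> (t - t0)" using Chom[of t0 "t - t0"] Clocal[OF *] by simp
      show "\<gamma> (t - t0) \<in> fst c1" by (rule \<gamma>U[OF *])
    qed
    have CQd: "C t \<in> fst d" if "t \<in> Q" for t
    proof -
      have t: "t \<in> J" "?x t \<in> ?S" using that by (auto simp: Q_def)
      from chart_image_mem[OF atl c1(1) t(2)] show ?thesis using CQ[OF t(1)] Q\<gamma>[OF t(1)] atl c1 by simp
    qed
    have "smooth_on Q (\<lambda>t. snd d (C t0 \<otimes> cinv c1 (?x t)))"
      by (rule smooth_on_compose[OF fd_atlas_dim[OF atl] oQ L(1) smooth_on_subset[OF smx] L(2)]) (auto simp: Q_def)
    then have "smooth_on Q (\<lambda>t. snd d (C t))"
      by (rule smooth_on_cong[OF oQ]) (use CQ Q\<gamma> atl c1 in \<open>auto simp: Q_def\<close>)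
    moreover have "t0 \<in> Q" using \<delta> \<gamma>0 CG[of t0] d c1 by (auto simp: Q_def J_def)
    ultimately show "\<exists>c\<in>real_atlas. \<exists>d\<in>A. \<exists>Q. t0 \<in> fst c \<and> open Q \<and> snd c t0 \<in> Q \<and> Q \<subseteq> snd c ` fst c
        \<and> (\<forall>y\<in>Q. C (cinv c y) \<in> fst d) \<and> smooth_on Q (\<lambda>y. snd d (C (cinv c y)))"
      using oQ CQd by (intro bexI[of _ "(UNIV, \<lambda>t. t)"] bexI[OF _ d(1)] exI[of _ Q]) auto
  qed
  have C0: "C 0 = \<one>" using Clocal[of 0] \<delta> \<gamma>0 by simp
  have "velocity A C 0 = Y"
  proof (rule velocity_eqI[where \<gamma>=C and t=0 and c=c1, OF atl c1(1)])
    show "C 0 \<in> fst c1" using C0 c1 by simp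
    then show "eventually (\<lambda>s. C s \<in> fst c1) (at 0)" by (rule smooth_curve_near(1)[OF atl Csmooth c1(1)])
    show "Y \<in> tangent_space A (C 0)" using Y by (simp add: C0 lie_algebra_eq)
    show "((\<lambda>s. snd c1 (C s)) has_vector_derivative Y c1) (at 0)"
      by (rule has_vector_derivative_transform_within_open[OF d0, where S="{-\<delta><..<\<delta>}"]) (use \<delta> Clocal in auto)
  qed
  then show ?thesis using Csmooth Chom by blast
qed

lemma one_parameter_subgroup_simps:
  assumes c: "smooth_map real_atlas A c" and hom: "\<And>s t. c (s + t) = c s \<otimes> c t"
  shows "c t \<in> carrier G" "c 0 = \<one>" "n > 0 \<Longrightarrow> c t = c (t / real n) [^] n"
proof -
  show cG: "c t \<in> carrier G" for t using smooth_map_space[OF c, of t] by (simp add: space)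
  show c0: "c 0 = \<one>" using hom[of 0 0] cG[of 0] by (metis add_0 r_cancel_one')
  have "c (real n * s) = c s [^] n" for n s
  proof (induction n)
    case (Suc n)
    have "c (real (Suc n) * s) = c (real n * s + s)" by (simp add: algebra_simps)
    then show ?case by (simp add: hom Suc.IH)
  qed (simp add: c0)
  from this[of n "t / real n"] show "n > 0 \<Longrightarrow> c t = c (t / real n) [^] n" by simp
qed

text \<open>From \<open>c s = c (s - t) \<otimes> c t\<close> the velocity at \<open>t\<close> is
  the right translate of the velocity at 0.\<close>

lemma one_parameter_subgroup_ode:
  assumes Y: "Y \<in> lie_algebra G A"
    and c: "smooth_map real_atlas A c" and hom: "\<And>s t. c (s + t) = c s \<otimes> c t" and v: "velocity A c 0 = Y"
    and d: "d \<in> A" "c t \<in> fst d"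
  shows "((\<lambda>s. snd d (c s)) has_vector_derivative rinv Y (c t) d) (at t)"
proof -
  note [simp] = one_parameter_subgroup_simps(1,2)[OF c hom]
  obtain c1 where c1: "c1 \<in> A" "\<one> \<in> fst c1" using atlas_spaceE[of \<one> A] by (auto simp: space)
  have c0: "c 0 \<in> fst c1" using c1 by simp
  define \<gamma> where "\<gamma> s = c (s - t)" for s
  have sh: "((\<lambda>s. s - t) has_vector_derivative 1) (at t)" by (auto intro!: derivative_eq_intros)
  have "((\<lambda>s. snd c1 (c s)) has_vector_derivative Y c1) (at (t - t))"
    using smooth_curve_near(2)[OF atl c c1(1) c0] by (simp add: v)
  from vector_diff_chain_at[OF sh this] have "((\<lambda>s. snd c1 (\<gamma> s)) has_vector_derivative rinv Y (\<gamma> t) c1) (at t)"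
    by (simp add: comp_def \<gamma>_def rinv_one[OF Y])
  moreover have "eventually (\<lambda>s. \<gamma> s \<in> fst c1) (at t)"
  proof -
    have "smooth_map real_atlas real_atlas (\<lambda>s. s - t)"
      by (rule smooth_map_realI[OF fd_atlas_real]) (auto intro!: smooth_on_diff)
    then have "smooth_map real_atlas A \<gamma>"
      unfolding \<gamma>_def by (rule smooth_map_compose[OF fd_atlas_real fd_atlas_real atl _ c])
    from smooth_curve_near(1)[OF atl this c1(1)] show ?thesis using c1 by (simp add: \<gamma>_def)
  qed
  moreover have "\<gamma> s \<otimes> c t = c s" for s using hom[of "s - t" t] by (simp add: \<gamma>_def)
  ultimately show ?thesis
    using right_translate_curve_derivative[where \<gamma>=\<gamma> and s=t, OF Y c1(1) _ _ d(1), of "c t"] c1 d by (simp add: \<gamma>_def)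
qed

text \<open>Both curves solve the equation of the right-invariant field and so agree near 0; the
  identity \<open>c t = c (t / n) [^] n\<close> spreads the agreement to all times.\<close>

lemma one_parameter_subgroup_unique:
  assumes Y: "Y \<in> lie_algebra G A"
    and c: "smooth_map real_atlas A c" and hom: "\<And>s t. c (s + t) = c s \<otimes> c t" and v: "velocity A c 0 = Y"
    and c': "smooth_map real_atlas A c'" and hom': "\<And>s t. c' (s + t) = c' s \<otimes> c' t" and v': "velocity A c' 0 = Y"
  shows "c = c'"
proof
  fix t
  obtain c1 where c1: "c1 \<in> A" "\<one> \<in> fst c1" using atlas_spaceE[of \<one> A] by (auto simp: space)
  obtain \<epsilon> K and x :: "real \<Rightarrow> 'm" where \<epsilon>: "\<epsilon> > 0" and K: "open K" "snd c1 \<one> \<in> K"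
    and uniq: "\<And>y z \<delta> t. \<lbrakk>\<delta> \<le> \<epsilon>; y 0 = z 0; \<bar>t\<bar> < \<delta>;
      \<And>s. \<bar>s\<bar> < \<delta> \<Longrightarrow> y s \<in> K \<and> (y has_vector_derivative rinv Y (cinv c1 (y s)) c1) (at s);
      \<And>s. \<bar>s\<bar> < \<delta> \<Longrightarrow> z s \<in> K \<and> (z has_vector_derivative rinv Y (cinv c1 (z s)) c1) (at s)\<rbrakk> \<Longrightarrow> y t = z t"
    using local_flow_at_one[OF Y c1] by metis
  have loc: "\<exists>\<delta>>0. \<forall>s. \<bar>s\<bar> < \<delta> \<longrightarrow> c s \<in> fst c1 \<and> snd c1 (c s) \<in> K"
    if c: "smooth_map real_atlas A c" and c0: "c 0 = \<one>" for c
  proof -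
    have L: "open {s. c s \<in> fst c1}" "smooth_on {s. c s \<in> fst c1} (\<lambda>s. snd c1 (c s))"
      using smooth_map_lrep[OF fd_atlas_real c, of "(UNIV, \<lambda>t. t)" c1] c1(1) by auto
    have "open ({s. c s \<in> fst c1} \<inter> (\<lambda>s. snd c1 (c s)) -` K)"
      by (rule continuous_open_preimage[OF smooth_on_continuous_on[OF L(2)] L(1) K(1)])
    moreover have "0 \<in> {s. c s \<in> fst c1} \<inter> (\<lambda>s. snd c1 (c s)) -` K" using c0 c1 K by simp
    ultimately obtain \<delta> where "\<delta> > 0" "ball 0 \<delta> \<subseteq> {s. c s \<in> fst c1} \<inter> (\<lambda>s. snd c1 (c s)) -` K"
      using open_contains_ball by blast
    then show ?thesis by (intro exI[of _ \<delta>]) auto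
  qed
  note simps = one_parameter_subgroup_simps[OF c hom] and simps' = one_parameter_subgroup_simps[OF c' hom']
  obtain \<delta>1 where \<delta>1: "\<delta>1 > 0" "\<And>s. \<bar>s\<bar> < \<delta>1 \<Longrightarrow> c s \<in> fst c1 \<and> snd c1 (c s) \<in> K"
    using loc[OF c simps(2)] by blast
  obtain \<delta>2 where \<delta>2: "\<delta>2 > 0" "\<And>s. \<bar>s\<bar> < \<delta>2 \<Longrightarrow> c' s \<in> fst c1 \<and> snd c1 (c' s) \<in> K"
    using loc[OF c' simps'(2)] by blast
  define \<delta> where "\<delta> = min \<epsilon> (min \<delta>1 \<delta>2)"
  have \<delta>: "\<delta> > 0" using \<epsilon> \<delta>1 \<delta>2 by (simp add: \<delta>_def)
  have eq: "c s = c' s" if s: "\<bar>s\<bar> < \<delta>" for s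
  proof -
    have "(\<lambda>s. snd c1 (c s)) s = (\<lambda>s. snd c1 (c' s)) s"
    proof (rule uniq[OF _ _ s])
      show "\<delta> \<le> \<epsilon>" by (simp add: \<delta>_def)
      show "snd c1 (c 0) = snd c1 (c' 0)" by (simp add: simps(2) simps'(2))
      fix s assume "\<bar>s\<bar> < \<delta>"
      then have *: "c s \<in> fst c1 \<and> snd c1 (c s) \<in> K" "c' s \<in> fst c1 \<and> snd c1 (c' s) \<in> K"
        using \<delta>1(2)[of s] \<delta>2(2)[of s] by (auto simp: \<delta>_def)
      show "snd c1 (c s) \<in> K \<and> ((\<lambda>s. snd c1 (c s)) has_vector_derivative rinv Y (cinv c1 (snd c1 (c s))) c1) (at s)"
        using * one_parameter_subgroup_ode[OF Y c hom v c1(1), of s] atl c1 by simp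
      show "snd c1 (c' s) \<in> K \<and> ((\<lambda>s. snd c1 (c' s)) has_vector_derivative rinv Y (cinv c1 (snd c1 (c' s))) c1) (at s)"
        using * one_parameter_subgroup_ode[OF Y c' hom' v' c1(1), of s] atl c1 by simp
    qed
    then show ?thesis
      using inj_onD[OF chart_inj[OF atl c1(1)], of "c s" "c' s"] \<delta>1(2)[of s] \<delta>2(2)[of s] s by (simp add: \<delta>_def)
  qed
  obtain n where n: "\<bar>t\<bar> / \<delta> < real n" using reals_Archimedean2 by blast
  have n0: "n > 0" using n \<delta> by (metis abs_ge_zero divide_nonneg_pos gr0I not_less of_nat_0)
  have "\<bar>t / real n\<bar> < \<delta>" using n n0 \<delta> by (simp add: abs_divide field_simps)
  then show "c t = c' t" unfolding simps(3)[OF n0, of t] simps'(3)[OF n0, of t] by (simp add: eq)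
qed

text \<open>The one-parameter subgroup with velocity \<open>fscale t Y\<close> is
  \<open>c (t * s)\<close> in the variable \<open>s\<close>, and the exponential is its value at
  1.\<close>

lemma lie_exp_curve:
  assumes Y: "Y \<in> lie_algebra G A"
  obtains c where "smooth_map real_atlas A c" "c 0 = \<one>" "velocity A c 0 = Y" "\<And>t. lie_exp G A (fscale t Y) = c t"
proof -
  obtain c where c: "smooth_map real_atlas A c" "\<And>s t. c (s + t) = c s \<otimes> c t" "velocity A c 0 = Y"
    using one_parameter_subgroup_exists[OF Y] by blast
  note c0 = one_parameter_subgroup_simps(2)[OF c(1,2)]
  have "lie_exp G A (fscale t Y) = c t" for t
  proof -
    have tY: "fscale t Y \<in> lie_algebra G A" using Y tangent_space_fscale[OF atl] by (simp add: lie_algebra_eq)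
    have sr: "smooth_map real_atlas real_atlas (\<lambda>s. t * s)"
      by (rule smooth_map_realI[OF fd_atlas_real])
        (auto intro!: smooth_on_bounded_linear bounded_linear_mult_right)
    have 1: "smooth_map real_atlas A (\<lambda>s. c (t * s))"
      by (rule smooth_map_compose[OF fd_atlas_real fd_atlas_real atl sr c(1)])
    have 2: "c (t * (s + s')) = c (t * s) \<otimes> c (t * s')" for s s' by (simp add: distrib_left c(2))
    have 3: "velocity A (\<lambda>s. c (t * s)) 0 = fscale t Y"
    proof -
      obtain c1 where c1: "c1 \<in> A" "\<one> \<in> fst c1" using atlas_spaceE[of \<one> A] by (auto simp: space)
      have m: "((\<lambda>s. t * s) has_vector_derivative t) (at 0)" by (auto intro!: derivative_eq_intros simp: has_vector_derivative_def)
      have "((\<lambda>s. snd c1 (c s)) has_vector_derivative Y c1) (at (t * 0))"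
        using smooth_curve_near(2)[OF atl c(1) c1(1), of 0] c1 by (simp add: c0 c(3))
      from vector_diff_chain_at[OF m this]
      have *: "((\<lambda>s. snd c1 (c (t * s))) has_vector_derivative fscale t Y c1) (at 0)"
        by (simp add: comp_def fscale_apply)
      show ?thesis
        by (rule velocity_eqI[where \<gamma>="\<lambda>s. c (t * s)" and t=0 and c=c1 and v="fscale t Y", OF atl c1(1) _ _ _ *])
          (use c1 tY smooth_curve_near(1)[OF atl 1 c1(1), of 0] in \<open>auto simp: c0 lie_algebra_eq\<close>)
    qed
    have "(THE c. smooth_map real_atlas A c \<and> (\<forall>s t. c (s + t) = c s \<otimes> c t) \<and> velocity A c 0 = fscale t Y) = (\<lambda>s. c (t * s))"
    proof (rule the_equality)
      show "smooth_map real_atlas A (\<lambda>s. c (t * s)) \<and> (\<forall>s s'. c (t * (s + s')) = c (t * s) \<otimes> c (t * s')) \<and>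
          velocity A (\<lambda>s. c (t * s)) 0 = fscale t Y" using 1 2 3 by blast
      fix c' assume "smooth_map real_atlas A c' \<and> (\<forall>s t. c' (s + t) = c' s \<otimes> c' t) \<and> velocity A c' 0 = fscale t Y"
      then show "c' = (\<lambda>s. c (t * s))" using one_parameter_subgroup_unique[OF tY _ _ _ 1 2 3] by blast
    qed
    then show ?thesis by (simp add: lie_exp_def)
  qed
  then show thesis using that c c0 by blast
qed

lemma lie_bracket_in:
  assumes "Y \<in> lie_algebra G A" "Z \<in> lie_algebra G A"
  shows "lie_bracket G A Y Z \<in> lie_algebra G A"
  using vf_bracket_in[OF atl rinv_smooth[OF assms(1)] rinv_smooth[OF assms(2)], of \<one>]
  by (simp add: lie_bracket_def lie_algebra_eq rinv_def[abs_def])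

text \<open>Right translations relate right-invariant fields to themselves, so by naturality the
  bracket of two of them is again right-invariant.\<close>

lemma rinv_lie_bracket:
  assumes Y: "Y \<in> lie_algebra G A" and Z: "Z \<in> lie_algebra G A" and s: "s \<in> carrier G"
  shows "rinv (lie_bracket G A Y Z) s = vf_bracket A (rinv Y) (rinv Z) s"
proof -
  have "vf_bracket A (rinv Y) (rinv Z) (\<one> \<otimes> s) = tangent_map A A (\<lambda>x. x \<otimes> s) \<one> (vf_bracket A (rinv Y) (rinv Z) \<one>)"
    by (rule vf_bracket_related[OF atl atl right_smooth[OF s] rinv_smooth[OF Y] rinv_smooth[OF Z] rinv_smooth[OF Y] rinv_smooth[OF Z]])
      (auto simp: space rinv_translate[OF Y _ s] rinv_translate[OF Z _ s])
  then show ?thesis using s by (simp add: lie_bracket_def rinv_def[abs_def])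
qed

end

section \<open>Hamiltonian vector fields of momentum functions\<close>

lemma differential_const:
  assumes A: "fd_atlas A" and p: "p \<in> atlas_space A" and v: "v \<in> tangent_space A p"
  shows "differential A (\<lambda>_. a) p v = 0"
proof -
  obtain c where c: "c \<in> A" "p \<in> fst c" using p by (rule atlas_spaceE)
  show ?thesis
    unfolding differential_eq[OF A smooth_map_real_const[OF A] c v]
    by (simp add: frechet_derivative_eqI[OF has_derivative_const])
qed

lemma differential_mult:
  assumes A: "fd_atlas A" and f: "smooth_map A real_atlas f" and g: "smooth_map A real_atlas g"
    and p: "p \<in> atlas_space A" and v: "v \<in> tangent_space A p"
  shows "differential A (\<lambda>x. f x * g x) p v = f p * differential A g p v + differential A f p v * g p"
proof -
  obtain c where c: "c \<in> A" "p \<in> fst c" using p by (rule atlas_spaceE)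
  show ?thesis
    unfolding differential_eq[OF A f c v] differential_eq[OF A g c v]
      differential_eq[OF A smooth_map_real_mult[OF A f g] c v]
    using c A
    by (simp add: frechet_derivative_eqI[OF has_derivative_mult[OF real_has_derivative[OF A f c] real_has_derivative[OF A g c]]])
qed

lemma differential_sum:
  assumes A: "fd_atlas A" and p: "p \<in> atlas_space A" and v: "v \<in> tangent_space A p"
    and f: "\<And>i. i \<in> I \<Longrightarrow> smooth_map A real_atlas (f i)"
  shows "differential A (\<lambda>x. \<Sum>i\<in>I. f i x) p v = (\<Sum>i\<in>I. differential A (f i) p v)"
  using f
proof (induction I rule: infinite_finite_induct)
  case (insert i I)
  have "smooth_map A real_atlas (\<lambda>x. \<Sum>i\<in>I. f i x)" by (rule smooth_map_real_sum[OF A]) (use insert.prems in auto)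
  from differential_add[OF A insert.prems[of i] this p v] insert show ?case by simp
qed (simp_all add: differential_const[OF A p v])

lemma differential_cong:
  assumes "fd_atlas A" "smooth_map A real_atlas f" "p \<in> atlas_space A" "v \<in> tangent_space A p"
    "\<And>x. x \<in> atlas_space A \<Longrightarrow> f x = g x"
  shows "differential A f p v = differential A g p v"
  unfolding differential_def using tangent_map_cong[OF assms(1) fd_atlas_real assms(2-5)] by simp

lemma smooth_map_differential_field:
  assumes A: "fd_atlas A" and f: "smooth_map A real_atlas f" and X: "smooth_vf A X"
  shows "smooth_map A real_atlas (\<lambda>p. differential A f p (X p))"
proof (rule smooth_map_realI[OF A])
  fix c assume c: "c \<in> A"
  have "smooth_on (snd c ` fst c) (\<lambda>y. frechet_derivative (\<lambda>y. f (cinv c y)) (at y) (X (cinv c y) c))"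
    by (rule smooth_on_derivative_compose[OF fd_atlas_dim[OF A] chart_open[OF A c] chart_open[OF A c] smooth_on_id _
          smooth_map_realD[OF A f c]]) (use X c in \<open>auto simp: smooth_vf_def\<close>)
  then show "smooth_on (snd c ` fst c) (\<lambda>y. differential A f (cinv c y) (X (cinv c y)))"
  proof (rule smooth_on_cong[OF chart_open[OF A c]])
    fix y assume y: "y \<in> snd c ` fst c"
    then have in': "cinv c y \<in> fst c" by (rule cinv_in[OF A c])
    then have "X (cinv c y) \<in> tangent_space A (cinv c y)" using X atlas_spaceI[OF c in'] by (simp add: smooth_vf_def)
    from differential_eq[OF A f c in' this]
    show "frechet_derivative (\<lambda>y. f (cinv c y)) (at y) (X (cinv c y) c) = differential A f (cinv c y) (X (cinv c y))"
      by (simp add: chart_cinv[OF y])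
  qed
qed

lemma differential_bracket:
  assumes A: "fd_atlas A" and f: "smooth_map A real_atlas f" and X: "smooth_vf A X" and Y: "smooth_vf A Y"
    and p: "p \<in> atlas_space A"
  shows "differential A f p (vf_bracket A X Y p) =
    differential A (\<lambda>q. differential A f q (Y q)) p (X p) - differential A (\<lambda>q. differential A f q (X q)) p (Y p)"
proof -
  obtain c where c: "c \<in> A" "p \<in> fst c" using p by (rule atlas_spaceE)
  let ?S = "snd c ` fst c" and ?f = "\<lambda>y. f (cinv c y)"
  have Sp: "snd c p \<in> ?S" using c by simp
  have XT: "X p \<in> tangent_space A p" and YT: "Y p \<in> tangent_space A p" using X Y p by (auto simp: smooth_vf_def)
  have dd: "differential A (\<lambda>q. differential A f q (Z q)) p v =
      frechet_derivative (\<lambda>y. frechet_derivative ?f (at y) (Z (cinv c y) c)) (at (snd c p)) (v c)"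
    if Z: "smooth_vf A Z" and v: "v \<in> tangent_space A p" for Z v
  proof -
    have "frechet_derivative (\<lambda>y. frechet_derivative ?f (at y) (Z (cinv c y) c)) (at (snd c p)) =
       frechet_derivative (\<lambda>y. differential A f (cinv c y) (Z (cinv c y))) (at (snd c p))"
    proof (rule frechet_derivative_cong_open[OF chart_open[OF A c(1)] Sp])
      fix y assume y: "y \<in> ?S"
      then have in': "cinv c y \<in> fst c" by (rule cinv_in[OF A c(1)])
      then have "Z (cinv c y) \<in> tangent_space A (cinv c y)" using Z atlas_spaceI[OF c(1) in'] by (simp add: smooth_vf_def)
      from differential_eq[OF A f c(1) in' this]
      show "frechet_derivative ?f (at y) (Z (cinv c y) c) = differential A f (cinv c y) (Z (cinv c y))"
        by (simp add: chart_cinv[OF y])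
    qed
    then show ?thesis using differential_eq[OF A smooth_map_differential_field[OF A f Z] c v] by simp
  qed
  have "smooth_on ?S (\<lambda>y. X (cinv c y) c)" "smooth_on ?S (\<lambda>y. Y (cinv c y) c)"
    using X Y c by (auto simp: smooth_vf_def)
  from bracket_commutator[OF fd_atlas_dim[OF A] finite_dimensional_real chart_open[OF A c(1)] Sp smooth_map_realD[OF A f c(1)] this]
  show ?thesis
    unfolding dd[OF Y XT] dd[OF X YT] differential_eq[OF A f c vf_bracket_in[OF A X Y]]
    using c A by (simp add: vf_bracket_apply)
qed

lemma smooth_map_momentum:
  assumes A: "fd_atlas A" and X: "smooth_vf A X" and f: "smooth_map A real_atlas f"
  shows "smooth_map (cotangent_atlas A) real_atlas (\<lambda>\<xi>. snd \<xi> (X (fst \<xi>)) + f (fst \<xi>))"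
  by (intro smooth_map_real_add fd_atlas_cotangent smooth_map_pairing A X
      smooth_map_compose[OF fd_atlas_cotangent[OF A] A fd_atlas_real smooth_map_cotangent_fst[OF A] f])

text \<open>In bundle coordinates the function is \<open>p\<close> applied to \<open>X\<close> at
  \<open>q\<close>, plus \<open>f\<close> at \<open>q\<close>. The three summands are the derivative
  in \<open>p\<close> and the derivatives in \<open>q\<close> through \<open>X\<close> and through
  \<open>f\<close>.\<close>

lemma momentum_differential_coords:
  assumes A: "fd_atlas A" and X: "smooth_vf A X" and f: "smooth_map A real_atlas f"
    and c: "c \<in> A" and \<xi>: "\<xi> \<in> fst (cochart A c)" and v: "v \<in> tangent_space (cotangent_atlas A) \<xi>"
  shows "differential (cotangent_atlas A) (\<lambda>\<xi>. snd \<xi> (X (fst \<xi>)) + f (fst \<xi>)) \<xi> v =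
    blinfun_apply (snd (v (cochart A c))) (X (fst \<xi>) c) +
    blinfun_apply (snd (snd (cochart A c) \<xi>))
      (frechet_derivative (\<lambda>y. X (cinv c y) c) (at (snd c (fst \<xi>))) (fst (v (cochart A c)))) +
    frechet_derivative (\<lambda>y. f (cinv c y)) (at (snd c (fst \<xi>))) (fst (v (cochart A c)))"
proof -
  let ?e = "cochart A c" and ?T = "cotangent_atlas A"
  let ?X = "\<lambda>y. X (cinv c y) c" and ?f = "\<lambda>y. f (cinv c y)" and ?q = "snd c (fst \<xi>)"
  note T = fd_atlas_cotangent[OF A] and e = cochart_in[OF c]
  have p: "fst \<xi> \<in> fst c" using \<xi> by (auto simp: fst_cochart)
  have dX: "(?X has_derivative frechet_derivative ?X (at ?q)) (at ?q)"
    by (rule smooth_on_has_derivative[of "snd c ` fst c"]) (use X c p in \<open>auto simp: smooth_vf_def\<close>)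
  have df: "(?f has_derivative frechet_derivative ?f (at ?q)) (at ?q)"
    by (rule smooth_on_has_derivative[OF smooth_map_realD[OF A f c]]) (use p in auto)
  have fe: "fst (snd ?e \<xi>) = ?q" by simp
  have h1: "((\<lambda>y. blinfun_apply (snd y) (?X (fst y)) + ?f (fst y)) has_derivative
    (\<lambda>u. (blinfun_apply (snd (snd ?e \<xi>)) (frechet_derivative ?X (at ?q) (fst u)) + blinfun_apply (snd u) (?X ?q))
       + frechet_derivative ?f (at ?q) (fst u))) (at (snd ?e \<xi>))"
    using dX df unfolding fe[symmetric]
    by (intro has_derivative_add bounded_bilinear.FDERIV[OF bounded_bilinear_blinfun_apply]
        has_derivative_compose[OF bounded_linear_imp_has_derivative[OF bounded_linear_fst]]
        bounded_linear_imp_has_derivative[OF bounded_linear_snd])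
  have h2: "frechet_derivative (\<lambda>y. blinfun_apply (snd y) (?X (fst y)) + ?f (fst y)) (at (snd ?e \<xi>)) =
    frechet_derivative (\<lambda>y. snd (cinv ?e y) (X (fst (cinv ?e y))) + f (fst (cinv ?e y))) (at (snd ?e \<xi>))"
  proof (rule frechet_derivative_cong_open[OF chart_open[OF T e]])
    fix y assume "y \<in> snd ?e ` fst ?e"
    then have q: "fst y \<in> snd c ` fst c" by (auto simp: cochart_full_image[OF A c])
    show "blinfun_apply (snd y) (?X (fst y)) + ?f (fst y) = snd (cinv ?e y) (X (fst (cinv ?e y))) + f (fst (cinv ?e y))"
      using pairing_in_cochart[OF A c X q] cinv_cochart[OF A c q, of "snd y"] by simp
  qed (use \<xi> in simp)
  have D: "frechet_derivative (\<lambda>y. snd (cinv ?e y) (X (fst (cinv ?e y))) + f (fst (cinv ?e y))) (at (snd ?e \<xi>)) =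
    (\<lambda>u. (blinfun_apply (snd (snd ?e \<xi>)) (frechet_derivative ?X (at ?q) (fst u)) + blinfun_apply (snd u) (?X ?q))
       + frechet_derivative ?f (at ?q) (fst u))"
    by (rule trans[OF sym[OF h2] frechet_derivative_eqI[OF h1]])
  have Xq: "?X ?q = X (fst \<xi>) c" using A c p by simp
  show ?thesis
    unfolding differential_eq[OF T smooth_map_momentum[OF A X f] e \<xi> v] D Xq by simp
qed

text \<open>In coordinates the vector has base part \<open>X\<close> and fibre part minus the
  derivative of the Hamiltonian in \<open>q\<close>. Inserted into the differential of another
  function of this kind, the derivatives of \<open>X\<close> and \<open>Z\<close> combine to the
  bracket. \<open>Z\<close> and \<open>h\<close> are left general, since both left-invariant and
  right-invariant fields are inserted later.\<close>

lemma hamiltonian_momentum: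
  assumes A: "fd_atlas A" and \<xi>: "\<xi> \<in> atlas_space (cotangent_atlas A)"
    and X: "smooth_vf A X" and f: "smooth_map A real_atlas f"
  obtains u where "u \<in> tangent_space (cotangent_atlas A) \<xi>"
    "\<And>w. w \<in> tangent_space (cotangent_atlas A) \<xi> \<Longrightarrow> cotangent_symplectic_form A \<xi> u w =
      - differential (cotangent_atlas A) (\<lambda>\<xi>. snd \<xi> (X (fst \<xi>)) + f (fst \<xi>)) \<xi> w"
    "tangent_map (cotangent_atlas A) A fst \<xi> u = X (fst \<xi>)"
    "\<And>Z h. smooth_vf A Z \<Longrightarrow> smooth_map A real_atlas h \<Longrightarrow>
      differential (cotangent_atlas A) (\<lambda>\<xi>. snd \<xi> (Z (fst \<xi>)) + h (fst \<xi>)) \<xi> u =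
      snd \<xi> (vf_bracket A X Z (fst \<xi>)) + differential A h (fst \<xi>) (X (fst \<xi>)) - differential A f (fst \<xi>) (Z (fst \<xi>))"
proof -
  let ?T = "cotangent_atlas A"
  note T = fd_atlas_cotangent[OF A]
  obtain c where c: "c \<in> A" "\<xi> \<in> fst (cochart A c)"
    and \<omega>: "\<And>v w. v \<in> tangent_space ?T \<xi> \<Longrightarrow> w \<in> tangent_space ?T \<xi> \<Longrightarrow>
      cotangent_symplectic_form A \<xi> v w =
      blinfun_apply (snd (v (cochart A c))) (fst (w (cochart A c))) -
      blinfun_apply (snd (w (cochart A c))) (fst (v (cochart A c)))"
    using symplectic_form_coords[OF A \<xi>] by metis
  let ?e = "cochart A c" and ?q = "snd c (fst \<xi>)"
  let ?X = "\<lambda>y. X (cinv c y) c" and ?f = "\<lambda>y. f (cinv c y)" and ?\<pi> = "snd (snd (cochart A c) \<xi>)"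
  have e: "?e \<in> ?T" by (rule cochart_in[OF c(1)])
  have p: "fst \<xi> \<in> fst c" and \<zeta>: "snd \<xi> \<in> cotangent_space A (fst \<xi>)" using c(2) by (auto simp: fst_cochart)
  have pA: "fst \<xi> \<in> atlas_space A" by (rule atlas_spaceI[OF c(1) p])
  have XT: "X (fst \<xi>) \<in> tangent_space A (fst \<xi>)" using X pA by (simp add: smooth_vf_def)
  have dloc: "((\<lambda>y. Z (cinv c y) c) has_derivative frechet_derivative (\<lambda>y. Z (cinv c y) c) (at ?q)) (at ?q)"
    if "smooth_vf A Z" for Z
    by (rule smooth_on_has_derivative[of "snd c ` fst c"]) (use that c p in \<open>auto simp: smooth_vf_def\<close>)
  have df: "(?f has_derivative frechet_derivative ?f (at ?q)) (at ?q)"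
    by (rule smooth_on_has_derivative[OF smooth_map_realD[OF A f c(1)]]) (use p in auto)
  define \<beta> where "\<beta> = Blinfun (\<lambda>a. - (blinfun_apply ?\<pi> (frechet_derivative ?X (at ?q) a) + frechet_derivative ?f (at ?q) a))"
  have \<beta>: "blinfun_apply \<beta> a = - (blinfun_apply ?\<pi> (frechet_derivative ?X (at ?q) a) + frechet_derivative ?f (at ?q) a)" for a
    unfolding \<beta>_def
    by (rule bounded_linear_Blinfun_apply[THEN fun_cong])
      (intro bounded_linear_minus bounded_linear_add bounded_linear_compose[OF blinfun.bounded_linear_right]
        has_derivative_bounded_linear[OF dloc[OF X]] has_derivative_bounded_linear[OF df])
  define u where "u = coord_vector ?T ?e \<xi> (X (fst \<xi>) c, \<beta>)"
  have u: "u \<in> tangent_space ?T \<xi>" unfolding u_def by (rule coord_vector_in[OF T e c(2)])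
  have ue: "u ?e = (X (fst \<xi>) c, \<beta>)" unfolding u_def by (rule coord_vector_self[OF T e c(2)])
  have \<zeta>\<pi>: "snd \<xi> v = blinfun_apply ?\<pi> (v c)" if "v \<in> tangent_space A (fst \<xi>)" for v
    using covector_coords_apply[OF A c(1) p \<zeta>, of "v c"] coord_vector_component[OF A c(1) p that]
    by (simp add: cochart_def)
  show thesis
  proof (rule that[OF u])
    show "cotangent_symplectic_form A \<xi> u w = - differential ?T (\<lambda>\<xi>. snd \<xi> (X (fst \<xi>)) + f (fst \<xi>)) \<xi> w"
      if w: "w \<in> tangent_space ?T \<xi>" for w
      unfolding \<omega>[OF u w] momentum_differential_coords[OF A X f c w] ue by (simp add: \<beta>)
    show "tangent_map ?T A fst \<xi> u = X (fst \<xi>)"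
    proof (rule tangent_space_eqI[OF _ XT c(1) p])
      show "tangent_map ?T A fst \<xi> u \<in> tangent_space A (fst \<xi>)"
        by (rule tangent_map_in[OF T A smooth_map_cotangent_fst[OF A] \<xi> u])
      show "tangent_map ?T A fst \<xi> u c = X (fst \<xi>) c"
        by (simp add: tangent_fst_cochart[OF A c u] ue)
    qed
    fix Z h assume Z: "smooth_vf A Z" and h: "smooth_map A real_atlas h"
    have ZT: "Z (fst \<xi>) \<in> tangent_space A (fst \<xi>)" using Z pA by (simp add: smooth_vf_def)
    show "differential ?T (\<lambda>\<xi>. snd \<xi> (Z (fst \<xi>)) + h (fst \<xi>)) \<xi> u =
      snd \<xi> (vf_bracket A X Z (fst \<xi>)) + differential A h (fst \<xi>) (X (fst \<xi>)) - differential A f (fst \<xi>) (Z (fst \<xi>))"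
      unfolding momentum_differential_coords[OF A Z h c u] ue \<zeta>\<pi>[OF vf_bracket_in[OF A X Z]]
        differential_eq[OF A h c(1) p XT] differential_eq[OF A f c(1) p ZT]
      using c(1) p by (simp add: \<beta> vf_bracket_apply blinfun.diff_right)
  qed
qed

text \<open>In coordinates the differential of the pairing with \<open>Z\<close> is the fibre part
  applied to \<open>Z\<close>, plus a term that depends on the base part only. Fields of the family
  \<open>\<Z>\<close> attain every value at the point, so they determine the fibre part.\<close>

lemma cotangent_tangent_eqI:
  assumes A: "fd_atlas A" and \<xi>: "\<xi> \<in> atlas_space (cotangent_atlas A)"
    and u: "u \<in> tangent_space (cotangent_atlas A) \<xi>" and v: "v \<in> tangent_space (cotangent_atlas A) \<xi>"
    and base: "tangent_map (cotangent_atlas A) A fst \<xi> u = tangent_map (cotangent_atlas A) A fst \<xi> v"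
    and \<Z>: "\<And>Z. Z \<in> \<Z> \<Longrightarrow> smooth_vf A Z" "\<And>w. w \<in> tangent_space A (fst \<xi>) \<Longrightarrow> \<exists>Z\<in>\<Z>. Z (fst \<xi>) = w"
    and eq: "\<And>Z. Z \<in> \<Z> \<Longrightarrow> differential (cotangent_atlas A) (\<lambda>\<xi>. snd \<xi> (Z (fst \<xi>))) \<xi> u =
      differential (cotangent_atlas A) (\<lambda>\<xi>. snd \<xi> (Z (fst \<xi>))) \<xi> v"
  shows "u = v"
proof -
  let ?T = "cotangent_atlas A"
  note T = fd_atlas_cotangent[OF A]
  obtain e where "e \<in> ?T" "\<xi> \<in> fst e" using \<xi> by (rule atlas_spaceE)
  then obtain c where c: "c \<in> A" "\<xi> \<in> fst (cochart A c)" by (auto simp: cotangent_atlas_alt)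
  have p: "fst \<xi> \<in> fst c" using c(2) by (auto simp: fst_cochart)
  have 1: "fst (u (cochart A c)) = fst (v (cochart A c))"
    using tangent_fst_cochart[OF A c u] tangent_fst_cochart[OF A c v] base by simp
  have "snd (u (cochart A c)) = snd (v (cochart A c))"
  proof (rule blinfun_eqI)
    fix w
    obtain Z where Z: "Z \<in> \<Z>" "Z (fst \<xi>) = coord_vector A c (fst \<xi>) w"
      using \<Z>(2)[OF coord_vector_in[OF A c(1) p]] by blast
    have Zc: "Z (fst \<xi>) c = w" by (simp add: Z(2) A c(1) p)
    have "differential ?T (\<lambda>\<xi>. snd \<xi> (Z (fst \<xi>)) + 0) \<xi> u = differential ?T (\<lambda>\<xi>. snd \<xi> (Z (fst \<xi>)) + 0) \<xi> v"
      using eq[OF Z(1)] by simp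
    then show "blinfun_apply (snd (u (cochart A c))) w = blinfun_apply (snd (v (cochart A c))) w"
      using momentum_differential_coords[OF A \<Z>(1)[OF Z(1)] smooth_map_real_const[OF A, of 0] c u]
        momentum_differential_coords[OF A \<Z>(1)[OF Z(1)] smooth_map_real_const[OF A, of 0] c v] 1 Zc
      by simp
  qed
  with 1 show ?thesis using tangent_space_eqI[OF u v cochart_in[OF c(1)] c(2)] by (simp add: prod_eq_iff)
qed

lemma tangent_map_inclusion:
  assumes A: "fd_atlas A" and B: "fd_atlas B" and c: "c \<in> A" "p \<in> fst c" and d: "d \<in> B" "q \<in> fst d"
    and v: "v \<in> tangent_space A p"
  shows "tangent_map A (prod_atlas A B) (\<lambda>x. (x, q)) p v (prod_chart c d) = (v c, 0)"
proof -
  note sm = smooth_map_Pair[OF A A B smooth_map_id[OF A] smooth_map_const[OF A B atlas_spaceI[OF d]]]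
  have "frechet_derivative (\<lambda>y. snd (prod_chart c d) (cinv c y, q)) (at (snd c p)) =
    frechet_derivative (\<lambda>y. (y, snd d q)) (at (snd c p))"
    by (rule frechet_derivative_cong_open[OF chart_open[OF A c(1)]]) (use c A in \<open>auto simp: chart_cinv\<close>)
  also have "\<dots> = (\<lambda>h. (h, 0))" by (rule frechet_derivative_eqI) (auto intro!: derivative_eq_intros)
  finally show ?thesis
    using tangent_map_apply[OF A sm c prod_chart_in[OF c(1) d(1)] _ v] c d by simp
qed

lemma tangent_map_inclusion':
  assumes A: "fd_atlas A" and B: "fd_atlas B" and c: "c \<in> A" "p \<in> fst c" and d: "d \<in> B" "q \<in> fst d"
    and v: "v \<in> tangent_space B q"
  shows "tangent_map B (prod_atlas A B) (\<lambda>x. (p, x)) q v (prod_chart c d) = (0, v d)"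
proof -
  note sm = smooth_map_Pair[OF B A B smooth_map_const[OF B A atlas_spaceI[OF c]] smooth_map_id[OF B]]
  have "frechet_derivative (\<lambda>y. snd (prod_chart c d) (p, cinv d y)) (at (snd d q)) =
    frechet_derivative (\<lambda>y. (snd c p, y)) (at (snd d q))"
    by (rule frechet_derivative_cong_open[OF chart_open[OF B d(1)]]) (use d B in \<open>auto simp: chart_cinv\<close>)
  also have "\<dots> = (\<lambda>h. (0, h))" by (rule frechet_derivative_eqI) (auto intro!: derivative_eq_intros)
  finally show ?thesis
    using tangent_map_apply[OF B sm d prod_chart_in[OF c(1) d(1)] _ v] c d by simp
qed

lemma prod_atlas_cases:
  assumes "e \<in> prod_atlas A B" obtains c d where "c \<in> A" "d \<in> B" "e = prod_chart c d"
  using assms by (auto simp: prod_atlas_iff prod_chart_def)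

section \<open>Left-invariant fields and the tangent map of the inversion\<close>

context lie_grp
begin

definition linv :: "('g, 'm) tangent \<Rightarrow> 'g \<Rightarrow> ('g, 'm) tangent"
  where "linv Z s = tangent_map A A (\<lambda>x. s \<otimes> x) \<one> Z"

lemma linv_in: "Z \<in> lie_algebra G A \<Longrightarrow> s \<in> carrier G \<Longrightarrow> linv Z s \<in> tangent_space A s"
  using tangent_map_in[OF atl atl left_smooth, of s \<one> Z] by (simp add: linv_def space lie_algebra_eq)

lemma linv_translate:
  assumes Z: "Z \<in> lie_algebra G A" and g: "g \<in> carrier G" and x: "x \<in> carrier G"
  shows "linv Z (g \<otimes> x) = tangent_map A A (\<lambda>y. g \<otimes> y) x (linv Z x)"
proof -
  have Z': "Z \<in> tangent_space A \<one>" using Z by (simp add: lie_algebra_eq)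
  have one: "\<one> \<in> atlas_space A" by (simp add: space)
  have "linv Z (g \<otimes> x) = tangent_map A A (\<lambda>z. g \<otimes> (x \<otimes> z)) \<one> Z" unfolding linv_def
    by (rule tangent_map_cong[OF atl atl left_smooth one Z']) (use x g in \<open>auto simp: space m_assoc\<close>)
  also have "\<dots> = tangent_map A A (\<lambda>z. g \<otimes> z) (x \<otimes> \<one>) (linv Z x)" unfolding linv_def
    by (rule tangent_map_compose[OF atl atl atl left_smooth[OF x] left_smooth[OF g] one Z'])
  finally show ?thesis using x by simp
qed

lemma left_translate_inverse:
  assumes g: "g \<in> carrier G" and x: "x \<in> carrier G" and v: "v \<in> tangent_space A x"
  shows "tangent_map A A (\<lambda>y. inv g \<otimes> y) (g \<otimes> x) (tangent_map A A (\<lambda>y. g \<otimes> y) x v) = v"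
proof -
  have xA: "x \<in> atlas_space A" using x by (simp add: space)
  have "tangent_map A A (\<lambda>y. y) x v = tangent_map A A (\<lambda>y. inv g \<otimes> (g \<otimes> y)) x v"
    by (rule tangent_map_cong[OF atl atl smooth_map_id[OF atl] xA v]) (use g in \<open>auto simp: space m_assoc[symmetric]\<close>)
  then show ?thesis
    using tangent_map_compose[OF atl atl atl left_smooth[OF g] left_smooth[OF inv_closed[OF g]] xA v] tangent_map_id[OF atl xA v]
    by simp
qed

lemma linv_surj:
  assumes x: "x \<in> carrier G" and v: "v \<in> tangent_space A x"
  defines "Z \<equiv> tangent_map A A (\<lambda>y. inv x \<otimes> y) x v"
  shows "Z \<in> lie_algebra G A" "linv Z x = v"
proof -
  have xA: "x \<in> atlas_space A" using x by (simp add: space)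
  show "Z \<in> lie_algebra G A"
    using tangent_map_in[OF atl atl left_smooth[OF inv_closed[OF x]] xA v] x by (simp add: Z_def lie_algebra_eq)
  show "linv Z x = v"
    using left_translate_inverse[of "inv x" x v] x v by (simp add: Z_def linv_def)
qed

lemma linv_smooth:
  assumes Z: "Z \<in> lie_algebra G A"
  shows "smooth_vf A (linv Z)"
  unfolding smooth_vf_def
proof (intro conjI ballI)
  show "linv Z p \<in> tangent_space A p" if "p \<in> atlas_space A" for p
    using linv_in[OF Z] that by (simp add: space)
  fix c assume c: "c \<in> A"
  obtain c1 where c1: "c1 \<in> A" "\<one> \<in> fst c1" using atlas_spaceE[of \<one> A] by (auto simp: space)
  let ?F = "\<lambda>(x, y). x \<otimes> y"
  let ?M = "\<lambda>z. snd c (?F (cinv (prod_chart c c1) z))"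
  let ?R = "snd (prod_chart c c1) ` {p \<in> fst (prod_chart c c1). ?F p \<in> fst c}"
  note M = smooth_map_lrep[OF fd_atlas_prod[OF atl atl] mult_smooth prod_chart_in[OF c c1(1)] c]
  have carr: "x \<in> carrier G" if "x \<in> fst c" for x using atlas_spaceI[OF c that] by (simp add: space)
  have inR: "(y, snd c1 \<one>) \<in> ?R" if "y \<in> snd c ` fst c" for y
    using that c1(2) carr by (auto intro!: image_eqI[of _ _ "(_, \<one>)"])
  have "smooth_on (snd c ` fst c) (\<lambda>y. frechet_derivative ?M (at (y, snd c1 \<one>)) (0, Z c1))"
    by (rule smooth_on_derivative_compose[OF finite_dimensional_prod[OF fd_atlas_dim[OF atl] fd_atlas_dim[OF atl]]
        chart_open[OF atl c] M(1) smooth_on_Pair[OF chart_open[OF atl c] smooth_on_id smooth_on_const] smooth_on_const M(2) inR])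
  then show "smooth_on (snd c ` fst c) (\<lambda>y. linv Z (cinv c y) c)"
  proof (rule smooth_on_cong[OF chart_open[OF atl c]])
    fix y assume y: "y \<in> snd c ` fst c"
    have p: "cinv c y \<in> fst c" by (rule cinv_in[OF atl c y])
    have "cinv c y \<otimes> \<one> \<in> fst c" using p carr by simp
    with partial_tangent_right[OF atl atl atl mult_smooth c p c1 c, of Z] Z
    show "frechet_derivative ?M (at (y, snd c1 \<one>)) (0, Z c1) = linv Z (cinv c y) c"
      by (simp add: linv_def lie_algebra_eq chart_cinv[OF y])
  qed
qed

text \<open>
  The multiplication relates the fields \<open>(Y\<^sup>R, 0)\<close> and \<open>(0, Z\<^sup>L)\<close> on \<open>G \<times> G\<close>, which obviously
  commute, to \<open>Y\<^sup>R\<close> and \<open>Z\<^sup>L\<close>.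
\<close>

lemma rinv_linv_commute:
  assumes Y: "Y \<in> lie_algebra G A" and Z: "Z \<in> lie_algebra G A" and s: "s \<in> carrier G"
  shows "vf_bracket A (rinv Y) (linv Z) s = 0"
proof -
  let ?P = "prod_atlas A A"
  note P = fd_atlas_prod[OF atl atl]
  define Y' where "Y' = (\<lambda>(p, q). tangent_map A ?P (\<lambda>x. (x, q)) p (rinv Y p))"
  define Z' where "Z' = (\<lambda>(p, q). tangent_map A ?P (\<lambda>x. (p, x)) q (linv Z q))"
  have incl1: "smooth_map A ?P (\<lambda>x. (x, q))" if "q \<in> carrier G" for q
    using smooth_map_Pair[OF atl atl atl smooth_map_id[OF atl] smooth_map_const[OF atl atl]] that by (simp add: space)
  have incl2: "smooth_map A ?P (\<lambda>x. (p, x))" if "p \<in> carrier G" for p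
    using smooth_map_Pair[OF atl atl atl smooth_map_const[OF atl atl] smooth_map_id[OF atl]] that by (simp add: space)
  have carr: "x \<in> carrier G" if "c \<in> A" "x \<in> fst c" for x c using atlas_spaceI[OF that] by (simp add: space)
  have Y'c: "Y' (p, q) (prod_chart c d) = (rinv Y p c, 0)" and Z'c: "Z' (p, q) (prod_chart c d) = (0, linv Z q d)"
    if "c \<in> A" "p \<in> fst c" "d \<in> A" "q \<in> fst d" for c p d q
    using tangent_map_inclusion[OF atl atl that rinv_in[OF Y carr[OF that(1,2)]]]
      tangent_map_inclusion'[OF atl atl that linv_in[OF Z carr[OF that(3,4)]]] by (auto simp: Y'_def Z'_def)
  have loc: "snd (prod_chart c d) ` fst (prod_chart c d) = (snd c ` fst c) \<times> (snd d ` fst d)" for c d :: "('g, 'm) chart"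
    by (auto simp: prod_chart_def map_prod_surj_on)
  have Y'l: "Y' (cinv (prod_chart c d) y) (prod_chart c d) = (rinv Y (cinv c (fst y)) c, 0)"
    and Z'l: "Z' (cinv (prod_chart c d) y) (prod_chart c d) = (0, linv Z (cinv d (snd y)) d)"
    if c: "c \<in> A" and d: "d \<in> A" and y: "y \<in> (snd c ` fst c) \<times> (snd d ` fst d)" for c d y
  proof -
    have y': "fst y \<in> snd c ` fst c" "snd y \<in> snd d ` fst d" using y by auto
    have "cinv (prod_chart c d) y = (cinv c (fst y), cinv d (snd y))"
      using cinv_prod_chart[OF atl atl c d y'] by simp
    then show "Y' (cinv (prod_chart c d) y) (prod_chart c d) = (rinv Y (cinv c (fst y)) c, 0)"
      "Z' (cinv (prod_chart c d) y) (prod_chart c d) = (0, linv Z (cinv d (snd y)) d)"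
      using Y'c[OF c cinv_in[OF atl c y'(1)] d cinv_in[OF atl d y'(2)]]
        Z'c[OF c cinv_in[OF atl c y'(1)] d cinv_in[OF atl d y'(2)]] by simp_all
  qed
  have Y'T: "Y' p \<in> tangent_space ?P p" and Z'T: "Z' p \<in> tangent_space ?P p" if "p \<in> atlas_space ?P" for p
  proof -
    have p: "fst p \<in> carrier G" "snd p \<in> carrier G" using that by (auto simp: space)
    show "Y' p \<in> tangent_space ?P p"
      using tangent_map_in[OF atl P incl1[OF p(2)] _ rinv_in[OF Y p(1)]] p by (simp add: Y'_def split_beta space)
    show "Z' p \<in> tangent_space ?P p"
      using tangent_map_in[OF atl P incl2[OF p(1)] _ linv_in[OF Z p(2)]] p by (simp add: Z'_def split_beta space)
  qed
  have op: "open ((snd c ` fst c) \<times> (snd d ` fst d))" if "c \<in> A" "d \<in> A" for c d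
    using that by (intro open_Times chart_open[OF atl])
  have smY: "smooth_on ((snd c ` fst c) \<times> (snd d ` fst d)) (\<lambda>y. rinv Y (cinv c (fst y)) c)"
    and smZ: "smooth_on ((snd c ` fst c) \<times> (snd d ` fst d)) (\<lambda>y. linv Z (cinv d (snd y)) d)"
    if "c \<in> A" "d \<in> A" for c d
  proof -
    have "smooth_on (snd c ` fst c) (\<lambda>y. rinv Y (cinv c y) c)" "smooth_on (snd d ` fst d) (\<lambda>y. linv Z (cinv d y) d)"
      using rinv_smooth[OF Y] linv_smooth[OF Z] that by (auto simp: smooth_vf_def)
    from smooth_on_compose[OF fd_atlas_dim[OF atl] op[OF that] chart_open[OF atl that(1)] smooth_on_bounded_linear[OF bounded_linear_fst] this(1)]
      smooth_on_compose[OF fd_atlas_dim[OF atl] op[OF that] chart_open[OF atl that(2)] smooth_on_bounded_linear[OF bounded_linear_snd] this(2)]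
    show "smooth_on ((snd c ` fst c) \<times> (snd d ` fst d)) (\<lambda>y. rinv Y (cinv c (fst y)) c)"
      "smooth_on ((snd c ` fst c) \<times> (snd d ` fst d)) (\<lambda>y. linv Z (cinv d (snd y)) d)" by auto
  qed
  have Y's: "smooth_vf ?P Y'"
    unfolding smooth_vf_def
  proof (intro conjI ballI Y'T)
    fix e assume "e \<in> ?P"
    then obtain c d where cd: "c \<in> A" "d \<in> A" "e = prod_chart c d" by (rule prod_atlas_cases)
    show "smooth_on (snd e ` fst e) (\<lambda>y. Y' (cinv e y) e)"
      unfolding cd(3) loc
      by (rule smooth_on_cong[OF op[OF cd(1,2)] smooth_on_Pair[OF op[OF cd(1,2)] smY[OF cd(1,2)] smooth_on_const[of _ 0]]])
        (rule Y'l[OF cd(1,2), symmetric])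
  qed
  have Z's: "smooth_vf ?P Z'"
    unfolding smooth_vf_def
  proof (intro conjI ballI Z'T)
    fix e assume "e \<in> ?P"
    then obtain c d where cd: "c \<in> A" "d \<in> A" "e = prod_chart c d" by (rule prod_atlas_cases)
    show "smooth_on (snd e ` fst e) (\<lambda>y. Z' (cinv e y) e)"
      unfolding cd(3) loc
      by (rule smooth_on_cong[OF op[OF cd(1,2)] smooth_on_Pair[OF op[OF cd(1,2)] smooth_on_const[of _ 0] smZ[OF cd(1,2)]]])
        (rule Z'l[OF cd(1,2), symmetric])
  qed
  have s1: "(s, \<one>) \<in> atlas_space ?P" using s by (simp add: space)
  obtain c d where c: "c \<in> A" "s \<in> fst c" and d: "d \<in> A" "\<one> \<in> fst d" using s1 by (auto elim!: atlas_spaceE)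
  have "vf_bracket ?P Y' Z' (s, \<one>) = 0"
  proof (rule tangent_space_eqI[OF vf_bracket_in[OF P Y's Z's] tangent_space_zero[OF P]])
    show e: "prod_chart c d \<in> ?P" by (rule prod_chart_in[OF c(1) d(1)])
    show in': "(s, \<one>) \<in> fst (prod_chart c d)" using c d by simp
    have sin: "(snd c s, snd d \<one>) \<in> (snd c ` fst c) \<times> (snd d ` fst d)" using c d by simp
    \<comment> \<open>In product charts \<open>Z'\<close> depends on the second coordinate only
      while \<open>Y'\<close> points along the first; with the roles exchanged in \<open>dY\<close>,
      both terms of the bracket vanish.\<close>
    have dZ: "frechet_derivative (\<lambda>y. Z' (cinv (prod_chart c d) y) (prod_chart c d)) (at (snd c s, snd d \<one>)) (v, 0) = 0" for v
    proof -
      have "((\<lambda>y. linv Z (cinv d y) d) has_derivative frechet_derivative (\<lambda>y. linv Z (cinv d y) d) (at (snd d \<one>))) (at (snd d \<one>))"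
        by (rule smooth_on_has_derivative[of "snd d ` fst d"]) (use linv_smooth[OF Z] d in \<open>auto simp: smooth_vf_def\<close>)
      then have h1: "((\<lambda>y. (0, linv Z (cinv d (snd y)) d)) has_derivative
          (\<lambda>h. (0, frechet_derivative (\<lambda>y. linv Z (cinv d y) d) (at (snd d \<one>)) (snd h)))) (at (snd c s, snd d \<one>))"
        by (intro has_derivative_Pair has_derivative_const
            has_derivative_compose[OF bounded_linear_imp_has_derivative[OF bounded_linear_snd]]) simp
      have h2: "frechet_derivative (\<lambda>y. Z' (cinv (prod_chart c d) y) (prod_chart c d)) (at (snd c s, snd d \<one>)) =
          frechet_derivative (\<lambda>y. (0, linv Z (cinv d (snd y)) d)) (at (snd c s, snd d \<one>))"
        by (rule frechet_derivative_cong_open[OF op[OF c(1) d(1)] sin Z'l[OF c(1) d(1)]])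
      have lin: "linear (frechet_derivative (\<lambda>y. linv Z (cinv d y) d) (at (snd d \<one>)))"
        using has_derivative_linear
          smooth_on_has_derivative[of "snd d ` fst d" "\<lambda>y. linv Z (cinv d y) d" "snd d \<one>"] linv_smooth[OF Z] d
        by (auto simp: smooth_vf_def)
      show ?thesis unfolding trans[OF h2 frechet_derivative_eqI[OF h1]]
        by (simp add: linear_0[OF lin] zero_prod_def)
    qed
    have dY: "frechet_derivative (\<lambda>y. Y' (cinv (prod_chart c d) y) (prod_chart c d)) (at (snd c s, snd d \<one>)) (0, w) = 0" for w
    proof -
      have "((\<lambda>y. rinv Y (cinv c y) c) has_derivative frechet_derivative (\<lambda>y. rinv Y (cinv c y) c) (at (snd c s))) (at (snd c s))"
        by (rule smooth_on_has_derivative[of "snd c ` fst c"]) (use rinv_smooth[OF Y] c in \<open>auto simp: smooth_vf_def\<close>)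
      then have h1: "((\<lambda>y. (rinv Y (cinv c (fst y)) c, 0)) has_derivative
          (\<lambda>h. (frechet_derivative (\<lambda>y. rinv Y (cinv c y) c) (at (snd c s)) (fst h), 0))) (at (snd c s, snd d \<one>))"
        by (intro has_derivative_Pair has_derivative_const
            has_derivative_compose[OF bounded_linear_imp_has_derivative[OF bounded_linear_fst]]) simp
      have h2: "frechet_derivative (\<lambda>y. Y' (cinv (prod_chart c d) y) (prod_chart c d)) (at (snd c s, snd d \<one>)) =
          frechet_derivative (\<lambda>y. (rinv Y (cinv c (fst y)) c, 0)) (at (snd c s, snd d \<one>))"
        by (rule frechet_derivative_cong_open[OF op[OF c(1) d(1)] sin Y'l[OF c(1) d(1)]])
      have lin: "linear (frechet_derivative (\<lambda>y. rinv Y (cinv c y) c) (at (snd c s)))"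
        using has_derivative_linear
          smooth_on_has_derivative[of "snd c ` fst c" "\<lambda>y. rinv Y (cinv c y) c" "snd c s"] rinv_smooth[OF Y] c
        by (auto simp: smooth_vf_def)
      show ?thesis unfolding trans[OF h2 frechet_derivative_eqI[OF h1]]
        by (simp add: linear_0[OF lin] zero_prod_def)
    qed
    show "vf_bracket ?P Y' Z' (s, \<one>) (prod_chart c d) = 0 (prod_chart c d)"
      using dY dZ Y'c[OF c d] Z'c[OF c d] by (simp add: vf_bracket_apply)
  qed
  moreover have "vf_bracket A (rinv Y) (linv Z) ((\<lambda>(x, y). x \<otimes> y) (s, \<one>)) =
      tangent_map ?P A (\<lambda>(x, y). x \<otimes> y) (s, \<one>) (vf_bracket ?P Y' Z' (s, \<one>))"
  proof (rule vf_bracket_related[OF P atl mult_smooth Y's Z's rinv_smooth[OF Y] linv_smooth[OF Z] _ _ s1])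
    fix p assume p: "p \<in> atlas_space ?P"
    then have p': "fst p \<in> carrier G" "snd p \<in> carrier G" by (auto simp: space)
    show "rinv Y ((\<lambda>(x, y). x \<otimes> y) p) = tangent_map ?P A (\<lambda>(x, y). x \<otimes> y) p (Y' p)"
      using tangent_map_compose[OF atl P atl incl1[OF p'(2)] mult_smooth _ rinv_in[OF Y p'(1)]] p'
        rinv_translate[OF Y p'] by (simp add: Y'_def split_beta space)
    show "linv Z ((\<lambda>(x, y). x \<otimes> y) p) = tangent_map ?P A (\<lambda>(x, y). x \<otimes> y) p (Z' p)"
      using tangent_map_compose[OF atl P atl incl2[OF p'(1)] mult_smooth _ linv_in[OF Z p'(2)]] p'
        linv_translate[OF Z p'] by (simp add: Z'_def split_beta space)
  qed
  moreover have "tangent_map ?P A (\<lambda>(x, y). x \<otimes> y) (s, \<one>) 0 = 0"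
    using tangent_map_fscale[OF P mult_smooth s1 tangent_space_zero[OF P], of 0]
    by (simp add: fscale_def zero_fun_def)
  ultimately show ?thesis using s by simp
qed

text \<open>On the one-parameter subgroup of \<open>Y\<close> the inversion reverses time, so the
  tangent map is read off from velocities at 0.\<close>

lemma tangent_map_inverse_one:
  assumes inv_smooth: "smooth_map A A (\<lambda>x. inv x)" and Y: "Y \<in> lie_algebra G A"
  shows "tangent_map A A (\<lambda>x. inv x) \<one> Y = fscale (- 1) Y"
proof -
  obtain c where c: "smooth_map real_atlas A c" "\<And>s t. c (s + t) = c s \<otimes> c t" "velocity A c 0 = Y"
    using one_parameter_subgroup_exists[OF Y] by blast
  note s = one_parameter_subgroup_simps(1,2)[OF c(1,2)]
  have "inv (c t) = c (- t)" for t
    using c(2)[of t "- t"] s by (intro inv_equality) (simp_all add: c(2)[symmetric])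
  then have eq: "tangent_map A A (\<lambda>x. inv x) \<one> Y = velocity A (\<lambda>t. c (- t)) 0"
    using velocity_compose[OF atl atl inv_smooth c(1), of 0] by (simp add: s c(3))
  obtain c1 where c1: "c1 \<in> A" "\<one> \<in> fst c1" using atlas_spaceE[of \<one> A] by (auto simp: space)
  have sm: "smooth_map real_atlas A (\<lambda>t. c (- t))"
  proof -
    have "smooth_map real_atlas real_atlas (\<lambda>t. - t)"
      by (rule smooth_map_realI[OF fd_atlas_real])
        (auto intro!: smooth_on_bounded_linear bounded_linear_minus bounded_linear_ident)
    then show ?thesis by (rule smooth_map_compose[OF fd_atlas_real fd_atlas_real atl _ c(1)])
  qed
  have m: "((\<lambda>s. - s) has_vector_derivative - 1) (at (0::real))" by (auto intro!: derivative_eq_intros)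
  have "((\<lambda>t. snd c1 (c t)) has_vector_derivative Y c1) (at (- 0))"
    using smooth_curve_near(2)[OF atl c(1) c1(1), of 0] c1 by (simp add: s c(3))
  from vector_diff_chain_at[OF m this]
  have *: "((\<lambda>t. snd c1 (c (- t))) has_vector_derivative fscale (- 1) Y c1) (at 0)"
    by (simp add: comp_def fscale_apply)
  have "velocity A (\<lambda>t. c (- t)) 0 = fscale (- 1) Y"
  proof (rule velocity_eqI[where \<gamma>="\<lambda>t. c (- t)" and t=0 and c=c1 and v="fscale (- 1) Y", OF atl c1(1) _ _ _ *])
    show "c (- 0) \<in> fst c1" using c1 by (simp add: s)
    show "fscale (- 1) Y \<in> tangent_space A (c (- 0))"
      using tangent_space_fscale[OF atl] Y s(2) by (simp only: minus_zero lie_algebra_eq)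
    show "eventually (\<lambda>t. c (- t) \<in> fst c1) (at 0)"
      using smooth_curve_near(1)[OF atl sm c1(1), of 0] c1 by (simp add: s)
  qed
  with eq show ?thesis by simp
qed

end

section \<open>The action of the semi-direct product\<close>

locale lie_inv = lie_grp +
  assumes inv_smooth: "smooth_map A A (\<lambda>x. inv x)"
begin

lemma smooth_map_mult:
  assumes P: "fd_atlas P" and F: "smooth_map P A F" and H: "smooth_map P A H"
  shows "smooth_map P A (\<lambda>p. F p \<otimes> H p)"
  using smooth_map_compose[OF P fd_atlas_prod[OF atl atl] atl smooth_map_Pair[OF P atl atl F H] mult_smooth] by simp

lemma smooth_map_inv:
  assumes P: "fd_atlas P" and F: "smooth_map P A F"
  shows "smooth_map P A (\<lambda>p. inv (F p))"
  by (rule smooth_map_compose[OF P atl atl F inv_smooth])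

lemma left_division_smooth: "smooth_map (prod_atlas A A) A (\<lambda>(x, y). inv x \<otimes> y)"
  using smooth_map_mult[OF fd_atlas_prod[OF atl atl] smooth_map_inv[OF fd_atlas_prod[OF atl atl] smooth_map_fst[OF atl atl]] smooth_map_snd[OF atl atl]]
  by (simp add: split_beta')

lemma covector_linv_linear:
  assumes y: "y \<in> carrier G" and \<zeta>: "\<zeta> \<in> cotangent_space A y" and c: "c \<in> A" "\<one> \<in> fst c"
  shows "linear (\<lambda>w. \<zeta> (linv (coord_vector A c \<one> w) y))"
proof (rule linearI)
  have one: "\<one> \<in> atlas_space A" by (simp add: space)
  note cv = coord_vector_in[OF atl c]
  have cvl: "coord_vector A c \<one> w \<in> lie_algebra G A" for w by (simp add: lie_algebra_eq cv)
  fix v w a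
  have "linv (coord_vector A c \<one> (v + w)) y = linv (coord_vector A c \<one> v) y + linv (coord_vector A c \<one> w) y"
    unfolding linv_def coord_vector_add[OF atl c] by (rule tangent_map_add[OF atl left_smooth[OF y] one cv cv])
  then show "\<zeta> (linv (coord_vector A c \<one> (v + w)) y) = \<zeta> (linv (coord_vector A c \<one> v) y) + \<zeta> (linv (coord_vector A c \<one> w) y)"
    by (simp add: cotangent_add[OF \<zeta> linv_in[OF cvl y] linv_in[OF cvl y]])
  have "linv (coord_vector A c \<one> (a *\<^sub>R v)) y = fscale a (linv (coord_vector A c \<one> v) y)"
    unfolding linv_def coord_vector_fscale[OF atl c] by (rule tangent_map_fscale[OF atl left_smooth[OF y] one cv])
  then show "\<zeta> (linv (coord_vector A c \<one> (a *\<^sub>R v)) y) = a *\<^sub>R \<zeta> (linv (coord_vector A c \<one> v) y)"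
    by (simp add: cotangent_fscale[OF \<zeta> linv_in[OF cvl y]])
qed

text \<open>Left-invariant fields trivialise the cotangent bundle.\<close>

lemma smooth_map_cotangent_linvI:
  assumes P: "fd_atlas P" and base: "smooth_map P A (\<lambda>p. fst (F p))"
    and fib: "\<And>p. p \<in> atlas_space P \<Longrightarrow> snd (F p) \<in> cotangent_space A (fst (F p))"
    and sm: "\<And>Z. Z \<in> lie_algebra G A \<Longrightarrow> smooth_map P real_atlas (\<lambda>p. snd (F p) (linv Z (fst (F p))))"
  shows "smooth_map P (cotangent_atlas A) F"
proof (rule smooth_map_cotangentI[OF atl P])
  fix p assume p: "p \<in> atlas_space P"
  obtain e where e: "e \<in> P" "p \<in> fst e" using p by (rule atlas_spaceE)
  obtain d where d: "d \<in> A" "fst (F p) \<in> fst d" using smooth_map_space[OF base p] by (rule atlas_spaceE)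
  obtain c1 where c1: "c1 \<in> A" "\<one> \<in> fst c1" using atlas_spaceE[of \<one> A] by (auto simp: space)
  define Q where "Q = snd e ` {x \<in> fst e. fst (F x) \<in> fst d}"
  define u where "u = (\<lambda>y. snd d (fst (F (cinv e y))))"
  have oQ: "open Q" and smb: "smooth_on Q u"
    unfolding Q_def u_def using smooth_map_lrep[OF P base e(1) d(1)] by auto
  have in': "cinv e y \<in> fst e" "fst (F (cinv e y)) \<in> fst d" if "y \<in> Q" for y
    using chart_image_mem[OF P e(1), of y "\<lambda>x. fst (F x) \<in> fst d"] that by (auto simp: Q_def)
  have inP: "cinv e y \<in> atlas_space P" if "y \<in> Q" for y by (rule atlas_spaceI[OF e(1) in'(1)[OF that]])
  have carr: "x \<in> carrier G" if "x \<in> fst d" for x using atlas_spaceI[OF d(1) that] by (simp add: space)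
  obtain B :: "'b set" and co where B: "finite B" "\<And>b. bounded_linear (co b)"
    "\<And>x. (\<Sum>b\<in>B. co b x *\<^sub>R b) = x"
    using finite_dimensional_frame[OF fd_atlas_dim[OF atl]] by metis
  let ?L = "\<lambda>z. snd c1 ((\<lambda>(x, y). inv x \<otimes> y) (cinv (prod_chart d d) z))"
  let ?R = "snd (prod_chart d d) ` {p \<in> fst (prod_chart d d). (\<lambda>(x, y). inv x \<otimes> y) p \<in> fst c1}"
  note L = smooth_map_lrep[OF fd_atlas_prod[OF atl atl] left_division_smooth prod_chart_in[OF d(1) d(1)] c1(1)]
  have uR: "(u y, u y) \<in> ?R" if "y \<in> Q" for y
    using in'(2)[OF that] carr[OF in'(2)[OF that]] c1(2)
    by (auto simp: u_def intro!: image_eqI[of _ _ "(fst (F (cinv e y)), fst (F (cinv e y)))"])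
  have "smooth_on Q (\<lambda>y. snd (F (cinv e y)) (coord_vector A d (fst (F (cinv e y))) w))" for w
  proof -
    \<comment> \<open>\<open>z y\<close> is the coordinate, at the unit, of the coordinate vector
      \<open>w\<close> carried there by left translation with the inverse of the base point. It
      varies smoothly, and expanding it in a frame leaves only pairings with fixed left-invariant
      fields.\<close>
    define z where "z = (\<lambda>y. frechet_derivative ?L (at (u y, u y)) (0, w))"
    have smz: "smooth_on Q z" unfolding z_def
      by (rule smooth_on_derivative_compose[OF finite_dimensional_prod[OF fd_atlas_dim[OF atl] fd_atlas_dim[OF atl]]
          oQ L(1) smooth_on_Pair[OF oQ smb smb] smooth_on_const L(2) uR])
    have "smooth_on Q (\<lambda>y. \<Sum>b\<in>B. co b (z y) *\<^sub>R snd (F (cinv e y)) (linv (coord_vector A c1 \<one> b) (fst (F (cinv e y)))))"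
    proof (intro smooth_on_sum smooth_on_scaleR oQ smooth_on_bounded_linear_compose[OF B(2)] smz)
      fix b
      have "coord_vector A c1 \<one> b \<in> lie_algebra G A" by (simp add: lie_algebra_eq coord_vector_in[OF atl c1])
      from smooth_map_realD[OF P sm[OF this] e(1)]
      show "smooth_on Q (\<lambda>y. snd (F (cinv e y)) (linv (coord_vector A c1 \<one> b) (fst (F (cinv e y)))))"
        by (rule smooth_on_subset) (auto simp: Q_def)
    qed
    then show ?thesis
    proof (rule smooth_on_cong[OF oQ])
      fix y assume y: "y \<in> Q"
      let ?y = "fst (F (cinv e y))" and ?\<zeta> = "snd (F (cinv e y))"
      have yG: "?y \<in> carrier G" by (rule carr[OF in'(2)[OF y]])
      have \<zeta>: "?\<zeta> \<in> cotangent_space A ?y" by (rule fib[OF inP[OF y]])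
      note cv = coord_vector_in[OF atl d(1) in'(2)[OF y], of w]
      define Z where "Z = tangent_map A A (\<lambda>z. inv ?y \<otimes> z) ?y (coord_vector A d ?y w)"
      note Z = linv_surj[OF yG cv, folded Z_def]
      have "Z c1 = z y"
        unfolding Z_def z_def u_def
        using partial_tangent_right[OF atl atl atl left_division_smooth d(1) in'(2)[OF y] d(1) in'(2)[OF y] c1(1) _ cv]
          yG c1(2) coord_vector_self[OF atl d(1) in'(2)[OF y], of w] by simp
      then have Zz: "coord_vector A c1 \<one> (z y) = Z"
        using coord_vector_component[OF atl c1, of Z] Z(1) by (simp add: lie_algebra_eq)
      note lin = covector_linv_linear[OF yG \<zeta> c1]
      have "?\<zeta> (coord_vector A d ?y w) = ?\<zeta> (linv (coord_vector A c1 \<one> (z y)) ?y)" unfolding Zz Z(2) ..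
      also have "\<dots> = ?\<zeta> (linv (coord_vector A c1 \<one> (\<Sum>b\<in>B. co b (z y) *\<^sub>R b)) ?y)" by (simp only: B(3))
      also have "\<dots> = (\<Sum>b\<in>B. co b (z y) *\<^sub>R ?\<zeta> (linv (coord_vector A c1 \<one> b) ?y))"
        by (simp only: linear_sum[OF lin] linear_scale[OF lin])
      finally show "(\<Sum>b\<in>B. co b (z y) *\<^sub>R ?\<zeta> (linv (coord_vector A c1 \<one> b) ?y)) = ?\<zeta> (coord_vector A d ?y w)" by simp
    qed
  qed
  moreover have "snd e p \<in> Q" "Q \<subseteq> snd e ` fst e" using e d by (auto simp: Q_def)
  ultimately show "\<exists>e\<in>P. \<exists>c\<in>A. \<exists>Q. p \<in> fst e \<and> open Q \<and> snd e p \<in> Q \<and> Q \<subseteq> snd e ` fst e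
      \<and> (\<forall>y\<in>Q. fst (F (cinv e y)) \<in> fst c \<and> snd (F (cinv e y)) \<in> cotangent_space A (fst (F (cinv e y))))
      \<and> smooth_on Q (\<lambda>y. snd c (fst (F (cinv e y))))
      \<and> (\<forall>w. smooth_on Q (\<lambda>y. snd (F (cinv e y)) (coord_vector A c (fst (F (cinv e y))) w)))"
    using oQ smb in' fib[OF inP] e(2) unfolding u_def
    by (intro bexI[OF _ e(1)] bexI[OF _ d(1)] exI[of _ Q]) blast
qed

lemma cotangent_linv_eqI:
  assumes x: "fst \<xi> \<in> carrier G" and \<xi>: "snd \<xi> \<in> cotangent_space A (fst \<xi>)" and \<xi>': "snd \<xi>' \<in> cotangent_space A (fst \<xi>')"
    and base: "fst \<xi> = fst \<xi>'"
    and eq: "\<And>Z. Z \<in> lie_algebra G A \<Longrightarrow> snd \<xi> (linv Z (fst \<xi>)) = snd \<xi>' (linv Z (fst \<xi>))"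
  shows "\<xi> = \<xi>'"
proof -
  have "snd \<xi> = snd \<xi>'"
  proof (rule cotangent_eqI[OF \<xi>])
    show "snd \<xi>' \<in> cotangent_space A (fst \<xi>)" using \<xi>' base by simp
    fix v assume v: "v \<in> tangent_space A (fst \<xi>)"
    from linv_surj[OF x v] eq show "snd \<xi> v = snd \<xi>' v" by metis
  qed
  then show ?thesis using base by (simp add: prod_eq_iff)
qed

end

text \<open>\<open>cV\<close> witnesses that the model space has the dimension of \<open>V\<close>,
  so that the atlas of \<open>V\<close> is not empty. Functions in \<open>V\<close> vanish off the
  carrier, which turns equality on the group into equality of functions.\<close>

locale lie_rep = lie_inv G A for G :: "'g monoid" (structure) and A :: "('g, 'm::banach) atlas" +
  fixes V :: "('g \<Rightarrow> real) set" and cV :: "('g \<Rightarrow> real, 'v::banach) chart"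
  assumes V: "fd_subspace V" and fdV: "finite_dimensional TYPE('v)" and cV: "cV \<in> vector_atlas V"
    and V_smooth: "f \<in> V \<Longrightarrow> smooth_map A real_atlas f" and V_outside: "f \<in> V \<Longrightarrow> x \<notin> carrier G \<Longrightarrow> f x = 0"
    and V_translate: "g \<in> carrier G \<Longrightarrow> f \<in> V \<Longrightarrow> translate G g f \<in> V"
begin

abbreviation VA :: "('g \<Rightarrow> real, 'v) atlas" where "VA \<equiv> vector_atlas V"
abbreviation SA :: "('g \<times> ('g \<Rightarrow> real), 'm \<times> 'v) atlas" where "SA \<equiv> semidirect_atlas A V"
abbreviation T where "T \<equiv> cotangent_atlas A"

lemma VA: "fd_atlas VA" by (rule fd_atlas_vector[OF V fdV])
lemma VA_space: "atlas_space VA = V" by (rule atlas_space_vector[OF cV])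
lemma SA: "fd_atlas SA" unfolding semidirect_atlas_def by (rule fd_atlas_prod[OF atl VA])
lemma SA_space: "atlas_space SA = carrier G \<times> V" by (simp add: semidirect_atlas_def VA_space space)
lemma TA: "fd_atlas T" by (rule fd_atlas_cotangent[OF atl])
lemma T_space: "\<xi> \<in> atlas_space T \<longleftrightarrow> fst \<xi> \<in> carrier G \<and> snd \<xi> \<in> cotangent_space A (fst \<xi>)"
  by (simp add: cotangent_atlas_space space Sigma_iff_fst_snd)
lemma S_fst: "smooth_map SA A fst" unfolding semidirect_atlas_def by (rule smooth_map_fst[OF atl VA])
lemma S_snd: "smooth_map SA VA snd" unfolding semidirect_atlas_def by (rule smooth_map_snd[OF atl VA])
lemma S_simps: "carrier (semidirect G V) = carrier G \<times> V"
  "s \<otimes>\<^bsub>semidirect G V\<^esub> s' = (fst s \<otimes> fst s', snd s + translate G (fst s) (snd s'))" "\<one>\<^bsub>semidirect G V\<^esub> = (\<one>, 0)"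
  by (simp_all add: semidirect_def split_beta)

text \<open>Evaluation is jointly smooth in function and point: by the point frame of
  \<open>V\<close> the value of \<open>f\<close> at \<open>y\<close> is a finite sum of products
  \<open>f x * e x y\<close>, in which the two arguments are separated.\<close>

lemma smooth_map_eval:
  assumes P: "fd_atlas P" and h: "smooth_map P A h" and k: "smooth_map P VA k"
  shows "smooth_map P real_atlas (\<lambda>p. k p (h p))"
proof -
  obtain X e where X: "finite X" "\<And>x. x \<in> X \<Longrightarrow> e x \<in> V" "\<And>f. f \<in> V \<Longrightarrow> f = (\<Sum>x\<in>X. fscale (f x) (e x))"
    using fd_subspace_point_frame[OF V] by metis
  show ?thesis
  proof (rule smooth_map_cong[OF P fd_atlas_real])
    show "smooth_map P real_atlas (\<lambda>p. \<Sum>x\<in>X. k p x * e x (h p))"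
      by (intro smooth_map_real_sum smooth_map_real_mult P smooth_map_compose[OF P atl fd_atlas_real h V_smooth[OF X(2)]]
          smooth_map_compose[OF P VA fd_atlas_real k smooth_map_linear[OF V fdV linear_on_subspace_eval]])
    fix p assume "p \<in> atlas_space P"
    then have "k p \<in> V" using smooth_map_space[OF k] by (simp add: VA_space)
    from fun_cong[OF X(3)[OF this], of "h p"]
    show "(\<Sum>x\<in>X. k p x * e x (h p)) = k p (h p)" by (simp add: sum_function_apply fscale_apply)
  qed
qed

lemma smooth_map_point_eval:
  assumes P: "fd_atlas P" and k: "smooth_map P VA k"
  shows "smooth_map P real_atlas (\<lambda>p. k p x)"
  by (rule smooth_map_compose[OF P VA fd_atlas_real k smooth_map_linear[OF V fdV linear_on_subspace_eval]])

lemma translate_one: "f \<in> V \<Longrightarrow> translate G \<one> f = f"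
  by (auto simp: translate_def fun_eq_iff V_outside)

lemma translate_mult: "g \<in> carrier G \<Longrightarrow> h \<in> carrier G \<Longrightarrow> translate G (g \<otimes> h) f = translate G g (translate G h f)"
  by (auto simp: translate_def fun_eq_iff inv_mult_group m_assoc)

lemma translate_add: "translate G g (f + f') = translate G g f + translate G g f'"
  by (auto simp: translate_def fun_eq_iff)

lemma semidirect_group: "group (semidirect G V)"
proof (rule groupI, unfold S_simps)
  fix s s' s'' assume s: "s \<in> carrier G \<times> V" and s': "s' \<in> carrier G \<times> V" and s'': "s'' \<in> carrier G \<times> V"
  then show "(fst s \<otimes> fst s', snd s + translate G (fst s) (snd s')) \<in> carrier G \<times> V"
    by (auto intro!: fd_subspace_add[OF V] V_translate)
  show "(fst (fst s \<otimes> fst s', snd s + translate G (fst s) (snd s')) \<otimes> fst s'',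
      snd (fst s \<otimes> fst s', snd s + translate G (fst s) (snd s')) +
      translate G (fst (fst s \<otimes> fst s', snd s + translate G (fst s) (snd s'))) (snd s'')) =
    (fst s \<otimes> fst (fst s' \<otimes> fst s'', snd s' + translate G (fst s') (snd s'')),
      snd s + translate G (fst s) (snd (fst s' \<otimes> fst s'', snd s' + translate G (fst s') (snd s''))))"
    using s s' s'' by (auto simp: m_assoc translate_mult translate_add add.assoc)
next
  show "(\<one>, 0) \<in> carrier G \<times> V" using fd_subspace_zero[OF V] by simp
next
  fix s assume s: "s \<in> carrier G \<times> V"
  then show "(fst (\<one>, 0) \<otimes> fst s, snd (\<one>, 0) + translate G (fst (\<one>, 0)) (snd s)) = s"
    by (auto simp: translate_one)
  have "(inv (fst s), fscale (- 1) (translate G (inv (fst s)) (snd s))) \<in> carrier G \<times> V"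
    using s fd_subspace_scale[OF V, of "translate G (inv (fst s)) (snd s)" "- 1"] V_translate[of "inv (fst s)" "snd s"] by auto
  moreover have "fscale (- 1) f + f = 0" for f :: "'g \<Rightarrow> real" by (simp add: fun_eq_iff fscale_apply)
  then have "(inv (fst s) \<otimes> fst s, fscale (- 1) (translate G (inv (fst s)) (snd s)) + translate G (inv (fst s)) (snd s)) = (\<one>, 0)"
    using s by auto
  ultimately show "\<exists>y\<in>carrier G \<times> V. (fst y \<otimes> fst s, snd y + translate G (fst y) (snd s)) = (\<one>, 0)"
    by (metis fst_conv snd_conv)
qed

text \<open>The component in \<open>V\<close> is tested at each point \<open>x\<close> of the group;
  there the translated function takes the value of the second function at
  \<open>inv g \<otimes> x\<close>, an evaluation covered by \<open>smooth_map_eval\<close>.\<close>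

lemma semidirect_mult_smooth: "smooth_map (prod_atlas SA SA) SA (\<lambda>(s, s'). s \<otimes>\<^bsub>semidirect G V\<^esub> s')"
proof -
  let ?P = "prod_atlas SA SA"
  note P = fd_atlas_prod[OF SA SA]
  have 1: "smooth_map ?P A (\<lambda>z. fst (fst z))" by (rule smooth_map_compose[OF P SA atl smooth_map_fst[OF SA SA] S_fst])
  have 2: "smooth_map ?P A (\<lambda>z. fst (snd z))" by (rule smooth_map_compose[OF P SA atl smooth_map_snd[OF SA SA] S_fst])
  have 3: "smooth_map ?P VA (\<lambda>z. snd (fst z))" by (rule smooth_map_compose[OF P SA VA smooth_map_fst[OF SA SA] S_snd])
  have 4: "smooth_map ?P VA (\<lambda>z. snd (snd z))" by (rule smooth_map_compose[OF P SA VA smooth_map_snd[OF SA SA] S_snd])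
  have "smooth_map ?P VA (\<lambda>z. snd (fst z) + translate G (fst (fst z)) (snd (snd z)))"
  proof (rule smooth_map_vectorI[OF V fdV cV P])
    show "snd (fst z) + translate G (fst (fst z)) (snd (snd z)) \<in> V" if "z \<in> atlas_space ?P" for z
      using that by (auto simp: SA_space intro!: fd_subspace_add[OF V] V_translate)
    fix x
    have "smooth_map ?P real_atlas (\<lambda>z. translate G (fst (fst z)) (snd (snd z)) x)"
    proof (cases "x \<in> carrier G")
      case True
      then have "smooth_map ?P A (\<lambda>_. x)" by (intro smooth_map_const[OF P atl]) (simp add: space)
      from smooth_map_eval[OF P smooth_map_mult[OF P smooth_map_inv[OF P 1] this] 4]
      show ?thesis using True by (simp add: translate_def)
    qed (simp add: translate_def smooth_map_real_const[OF P])
    from smooth_map_real_add[OF P smooth_map_point_eval[OF P 3] this]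
    show "smooth_map ?P real_atlas (\<lambda>z. (snd (fst z) + translate G (fst (fst z)) (snd (snd z))) x)" by simp
  qed
  from smooth_map_Pair[OF P atl VA smooth_map_mult[OF P 1 2] this]
  show ?thesis by (simp add: S_simps split_beta' semidirect_atlas_def)
qed

sublocale S: lie_grp "semidirect G V" SA
proof (rule lie_grp.intro[OF semidirect_group], rule lie_grp_axioms.intro)
  show "atlas_space SA = carrier (semidirect G V)" by (simp add: SA_space S_simps)
qed (rule SA semidirect_mult_smooth)+

text \<open>The differential is taken at the translated point, in accordance with the law
  \<open>f\<^sub>1 + g\<^sub>1 f\<^sub>2\<close>, in which the outer function is not translated.
  Covectors are 0 off the tangent space by the normalisation of \<open>dual_space\<close>.\<close>

definition act :: "'g \<times> ('g \<Rightarrow> real) \<Rightarrow> ('g, 'm) cotangent \<Rightarrow> ('g, 'm) cotangent"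
  where "act s \<xi> = (fst s \<otimes> fst \<xi>, \<lambda>w. if w \<in> tangent_space A (fst s \<otimes> fst \<xi>)
    then snd \<xi> (tangent_map A A (\<lambda>y. inv (fst s) \<otimes> y) (fst s \<otimes> fst \<xi>) w) - differential A (snd s) (fst s \<otimes> fst \<xi>) w
    else 0)"

lemma fst_act [simp]: "fst (act s \<xi>) = fst s \<otimes> fst \<xi>"
  by (simp add: act_def)

lemma act_in:
  assumes s: "fst s \<in> carrier G" "snd s \<in> V" and \<xi>: "\<xi> \<in> atlas_space T"
  shows "act s \<xi> \<in> atlas_space T"
proof -
  have x: "fst \<xi> \<in> carrier G" and \<zeta>: "snd \<xi> \<in> cotangent_space A (fst \<xi>)" using \<xi> by (auto simp: T_space)
  have gx: "fst s \<otimes> fst \<xi> \<in> atlas_space A" using s x by (simp add: space)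
  have sm: "smooth_map A A (\<lambda>y. inv (fst s) \<otimes> y)" by (rule left_smooth) (use s in simp)
  have bk: "inv (fst s) \<otimes> (fst s \<otimes> fst \<xi>) = fst \<xi>" using s x by (simp add: m_assoc[symmetric])
  have tin: "tangent_map A A (\<lambda>y. inv (fst s) \<otimes> y) (fst s \<otimes> fst \<xi>) w \<in> tangent_space A (fst \<xi>)"
    if "w \<in> tangent_space A (fst s \<otimes> fst \<xi>)" for w
    using tangent_map_in[OF atl atl sm gx that] by (simp add: bk)
  have "snd (act s \<xi>) \<in> cotangent_space A (fst (act s \<xi>))"
  proof (rule cotangentI; unfold fst_act)
    fix v w a assume v: "v \<in> tangent_space A (fst s \<otimes> fst \<xi>)"
    show "snd (act s \<xi>) (fscale a v) = a * snd (act s \<xi>) v"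
      using v by (simp add: act_def tangent_space_fscale[OF atl] tangent_map_fscale[OF atl sm gx]
          differential_fscale_vector[OF atl V_smooth[OF s(2)] gx] cotangent_fscale[OF \<zeta> tin] right_diff_distrib)
    assume w: "w \<in> tangent_space A (fst s \<otimes> fst \<xi>)"
    show "snd (act s \<xi>) (v + w) = snd (act s \<xi>) v + snd (act s \<xi>) w"
      using v w by (simp add: act_def tangent_space_add[OF atl] tangent_map_add[OF atl sm gx]
          differential_add_vector[OF atl V_smooth[OF s(2)] gx] cotangent_add[OF \<zeta> tin tin])
  qed (simp add: act_def)
  then show ?thesis using s x by (simp add: T_space)
qed

text \<open>Left translation preserves left-invariant fields, so in these pairings only the
  differential of the function component changes the value. Identities for the action reduce to
  identities between derivatives of functions.\<close>

lemma act_linv: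
  assumes s: "fst s \<in> carrier G" and x: "fst \<xi> \<in> carrier G" and Z: "Z \<in> lie_algebra G A"
  shows "snd (act s \<xi>) (linv Z (fst s \<otimes> fst \<xi>)) =
    snd \<xi> (linv Z (fst \<xi>)) - differential A (snd s) (fst s \<otimes> fst \<xi>) (linv Z (fst s \<otimes> fst \<xi>))"
proof -
  have "tangent_map A A (\<lambda>y. inv (fst s) \<otimes> y) (fst s \<otimes> fst \<xi>) (linv Z (fst s \<otimes> fst \<xi>)) = linv Z (fst \<xi>)"
    unfolding linv_translate[OF Z s x] by (rule left_translate_inverse[OF s x linv_in[OF Z x]])
  then show ?thesis using linv_in[OF Z m_closed[OF s x]] by (simp add: act_def)
qed

text \<open>Left-invariant derivations commute with the representation of the group on
  functions.\<close>

lemma differential_translate_linv: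
  assumes g: "g \<in> carrier G" and y: "y \<in> carrier G" and f: "f \<in> V" and Z: "Z \<in> lie_algebra G A"
  shows "differential A (translate G g f) (g \<otimes> y) (linv Z (g \<otimes> y)) = differential A f y (linv Z y)"
proof -
  have gy: "g \<otimes> y \<in> atlas_space A" using g y by (simp add: space)
  note sm = left_smooth[OF inv_closed[OF g]]
  have bk: "inv g \<otimes> (g \<otimes> y) = y" using g y by (simp add: m_assoc[symmetric])
  have "differential A (translate G g f) (g \<otimes> y) (linv Z (g \<otimes> y)) = differential A (\<lambda>x. f (inv g \<otimes> x)) (g \<otimes> y) (linv Z (g \<otimes> y))"
    by (rule differential_cong[OF atl V_smooth[OF V_translate[OF g f]] gy linv_in[OF Z m_closed[OF g y]]])
      (simp add: translate_def space)
  also have "\<dots> = differential A f (inv g \<otimes> (g \<otimes> y)) (tangent_map A A (\<lambda>x. inv g \<otimes> x) (g \<otimes> y) (linv Z (g \<otimes> y)))"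
    by (rule differential_compose[OF atl atl sm V_smooth[OF f] gy linv_in[OF Z m_closed[OF g y]]])
  also have "\<dots> = differential A f y (linv Z y)"
    unfolding bk linv_translate[OF Z g y] left_translate_inverse[OF g y linv_in[OF Z y]] ..
  finally show ?thesis .
qed

text \<open>Compared on left-invariant fields, the contributions of the two functions add up; the
  one of the inner function is not altered by the outer translation, by
  \<open>differential_translate_linv\<close>.\<close>

lemma act_mult:
  assumes s: "s \<in> carrier G \<times> V" and s': "s' \<in> carrier G \<times> V" and \<xi>: "\<xi> \<in> atlas_space T"
  shows "act (s \<otimes>\<^bsub>semidirect G V\<^esub> s') \<xi> = act s (act s' \<xi>)"
proof -
  have sv: "fst s \<in> carrier G" "snd s \<in> V" "fst s' \<in> carrier G" "snd s' \<in> V" using s s' by auto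
  have x: "fst \<xi> \<in> carrier G" using \<xi> by (simp add: T_space)
  let ?m = "s \<otimes>\<^bsub>semidirect G V\<^esub> s'"
  have m: "fst ?m \<in> carrier G" "snd ?m \<in> V" using sv by (auto simp: S_simps intro!: fd_subspace_add[OF V] V_translate)
  have in1: "act ?m \<xi> \<in> atlas_space T" by (rule act_in[OF m \<xi>])
  have in2: "act s (act s' \<xi>) \<in> atlas_space T" by (intro act_in sv \<xi>)
  have base: "fst ?m \<otimes> fst \<xi> = fst s \<otimes> (fst s' \<otimes> fst \<xi>)" using sv x by (simp add: S_simps m_assoc)
  show ?thesis
  proof (rule cotangent_linv_eqI)
    fix Z assume Z: "Z \<in> lie_algebra G A"
    let ?y = "fst s' \<otimes> fst \<xi>"
    have y: "?y \<in> carrier G" using sv x by simp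
    have sy: "fst s \<otimes> ?y \<in> carrier G" "fst s \<otimes> ?y \<in> atlas_space A" using sv y by (simp_all add: space)
    have "differential A (snd ?m) (fst s \<otimes> ?y) (linv Z (fst s \<otimes> ?y)) =
      differential A (snd s) (fst s \<otimes> ?y) (linv Z (fst s \<otimes> ?y)) + differential A (snd s') ?y (linv Z ?y)"
      using differential_add[OF atl V_smooth[OF sv(2)] V_smooth[OF V_translate[OF sv(1,4)]] sy(2) linv_in[OF Z sy(1)]]
        differential_translate_linv[OF sv(1) y sv(4) Z] by (simp add: S_simps plus_fun_def)
    then show "snd (act ?m \<xi>) (linv Z (fst (act ?m \<xi>))) = snd (act s (act s' \<xi>)) (linv Z (fst (act ?m \<xi>)))"
      using act_linv[OF m(1) x Z] act_linv[of s "act s' \<xi>" Z] act_linv[OF sv(3) x Z] sv x y Z by (simp add: base)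
  qed (use in1 in2 base in \<open>auto simp: T_space\<close>)
qed

lemma act_one:
  assumes \<xi>: "\<xi> \<in> atlas_space T" shows "act (\<one>, 0) \<xi> = \<xi>"
proof -
  have x: "fst \<xi> \<in> carrier G" using \<xi> by (simp add: T_space)
  have in1: "act (\<one>, 0) \<xi> \<in> atlas_space T" by (rule act_in) (simp_all add: fd_subspace_zero[OF V] \<xi>)
  show ?thesis
  proof (rule cotangent_linv_eqI)
    fix Z assume Z: "Z \<in> lie_algebra G A"
    have "differential A 0 (fst \<xi>) (linv Z (fst \<xi>)) = 0"
      using differential_const[OF atl _ linv_in[OF Z x], of 0] x by (simp add: space zero_fun_def)
    then show "snd (act (\<one>, 0) \<xi>) (linv Z (fst (act (\<one>, 0) \<xi>))) = snd \<xi> (linv Z (fst (act (\<one>, 0) \<xi>)))"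
      using act_linv[of "(\<one>, 0)" \<xi> Z] x Z by simp
  qed (use in1 \<xi> x in \<open>auto simp: T_space\<close>)
qed

text \<open>\<open>BijGroup\<close> consists of extensional bijections, hence the restriction to the
  total space of the bundle.\<close>

lemma act_group_action: "group_action (semidirect G V) (atlas_space T) (\<lambda>s. restrict (act s) (atlas_space T))"
proof -
  let ?E = "atlas_space T" and ?\<Phi> = "\<lambda>s. restrict (act s) (atlas_space T)"
  have in': "act s \<xi> \<in> ?E" if "s \<in> carrier (semidirect G V)" "\<xi> \<in> ?E" for s \<xi>
    using that by (auto simp: S_simps intro: act_in)
  have mult: "act (s \<otimes>\<^bsub>semidirect G V\<^esub> s') \<xi> = act s (act s' \<xi>)"
    if "s \<in> carrier (semidirect G V)" "s' \<in> carrier (semidirect G V)" "\<xi> \<in> ?E" for s s' \<xi>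
    using that act_mult by (simp add: S_simps(1))
  have bij: "?\<Phi> s \<in> Bij ?E" if s: "s \<in> carrier (semidirect G V)" for s
  proof -
    have si: "inv\<^bsub>semidirect G V\<^esub> s \<in> carrier (semidirect G V)" using s by (rule S.inv_closed)
    have one: "act \<one>\<^bsub>semidirect G V\<^esub> \<xi> = \<xi>" if "\<xi> \<in> ?E" for \<xi> using act_one[OF that] by (simp add: S_simps)
    have "bij_betw (?\<Phi> s) ?E ?E"
      by (rule bij_betw_byWitness[where f'="?\<Phi> (inv\<^bsub>semidirect G V\<^esub> s)"])
        (use s si in \<open>auto simp: in'[OF s] in'[OF si] mult[OF si s, symmetric] mult[OF s si, symmetric] S.l_inv[OF s] S.r_inv[OF s] one\<close>)
    then show ?thesis by (simp add: Bij_def)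
  qed
  show ?thesis
    unfolding group_action_def group_hom_def group_hom_axioms_def
  proof (intro conjI S.is_group group_BijGroup homI)
    show "?\<Phi> s \<in> carrier (BijGroup ?E)" if "s \<in> carrier (semidirect G V)" for s
      using bij[OF that] by (simp add: BijGroup_def)
    fix s s' assume s: "s \<in> carrier (semidirect G V)" and s': "s' \<in> carrier (semidirect G V)"
    have "?\<Phi> (s \<otimes>\<^bsub>semidirect G V\<^esub> s') = compose ?E (?\<Phi> s) (?\<Phi> s')"
      by (rule ext) (use s s' in \<open>auto simp: in'[OF s'] compose_def restrict_def mult[OF s s']\<close>)
    then show "?\<Phi> (s \<otimes>\<^bsub>semidirect G V\<^esub> s') = ?\<Phi> s \<otimes>\<^bsub>BijGroup ?E\<^esub> ?\<Phi> s'"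
      using bij[OF s] bij[OF s'] by (simp add: BijGroup_def)
  qed
qed

lemma differential_V_linear:
  assumes y: "y \<in> carrier G" and v: "v \<in> tangent_space A y"
  shows "linear_on_subspace V (\<lambda>f. differential A f y v)"
  unfolding linear_on_subspace_def
proof (intro conjI ballI allI)
  have yA: "y \<in> atlas_space A" using y by (simp add: space)
  show "differential A (f + g) y v = differential A f y v + differential A g y v" if "f \<in> V" "g \<in> V" for f g
    using differential_add[OF atl V_smooth[OF that(1)] V_smooth[OF that(2)] yA v] by (simp add: plus_fun_def)
  show "differential A (fscale a f) y v = a *\<^sub>R differential A f y v" if "f \<in> V" for f a
    using differential_const_mult[OF atl V_smooth[OF that] yA v, of a] by (simp add: fscale_def)
qed

text \<open>The point frame separates the varying function from the varying point: only derivatives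
  of the fixed functions \<open>e x\<close> remain.\<close>

lemma smooth_map_V_derivative:
  assumes P: "fd_atlas P" and h: "smooth_map P A h" and k: "smooth_map P VA k" and X: "smooth_vf A X"
  shows "smooth_map P real_atlas (\<lambda>p. differential A (k p) (h p) (X (h p)))"
proof -
  obtain F e where F: "finite F" "\<And>x. x \<in> F \<Longrightarrow> e x \<in> V"
    "\<And>\<phi> f. linear_on_subspace V (\<phi> :: _ \<Rightarrow> real) \<Longrightarrow> f \<in> V \<Longrightarrow> \<phi> f = (\<Sum>x\<in>F. f x *\<^sub>R \<phi> (e x))"
    using vector_chart_point_frame[OF V] by metis
  show ?thesis
  proof (rule smooth_map_cong[OF P fd_atlas_real])
    show "smooth_map P real_atlas (\<lambda>p. \<Sum>x\<in>F. k p x * differential A (e x) (h p) (X (h p)))"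
      by (intro smooth_map_real_sum smooth_map_real_mult P smooth_map_point_eval[OF P k]
          smooth_map_compose[OF P atl fd_atlas_real h smooth_map_differential_field[OF atl V_smooth[OF F(2)] X]])
    fix p assume p: "p \<in> atlas_space P"
    have y: "h p \<in> carrier G" "k p \<in> V" using smooth_map_space[OF h p] smooth_map_space[OF k p] by (simp_all add: space VA_space)
    have "X (h p) \<in> tangent_space A (h p)" using X y by (simp add: smooth_vf_def space)
    from F(3)[OF differential_V_linear[OF y(1) this] y(2)]
    show "(\<Sum>x\<in>F. k p x * differential A (e x) (h p) (X (h p))) = differential A (k p) (h p) (X (h p))" by simp
  qed
qed

text \<open>In the left-invariant trivialisation the new fibre part is the old pairing minus the
  derivative of a function in \<open>V\<close> at a moving point, which is the case treated by
  \<open>smooth_map_V_derivative\<close>.\<close>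

lemma act_smooth: "smooth_map (prod_atlas SA T) T (\<lambda>(s, \<xi>). act s \<xi>)"
proof -
  let ?P = "prod_atlas SA T"
  note P = fd_atlas_prod[OF SA TA]
  have g: "smooth_map ?P A (\<lambda>z. fst (fst z))" by (rule smooth_map_compose[OF P SA atl smooth_map_fst[OF SA TA] S_fst])
  have f: "smooth_map ?P VA (\<lambda>z. snd (fst z))" by (rule smooth_map_compose[OF P SA VA smooth_map_fst[OF SA TA] S_snd])
  have x: "smooth_map ?P A (\<lambda>z. fst (snd z))"
    by (rule smooth_map_compose[OF P TA atl smooth_map_snd[OF SA TA] smooth_map_cotangent_fst[OF atl]])
  have gx: "smooth_map ?P A (\<lambda>z. fst (fst z) \<otimes> fst (snd z))" by (rule smooth_map_mult[OF P g x])
  have "smooth_map ?P T (\<lambda>z. act (fst z) (snd z))"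
  proof (rule smooth_map_cotangent_linvI[OF P])
    show "smooth_map ?P A (\<lambda>z. fst (act (fst z) (snd z)))" using gx by simp
    show "snd (act (fst z) (snd z)) \<in> cotangent_space A (fst (act (fst z) (snd z)))" if "z \<in> atlas_space ?P" for z
      using act_in[of "fst z" "snd z"] that by (auto simp: SA_space T_space)
    fix Z assume Z: "Z \<in> lie_algebra G A"
    show "smooth_map ?P real_atlas (\<lambda>z. snd (act (fst z) (snd z)) (linv Z (fst (act (fst z) (snd z)))))"
    proof (rule smooth_map_cong[OF P fd_atlas_real])
      show "smooth_map ?P real_atlas (\<lambda>z. snd (snd z) (linv Z (fst (snd z))) -
          differential A (snd (fst z)) (fst (fst z) \<otimes> fst (snd z)) (linv Z (fst (fst z) \<otimes> fst (snd z))))"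
        by (intro smooth_map_real_diff[OF P] smooth_map_V_derivative[OF P gx f linv_smooth[OF Z]]
            smooth_map_compose[OF P TA fd_atlas_real smooth_map_snd[OF SA TA] smooth_map_pairing[OF atl linv_smooth[OF Z]]])
      show "snd (snd z) (linv Z (fst (snd z))) -
          differential A (snd (fst z)) (fst (fst z) \<otimes> fst (snd z)) (linv Z (fst (fst z) \<otimes> fst (snd z))) =
          snd (act (fst z) (snd z)) (linv Z (fst (act (fst z) (snd z))))" if "z \<in> atlas_space ?P" for z
        using act_linv[of "fst z" "snd z" Z] Z that by (auto simp: SA_space T_space)
    qed
  qed
  then show ?thesis by (simp add: split_beta')
qed

lemma act_lift_left:
  assumes g: "g \<in> carrier G" and \<xi>: "\<xi> \<in> atlas_space T"
  shows "act (g, 0) \<xi> = lift_left G A g \<xi>"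
proof -
  have gx: "g \<otimes> fst \<xi> \<in> atlas_space A" using g \<xi> by (simp add: space T_space)
  have "differential A 0 (g \<otimes> fst \<xi>) w = 0" if "w \<in> tangent_space A (g \<otimes> fst \<xi>)" for w
    using differential_const[OF atl gx that, of 0] by (simp add: zero_fun_def)
  then show ?thesis by (auto simp: act_def lift_left_def split_beta transpose_tangent_def fun_eq_iff)
qed

end

section \<open>The momentum map\<close>

context lie_grp
begin

lemma right_translate_inverse:
  assumes g: "g \<in> carrier G" and x: "x \<in> carrier G" and v: "v \<in> tangent_space A x"
  shows "tangent_map A A (\<lambda>y. y \<otimes> inv g) (x \<otimes> g) (tangent_map A A (\<lambda>y. y \<otimes> g) x v) = v"
proof -
  have xA: "x \<in> atlas_space A" using x by (simp add: space)
  have "tangent_map A A (\<lambda>y. y) x v = tangent_map A A (\<lambda>y. (y \<otimes> g) \<otimes> inv g) x v"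
    by (rule tangent_map_cong[OF atl atl smooth_map_id[OF atl] xA v]) (use g in \<open>auto simp: space m_assoc\<close>)
  then show ?thesis
    using tangent_map_compose[OF atl atl atl right_smooth[OF g] right_smooth[OF inv_closed[OF g]] xA v] tangent_map_id[OF atl xA v]
    by simp
qed

lemma rinv_surj:
  assumes x: "x \<in> carrier G" and v: "v \<in> tangent_space A x"
  obtains Z where "Z \<in> lie_algebra G A" "rinv Z x = v"
proof
  have xA: "x \<in> atlas_space A" using x by (simp add: space)
  show "tangent_map A A (\<lambda>y. y \<otimes> inv x) x v \<in> lie_algebra G A"
    using tangent_map_in[OF atl atl right_smooth[OF inv_closed[OF x]] xA v] x by (simp add: lie_algebra_eq)
  show "rinv (tangent_map A A (\<lambda>y. y \<otimes> inv x) x v) x = v"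
    using right_translate_inverse[of "inv x" x v] x v by (simp add: rinv_def)
qed

lemma momentum_left_apply:
  "Y \<in> lie_algebra G A \<Longrightarrow> momentum_left G A \<xi> Y = snd \<xi> (rinv Y (fst \<xi>))"
  by (simp add: momentum_left_def split_beta transpose_tangent_def lie_algebra_eq rinv_def)

lemma momentum_left_outside: "Y \<notin> lie_algebra G A \<Longrightarrow> momentum_left G A \<xi> Y = 0"
  by (simp add: momentum_left_def split_beta transpose_tangent_def lie_algebra_eq)

lemma fst_lift_right [simp]: "fst (lift_right G A \<xi> k) = fst \<xi> \<otimes> k"
  by (simp add: lift_right_def split_beta)

lemma lift_right_in:
  assumes k: "k \<in> carrier G" and x: "fst \<xi> \<in> carrier G" and \<zeta>: "snd \<xi> \<in> cotangent_space A (fst \<xi>)"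
  shows "snd (lift_right G A \<xi> k) \<in> cotangent_space A (fst \<xi> \<otimes> k)"
proof -
  have xk: "fst \<xi> \<otimes> k \<in> atlas_space A" using x k by (simp add: space)
  note sm = right_smooth[OF inv_closed[OF k]]
  have bk: "fst \<xi> \<otimes> k \<otimes> inv k = fst \<xi>" using x k by (simp add: m_assoc)
  have tin: "tangent_map A A (\<lambda>y. y \<otimes> inv k) (fst \<xi> \<otimes> k) w \<in> tangent_space A (fst \<xi>)"
    if "w \<in> tangent_space A (fst \<xi> \<otimes> k)" for w
    using tangent_map_in[OF atl atl sm xk that] by (simp add: bk)
  show ?thesis
    by (rule cotangentI)
      (simp_all add: lift_right_def split_beta transpose_tangent_def tangent_space_add[OF atl] tangent_space_fscale[OF atl]
        tangent_map_add[OF atl sm xk] tangent_map_fscale[OF atl sm xk] cotangent_add[OF \<zeta> tin tin] cotangent_fscale[OF \<zeta> tin])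
qed

text \<open>\<open>momentum_left\<close> is the pairing with right-invariant fields, and right
  translations preserve these.\<close>

lemma momentum_left_lift_right:
  assumes k: "k \<in> carrier G" and x: "fst \<xi> \<in> carrier G"
  shows "momentum_left G A (lift_right G A \<xi> k) = momentum_left G A \<xi>"
proof
  fix Y
  show "momentum_left G A (lift_right G A \<xi> k) Y = momentum_left G A \<xi> Y"
  proof (cases "Y \<in> lie_algebra G A")
    case True
    have "snd (lift_right G A \<xi> k) (rinv Y (fst \<xi> \<otimes> k)) =
        snd \<xi> (tangent_map A A (\<lambda>y. y \<otimes> inv k) (fst \<xi> \<otimes> k) (rinv Y (fst \<xi> \<otimes> k)))"
      using rinv_in[OF True m_closed[OF x k]] by (simp add: lift_right_def split_beta transpose_tangent_def)
    also have "\<dots> = snd \<xi> (rinv Y (fst \<xi>))"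
      unfolding rinv_translate[OF True x k] right_translate_inverse[OF k x rinv_in[OF True x]] ..
    finally show ?thesis by (simp add: momentum_left_apply[OF True])
  qed (simp add: momentum_left_outside)
qed

text \<open>Right-invariant fields attain every tangent vector at a given point, so the pairings
  determine the covector.\<close>

lemma momentum_left_eqI:
  assumes x: "fst \<xi> \<in> carrier G" and \<xi>: "snd \<xi> \<in> cotangent_space A (fst \<xi>)" and \<xi>': "snd \<xi>' \<in> cotangent_space A (fst \<xi>')"
    and base: "fst \<xi> = fst \<xi>'" and eq: "momentum_left G A \<xi> = momentum_left G A \<xi>'"
  shows "\<xi> = \<xi>'"
proof -
  have "snd \<xi> = snd \<xi>'"
  proof (rule cotangent_eqI[OF \<xi>])
    show "snd \<xi>' \<in> cotangent_space A (fst \<xi>)" using \<xi>' base by simp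
    fix v assume v: "v \<in> tangent_space A (fst \<xi>)"
    obtain Z where Z: "Z \<in> lie_algebra G A" "rinv Z (fst \<xi>) = v" using rinv_surj[OF x v] .
    show "snd \<xi> v = snd \<xi>' v"
      using fun_cong[OF eq, of Z] momentum_left_apply[OF Z(1), of \<xi>] momentum_left_apply[OF Z(1), of \<xi>'] Z(2) base by simp
  qed
  then show ?thesis using base by (simp add: prod_eq_iff)
qed

end

context lie_rep
begin

abbreviation \<SS> where "\<SS> \<equiv> semidirect G V"
abbreviation LS where "LS \<equiv> lie_algebra \<SS> SA"
abbreviation Y1 :: "('g \<times> ('g \<Rightarrow> real), 'm \<times> 'v) tangent \<Rightarrow> ('g, 'm) tangent"
  where "Y1 \<equiv> semidirect_lie_fst G A V"
abbreviation Y2 :: "('g \<times> ('g \<Rightarrow> real), 'm \<times> 'v) tangent \<Rightarrow> 'g \<Rightarrow> real"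
  where "Y2 \<equiv> semidirect_lie_snd G A V"
abbreviation mom :: "('g, 'm) cotangent \<Rightarrow> ('g \<times> ('g \<Rightarrow> real), 'm \<times> 'v) tangent \<Rightarrow> real"
  where "mom \<xi> \<equiv> semidirect_dual G A V (momentum_pair G A V \<xi>)"

lemma LS_eq: "LS = tangent_space SA (\<one>, 0)"
  by (simp add: lie_algebra_def S_simps)

lemma oneS: "(\<one>, 0) \<in> atlas_space SA"
  by (simp add: SA_space fd_subspace_zero[OF V])

lemma Y1_in: "Y \<in> LS \<Longrightarrow> Y1 Y \<in> lie_algebra G A"
  using tangent_map_in[OF SA atl S_fst oneS, of Y] by (simp add: semidirect_lie_fst_def LS_eq lie_algebra_eq)

text \<open>The \<open>inv_into\<close> in the definition of \<open>Y2\<close> is meaningful because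
  every tangent vector of \<open>V\<close> at 0 is the velocity of a line through 0.\<close>

lemma Y2: 
  assumes Y: "Y \<in> LS"
  shows "Y2 Y \<in> V" "vector_tangent V (Y2 Y) = tangent_map SA VA snd (\<one>, 0) Y"
proof -
  let ?v = "tangent_map SA VA snd (\<one>, 0) Y" and ?vel = "\<lambda>f. velocity VA (\<lambda>t. fscale t f) 0"
  have "?v \<in> tangent_space VA 0"
    using tangent_map_in[OF SA VA S_snd oneS, of Y] Y by (simp add: LS_eq)
  from vector_tangent_cases[OF V fdV cV fd_subspace_zero[OF V] this]
  have "?v = ?vel (cinv cV (?v cV))" by (simp add: velocity_line[OF V vector_chart_inverse_linear(3)[OF V cV]])
  then have mem: "?v \<in> ?vel ` V" using vector_chart_inverse_linear(3)[OF V cV] by blast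
  have "Y2 Y \<in> V" "?vel (Y2 Y) = ?v"
    using inv_into_into[OF mem] f_inv_into_f[OF mem] by (simp_all only: semidirect_lie_snd_def)
  then show "Y2 Y \<in> V" "vector_tangent V (Y2 Y) = ?v" by (simp_all add: velocity_line[OF V])
qed

lemma Y1_add: "Y \<in> LS \<Longrightarrow> Z \<in> LS \<Longrightarrow> Y1 (Y + Z) = Y1 Y + Y1 Z"
  unfolding semidirect_lie_fst_def LS_eq by (rule tangent_map_add[OF SA S_fst oneS])

lemma Y1_fscale: "Y \<in> LS \<Longrightarrow> Y1 (fscale a Y) = fscale a (Y1 Y)"
  unfolding semidirect_lie_fst_def LS_eq by (rule tangent_map_fscale[OF SA S_fst oneS])

text \<open>Differentials of evaluations describe \<open>Y2 Y\<close> without the inverse in its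
  definition; sums, multiples and brackets are then computed by differential calculus on the group
  manifold.\<close>

lemma point_eval_differential:
  assumes Y: "Y \<in> LS"
  shows "differential SA (\<lambda>s. snd s x) (\<one>, 0) Y = Y2 Y x"
    and "linear_on_subspace V L \<Longrightarrow> differential SA (\<lambda>s. L (snd s)) (\<one>, 0) Y = L (Y2 Y)"
proof -
  have "differential SA (\<lambda>s. L (snd s)) (\<one>, 0) Y = L (Y2 Y)" if L: "linear_on_subspace V L" for L
    using differential_compose[OF SA VA S_snd smooth_map_linear[OF V fdV L] oneS, of Y]
      differential_linear[OF V fdV cV fd_subspace_zero[OF V] Y2(1)[OF Y] L] Y2(2)[OF Y] Y by (simp add: LS_eq)
  from this[OF linear_on_subspace_eval] this
  show "differential SA (\<lambda>s. snd s x) (\<one>, 0) Y = Y2 Y x"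
    "linear_on_subspace V L \<Longrightarrow> differential SA (\<lambda>s. L (snd s)) (\<one>, 0) Y = L (Y2 Y)" by auto
qed

lemma LS_add: "Y \<in> LS \<Longrightarrow> Z \<in> LS \<Longrightarrow> Y + Z \<in> LS" and LS_fscale: "Y \<in> LS \<Longrightarrow> fscale a Y \<in> LS"
  by (simp_all add: LS_eq tangent_space_add[OF SA] tangent_space_fscale[OF SA])

lemma Y2_add: "Y \<in> LS \<Longrightarrow> Z \<in> LS \<Longrightarrow> Y2 (Y + Z) x = Y2 Y x + Y2 Z x"
  using differential_add_vector[OF SA smooth_map_point_eval[OF SA S_snd, where x=x] oneS, where v=Y and w=Z]
  by (simp add: point_eval_differential(1)[symmetric] LS_add) (simp add: LS_eq)

lemma Y2_fscale: "Y \<in> LS \<Longrightarrow> Y2 (fscale a Y) x = a * Y2 Y x"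
  using differential_fscale_vector[OF SA smooth_map_point_eval[OF SA S_snd, where x=x] oneS, where v=Y and a=a]
  by (simp add: point_eval_differential(1)[symmetric] LS_fscale) (simp add: LS_eq)

lemma mom_apply:
  "Y \<in> LS \<Longrightarrow> mom \<xi> Y = snd \<xi> (rinv (Y1 Y) (fst \<xi>)) + Y2 Y (fst \<xi>)"
  by (simp add: semidirect_dual_def momentum_pair_def momentum_left_apply[OF Y1_in] momentum_functions_def Y2(1))

lemma mom_outside: "Y \<notin> LS \<Longrightarrow> mom \<xi> Y = 0"
  by (simp add: semidirect_dual_def momentum_pair_def)

lemma lie_dual_eq: "lie_dual \<SS> SA = cotangent_space SA (\<one>, 0)"
  by (simp add: lie_dual_def cotangent_space_def LS_eq)

lemma mom_in:
  assumes \<xi>: "\<xi> \<in> atlas_space T" shows "mom \<xi> \<in> lie_dual \<SS> SA"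
  unfolding lie_dual_eq
proof (rule cotangentI; unfold LS_eq[symmetric])
  have x: "fst \<xi> \<in> carrier G" and \<zeta>: "snd \<xi> \<in> cotangent_space A (fst \<xi>)" using \<xi> by (auto simp: T_space)
  fix Y Z a assume Y: "Y \<in> LS"
  show "mom \<xi> (fscale a Y) = a * mom \<xi> Y"
    using Y x by (simp add: mom_apply LS_fscale Y1_fscale Y2_fscale rinv_fscale Y1_in cotangent_fscale[OF \<zeta> rinv_in] distrib_left)
  assume Z: "Z \<in> LS"
  show "mom \<xi> (Y + Z) = mom \<xi> Y + mom \<xi> Z"
    using Y Z x by (simp add: mom_apply LS_add Y1_add Y2_add rinv_add Y1_in cotangent_add[OF \<zeta> rinv_in rinv_in])
qed (rule mom_outside)

lemma mom_smooth_component: "smooth_map T real_atlas (\<lambda>\<xi>. mom \<xi> Y)"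
proof (cases "Y \<in> LS")
  case True
  from smooth_map_momentum[OF atl rinv_smooth[OF Y1_in[OF True]] V_smooth[OF Y2(1)[OF True]]]
  show ?thesis by (simp add: mom_apply[OF True])
qed (simp add: mom_outside smooth_map_real_const[OF TA])

lemma obtain_dual_chart:
  obtains cW where "cW \<in> (vector_atlas (lie_dual \<SS> SA) :: (_, ('m \<times> 'v) \<Rightarrow>\<^sub>L real) atlas)"
    and "fd_subspace (lie_dual \<SS> SA)" and "finite_dimensional TYPE(('m \<times> 'v) \<Rightarrow>\<^sub>L real)"
proof -
  obtain c where c: "c \<in> SA" "(\<one>, 0) \<in> fst c" using oneS by (rule atlas_spaceE)
  show thesis
    using that cotangent_space_chart[OF SA c] finite_dimensional_blinfun[OF fd_atlas_dim[OF SA]] unfolding lie_dual_eq by blast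
qed

lemma mom_smooth: "smooth_map T (lie_dual_atlas \<SS> SA) mom"
proof -
  obtain cW where cW: "cW \<in> (vector_atlas (lie_dual \<SS> SA) :: (_, ('m \<times> 'v) \<Rightarrow>\<^sub>L real) atlas)"
    "fd_subspace (lie_dual \<SS> SA)" "finite_dimensional TYPE(('m \<times> 'v) \<Rightarrow>\<^sub>L real)" using obtain_dual_chart .
  show ?thesis unfolding lie_dual_atlas_def
    by (rule smooth_map_vectorI[OF cW(2,3,1) TA mom_in mom_smooth_component])
qed

lemma orbit_smooth: "\<xi> \<in> atlas_space T \<Longrightarrow> smooth_map SA T (\<lambda>s. act s \<xi>)"
  using smooth_map_partial_left[OF SA TA TA act_smooth] by simp

lemma hamiltonian_mom:
  assumes \<xi>: "\<xi> \<in> atlas_space T" and Y: "Y \<in> LS"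
  shows "\<exists>u. u \<in> tangent_space T \<xi> \<and>
    (\<forall>w\<in>tangent_space T \<xi>. cotangent_symplectic_form A \<xi> u w = - differential T (\<lambda>\<xi>. mom \<xi> Y) \<xi> w) \<and>
    tangent_map T A fst \<xi> u = rinv (Y1 Y) (fst \<xi>) \<and>
    (\<forall>Z h. smooth_vf A Z \<longrightarrow> smooth_map A real_atlas h \<longrightarrow>
      differential T (\<lambda>\<xi>. snd \<xi> (Z (fst \<xi>)) + h (fst \<xi>)) \<xi> u =
      snd \<xi> (vf_bracket A (rinv (Y1 Y)) Z (fst \<xi>)) + differential A h (fst \<xi>) (rinv (Y1 Y) (fst \<xi>)) -
      differential A (Y2 Y) (fst \<xi>) (Z (fst \<xi>)))"
proof (rule hamiltonian_momentum[OF atl \<xi> rinv_smooth[OF Y1_in[OF Y]] V_smooth[OF Y2(1)[OF Y]]])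
  fix u assume u: "u \<in> tangent_space T \<xi>"
    "\<And>w. w \<in> tangent_space T \<xi> \<Longrightarrow> cotangent_symplectic_form A \<xi> u w =
      - differential T (\<lambda>\<xi>. snd \<xi> (rinv (Y1 Y) (fst \<xi>)) + Y2 Y (fst \<xi>)) \<xi> w"
    "tangent_map T A fst \<xi> u = rinv (Y1 Y) (fst \<xi>)"
    "\<And>Z h. smooth_vf A Z \<Longrightarrow> smooth_map A real_atlas h \<Longrightarrow>
      differential T (\<lambda>\<xi>. snd \<xi> (Z (fst \<xi>)) + h (fst \<xi>)) \<xi> u =
      snd \<xi> (vf_bracket A (rinv (Y1 Y)) Z (fst \<xi>)) + differential A h (fst \<xi>) (rinv (Y1 Y) (fst \<xi>)) -
      differential A (Y2 Y) (fst \<xi>) (Z (fst \<xi>))"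
  show ?thesis
    by (intro exI[of _ u] conjI ballI allI impI u(1) u(3) u(4)) (simp_all only: mom_apply[OF Y] u(2))
qed

lemma fundamental_field:
  assumes \<xi>: "\<xi> \<in> atlas_space T" and Y: "Y \<in> LS"
  shows "velocity T (\<lambda>t. restrict (act (lie_exp \<SS> SA (fscale t Y))) (atlas_space T) \<xi>) 0 =
    hamiltonian_vf T (cotangent_symplectic_form A) (\<lambda>\<xi>'. mom \<xi>' Y) \<xi>"
proof -
  have x: "fst \<xi> \<in> carrier G" and \<zeta>: "snd \<xi> \<in> cotangent_space A (fst \<xi>)" using \<xi> by (auto simp: T_space)
  have xA: "fst \<xi> \<in> atlas_space A" using x by (simp add: space)
  obtain u where u: "u \<in> tangent_space T \<xi>"
    "\<forall>w\<in>tangent_space T \<xi>. cotangent_symplectic_form A \<xi> u w = - differential T (\<lambda>\<xi>. mom \<xi> Y) \<xi> w"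
    "tangent_map T A fst \<xi> u = rinv (Y1 Y) (fst \<xi>)"
    and du: "\<forall>X h. smooth_vf A X \<longrightarrow> smooth_map A real_atlas h \<longrightarrow>
      differential T (\<lambda>\<xi>. snd \<xi> (X (fst \<xi>)) + h (fst \<xi>)) \<xi> u =
      snd \<xi> (vf_bracket A (rinv (Y1 Y)) X (fst \<xi>)) + differential A h (fst \<xi>) (rinv (Y1 Y) (fst \<xi>)) -
      differential A (Y2 Y) (fst \<xi>) (X (fst \<xi>))"
    using hamiltonian_mom[OF \<xi> Y] by (elim exE conjE)
  have Xu: "hamiltonian_vf T (cotangent_symplectic_form A) (\<lambda>\<xi>'. mom \<xi>' Y) \<xi> = u"
    by (rule hamiltonian_vf_eqI[OF atl \<xi> u(1) u(2)[rule_format]])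
  obtain c where c: "smooth_map real_atlas SA c" "c 0 = \<one>\<^bsub>\<SS>\<^esub>" "velocity SA c 0 = Y" "\<And>t. lie_exp \<SS> SA (fscale t Y) = c t"
    by (rule S.lie_exp_curve[OF Y], rule that)
  have YT: "Y \<in> tangent_space SA (\<one>, 0)" using Y by (simp add: LS_eq)
  note orb = orbit_smooth[OF \<xi>]
  define v where "v = tangent_map SA T (\<lambda>s. act s \<xi>) (\<one>, 0) Y"
  have vel: "velocity T (\<lambda>t. restrict (act (lie_exp \<SS> SA (fscale t Y))) (atlas_space T) \<xi>) 0 = v"
    using velocity_compose[OF SA TA orb c(1), of 0] \<xi> by (simp add: c(2-4) v_def S_simps)
  have one: "act (\<one>, 0) \<xi> = \<xi>" by (rule act_one[OF \<xi>])
  have v: "v \<in> tangent_space T \<xi>" using tangent_map_in[OF SA TA orb oneS YT] by (simp add: v_def one)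
  have "v = u"
  proof (rule cotangent_tangent_eqI[OF atl \<xi> v u(1), where \<Z>="linv ` lie_algebra G A"])
    have "tangent_map T A fst \<xi> v = tangent_map SA A (\<lambda>s. fst s \<otimes> fst \<xi>) (\<one>, 0) Y"
      using tangent_map_compose[OF SA TA atl orb smooth_map_cotangent_fst[OF atl] oneS YT] by (simp add: v_def one)
    also have "\<dots> = rinv (Y1 Y) (fst \<xi>)"
      using tangent_map_compose[OF SA atl atl S_fst right_smooth[OF x] oneS YT] by (simp add: rinv_def semidirect_lie_fst_def)
    finally show "tangent_map T A fst \<xi> v = tangent_map T A fst \<xi> u" by (simp add: u(3))
    show "smooth_vf A Z" if "Z \<in> linv ` lie_algebra G A" for Z using that linv_smooth by auto
    show "\<exists>Z\<in>linv ` lie_algebra G A. Z (fst \<xi>) = w" if "w \<in> tangent_space A (fst \<xi>)" for w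
      using linv_surj[OF x that] by blast
    fix Z' assume "Z' \<in> linv ` lie_algebra G A"
    then obtain Z where Z: "Z \<in> lie_algebra G A" "Z' = linv Z" by blast
    obtain F e where F: "finite F" "\<And>b. b \<in> F \<Longrightarrow> e b \<in> V"
      "\<And>\<phi> f. linear_on_subspace V (\<phi> :: _ \<Rightarrow> real) \<Longrightarrow> f \<in> V \<Longrightarrow> \<phi> f = (\<Sum>b\<in>F. f b *\<^sub>R \<phi> (e b))"
      using vector_chart_point_frame[OF V] by metis
    define D where "D b y = differential A (e b) y (linv Z y)" for b y
    have Dsum: "differential A f y (linv Z y) = (\<Sum>b\<in>F. f b * D b y)" if "y \<in> carrier G" "f \<in> V" for f y
      using F(3)[OF differential_V_linear[OF that(1) linv_in[OF Z(1) that(1)]] that(2)] by (simp add: D_def)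
    have smD: "smooth_map SA real_atlas (\<lambda>s. D b (fst s \<otimes> fst \<xi>))" if "b \<in> F" for b
      unfolding D_def
      by (rule smooth_map_compose[OF SA atl fd_atlas_real _ smooth_map_differential_field[OF atl V_smooth[OF F(2)[OF that]] linv_smooth[OF Z(1)]]])
        (rule smooth_map_compose[OF SA atl atl S_fst right_smooth[OF x]])
    \<comment> \<open>\<open>k s\<close> is the derivative of \<open>snd s\<close> along the
      left-invariant field at the moved point, written as a sum of products. Since
      \<open>snd s\<close> is 0 at the unit, the product rule leaves only the derivatives of the
      coefficients; the motion of the point contributes nothing.\<close>
    define k where "k s = (\<Sum>b\<in>F. snd s b * D b (fst s \<otimes> fst \<xi>))" for s
    have smb: "smooth_map SA real_atlas (\<lambda>s. snd s b * D b (fst s \<otimes> fst \<xi>))" if "b \<in> F" for b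
      by (intro smooth_map_real_mult SA smooth_map_point_eval[OF SA S_snd] smD that)
    have smk: "smooth_map SA real_atlas k"
      unfolding k_def by (intro smooth_map_real_sum SA smb)
    have "differential SA k (\<one>, 0) Y = (\<Sum>b\<in>F. Y2 Y b * D b (fst \<xi>))"
      unfolding k_def
    proof (subst differential_sum[OF SA oneS YT smb], assumption, intro sum.cong refl)
      fix b assume b: "b \<in> F"
      show "differential SA (\<lambda>s. snd s b * D b (fst s \<otimes> fst \<xi>)) (\<one>, 0) Y = Y2 Y b * D b (fst \<xi>)"
        using differential_mult[OF SA smooth_map_point_eval[OF SA S_snd, where x=b] smD[OF b] oneS YT] x
        by (simp add: point_eval_differential(1)[OF Y])
    qed
    also have "\<dots> = differential A (Y2 Y) (fst \<xi>) (linv Z (fst \<xi>))" using Dsum[OF x Y2(1)[OF Y]] by simp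
    finally have dk: "differential SA k (\<one>, 0) Y = differential A (Y2 Y) (fst \<xi>) (linv Z (fst \<xi>))" .
    have "differential T (\<lambda>\<xi>. snd \<xi> (linv Z (fst \<xi>))) \<xi> v =
        differential SA (\<lambda>s. snd (act s \<xi>) (linv Z (fst (act s \<xi>)))) (\<one>, 0) Y"
      using differential_compose[OF SA TA orb smooth_map_pairing[OF atl linv_smooth[OF Z(1)]] oneS YT] by (simp add: v_def one)
    also have "\<dots> = differential SA (\<lambda>s. snd \<xi> (linv Z (fst \<xi>)) + (- 1) * k s) (\<one>, 0) Y"
    proof (rule differential_cong[OF SA smooth_map_compose[OF SA TA fd_atlas_real orb smooth_map_pairing[OF atl linv_smooth[OF Z(1)]]] oneS YT])
      fix s assume "s \<in> atlas_space SA"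
      then have s: "fst s \<in> carrier G" "snd s \<in> V" by (auto simp: SA_space)
      show "snd (act s \<xi>) (linv Z (fst (act s \<xi>))) = snd \<xi> (linv Z (fst \<xi>)) + (- 1) * k s"
        using act_linv[OF s(1) x Z(1)] Dsum[OF m_closed[OF s(1) x] s(2)] by (simp add: k_def)
    qed
    also have "\<dots> = - differential A (Y2 Y) (fst \<xi>) (linv Z (fst \<xi>))"
      unfolding differential_add[OF SA smooth_map_real_const[OF SA] smooth_map_real_mult[OF SA smooth_map_real_const[OF SA] smk] oneS YT]
        differential_const_mult[OF SA smk oneS YT] differential_const[OF SA oneS YT] dk by simp
    finally have "differential T (\<lambda>\<xi>. snd \<xi> (linv Z (fst \<xi>))) \<xi> v = - differential A (Y2 Y) (fst \<xi>) (linv Z (fst \<xi>))" .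
    moreover have "snd \<xi> 0 = 0"
      using cotangent_fscale[OF \<zeta> tangent_space_zero[OF atl], of 0] by (simp add: fscale_def zero_fun_def)
    then have "differential T (\<lambda>\<xi>. snd \<xi> (linv Z (fst \<xi>))) \<xi> u = - differential A (Y2 Y) (fst \<xi>) (linv Z (fst \<xi>))"
      using du[rule_format, OF linv_smooth[OF Z(1)] smooth_map_real_const[OF atl, of 0]] rinv_linv_commute[OF Y1_in[OF Y] Z(1) x]
        differential_const[OF atl xA rinv_in[OF Y1_in[OF Y] x], of 0] by simp
    ultimately show "differential T (\<lambda>\<xi>. snd \<xi> (Z' (fst \<xi>))) \<xi> v = differential T (\<lambda>\<xi>. snd \<xi> (Z' (fst \<xi>))) \<xi> u"
      by (simp add: Z(2))
  qed
  then show ?thesis unfolding vel Xu .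
qed

lemma hamiltonian_action_act:
  "hamiltonian_action \<SS> SA T (cotangent_symplectic_form A) (\<lambda>s. restrict (act s) (atlas_space T)) mom"
  unfolding hamiltonian_action_def
proof (intro conjI ballI act_group_action mom_smooth fundamental_field)
  show "smooth_map (prod_atlas SA T) T (\<lambda>(s, \<xi>). restrict (act s) (atlas_space T) \<xi>)"
    by (rule smooth_map_cong[OF fd_atlas_prod[OF SA TA] TA act_smooth]) auto
qed

text \<open>The projection to \<open>G\<close> is a homomorphism, so it relates right-invariant
  fields to right-invariant fields, and brackets are natural.\<close>

lemma Y1_bracket:
  assumes Z: "Z \<in> LS" and Y: "Y \<in> LS"
  shows "Y1 (lie_bracket \<SS> SA Z Y) = lie_bracket G A (Y1 Z) (Y1 Y)"
proof -
  have rel: "rinv (Y1 W) (fst s) = tangent_map SA A fst s (S.rinv W s)" if W: "W \<in> LS" and s: "s \<in> atlas_space SA" for W s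
  proof -
    have s': "fst s \<in> carrier G" "s \<in> carrier \<SS>" using s by (auto simp: SA_space S_simps)
    have WT: "W \<in> tangent_space SA (\<one>, 0)" using W by (simp add: LS_eq)
    have "tangent_map SA A fst s (S.rinv W s) = tangent_map SA A (\<lambda>t. fst (t \<otimes>\<^bsub>\<SS>\<^esub> s)) (\<one>, 0) W"
      using tangent_map_compose[OF SA SA atl S.right_smooth[OF s'(2)] S_fst oneS WT] S.l_one[OF s'(2)]
      by (simp add: S.rinv_def S_simps(3))
    also have "\<dots> = tangent_map SA A (\<lambda>t. fst t \<otimes> fst s) (\<one>, 0) W" by (simp add: S_simps(2))
    also have "\<dots> = rinv (Y1 W) (fst s)"
      using tangent_map_compose[OF SA atl atl S_fst right_smooth[OF s'(1)] oneS WT] by (simp add: rinv_def semidirect_lie_fst_def)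
    finally show ?thesis by simp
  qed
  have "vf_bracket A (rinv (Y1 Z)) (rinv (Y1 Y)) (fst (\<one>, 0 :: 'g \<Rightarrow> real)) = tangent_map SA A fst (\<one>, 0) (vf_bracket SA (S.rinv Z) (S.rinv Y) (\<one>, 0))"
    by (rule vf_bracket_related[OF SA atl S_fst S.rinv_smooth[OF Z] S.rinv_smooth[OF Y] rinv_smooth[OF Y1_in[OF Z]] rinv_smooth[OF Y1_in[OF Y]]
        rel[OF Z] rel[OF Y] oneS])
  then show ?thesis by (simp add: lie_bracket_def semidirect_lie_fst_def[of G A V "vf_bracket _ _ _ _"] rinv_def[abs_def] S.rinv_def[abs_def] S_simps(3))
qed

text \<open>The bracket acts on the evaluation at \<open>x\<close> as the commutator of the
  derivatives along two right-invariant fields of the semi-direct product.\<close>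

lemma Y2_bracket:
  assumes Z: "Z \<in> LS" and Y: "Y \<in> LS" and x: "x \<in> carrier G"
  shows "Y2 (lie_bracket \<SS> SA Z Y) x =
    differential A (Y2 Y) x (rinv (Y1 Z) x) - differential A (Y2 Z) x (rinv (Y1 Y) x)"
proof -
  have xA: "x \<in> atlas_space A" "\<one> \<in> atlas_space A" using x by (simp_all add: space)
  \<comment> \<open>The function component of the product of \<open>t\<close> and \<open>s\<close>
    has at \<open>x\<close> the value \<open>snd t x + snd s (inv (fst t) \<otimes> x)\<close>. The
    minus sign is the derivative of the inversion at the unit.\<close>
  have along: "differential SA (\<lambda>t. snd t x) s (S.rinv W s) = Y2 W x + (- 1) * differential A (snd s) x (rinv (Y1 W) x)"
    if W: "W \<in> LS" and s: "s \<in> atlas_space SA" for W s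
  proof -
    have s': "s \<in> carrier \<SS>" "snd s \<in> V" using s by (auto simp: SA_space S_simps)
    have WT: "W \<in> tangent_space SA (\<one>, 0)" using W by (simp add: LS_eq)
    have W1: "Y1 W \<in> tangent_space A \<one>" using Y1_in[OF W] by (simp add: lie_algebra_eq)
    have smx: "smooth_map A A (\<lambda>h. inv h \<otimes> x)" by (rule smooth_map_compose[OF atl atl atl inv_smooth right_smooth[OF x]])
    note smf = smooth_map_compose[OF atl atl fd_atlas_real smx V_smooth[OF s'(2)]]
    have "differential SA (\<lambda>t. snd t x) s (S.rinv W s) = differential SA (\<lambda>t. snd (t \<otimes>\<^bsub>\<SS>\<^esub> s) x) (\<one>, 0) W"
      using differential_compose[OF SA SA S.right_smooth[OF s'(1)] smooth_map_point_eval[OF SA S_snd, of x] oneS WT] S.l_one[OF s'(1)]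
      by (simp add: S.rinv_def S_simps(3))
    also have "\<dots> = differential SA (\<lambda>t. snd t x + snd s (inv (fst t) \<otimes> x)) (\<one>, 0) W"
      using x by (simp add: S_simps(2) translate_def)
    also have "\<dots> = Y2 W x + differential SA (\<lambda>t. snd s (inv (fst t) \<otimes> x)) (\<one>, 0) W"
      by (simp only: differential_add[OF SA smooth_map_point_eval[OF SA S_snd] smooth_map_compose[OF SA atl fd_atlas_real S_fst smf] oneS WT]
          point_eval_differential(1)[OF W])
    also have "differential SA (\<lambda>t. snd s (inv (fst t) \<otimes> x)) (\<one>, 0) W = differential A (\<lambda>h. snd s (inv h \<otimes> x)) \<one> (Y1 W)"
      using differential_compose[OF SA atl S_fst smf oneS WT] by (simp add: semidirect_lie_fst_def)
    also have "\<dots> = differential A (snd s) x (tangent_map A A (\<lambda>h. inv h \<otimes> x) \<one> (Y1 W))"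
      using differential_compose[OF atl atl smx V_smooth[OF s'(2)] xA(2) W1] x by simp
    also have "tangent_map A A (\<lambda>h. inv h \<otimes> x) \<one> (Y1 W) = fscale (- 1) (rinv (Y1 W) x)"
      using tangent_map_compose[OF atl atl atl inv_smooth right_smooth[OF x] xA(2) W1]
        tangent_map_inverse_one[OF inv_smooth Y1_in[OF W]] tangent_map_fscale[OF atl right_smooth[OF x] xA(2) W1, of "- 1"]
      by (simp only: rinv_def inv_one)
    also have "differential A (snd s) x (fscale (- 1) (rinv (Y1 W) x)) = (- 1) * differential A (snd s) x (rinv (Y1 W) x)"
      by (rule differential_fscale_vector[OF atl V_smooth[OF s'(2)] xA(1) rinv_in[OF Y1_in[OF W] x]])
    finally show ?thesis .
  qed
  \<comment> \<open>The first derivative is affine in \<open>snd s\<close> with \<open>x\<close>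
    fixed, so its derivative in the direction \<open>U\<close> keeps the linear term only, with
    \<open>Y2 U\<close> in place of \<open>snd s\<close>.\<close>
  have second: "differential SA (\<lambda>s. differential SA (\<lambda>t. snd t x) s (S.rinv W s)) (\<one>, 0) U = - differential A (Y2 U) x (rinv (Y1 W) x)"
    if W: "W \<in> LS" and U: "U \<in> LS" for W U
  proof -
    have UT: "U \<in> tangent_space SA (\<one>, 0)" using U by (simp add: LS_eq)
    have lin: "linear_on_subspace V (\<lambda>f. differential A f x (rinv (Y1 W) x))"
      by (rule differential_V_linear[OF x rinv_in[OF Y1_in[OF W] x]])
    note sml = smooth_map_compose[OF SA VA fd_atlas_real S_snd smooth_map_linear[OF V fdV lin]]
    have "differential SA (\<lambda>s. differential SA (\<lambda>t. snd t x) s (S.rinv W s)) (\<one>, 0) U =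
        differential SA (\<lambda>s. Y2 W x + (- 1) * differential A (snd s) x (rinv (Y1 W) x)) (\<one>, 0) U"
      by (rule differential_cong[OF SA smooth_map_differential_field[OF SA smooth_map_point_eval[OF SA S_snd] S.rinv_smooth[OF W]] oneS UT along[OF W]])
    also have "\<dots> = - differential A (Y2 U) x (rinv (Y1 W) x)"
      unfolding differential_add[OF SA smooth_map_real_const[OF SA] smooth_map_real_mult[OF SA smooth_map_real_const[OF SA] sml] oneS UT]
        differential_const_mult[OF SA sml oneS UT] differential_const[OF SA oneS UT] point_eval_differential(2)[OF U lin] by simp
    finally show ?thesis .
  qed
  have rS: "S.rinv W (\<one>, 0) = W" if "W \<in> LS" for W using S.rinv_one[OF that] by (simp add: S_simps(3))
  have lb: "lie_bracket \<SS> SA Z Y = vf_bracket SA (S.rinv Z) (S.rinv Y) (\<one>, 0)"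
    by (simp add: lie_bracket_def S.rinv_def[abs_def] S_simps(3))
  have "Y2 (lie_bracket \<SS> SA Z Y) x = differential SA (\<lambda>t. snd t x) (\<one>, 0) (vf_bracket SA (S.rinv Z) (S.rinv Y) (\<one>, 0))"
    using point_eval_differential(1)[OF S.lie_bracket_in[OF Z Y], of x] by (simp add: lb)
  also have "\<dots> =
      - differential A (Y2 Z) x (rinv (Y1 Y) x) - - differential A (Y2 Y) x (rinv (Y1 Z) x)"
    unfolding differential_bracket[OF SA smooth_map_point_eval[OF SA S_snd] S.rinv_smooth[OF Z] S.rinv_smooth[OF Y] oneS]
      rS[OF Z] rS[OF Y] second[OF Y Z] second[OF Z Y] ..
  finally show ?thesis by simp
qed

text \<open>For two right-invariant fields the formula of \<open>hamiltonian_momentum\<close>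
  consists of exactly the terms of \<open>Y1_bracket\<close> and \<open>Y2_bracket\<close>, with the
  same signs.\<close>

lemma mom_poisson:
  assumes \<xi>: "\<xi> \<in> atlas_space T" and Z: "Z \<in> LS" and Y: "Y \<in> LS"
  shows "differential T (\<lambda>\<xi>. mom \<xi> Y) \<xi> (hamiltonian_vf T (cotangent_symplectic_form A) (\<lambda>\<xi>'. mom \<xi>' Z) \<xi>) =
    mom \<xi> (lie_bracket \<SS> SA Z Y)"
proof -
  have x: "fst \<xi> \<in> carrier G" using \<xi> by (auto simp: T_space)
  obtain u where u: "u \<in> tangent_space T \<xi>"
    "\<forall>w\<in>tangent_space T \<xi>. cotangent_symplectic_form A \<xi> u w = - differential T (\<lambda>\<xi>. mom \<xi> Z) \<xi> w"
    "tangent_map T A fst \<xi> u = rinv (Y1 Z) (fst \<xi>)"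
    and du: "\<forall>X h. smooth_vf A X \<longrightarrow> smooth_map A real_atlas h \<longrightarrow>
      differential T (\<lambda>\<xi>. snd \<xi> (X (fst \<xi>)) + h (fst \<xi>)) \<xi> u =
      snd \<xi> (vf_bracket A (rinv (Y1 Z)) X (fst \<xi>)) + differential A h (fst \<xi>) (rinv (Y1 Z) (fst \<xi>)) -
      differential A (Y2 Z) (fst \<xi>) (X (fst \<xi>))"
    using hamiltonian_mom[OF \<xi> Z] by (elim exE conjE)
  have Xu: "hamiltonian_vf T (cotangent_symplectic_form A) (\<lambda>\<xi>'. mom \<xi>' Z) \<xi> = u"
    by (rule hamiltonian_vf_eqI[OF atl \<xi> u(1) u(2)[rule_format]])
  show ?thesis
    unfolding Xu mom_apply[OF Y] du[rule_format, OF rinv_smooth[OF Y1_in[OF Y]] V_smooth[OF Y2(1)[OF Y]]]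
      mom_apply[OF S.lie_bracket_in[OF Z Y]] Y1_bracket[OF Z Y] Y2_bracket[OF Z Y x]
      rinv_lie_bracket[OF Y1_in[OF Z] Y1_in[OF Y] x] by simp
qed

end

section \<open>The Poisson structure\<close>

text \<open>Equal dimensions give a bijection \<open>b\<close> between bases, and its linear
  extension is a chart. This is how the assumption on the dimension of the model space
  enters.\<close>

lemma vector_atlas_nonempty:
  assumes V: "fd_subspace V" and fd: "finite_dimensional TYPE('v::real_normed_vector)"
    and dim: "dim (UNIV :: 'v set) = fun_space.dim V"
  shows "\<exists>c :: ('x \<Rightarrow> real, 'v) chart. c \<in> vector_atlas V"
proof -
  have sub: "fun_space.subspace V" using V by (simp add: fd_subspace_def)
  obtain B0 where B0: "finite B0" "fun_space.span B0 = V" using V by (auto simp: fd_subspace_def)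
  obtain B where B: "B \<subseteq> V" "fun_space.independent B" "V \<subseteq> fun_space.span B"
    using fun_space.maximal_independent_subset[of V] by blast
  have finB: "finite B" using fun_space.independent_span_bound[OF B0(1) B(2)] B(1) B0(2) by blast
  have spB: "fun_space.span B = V" using B(1,3) fun_space.span_minimal[OF B(1) sub] by blast
  obtain C :: "'v set" and co where C: "finite C" "independent C" "span C = UNIV" "\<And>w. (\<Sum>c\<in>C. co c w *\<^sub>R c) = w"
    using finite_dimensional_frame[OF fd] by metis
  have "card C = dim (UNIV :: 'v set)"
    using real_vector.dim_eq_card[of C UNIV] C(2,3) by simp
  also have "\<dots> = card B"
    unfolding dim
  proof (rule fun_space.dim_eq_card[OF _ B(2)])
    have "fun_space.span V = V" using sub by simp
    then show "fun_space.span B = fun_space.span V" by (simp only: spB)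
  qed
  finally obtain b where b: "bij_betw b B C" using finite_same_card_bij[OF finB C(1)] by metis
  define rep where "rep = fun_space.representation B"
  define \<phi> where "\<phi> f = (\<Sum>x\<in>B. rep f x *\<^sub>R b x)" for f
  have f_rep: "(\<Sum>x\<in>B. fscale (rep f x) x) = f" if "f \<in> V" for f
    unfolding rep_def by (rule fun_space.sum_representation_eq[OF B(2)]) (use that spB finB in auto)
  have lin: "linear_on_subspace V \<phi>"
    unfolding linear_on_subspace_def
  proof (intro conjI ballI allI)
    fix f g assume "f \<in> V" "g \<in> V"
    then have "rep (f + g) x = rep f x + rep g x" for x
      unfolding rep_def using fun_space.representation_add[OF B(2)] spB by simp
    then show "\<phi> (f + g) = \<phi> f + \<phi> g" by (simp add: \<phi>_def scaleR_add_left sum.distrib)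
  next
    fix f a assume "f \<in> V"
    then have "rep (fscale a f) x = a * rep f x" for x
      unfolding rep_def using fun_space.representation_scale[OF B(2)] spB by simp
    then show "\<phi> (fscale a f) = a *\<^sub>R \<phi> f" by (simp add: \<phi>_def scaleR_sum_right)
  qed
  have \<phi>b: "\<phi> x = b x" if "x \<in> B" for x
  proof -
    have "\<phi> x = (\<Sum>y\<in>B. if y = x then b x else 0)"
      unfolding \<phi>_def rep_def using fun_space.representation_basis[OF B(2) that] by (intro sum.cong) auto
    then show ?thesis using that finB by simp
  qed
  have "bij_betw \<phi> V UNIV"
  proof (rule bij_betw_imageI)
    show "inj_on \<phi> V"
    proof (rule inj_onI)
      fix f g assume f: "f \<in> V" and g: "g \<in> V" and eq: "\<phi> f = \<phi> g"
      let ?i = "inv_into B b"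
      have i: "?i (b x) = x" if "x \<in> B" for x using b that by (simp add: bij_betw_inv_into_left)
      have "(\<Sum>c\<in>C. (rep f (?i c) - rep g (?i c)) *\<^sub>R c) = (\<Sum>x\<in>B. (rep f x - rep g x) *\<^sub>R b x)"
        by (subst sum.reindex_bij_betw[OF b, symmetric]) (simp add: i)
      also have "\<dots> = 0" using eq by (simp add: \<phi>_def scaleR_left_diff_distrib sum_subtractf)
      finally have "rep f (?i c) - rep g (?i c) = 0" if "c \<in> C" for c
        using independentD[OF C(2) C(1) subset_refl, of "\<lambda>c. rep f (?i c) - rep g (?i c)" c] that by simp
      then have "rep f x = rep g x" if "x \<in> B" for x
        using i[OF that] bij_betwE[OF b] that by fastforce
      then have "(\<Sum>x\<in>B. fscale (rep f x) x) = (\<Sum>x\<in>B. fscale (rep g x) x)" by (intro sum.cong) auto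
      then show "f = g" by (simp only: f_rep[OF f] f_rep[OF g])
    qed
    show "\<phi> ` V = UNIV"
    proof safe
      fix w
      have in': "(\<Sum>x\<in>B. fscale (co (b x) w) x) \<in> V"
        using B(1) by (intro fd_subspace_sum[OF V] fd_subspace_scale[OF V]) auto
      have "\<phi> (\<Sum>x\<in>B. fscale (co (b x) w) x) = (\<Sum>x\<in>B. co (b x) w *\<^sub>R \<phi> x)"
        by (rule linear_on_subspace_sum[OF sub lin]) (use B(1) in auto)
      then have "\<phi> (\<Sum>x\<in>B. fscale (co (b x) w) x) = (\<Sum>x\<in>B. co (b x) w *\<^sub>R b x)" by (simp add: \<phi>b)
      then have eq: "\<phi> (\<Sum>x\<in>B. fscale (co (b x) w) x) = w"
        using sum.reindex_bij_betw[OF b, of "\<lambda>c. co c w *\<^sub>R c"] C(4) by simp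
      show "w \<in> \<phi> ` V" using imageI[OF in', of \<phi>] unfolding eq .
    qed simp
  qed
  then show ?thesis using lin by (intro exI[of _ "(V, \<phi>)"]) (simp add: vector_atlas_iff)
qed

lemma vector_tangent_linear:
  assumes "f \<in> W" "g \<in> W"
  shows "vector_tangent W (f + g) = vector_tangent W f + vector_tangent W g"
    and "vector_tangent W (fscale a f) = fscale a (vector_tangent W f)"
  using assms by (auto simp: vector_tangent_def fun_eq_iff fscale_apply vector_atlas_iff
      linear_on_subspace_add linear_on_subspace_def)

section \<open>The dual of the Lie algebra as a Poisson manifold\<close>

context lie_grp
begin

abbreviation W where "W \<equiv> lie_dual G A"
abbreviation WA :: "(('g, 'm) tangent \<Rightarrow> real, 'm \<Rightarrow>\<^sub>L real) atlas" where "WA \<equiv> lie_dual_atlas G A"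

lemma W_eq: "W = cotangent_space A \<one>"
  by (simp add: lie_dual_def cotangent_space_def lie_algebra_eq)

lemma unit_chart: obtains c where "c \<in> A" "\<one> \<in> fst c"
  using atlas_spaceE[of \<one> A] by (auto simp: space)

lemma W_subspace: "fd_subspace W"
  by (rule unit_chart) (simp add: W_eq cotangent_space_chart(2)[OF atl])

lemma W_fd: "finite_dimensional TYPE('m \<Rightarrow>\<^sub>L real)"
  by (rule finite_dimensional_blinfun[OF fd_atlas_dim[OF atl]])

lemma W_chart: obtains cW :: "(('g, 'm) tangent \<Rightarrow> real, 'm \<Rightarrow>\<^sub>L real) chart" where "cW \<in> vector_atlas W"
  by (rule unit_chart, rule that) (unfold W_eq, rule cotangent_space_chart(1)[OF atl])

lemma WA: "fd_atlas WA"
  unfolding lie_dual_atlas_def by (rule fd_atlas_vector[OF W_subspace W_fd])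

lemma WA_space: "atlas_space WA = W"
  unfolding lie_dual_atlas_def by (rule W_chart) (rule atlas_space_vector)

lemma dual_add: "\<nu> \<in> W \<Longrightarrow> Y \<in> lie_algebra G A \<Longrightarrow> Z \<in> lie_algebra G A \<Longrightarrow> \<nu> (Y + Z) = \<nu> Y + \<nu> Z"
  unfolding W_eq lie_algebra_eq by (rule cotangent_add)

lemma dual_fscale: "\<nu> \<in> W \<Longrightarrow> Y \<in> lie_algebra G A \<Longrightarrow> \<nu> (fscale a Y) = a * \<nu> Y"
  unfolding W_eq lie_algebra_eq by (rule cotangent_fscale)

lemma dual_separates:
  assumes Y: "Y \<in> lie_algebra G A" and Z: "Z \<in> lie_algebra G A" and eq: "\<And>\<nu>. \<nu> \<in> W \<Longrightarrow> \<nu> Y = \<nu> Z"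
  shows "Y = Z"
proof -
  obtain c where c: "c \<in> A" "\<one> \<in> fst c" by (rule unit_chart)
  have "blinfun_apply \<beta> (Y c) = blinfun_apply \<beta> (Z c)" for \<beta> :: "'m \<Rightarrow>\<^sub>L real"
    using eq[of "covector A c \<one> \<beta>"] covector_in[OF atl, of c \<one> \<beta>] Y Z by (simp add: W_eq lie_algebra_eq covector_def)
  then have "Y c = Z c" by (rule blinfun_separates[OF fd_atlas_dim[OF atl]])
  then show ?thesis using tangent_space_eqI[OF _ _ c, of Y Z] Y Z by (simp add: lie_algebra_eq)
qed

text \<open>Reflexivity: elements of the dual are functions on vectors, so the point frame writes
  \<open>L \<nu>\<close> as a combination of values of \<open>\<nu>\<close>, which is the value of
  \<open>\<nu>\<close> at one combined vector. Frame points outside the Lie algebra drop out because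
  \<open>\<nu>\<close> is 0 there.\<close>

lemma dual_represent:
  assumes L: "linear_on_subspace W (L :: _ \<Rightarrow> real)"
  shows "\<exists>Y\<in>lie_algebra G A. \<forall>\<nu>\<in>W. L \<nu> = \<nu> Y"
proof -
  obtain X e where X: "finite X" "\<And>x. x \<in> X \<Longrightarrow> e x \<in> W"
    "\<And>\<phi> f. linear_on_subspace W (\<phi> :: _ \<Rightarrow> real) \<Longrightarrow> f \<in> W \<Longrightarrow> \<phi> f = (\<Sum>x\<in>X. f x *\<^sub>R \<phi> (e x))"
    by (rule vector_chart_point_frame[OF W_subspace], rule that)
  let ?L = "lie_algebra G A"
  define Y where "Y = (\<Sum>x\<in>X \<inter> ?L. fscale (L (e x)) x)"
  have sub: "fun_space.subspace ?L"
    unfolding fun_space.subspace_def lie_algebra_eq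
    by (simp add: tangent_space_zero[OF atl] tangent_space_add[OF atl] tangent_space_fscale[OF atl])
  have "Y \<in> ?L" unfolding Y_def
    by (intro fun_space.subspace_sum[OF sub] fun_space.subspace_scale[OF sub]) auto
  moreover have "L \<nu> = \<nu> Y" if \<nu>: "\<nu> \<in> W" for \<nu>
  proof -
    have lin\<nu>: "linear_on_subspace ?L \<nu>" and out: "\<And>x. x \<notin> ?L \<Longrightarrow> \<nu> x = 0"
      using \<nu> by (auto simp: W_eq lie_algebra_eq cotangent_space_iff)
    have "L \<nu> = (\<Sum>x\<in>X. \<nu> x * L (e x))" using X(3)[OF L \<nu>] by simp
    also have "\<dots> = (\<Sum>x\<in>X \<inter> ?L. L (e x) *\<^sub>R \<nu> x)"
      using X(1) out by (intro sum.mono_neutral_cong_right) auto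
    also have "\<dots> = \<nu> Y" unfolding Y_def by (rule linear_on_subspace_sum[OF sub lin\<nu>, symmetric]) auto
    finally show ?thesis .
  qed
  ultimately show ?thesis by blast
qed

text \<open>The derivative is linear in the direction, hence given by a vector of the Lie algebra,
  and linear forms separate vectors; so the description in \<open>dual_differential\<close> has
  exactly one solution.\<close>

lemma dual_differential:
  assumes F: "smooth_map WA real_atlas F" and \<mu>: "\<mu> \<in> W"
  shows "dual_differential G A F \<mu> \<in> lie_algebra G A"
    and "\<nu> \<in> W \<Longrightarrow> differential WA F \<mu> (vector_tangent W \<nu>) = \<nu> (dual_differential G A F \<mu>)"
proof -
  obtain cW :: "(('g, 'm) tangent \<Rightarrow> real, 'm \<Rightarrow>\<^sub>L real) chart" where cW: "cW \<in> vector_atlas W" by (rule W_chart)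
  define L where "L \<nu> = differential WA F \<mu> (vector_tangent W \<nu>)" for \<nu>
  have vt: "vector_tangent W \<nu> \<in> tangent_space WA \<mu>" if "\<nu> \<in> W" for \<nu>
    unfolding lie_dual_atlas_def by (rule vector_tangent_in[OF W_subspace W_fd that \<mu>])
  have \<mu>A: "\<mu> \<in> atlas_space WA" using \<mu> by (simp add: WA_space)
  have "linear_on_subspace W L"
    unfolding linear_on_subspace_def L_def
    using differential_add_vector[OF WA F \<mu>A vt vt] differential_fscale_vector[OF WA F \<mu>A vt]
    by (simp add: vector_tangent_linear)
  then obtain Y where Y: "Y \<in> lie_algebra G A" "\<And>\<nu>. \<nu> \<in> W \<Longrightarrow> L \<nu> = \<nu> Y" using dual_represent by blast
  have deriv: "((\<lambda>t. F (\<mu> + fscale t \<nu>)) has_real_derivative L \<nu>) (at 0)" if "\<nu> \<in> W" for \<nu>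
    unfolding L_def lie_dual_atlas_def
    by (rule smooth_function_line_derivative[OF W_subspace W_fd cW \<mu> that F[unfolded lie_dual_atlas_def]])
  have "dual_differential G A F \<mu> = Y"
    unfolding dual_differential_def
  proof (rule the_equality)
    show "Y \<in> lie_algebra G A \<and> (\<forall>\<nu>\<in>W. ((\<lambda>t. F (\<mu> + fscale t \<nu>)) has_real_derivative \<nu> Y) (at 0))"
      using Y(1) deriv Y(2) by simp
    fix Z assume Z: "Z \<in> lie_algebra G A \<and> (\<forall>\<nu>\<in>W. ((\<lambda>t. F (\<mu> + fscale t \<nu>)) has_real_derivative \<nu> Z) (at 0))"
    show "Z = Y"
    proof (rule dual_separates)
      fix \<nu> assume \<nu>: "\<nu> \<in> W"
      show "\<nu> Z = \<nu> Y"
        using DERIV_unique[OF bspec[OF conjunct2[OF Z] \<nu>] deriv[OF \<nu>]] Y(2)[OF \<nu>] by simp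
    qed (use Z Y in auto)
  qed
  then show "dual_differential G A F \<mu> \<in> lie_algebra G A"
    "\<nu> \<in> W \<Longrightarrow> differential WA F \<mu> (vector_tangent W \<nu>) = \<nu> (dual_differential G A F \<mu>)"
    using Y by (simp_all add: L_def)
qed

lemma lie_bracket_apply:
  assumes Z: "Z \<in> lie_algebra G A" and Y: "Y \<in> lie_algebra G A" and c: "c \<in> A" "\<one> \<in> fst c"
  shows "lie_bracket G A Z Y c = frechet_derivative (\<lambda>y. rinv Y (cinv c y) c) (at (snd c \<one>)) (Z c) -
    frechet_derivative (\<lambda>y. rinv Z (cinv c y) c) (at (snd c \<one>)) (Y c)"
  using vf_bracket_apply[of A "rinv Z" "rinv Y" \<one> c] c rinv_one[OF Z] rinv_one[OF Y]
  by (simp add: lie_bracket_def rinv_def[abs_def])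

lemma rinv_chart_derivative:
  assumes Y: "Y \<in> lie_algebra G A" and c: "c \<in> A" "\<one> \<in> fst c"
  shows "((\<lambda>y. rinv Y (cinv c y) c) has_derivative frechet_derivative (\<lambda>y. rinv Y (cinv c y) c) (at (snd c \<one>))) (at (snd c \<one>))"
  by (rule smooth_on_has_derivative[of "snd c ` fst c"]) (use rinv_smooth[OF Y] c in \<open>auto simp: smooth_vf_def\<close>)

lemma lie_algebra_add: "Y \<in> lie_algebra G A \<Longrightarrow> Z \<in> lie_algebra G A \<Longrightarrow> Y + Z \<in> lie_algebra G A"
  unfolding lie_algebra_eq by (rule tangent_space_add[OF atl])

lemma lie_algebra_fscale: "Y \<in> lie_algebra G A \<Longrightarrow> fscale a Y \<in> lie_algebra G A"
  unfolding lie_algebra_eq by (rule tangent_space_fscale[OF atl])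

text \<open>Linearity in the second argument is what makes \<open>coad\<close> a linear
  form.\<close>

lemma lie_bracket_add:
  assumes Z: "Z \<in> lie_algebra G A" and Y: "Y \<in> lie_algebra G A" and Y': "Y' \<in> lie_algebra G A"
  shows "lie_bracket G A Z (Y + Y') = lie_bracket G A Z Y + lie_bracket G A Z Y'"
proof -
  obtain c where c: "c \<in> A" "\<one> \<in> fst c" by (rule unit_chart)
  note [simp] = lie_algebra_add[OF Y Y']
  have "frechet_derivative (\<lambda>y. rinv (Y + Y') (cinv c y) c) (at (snd c \<one>)) =
    frechet_derivative (\<lambda>y. rinv Y (cinv c y) c + rinv Y' (cinv c y) c) (at (snd c \<one>))"
  proof (rule frechet_derivative_cong_open[OF chart_open[OF atl c(1)]])
    fix y assume "y \<in> snd c ` fst c"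
    then have "cinv c y \<in> carrier G" using atlas_spaceI[OF c(1) cinv_in[OF atl c(1)]] by (simp add: space)
    from rinv_add[OF Y Y' this] show "rinv (Y + Y') (cinv c y) c = rinv Y (cinv c y) c + rinv Y' (cinv c y) c" by simp
  qed (use c in simp)
  also have "\<dots> = (\<lambda>v. frechet_derivative (\<lambda>y. rinv Y (cinv c y) c) (at (snd c \<one>)) v +
      frechet_derivative (\<lambda>y. rinv Y' (cinv c y) c) (at (snd c \<one>)) v)"
    by (rule frechet_derivative_eqI[OF has_derivative_add[OF rinv_chart_derivative[OF Y c] rinv_chart_derivative[OF Y' c]]])
  finally have "lie_bracket G A Z (Y + Y') c = (lie_bracket G A Z Y + lie_bracket G A Z Y') c"
    using linear_add[OF has_derivative_linear[OF rinv_chart_derivative[OF Z c]]]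
    by (simp add: lie_bracket_apply[OF Z _ c] Y Y')
  then show ?thesis
    using tangent_space_eqI[OF _ _ c] lie_bracket_in[OF Z lie_algebra_add[OF Y Y']]
      lie_algebra_add[OF lie_bracket_in[OF Z Y] lie_bracket_in[OF Z Y']] unfolding lie_algebra_eq by blast
qed

lemma lie_bracket_fscale:
  assumes Z: "Z \<in> lie_algebra G A" and Y: "Y \<in> lie_algebra G A"
  shows "lie_bracket G A Z (fscale a Y) = fscale a (lie_bracket G A Z Y)"
proof -
  obtain c where c: "c \<in> A" "\<one> \<in> fst c" by (rule unit_chart)
  have "frechet_derivative (\<lambda>y. rinv (fscale a Y) (cinv c y) c) (at (snd c \<one>)) =
    frechet_derivative (\<lambda>y. a *\<^sub>R rinv Y (cinv c y) c) (at (snd c \<one>))"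
  proof (rule frechet_derivative_cong_open[OF chart_open[OF atl c(1)]])
    fix y assume "y \<in> snd c ` fst c"
    then have "cinv c y \<in> carrier G" using atlas_spaceI[OF c(1) cinv_in[OF atl c(1)]] by (simp add: space)
    from rinv_fscale[OF Y this] show "rinv (fscale a Y) (cinv c y) c = a *\<^sub>R rinv Y (cinv c y) c" by (simp add: fscale_apply)
  qed (use c in simp)
  also have "\<dots> = (\<lambda>v. a *\<^sub>R frechet_derivative (\<lambda>y. rinv Y (cinv c y) c) (at (snd c \<one>)) v)"
    by (rule frechet_derivative_eqI[OF has_derivative_scaleR_right[OF rinv_chart_derivative[OF Y c]]])
  finally have "lie_bracket G A Z (fscale a Y) c = fscale a (lie_bracket G A Z Y) c"
    using linear_scale[OF has_derivative_linear[OF rinv_chart_derivative[OF Z c]]]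
    by (simp add: lie_bracket_apply[OF Z _ c] Y lie_algebra_fscale[OF Y] fscale_apply scaleR_right_diff_distrib)
  then show ?thesis
    using tangent_space_eqI[OF _ _ c] lie_bracket_in[OF Z lie_algebra_fscale[OF Y]]
      lie_algebra_fscale[OF lie_bracket_in[OF Z Y]] unfolding lie_algebra_eq by blast
qed

text \<open>Up to sign conventions the coadjoint vector field of \<open>Z\<close>; it is the value
  at \<open>\<mu>\<close> of the Hamiltonian field of any smooth function whose differential at
  \<open>\<mu>\<close> is \<open>Z\<close>.\<close>

definition coad :: "('g, 'm) tangent \<Rightarrow> (('g, 'm) tangent \<Rightarrow> real) \<Rightarrow> ('g, 'm) tangent \<Rightarrow> real"
  where "coad Z \<mu> = (\<lambda>Y. if Y \<in> lie_algebra G A then \<mu> (lie_bracket G A Z Y) else 0)"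

lemma coad_in:
  assumes Z: "Z \<in> lie_algebra G A" and \<mu>: "\<mu> \<in> W"
  shows "coad Z \<mu> \<in> W"
  unfolding W_eq
proof (rule cotangentI; unfold lie_algebra_eq[symmetric])
  fix Y Y' a assume Y: "Y \<in> lie_algebra G A"
  show "coad Z \<mu> (fscale a Y) = a * coad Z \<mu> Y"
    using Y by (simp add: coad_def lie_algebra_fscale lie_bracket_fscale[OF Z] dual_fscale[OF \<mu> lie_bracket_in[OF Z]])
  assume Y': "Y' \<in> lie_algebra G A"
  show "coad Z \<mu> (Y + Y') = coad Z \<mu> Y + coad Z \<mu> Y'"
    using Y Y' by (simp add: coad_def lie_algebra_add lie_bracket_add[OF Z] dual_add[OF \<mu> lie_bracket_in[OF Z] lie_bracket_in[OF Z]])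
qed (simp add: coad_def)

text \<open>The evaluations at Lie algebra elements are linear, hence among the smooth test
  functions, and they already determine a tangent vector of the dual.\<close>

lemma kks_hamiltonian_vf_eq:
  assumes h: "smooth_map WA real_atlas h" and \<mu>: "\<mu> \<in> W"
  shows "kks_hamiltonian_vf G A h \<mu> = vector_tangent W (coad (dual_differential G A h \<mu>) \<mu>)"
  unfolding kks_hamiltonian_vf_def
proof (rule the_equality)
  obtain cW :: "(('g, 'm) tangent \<Rightarrow> real, 'm \<Rightarrow>\<^sub>L real) chart" where cW: "cW \<in> vector_atlas W" by (rule W_chart)
  let ?Z = "dual_differential G A h \<mu>"
  note Z = dual_differential(1)[OF h \<mu>]
  note \<alpha> = coad_in[OF Z \<mu>]
  have bracket: "differential WA F \<mu> (vector_tangent W (coad ?Z \<mu>)) = kks_bracket G A h F \<mu>" if "smooth_map WA real_atlas F" for F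
    using dual_differential[OF that \<mu>] \<alpha> by (simp add: kks_bracket_def coad_def)
  have vin: "vector_tangent W (coad ?Z \<mu>) \<in> tangent_space WA \<mu>"
    unfolding lie_dual_atlas_def by (rule vector_tangent_in[OF W_subspace W_fd \<alpha> \<mu>])
  show "vector_tangent W (coad ?Z \<mu>) \<in> tangent_space WA \<mu> \<and>
    (\<forall>F. smooth_map WA real_atlas F \<longrightarrow> differential WA F \<mu> (vector_tangent W (coad ?Z \<mu>)) = kks_bracket G A h F \<mu>)"
    using bracket vin by blast
  fix v assume v: "v \<in> tangent_space WA \<mu> \<and> (\<forall>F. smooth_map WA real_atlas F \<longrightarrow> differential WA F \<mu> v = kks_bracket G A h F \<mu>)"
  define \<alpha>' where "\<alpha>' = cinv cW (v cW)"
  have \<alpha>': "\<alpha>' \<in> W" "v = vector_tangent W \<alpha>'"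
    unfolding \<alpha>'_def using vector_chart_inverse_linear(3)[OF W_subspace cW]
      vector_tangent_cases[OF W_subspace W_fd cW \<mu>, of v] v by (simp_all add: lie_dual_atlas_def)
  have "\<alpha>' Y = coad ?Z \<mu> Y" for Y
  proof -
    have ev: "smooth_map WA real_atlas (\<lambda>\<nu>. \<nu> Y)"
      unfolding lie_dual_atlas_def by (rule smooth_map_linear[OF W_subspace W_fd linear_on_subspace_eval])
    have "differential WA (\<lambda>\<nu>. \<nu> Y) \<mu> (vector_tangent W \<nu>) = \<nu> Y" if "\<nu> \<in> W" for \<nu>
      unfolding lie_dual_atlas_def by (rule differential_linear[OF W_subspace W_fd cW \<mu> that linear_on_subspace_eval])
    from this[OF \<alpha>'(1)] this[OF \<alpha>] show ?thesis using v ev bracket[OF ev] \<alpha>'(2) by simp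
  qed
  then show "v = vector_tangent W (coad ?Z \<mu>)" using \<alpha>'(2) by presburger
qed

end

lemma integral_curve_near:
  assumes \<gamma>: "continuous_map (top_of_set I) (atlas_topology M) \<gamma>" and t: "t \<in> I" and e: "e \<in> M" "\<gamma> t \<in> fst e"
  shows "eventually (\<lambda>s. \<gamma> s \<in> fst e) (at t within I)"
proof -
  have "openin (top_of_set I) {s \<in> topspace (top_of_set I). \<gamma> s \<in> fst e}"
    using \<gamma> openin_chart_domain[OF e(1)] by (rule openin_continuous_map_preimage)
  then obtain U where U: "open U" "{s \<in> I. \<gamma> s \<in> fst e} = I \<inter> U" by (auto simp: openin_open)
  have tU: "t \<in> U" using U(2) t e(2) by auto
  show ?thesis
    unfolding eventually_at_topological
    using U tU by (intro exI[of _ U]) auto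
qed

section \<open>Transport of Hamiltonian fields and integral curves by the momentum map\<close>

context lie_rep
begin

text \<open>The Lie algebra element is frozen at the point \<open>\<xi>\<close>. Agreement of the
  two differentials at this one point is all that the Hamiltonian vector of \<open>H\<close> there
  depends on.\<close>

lemma differential_mom_hamiltonian:
  assumes h: "smooth_map S.WA real_atlas h" and H: "smooth_map T real_atlas H"
    and Hh: "\<And>\<xi>. \<xi> \<in> atlas_space T \<Longrightarrow> H \<xi> = h (mom \<xi>)" and \<xi>: "\<xi> \<in> atlas_space T" and w: "w \<in> tangent_space T \<xi>"
    and \<mu>: "\<mu> = mom \<xi>"
  shows "differential T H \<xi> w = differential T (\<lambda>\<xi>. mom \<xi> (dual_differential \<SS> SA h \<mu>)) \<xi> w"
proof -
  obtain cW :: "(('g \<times> ('g \<Rightarrow> real), 'm \<times> 'v) tangent \<Rightarrow> real, ('m \<times> 'v) \<Rightarrow>\<^sub>L real) chart"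
    where cW: "cW \<in> vector_atlas S.W" by (rule S.W_chart)
  let ?Z = "dual_differential \<SS> SA h (mom \<xi>)"
  note \<mu>W = mom_in[OF \<xi>]
  define \<nu> where "\<nu> = cinv cW (tangent_map T S.WA mom \<xi> w cW)"
  have \<nu>: "\<nu> \<in> S.W" unfolding \<nu>_def by (rule vector_chart_inverse_linear(3)[OF S.W_subspace cW])
  have t\<nu>: "tangent_map T S.WA mom \<xi> w = vector_tangent S.W \<nu>"
    unfolding \<nu>_def using tangent_map_in[OF TA S.WA mom_smooth \<xi> w] unfolding lie_dual_atlas_def
    by (rule vector_tangent_cases[OF S.W_subspace S.W_fd cW \<mu>W])
  have ev: "smooth_map S.WA real_atlas (\<lambda>\<nu>. \<nu> Y)" for Y
    unfolding lie_dual_atlas_def by (rule smooth_map_linear[OF S.W_subspace S.W_fd linear_on_subspace_eval])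
  have dev: "differential S.WA (\<lambda>\<nu>. \<nu> Y) (mom \<xi>) (vector_tangent S.W \<nu>) = \<nu> Y" for Y
    unfolding lie_dual_atlas_def by (rule differential_linear[OF S.W_subspace S.W_fd cW \<mu>W \<nu> linear_on_subspace_eval])
  have "differential T H \<xi> w = differential T (\<lambda>\<xi>. h (mom \<xi>)) \<xi> w"
    by (rule differential_cong[OF TA H \<xi> w Hh])
  also have "\<dots> = \<nu> ?Z"
    unfolding differential_compose[OF TA S.WA mom_smooth h \<xi> w] t\<nu> by (rule S.dual_differential(2)[OF h \<mu>W \<nu>])
  also have "\<dots> = differential T (\<lambda>\<xi>. mom \<xi> ?Z) \<xi> w"
    unfolding differential_compose[OF TA S.WA mom_smooth ev \<xi> w] t\<nu> dev ..
  finally show ?thesis by (simp add: \<mu>)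
qed

text \<open>Both sides are tested on the evaluations at \<open>Y\<close>, where
  \<open>mom_poisson\<close> applies; for \<open>Y\<close> outside the Lie algebra both values are
  0.\<close>

lemma tangent_map_mom_hamiltonian:
  assumes \<xi>: "\<xi> \<in> atlas_space T" and Z: "Z \<in> LS"
    and u: "u = hamiltonian_vf T (cotangent_symplectic_form A) (\<lambda>\<xi>'. mom \<xi>' Z) \<xi>" "u \<in> tangent_space T \<xi>"
  shows "tangent_map T S.WA mom \<xi> u = vector_tangent S.W (S.coad Z (mom \<xi>))"
proof -
  obtain cW :: "(('g \<times> ('g \<Rightarrow> real), 'm \<times> 'v) tangent \<Rightarrow> real, ('m \<times> 'v) \<Rightarrow>\<^sub>L real) chart"
    where cW: "cW \<in> vector_atlas S.W" by (rule S.W_chart)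
  note \<mu> = mom_in[OF \<xi>]
  define \<nu> where "\<nu> = cinv cW (tangent_map T S.WA mom \<xi> u cW)"
  have \<nu>: "\<nu> \<in> S.W" unfolding \<nu>_def by (rule vector_chart_inverse_linear(3)[OF S.W_subspace cW])
  have t\<nu>: "tangent_map T S.WA mom \<xi> u = vector_tangent S.W \<nu>"
    unfolding \<nu>_def using tangent_map_in[OF TA S.WA mom_smooth \<xi> u(2)] unfolding lie_dual_atlas_def
    by (rule vector_tangent_cases[OF S.W_subspace S.W_fd cW \<mu>])
  have "\<nu> Y = S.coad Z (mom \<xi>) Y" for Y
  proof -
    have ev: "smooth_map S.WA real_atlas (\<lambda>\<nu>. \<nu> Y)"
      unfolding lie_dual_atlas_def by (rule smooth_map_linear[OF S.W_subspace S.W_fd linear_on_subspace_eval])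
    have "\<nu> Y = differential S.WA (\<lambda>\<nu>. \<nu> Y) (mom \<xi>) (vector_tangent S.W \<nu>)"
      unfolding lie_dual_atlas_def by (rule differential_linear[OF S.W_subspace S.W_fd cW \<mu> \<nu> linear_on_subspace_eval, symmetric])
    also have "\<dots> = differential T (\<lambda>\<xi>. mom \<xi> Y) \<xi> u"
      unfolding t\<nu>[symmetric] by (rule differential_compose[OF TA S.WA mom_smooth ev \<xi> u(2), symmetric])
    also have "\<dots> = S.coad Z (mom \<xi>) Y"
    proof (cases "Y \<in> LS")
      case True
      then show ?thesis using mom_poisson[OF \<xi> Z True] by (simp add: u(1)[symmetric] S.coad_def)
    next
      case False
      then show ?thesis using differential_const[OF TA \<xi> u(2), of 0] by (simp add: mom_outside S.coad_def)
    qed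
    finally show ?thesis .
  qed
  then have "\<nu> = S.coad Z (mom \<xi>)" by (rule ext)
  then show ?thesis using t\<nu> by simp
qed

lemma mom_maps_integral_curves:
  assumes h: "smooth_map S.WA real_atlas h" and H: "smooth_map T real_atlas H"
    and Hh: "\<And>\<xi>. \<xi> \<in> atlas_space T \<Longrightarrow> H \<xi> = h (mom \<xi>)"
    and \<gamma>: "integral_curve T (hamiltonian_vf T (cotangent_symplectic_form A) H) I \<gamma>"
  shows "integral_curve S.WA (kks_hamiltonian_vf \<SS> SA h) I (\<lambda>t. mom (\<gamma> t))"
  unfolding integral_curve_def
proof (intro conjI ballI)
  have \<gamma>c: "continuous_map (top_of_set I) (atlas_topology T) \<gamma>" and int: "is_interval I" using \<gamma> by (simp_all add: integral_curve_def)
  show "is_interval I" by (rule int)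
  have "continuous_map (atlas_topology T) (atlas_topology S.WA) mom" using mom_smooth by (simp add: smooth_map_iff)
  from continuous_map_compose[OF \<gamma>c this]
  show "continuous_map (top_of_set I) (atlas_topology S.WA) (\<lambda>t. mom (\<gamma> t))" by (simp add: comp_def)
  fix t d assume t: "t \<in> I" and d: "d \<in> S.WA"
  have \<xi>: "\<gamma> t \<in> atlas_space T" using \<gamma>c t by (auto simp: continuous_map_def Pi_iff)
  let ?\<xi> = "\<gamma> t" and ?\<mu> = "mom (\<gamma> t)"
  let ?Z = "dual_differential \<SS> SA h ?\<mu>"
  note \<mu> = mom_in[OF \<xi>]
  note Z = S.dual_differential(1)[OF h \<mu>]
  obtain u where u: "u \<in> tangent_space T ?\<xi>"
    "\<forall>w\<in>tangent_space T ?\<xi>. cotangent_symplectic_form A ?\<xi> u w = - differential T (\<lambda>\<xi>. mom \<xi> ?Z) ?\<xi> w"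
    using hamiltonian_mom[OF \<xi> Z] by (elim exE conjE)
  have XZ: "hamiltonian_vf T (cotangent_symplectic_form A) (\<lambda>\<xi>'. mom \<xi>' ?Z) ?\<xi> = u"
    by (rule hamiltonian_vf_eqI[OF atl \<xi> u(1) u(2)[rule_format]])
  have XH: "hamiltonian_vf T (cotangent_symplectic_form A) H ?\<xi> = u"
    by (rule hamiltonian_vf_eqI[OF atl \<xi> u(1)])
      (simp only: u(2)[rule_format] differential_mom_hamiltonian[OF h H Hh \<xi> _ refl])
  have X: "tangent_map T S.WA mom ?\<xi> u = kks_hamiltonian_vf \<SS> SA h ?\<mu>"
    unfolding S.kks_hamiltonian_vf_eq[OF h \<mu>] by (rule tangent_map_mom_hamiltonian[OF \<xi> Z XZ[symmetric] u(1)])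
  obtain e where e: "e \<in> T" "?\<xi> \<in> fst e" using \<xi> by (rule atlas_spaceE)
  have "((\<lambda>s. snd e (\<gamma> s)) has_vector_derivative u e) (at t within I)"
    using \<gamma> t e XH by (force simp: integral_curve_def comp_def split_beta dest!: bspec)
  from chart_has_vector_derivative_transfer[where \<gamma>=\<gamma> and t=t, OF TA S.WA mom_smooth e d _ u(1) integral_curve_near[OF \<gamma>c t e] t this]
  show "case d of (U, \<phi>) \<Rightarrow> mom (\<gamma> t) \<in> U \<longrightarrow>
      (\<phi> \<circ> (\<lambda>t. mom (\<gamma> t)) has_vector_derivative kks_hamiltonian_vf \<SS> SA h (mom (\<gamma> t)) (U, \<phi>)) (at t within I)"
    by (cases d) (simp add: X comp_def)
qed

end

theorem proposition13:
  fixes G :: "'g monoid"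
    and A :: "('g, 'e::banach) atlas"
    and G1 :: "'g set"
    and V :: "('g \<Rightarrow> real) set"
    and H :: "('g, 'e) cotangent \<Rightarrow> real"
  assumes lie: "lie_group G A"
    and connected_G: "connected_space (atlas_topology A)"
    and subgroup_G1: "subgroup G1 G"
    and closed_G1: "closedin (atlas_topology A) G1"
    and connected_G1: "connectedin (atlas_topology A) G1"
    and smooth_H: "smooth_map (cotangent_atlas A) real_atlas H"
    and invariant_H: "\<And>\<xi> k. \<xi> \<in> atlas_space (cotangent_atlas A) \<Longrightarrow> k \<in> G1
          \<Longrightarrow> H (lift_right G A \<xi> k) = H \<xi>"
    and V_subspace: "fun_space.subspace V"
    and V_functions: "V \<subseteq> smooth_coset_functions G A G1"
    and V_finite_dim: "\<exists>B. finite B \<and> fun_space.span B = V"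
    and model: "finite_dimensional TYPE('v::banach)" "dim (UNIV :: 'v set) = fun_space.dim V"
    and onto: "\<And>g. g \<in> carrier G \<Longrightarrow> translate G g ` V = V"
    and separates: "\<And>x y. x \<in> carrier G \<Longrightarrow> y \<in> carrier G \<Longrightarrow> x <#\<^bsub>G\<^esub> G1 \<noteq> y <#\<^bsub>G\<^esub> G1
          \<Longrightarrow> \<exists>f\<in>V. f x \<noteq> f y"
  shows
    "(\<exists>\<Phi>. hamiltonian_action (semidirect G V) (semidirect_atlas A V :: (_, 'e \<times> 'v) atlas)
          (cotangent_atlas A) (cotangent_symplectic_form A)
          \<Phi> (\<lambda>\<xi>. semidirect_dual G A V (momentum_pair G A V \<xi>)) \<and>
        (\<forall>g\<in>carrier G. \<forall>\<xi>\<in>atlas_space (cotangent_atlas A). \<Phi> (g, 0) \<xi> = lift_left G A g \<xi>)) \<and>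
     (\<forall>\<xi>\<in>atlas_space (cotangent_atlas A). \<forall>k\<in>G1.
        momentum_pair G A V (lift_right G A \<xi> k) = momentum_pair G A V \<xi>) \<and>
     (\<forall>\<xi>\<in>atlas_space (cotangent_atlas A). \<forall>\<xi>'\<in>atlas_space (cotangent_atlas A).
        momentum_pair G A V \<xi> = momentum_pair G A V \<xi>' \<longrightarrow> H \<xi> = H \<xi>') \<and>
     (\<forall>h. smooth_map (lie_dual_atlas (semidirect G V) (semidirect_atlas A V :: (_, 'e \<times> 'v) atlas))
            real_atlas h \<and>
          (\<forall>\<xi>\<in>atlas_space (cotangent_atlas A).
             H \<xi> = h (semidirect_dual G A V (momentum_pair G A V \<xi>))) \<longrightarrow>
        (\<forall>I \<gamma>. integral_curve (cotangent_atlas A)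
             (hamiltonian_vf (cotangent_atlas A) (cotangent_symplectic_form A) H) I \<gamma> \<longrightarrow>
           integral_curve (lie_dual_atlas (semidirect G V) (semidirect_atlas A V :: (_, 'e \<times> 'v) atlas))
             (kks_hamiltonian_vf (semidirect G V) (semidirect_atlas A V) h) I
             (\<lambda>t. semidirect_dual G A V (momentum_pair G A V (\<gamma> t)))))"
proof -
  have fdsV: "fd_subspace V" using V_subspace V_finite_dim by (simp add: fd_subspace_def)
  obtain cV :: "('g \<Rightarrow> real, 'v) chart" where cV: "cV \<in> vector_atlas V"
    using vector_atlas_nonempty[OF fdsV model] by blast
  have fdA: "fd_atlas A" using lie by (simp add: lie_group_def manifold_def fd_atlas_def)
  interpret group G using lie by (simp add: lie_group_def)
  have rep: "lie_rep G A V cV"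
  proof (intro lie_rep.intro lie_inv.intro lie_grp.intro lie_grp_axioms.intro lie_inv_axioms.intro lie_rep_axioms.intro)
    show "group G" by (rule is_group)
    show "atlas_space A = carrier G" "smooth_map (prod_atlas A A) A (\<lambda>(x, y). x \<otimes>\<^bsub>G\<^esub> y)"
      "smooth_map A A (\<lambda>x. inv\<^bsub>G\<^esub> x)" using lie by (simp_all add: lie_group_def)
    show "smooth_map A real_atlas f" if "f \<in> V" for f
      using that V_functions by (auto simp: smooth_coset_functions_def)
    show "f x = 0" if "f \<in> V" "x \<notin> carrier G" for f x
      using that V_functions by (auto simp: smooth_coset_functions_def)
    show "translate G g f \<in> V" if "g \<in> carrier G" "f \<in> V" for g f
      using onto[OF that(1)] that(2) by blast
  qed (rule fdA fdsV model(1) cV)+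
  interpret R: lie_rep G A V cV by (rule rep)
  have G1: "k \<in> carrier G" if "k \<in> G1" for k using subgroup.subset[OF subgroup_G1] that by blast
  have inv: "momentum_pair G A V (lift_right G A \<xi> k) = momentum_pair G A V \<xi>"
    if \<xi>: "\<xi> \<in> atlas_space (cotangent_atlas A)" and k: "k \<in> G1" for \<xi> k
  proof -
    have x: "fst \<xi> \<in> carrier G" using \<xi> by (simp add: R.T_space)
    have "f (fst \<xi> \<otimes>\<^bsub>G\<^esub> k) = f (fst \<xi>)" if "f \<in> V" for f
    proof -
      have "fst \<xi> \<otimes>\<^bsub>G\<^esub> k \<in> fst \<xi> <#\<^bsub>G\<^esub> G1" using k by (auto simp: l_coset_def)
      then show ?thesis using that V_functions x by (auto simp: smooth_coset_functions_def)
    qed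
    then show ?thesis
      by (simp add: momentum_pair_def R.momentum_left_lift_right[OF G1[OF k] x] momentum_functions_def fun_eq_iff)
  qed
  have level: "H \<xi> = H \<xi>'"
    if \<xi>: "\<xi> \<in> atlas_space (cotangent_atlas A)" and \<xi>': "\<xi>' \<in> atlas_space (cotangent_atlas A)"
      and eq: "momentum_pair G A V \<xi> = momentum_pair G A V \<xi>'" for \<xi> \<xi>'
  proof -
    have x: "fst \<xi> \<in> carrier G" and x': "fst \<xi>' \<in> carrier G" and \<zeta>: "snd \<xi> \<in> cotangent_space A (fst \<xi>)"
      and \<zeta>': "snd \<xi>' \<in> cotangent_space A (fst \<xi>')"
      using \<xi> \<xi>' by (auto simp: R.T_space)
    have eqf: "momentum_functions V \<xi> = momentum_functions V \<xi>'" using eq by (simp add: momentum_pair_def)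
    have "f (fst \<xi>) = f (fst \<xi>')" if "f \<in> V" for f
      using fun_cong[OF eqf, of f] that by (simp add: momentum_functions_def)
    then have "fst \<xi> <#\<^bsub>G\<^esub> G1 = fst \<xi>' <#\<^bsub>G\<^esub> G1" using separates[OF x x'] by blast
    moreover have "fst \<xi>' \<in> fst \<xi>' <#\<^bsub>G\<^esub> G1"
      using subgroup.one_closed[OF subgroup_G1] x' by (force simp: l_coset_def)
    ultimately obtain k where k: "k \<in> G1" "fst \<xi>' = fst \<xi> \<otimes>\<^bsub>G\<^esub> k" by (auto simp: l_coset_def)
    \<comment> \<open>Right translation by \<open>k\<close> keeps the momentum, so both covectors
      lie over the same point with the same left momentum, which determines them.\<close>
    have "lift_right G A \<xi> k = \<xi>'"
    proof (rule R.momentum_left_eqI)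
      show "momentum_left G A (lift_right G A \<xi> k) = momentum_left G A \<xi>'"
        using inv[OF \<xi> k(1)] eq by (simp add: momentum_pair_def)
      show "snd (lift_right G A \<xi> k) \<in> cotangent_space A (fst (lift_right G A \<xi> k))"
        using R.lift_right_in[OF G1[OF k(1)] x \<zeta>] by simp
    qed (use k x' \<zeta>' in simp_all)
    then show ?thesis using invariant_H[OF \<xi> k(1)] by simp
  qed
  show ?thesis
  proof (intro conjI ballI allI impI)
    show "\<exists>\<Phi>. hamiltonian_action (semidirect G V) (semidirect_atlas A V :: (_, 'e \<times> 'v) atlas)
          (cotangent_atlas A) (cotangent_symplectic_form A)
          \<Phi> (\<lambda>\<xi>. semidirect_dual G A V (momentum_pair G A V \<xi>)) \<and>
        (\<forall>g\<in>carrier G. \<forall>\<xi>\<in>atlas_space (cotangent_atlas A). \<Phi> (g, 0) \<xi> = lift_left G A g \<xi>)"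
      using R.hamiltonian_action_act R.act_lift_left
      by (intro exI[of _ "\<lambda>s. restrict (R.act s) (atlas_space (cotangent_atlas A))"]) simp
  qed (use inv level R.mom_maps_integral_curves smooth_H in blast)+
qed

end
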